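(* Let $k,s\in\mathbb{R}$ satisfy either ($0<k<1$ and $s>2k-\tfrac12$) or ($k\le 0$ and $s>-\tfrac12$). Then there exist $T>0$, $\alpha=\alpha(k,s)>0$, constants $c_1,c_2>0$ (with $T,\alpha,c_1,c_2$ independent of $N$ and $t$), and a sequence $(\phi_N)_{N\ge 1}$ of Schwartz functions $\phi_N\in\mathcal{S}(\mathbb{R})$ such that $\|\phi_N\|_{H^k}\le 1$ for all $N$, and such that the solution $(u_N,n_N)$ on $[0,T]$ of the one-dimensional Zakharov system with initial data $(u_0,n_0,n_1)=(\phi_N,0,0)$ satisfies $$\|n_N(\cdot,t)\|_{H^s_x}\ \ge\ c_1\, t\, N^{\alpha}\qquad\text{whenever } 0<t\le T \text{ and } N\ge c_2\, t^{-1}.$$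
   Context: The one-dimensional Zakharov system (1D ZS) is the initial value problem $$i\partial_t u+\partial_x^2u=nu,\qquad \partial_t^2 n-\partial_x^2 n=\partial_x^2|u|^2,$$ $$u(x,0)=u_0(x),\quad n(x,0)=n_0(x),\quad \partial_t n(x,0)=n_1(x),$$ for $x,t\in\mathbb{R}$, with $u=u(x,t)\in\mathbb{C}$ and $n=n(x,t)\in\mathbb{R}$. $H^s=H^s(\mathbb{R})$ denotes the inhomogeneous $L^2$-based Sobolev space, $\|\phi\|_{H^s}=\left(\int\langle\xi\rangle^{2s}|\hat\phi(\xi)|^2\,d\xi\right)^{1/2}$ with $\langle\xi\rangle=(1+|\xi|^2)^{1/2}$. For smooth data (Schwartz, or in $H^m$ for all $m$), "the solution" means the unique solution with $u\in C([0,T];H^m)$, $n\in C([0,T];H^m)$, $\partial_t n\in C([0,T];H^{m-1})$ for all $m$. *)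

theory Defs
  imports "HOL-Analysis.Analysis"
begin

text \<open>
  Functions of space and time are curried with time first: \<open>u t x\<close> stands for $u(x,t)$, so that
  \<open>u t\<close> is the spatial profile $u(\cdot,t)$.
\<close>

definition dx :: "(real \<Rightarrow> 'a::real_normed_vector) \<Rightarrow> real \<Rightarrow> 'a" where
  "dx f = (\<lambda>x. vector_derivative f (at x))"

text \<open>Time derivative on \<open>[0,T]\<close>, one-sided at the endpoints.\<close>

definition dt :: "real \<Rightarrow> (real \<Rightarrow> real \<Rightarrow> 'a::real_normed_vector) \<Rightarrow> real \<Rightarrow> real \<Rightarrow> 'a" where
  "dt T f = (\<lambda>t x. vector_derivative (\<lambda>\<tau>. f \<tau> x) (at t within {0..T}))"

definition smooth_fun :: "(real \<Rightarrow> 'a::real_normed_vector) \<Rightarrow> bool" where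
  "smooth_fun f \<longleftrightarrow> (\<forall>j x. (dx ^^ j) f differentiable (at x))"

definition schwartz :: "(real \<Rightarrow> complex) \<Rightarrow> bool" where
  "schwartz f \<longleftrightarrow> smooth_fun f \<and> (\<forall>p j. bounded (range (\<lambda>x. x ^ p *\<^sub>R (dx ^^ j) f x)))"

definition square_integrable :: "(real \<Rightarrow> complex) \<Rightarrow> bool" where
  "square_integrable f \<longleftrightarrow>
     f \<in> borel_measurable lborel \<and> integrable lborel (\<lambda>x. (cmod (f x))\<^sup>2)"

text \<open>The Fourier transform is normalised to be unitary, so that $H^0 = L^2$ isometrically.\<close>

definition fourier_integral :: "(real \<Rightarrow> complex) \<Rightarrow> real \<Rightarrow> complex" where
  "fourier_integral f \<xi> =
     complex_of_real (1 / sqrt (2 * pi)) * (LINT x|lborel. exp (- \<i> * of_real (x * \<xi>)) * f x)"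

text \<open>
  The Plancherel transform of an $L^2$ function: the $L^2$ limit of the Fourier integrals of its
  truncations to \<open>[-R,R]\<close> as \<open>R\<close> tends to infinity. A function in $H^m$ need not be Lebesgue
  integrable, so \<open>fourier_integral\<close> cannot be applied to it directly. The limit is unique only
  almost everywhere, and \<open>fourier_L2\<close> selects a representative.
\<close>

definition is_fourier_L2 :: "(real \<Rightarrow> complex) \<Rightarrow> (real \<Rightarrow> complex) \<Rightarrow> bool" where
  "is_fourier_L2 f g \<longleftrightarrow> square_integrable g \<and>
     ((\<lambda>R. \<integral>\<^sup>+ \<xi>. ennreal ((cmod (fourier_integral (\<lambda>x. indicator {-R..R} x *\<^sub>R f x) \<xi> - g \<xi>))\<^sup>2)
             \<partial>lborel) \<longlongrightarrow> 0) at_top"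

definition fourier_L2 :: "(real \<Rightarrow> complex) \<Rightarrow> real \<Rightarrow> complex" where
  "fourier_L2 f = (SOME g. is_fourier_L2 f g)"

definition japanese_bracket :: "real \<Rightarrow> real" where
  "japanese_bracket \<xi> = sqrt (1 + \<bar>\<xi>\<bar>\<^sup>2)"

text \<open>
  For \<open>s \<ge> 0\<close> the predicate \<open>in_Hs s\<close> is membership in $H^s$; for \<open>s < 0\<close> it is membership in
  $H^s \cap L^2 = L^2$. The value of \<open>Hs_norm s f\<close> is meaningful when \<open>in_Hs s f\<close> holds, which is
  the case for all \<open>s\<close> if \<open>f\<close> is Schwartz or lies in $H^m$ for every \<open>m\<close>.
\<close>

definition in_Hs :: "real \<Rightarrow> (real \<Rightarrow> complex) \<Rightarrow> bool" where
  "in_Hs s f \<longleftrightarrow> square_integrable f \<and>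
     integrable lborel (\<lambda>\<xi>. japanese_bracket \<xi> powr (2 * s) * (cmod (fourier_L2 f \<xi>))\<^sup>2)"

definition Hs_norm :: "real \<Rightarrow> (real \<Rightarrow> complex) \<Rightarrow> real" where
  "Hs_norm s f =
     sqrt (LINT \<xi>|lborel. japanese_bracket \<xi> powr (2 * s) * (cmod (fourier_L2 f \<xi>))\<^sup>2)"

text \<open>$f \in C([0,T]; H^s)$\<close>

definition continuous_in_Hs :: "real \<Rightarrow> real \<Rightarrow> (real \<Rightarrow> real \<Rightarrow> complex) \<Rightarrow> bool" where
  "continuous_in_Hs T s f \<longleftrightarrow> (\<forall>t\<in>{0..T}. in_Hs s (f t) \<and>
     ((\<lambda>\<tau>. Hs_norm s (\<lambda>x. f \<tau> x - f t x)) \<longlongrightarrow> 0) (at t within {0..T}))"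

text \<open>
  A smooth solution on \<open>[0,T]\<close>. The condition \<open>smooth_fun\<close> merely fixes the smooth representative
  of a profile lying in every $H^m$; for such representatives the equations hold classically.
\<close>

definition zakharov_solution ::
  "real \<Rightarrow> (real \<Rightarrow> complex) \<Rightarrow> (real \<Rightarrow> real) \<Rightarrow> (real \<Rightarrow> real) \<Rightarrow>
   (real \<Rightarrow> real \<Rightarrow> complex) \<Rightarrow> (real \<Rightarrow> real \<Rightarrow> real) \<Rightarrow> bool" where
  "zakharov_solution T u0 n0 n1 u n \<longleftrightarrow>
     (\<forall>m::nat. continuous_in_Hs T (real m) u \<and>
               continuous_in_Hs T (real m) (\<lambda>t x. complex_of_real (n t x)) \<and>
               continuous_in_Hs T (real m - 1) (\<lambda>t x. complex_of_real (dt T n t x))) \<and>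
     (\<forall>t\<in>{0..T}. smooth_fun (u t) \<and> smooth_fun (n t)) \<and>
     (\<forall>t\<in>{0..T}. \<forall>x.
        (\<lambda>\<tau>. u \<tau> x) differentiable (at t within {0..T}) \<and>
        (\<lambda>\<tau>. n \<tau> x) differentiable (at t within {0..T}) \<and>
        (\<lambda>\<tau>. dt T n \<tau> x) differentiable (at t within {0..T}) \<and>
        \<i> * dt T u t x + (dx ^^ 2) (u t) x = complex_of_real (n t x) * u t x \<and>
        dt T (dt T n) t x - (dx ^^ 2) (n t) x = (dx ^^ 2) (\<lambda>y. (cmod (u t y))\<^sup>2) x) \<and>
     (\<forall>x. u 0 x = u0 x \<and> n 0 x = n0 x \<and> dt T n 0 x = n1 x)"

end

theory Submission
  imports Defs "HOL-Probability.Probability" "HOL-Real_Asymp.Real_Asymp"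
begin

text \<open>
  The datum $\phi_N$ has frequency profile of height $\varepsilon N^{1/2-\max(k,0)}$ on bumps of width
  $1/N$ around $N + 1/2$ and $-N + 1/2$. To first order $|u|^2$ then has a bump at frequency
  $\xi \approx 2N$, built from pairs $(\xi+\eta, \eta)$ with $\xi + 2\eta \approx 1$, whose phase
  $e^{-it\xi(\xi+2\eta)} \approx e^{-it\xi}$ is a free wave. The wave equation is driven at
  resonance, so $\hat n(t,\xi)$ grows linearly in $t$ there, and the $H^s$ norm of this bump is of size
  $t N^{s + 1/2 - 2\max(k,0)}$.

  To control the remainder up to a time independent of $N$, the system is solved on the Fourier side by a
  Cauchy--Kovalevskaya fixed point in spaces with weight $W(\xi) e^{-a(t)|\xi|}$, where $W$ peaks along the
  lattice generated by $N$ and satisfies $W * W \lesssim W$ uniformly in $N$, and where the radius $a(t)$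
  decreases from $1/N$ to $1/(2N)$. The solution so obtained is smooth, and every smooth solution has the same
  $n$, by an energy estimate for the difference of two solutions, localised with a slowly varying integrable weight.
\<close>

subsection \<open>Parameter integrals\<close>

text \<open>The existence time is uniform in N by a count of powers. A bump of height N a and width
  1/N has mass of order a, and a^2 N stays bounded because a = N^{-1/2 - max(k,0)} / 40. Since n is
  quadratic in the bumps and carries one derivative, which costs N at the frequencies in play, n has
  mass of order T a^2 N, and its feedback on u through n u is of relative size T^2 a^2 N. The radius
  1/N reflects the same balance: the exponential weight is comparable to 1 at frequencies of order
  N, while its decrease in time buys back the factor |\<xi>| at the price 2 T N. The fixed point
  lives among functions with exponentially decaying spectrum, whereas the claim speaks of every
  smooth solution; hence a uniqueness proof independent of the fixed point. A naive L^2 estimate for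
  the difference of two solutions loses derivatives, since n is driven by two derivatives of |u|^2
  and u by n itself; the Hamiltonian structure is used to cancel this loss.\<close>

lemma borel_measurable_cnj[measurable]:
  assumes [measurable]: "f \<in> borel_measurable M"
  shows "(\<lambda>x. cnj (f x)) \<in> borel_measurable M"
  by (rule borel_measurable_continuous_on[OF _ assms]) (intro continuous_intros)

lemma integral_norm_bound_ennreal':
  fixes f :: "'a \<Rightarrow> 'b::{banach, second_countable_topology}"
  shows "ennreal (norm (integral\<^sup>L M f)) \<le> (\<integral>\<^sup>+x. ennreal (norm (f x)) \<partial>M)"
  by (cases "integrable M f") (auto simp: integral_norm_bound_ennreal not_integrable_integral_eq)

text \<open>In a first-countable parameter space a limit at a point may be tested along sequences,
  which reduces the claim to dominated convergence. Domination is asked only off \<open>p0\<close>,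
  as suits difference quotients.\<close>

lemma tendsto_integral_at_within:
  fixes h :: "'p::first_countable_topology \<Rightarrow> 'y \<Rightarrow> 'c::{banach, second_countable_topology}"
  assumes lim: "\<And>y. y \<in> space M \<Longrightarrow> ((\<lambda>p. h p y) \<longlongrightarrow> l y) (at p0 within S)"
    and meas: "\<And>p. p \<in> S - {p0} \<Longrightarrow> h p \<in> borel_measurable M" "l \<in> borel_measurable M"
    and w: "integrable M w" "\<And>p y. p \<in> S - {p0} \<Longrightarrow> y \<in> space M \<Longrightarrow> norm (h p y) \<le> w y"
  shows "((\<lambda>p. \<integral>y. h p y \<partial>M) \<longlongrightarrow> (\<integral>y. l y \<partial>M)) (at p0 within S)"
  unfolding tendsto_at_iff_sequentially comp_def
proof safe
  fix X :: "nat \<Rightarrow> 'p" assume X: "\<forall>i. X i \<in> S - {p0}" "X \<longlonglongrightarrow> p0"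
  show "(\<lambda>i. \<integral>y. h (X i) y \<partial>M) \<longlonglongrightarrow> (\<integral>y. l y \<partial>M)"
  proof (rule integral_dominated_convergence[where w=w])
    show "AE y in M. (\<lambda>i. h (X i) y) \<longlonglongrightarrow> l y"
      using lim X unfolding tendsto_at_iff_sequentially comp_def by auto
  qed (use meas w X in auto)
qed

lemma continuous_on_lebesgue_integral:
  fixes h :: "'p::first_countable_topology \<Rightarrow> 'y \<Rightarrow> 'c::{banach, second_countable_topology}"
  assumes cont: "\<And>y. y \<in> space M \<Longrightarrow> continuous_on S (\<lambda>p. h p y)"
    and meas: "\<And>p. p \<in> S \<Longrightarrow> h p \<in> borel_measurable M"
    and w: "integrable M w" "\<And>p y. p \<in> S \<Longrightarrow> y \<in> space M \<Longrightarrow> norm (h p y) \<le> w y"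
  shows "continuous_on S (\<lambda>p. \<integral>y. h p y \<partial>M)"
  unfolding continuous_on_def
proof
  fix p assume "p \<in> S"
  then show "((\<lambda>p. \<integral>y. h p y \<partial>M) \<longlongrightarrow> (\<integral>y. h p y \<partial>M)) (at p within S)"
    by (intro tendsto_integral_at_within[where w=w]) (use cont meas w in \<open>auto simp: continuous_on_def\<close>)
qed

lemma has_vector_derivative_iff_tendsto:
  "(f has_vector_derivative d) (at x within S) \<longleftrightarrow>
     ((\<lambda>y. (f y - f x) /\<^sub>R (y - x)) \<longlongrightarrow> d) (at x within S)"
proof -
  have "norm (f y - (f x + (y - x) *\<^sub>R d)) / norm (y - x) = norm ((f y - f x) /\<^sub>R (y - x) - d)"
    if "y \<noteq> x" for y
  proof -
    have "(f y - f x) /\<^sub>R (y - x) - d = (f y - (f x + (y - x) *\<^sub>R d)) /\<^sub>R (y - x)"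
    proof -
      have "((y - x) *\<^sub>R d) /\<^sub>R (y - x) = d" using that by simp
      then show ?thesis by (metis diff_diff_add scaleR_right_diff_distrib)
    qed
    then show ?thesis using that by (simp add: divide_simps)
  qed
  then have "((\<lambda>y. norm (f y - (f x + (y - x) *\<^sub>R d)) / norm (y - x)) \<longlongrightarrow> 0) (at x within S) \<longleftrightarrow>
    ((\<lambda>y. norm ((f y - f x) /\<^sub>R (y - x) - d)) \<longlongrightarrow> 0) (at x within S)"
    by (intro Lim_cong_within) auto
  then show ?thesis
    unfolding has_vector_derivative_def has_derivative_iff_norm
    by (simp add: tendsto_norm_zero_iff LIM_zero_iff bounded_linear_scaleR_left diff_diff_add)
qed

text \<open>The mean value inequality on the convex set \<open>S\<close> bounds the difference
  quotients by the majorant \<open>w\<close> of the derivative; dominated convergence does the rest.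
  Derivatives within \<open>S\<close> cover the one-sided time derivatives at the ends of
  [0,T].\<close>

lemma has_vector_derivative_lebesgue_integral:
  fixes h :: "real \<Rightarrow> 'y \<Rightarrow> 'c::{banach, second_countable_topology}"
  assumes S: "convex S" "t0 \<in> S"
    and der: "\<And>t y. t \<in> S \<Longrightarrow> y \<in> space M \<Longrightarrow> ((\<lambda>t. h t y) has_vector_derivative h' t y) (at t within S)"
    and int: "\<And>t. t \<in> S \<Longrightarrow> integrable M (h t)" and meas: "h' t0 \<in> borel_measurable M"
    and w: "integrable M w" "\<And>t y. t \<in> S \<Longrightarrow> y \<in> space M \<Longrightarrow> norm (h' t y) \<le> w y"
  shows "((\<lambda>t. \<integral>y. h t y \<partial>M) has_vector_derivative (\<integral>y. h' t0 y \<partial>M)) (at t0 within S)"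
proof -
  have "((\<lambda>t. \<integral>y. (h t y - h t0 y) /\<^sub>R (t - t0) \<partial>M) \<longlongrightarrow> (\<integral>y. h' t0 y \<partial>M)) (at t0 within S)"
  proof (rule tendsto_integral_at_within[where w=w])
    fix y assume "y \<in> space M"
    show "((\<lambda>t. (h t y - h t0 y) /\<^sub>R (t - t0)) \<longlongrightarrow> h' t0 y) (at t0 within S)"
      using der[OF S(2) \<open>y \<in> space M\<close>] by (simp add: has_vector_derivative_iff_tendsto)
  next
    fix t y assume t: "t \<in> S - {t0}" and y: "y \<in> space M"
    have "norm (h t y - h t0 y) \<le> w y * norm (t - t0)"
    proof (rule differentiable_bound[OF S(1)])
      show "((\<lambda>t. h t y) has_derivative (\<lambda>s. s *\<^sub>R h' t y)) (at t within S)" if "t \<in> S" for t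
        using der[OF that y] by (simp add: has_vector_derivative_def)
      show "onorm (\<lambda>s. s *\<^sub>R h' t y) \<le> w y" if "t \<in> S" for t
        using w(2)[OF that y] by (intro onorm_le) (simp add: mult.commute mult_left_mono)
    qed (use t S in auto)
    then show "norm ((h t y - h t0 y) /\<^sub>R (t - t0)) \<le> w y"
      using t by (simp add: divide_simps mult.commute)
  qed (use int meas w S in auto)
  moreover have "(\<integral>y. (h t y - h t0 y) /\<^sub>R (t - t0) \<partial>M) = ((\<integral>y. h t y \<partial>M) - (\<integral>y. h t0 y \<partial>M)) /\<^sub>R (t - t0)"
    if "t \<in> S" for t
    by (simp add: Bochner_Integration.integral_diff[OF int[OF that] int[OF S(2)]])
  then have "((\<lambda>t. \<integral>y. (h t y - h t0 y) /\<^sub>R (t - t0) \<partial>M) \<longlongrightarrow> (\<integral>y. h' t0 y \<partial>M)) (at t0 within S) \<longleftrightarrow>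
      ((\<lambda>t. ((\<integral>y. h t y \<partial>M) - (\<integral>y. h t0 y \<partial>M)) /\<^sub>R (t - t0)) \<longlongrightarrow> (\<integral>y. h' t0 y \<partial>M)) (at t0 within S)"
    by (intro Lim_cong_within) auto
  ultimately show ?thesis
    unfolding has_vector_derivative_iff_tendsto by simp
qed

text \<open>The integrability behind the multiplication formula for \<open>synth\<close>, whose
  kernel has modulus 1.\<close>

lemma integrable_pair_mult_bounded:
  fixes f g :: "real \<Rightarrow> complex" and k :: "real \<times> real \<Rightarrow> complex"
  assumes f: "integrable lborel f" and g: "integrable lborel g"
    and k: "k \<in> borel_measurable borel" "\<And>z. cmod (k z) \<le> B"
  shows "integrable (lborel \<Otimes>\<^sub>M lborel) (\<lambda>(x, y). k (x, y) * (f x * g y))"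
proof -
  have k'[measurable]: "k \<in> borel_measurable (lborel \<Otimes>\<^sub>M lborel)"
    using k(1) by (simp add: borel_prod[symmetric] lborel_prod)
  note [measurable] = borel_measurable_integrable[OF f] borel_measurable_integrable[OF g]
  have "integrable (lborel \<Otimes>\<^sub>M lborel) (\<lambda>(x, y). f x * g y)"
  proof (rule lborel_pair.Fubini_integrable)
    show "integrable lborel (\<lambda>x. LINT y|lborel. norm (case (x, y) of (x, y) \<Rightarrow> f x * g y))"
      using f g by (simp add: norm_mult)
    show "AE x in lborel. integrable lborel (\<lambda>y. case (x, y) of (x, y) \<Rightarrow> f x * g y)"
      using g by simp
  qed simp
  then have "integrable (lborel \<Otimes>\<^sub>M lborel) (\<lambda>z. norm (case z of (x, y) \<Rightarrow> f x * g y))"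
    by (rule integrable_norm)
  then have "integrable (lborel \<Otimes>\<^sub>M lborel) (\<lambda>z. B * norm (case z of (x, y) \<Rightarrow> f x * g y))"
    by (rule integrable_mult_right)
  then show ?thesis
  proof (rule Bochner_Integration.integrable_bound)
    show "AE x in lborel \<Otimes>\<^sub>M lborel. norm (case x of (x, y) \<Rightarrow> k (x, y) * (f x * g y))
        \<le> norm (B * cmod (case x of (x, y) \<Rightarrow> f x * g y))"
    proof (rule AE_I2)
      fix z
      have "0 \<le> B" using k(2)[of undefined] norm_ge_zero order_trans by blast
      then have "cmod (k z) * cmod (f (fst z) * g (snd z)) \<le> \<bar>B\<bar> * cmod (f (fst z) * g (snd z))"
        using k(2)[of z] by (intro mult_right_mono) auto
      then show "norm (case z of (x, y) \<Rightarrow> k (x, y) * (f x * g y))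
        \<le> norm (B * cmod (case z of (x, y) \<Rightarrow> f x * g y))"
        by (simp add: case_prod_beta' norm_mult abs_mult)
    qed
  qed simp
qed

lemma Fubini_pair_mult_bounded:
  fixes f g :: "real \<Rightarrow> complex" and k :: "real \<times> real \<Rightarrow> complex"
  assumes "integrable lborel f" "integrable lborel g"
    and "k \<in> borel_measurable borel" "\<And>z. cmod (k z) \<le> B"
  shows "(LINT y|lborel. g y * (LINT x|lborel. k (x, y) * f x)) =
         (LINT x|lborel. f x * (LINT y|lborel. k (x, y) * g y))"
proof -
  have 1: "g y * (LINT x|lborel. k (x, y) * f x) = (LINT x|lborel. k (x, y) * (f x * g y))" for y
    by (subst integral_mult_right_zero[symmetric]) (simp only: mult_ac)
  have 2: "f x * (LINT y|lborel. k (x, y) * g y) = (LINT y|lborel. k (x, y) * (f x * g y))" for x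
    by (subst integral_mult_right_zero[symmetric]) (simp only: mult_ac)
  show ?thesis unfolding 1 2
    by (rule lborel_pair.Fubini_integral[OF integrable_pair_mult_bounded[OF assms], unfolded prod.case])
qed

subsection \<open>The Fourier transform of integrable functions\<close>

text \<open>The inverse Fourier integral without a normalising factor. In this form products of
  functions become correlations of spectra with no powers of 2 pi, which are confined to the
  comparison with the unitary transform.\<close>

definition synth :: "(real \<Rightarrow> complex) \<Rightarrow> real \<Rightarrow> complex" where
  "synth F x = (LINT \<xi>|lborel. exp (\<i> * of_real (x * \<xi>)) * F \<xi>)"

lemma fourier_integral_synth:
  "fourier_integral f \<xi> = of_real (1 / sqrt (2 * pi)) * synth f (- \<xi>)"
  unfolding fourier_integral_def synth_def by (simp add: mult.commute)

lemma norm_exp_i_real[simp]: "cmod (exp (\<i> * complex_of_real a)) = 1"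
  by simp

lemma integrable_exp_mult:
  assumes "integrable lborel (F :: real \<Rightarrow> complex)"
  shows "integrable lborel (\<lambda>\<xi>. exp (\<i> * of_real (x * \<xi>)) * F \<xi>)"
  by (rule Bochner_Integration.integrable_bound[OF assms])
     (use borel_measurable_integrable[OF assms] in \<open>auto simp: norm_mult\<close>)

lemma continuous_synth:
  assumes "integrable lborel F"
  shows "continuous_on UNIV (synth F)"
  unfolding synth_def
  by (rule continuous_on_lebesgue_integral[where w="\<lambda>\<xi>. cmod (F \<xi>)"])
     (use assms borel_measurable_integrable[OF assms] in \<open>auto simp: norm_mult intro!: continuous_intros\<close>)

lemma borel_measurable_synth[measurable]:
  assumes [measurable]: "F \<in> borel_measurable borel"
  shows "synth F \<in> borel_measurable borel"
  unfolding synth_def by measurable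

lemma borel_measurable_fourier_integral[measurable]:
  assumes [measurable]: "F \<in> borel_measurable borel"
  shows "fourier_integral F \<in> borel_measurable borel"
  unfolding fourier_integral_def by measurable

lemma norm_synth_le: "cmod (synth F x) \<le> (LINT \<xi>|lborel. cmod (F \<xi>))"
  unfolding synth_def by (rule order_trans[OF integral_norm_bound]) (simp add: norm_mult)

lemma norm_fourier_integral_le:
  "cmod (fourier_integral F x) \<le> 1 / sqrt (2 * pi) * (LINT \<xi>|lborel. cmod (F \<xi>))"
  unfolding fourier_integral_synth norm_mult
  using norm_synth_le[of F "-x"] by (simp add: divide_right_mono norm_divide)

lemma synth_mult_formula:
  assumes "integrable lborel F" "integrable lborel G"
  shows "(LINT \<xi>|lborel. G \<xi> * synth F \<xi>) = (LINT x|lborel. F x * synth G x)"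
proof -
  have "(\<lambda>z. exp (\<i> * of_real (snd z * fst z))) \<in> borel_measurable borel"
    by (intro borel_measurable_continuous_onI continuous_intros)
  from Fubini_pair_mult_bounded[OF assms this, of 1] show ?thesis
    unfolding synth_def by (simp add: mult.commute)
qed

lemma synth_shift: "synth (\<lambda>\<xi>. exp (\<i> * of_real (a * \<xi>)) * F \<xi>) x = synth F (x + a)"
  unfolding synth_def by (intro Bochner_Integration.integral_cong) (auto simp: algebra_simps exp_add)

section \<open>Gaussian cut-offs and Bessel's inequality\<close>

definition gauss_cut :: "real \<Rightarrow> real \<Rightarrow> complex" where
  "gauss_cut \<sigma> \<xi> = of_real (exp (- (\<sigma> * \<xi>)\<^sup>2 / 2))"

text \<open>After rescaling by \<sigma> the integral is the characteristic function of the standard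
  normal distribution.\<close>

lemma synth_normal_density:
  assumes "\<sigma> > 0"
  shows "synth (\<lambda>\<xi>. of_real (normal_density 0 \<sigma> \<xi>)) x = of_real (exp (- (\<sigma> * x)\<^sup>2 / 2))"
proof -
  have "synth (\<lambda>\<xi>. of_real (normal_density 0 \<sigma> \<xi>)) x =
     \<sigma> *\<^sub>R (LINT y|lborel. exp (\<i> * of_real (x * (0 + \<sigma> * y))) * of_real (normal_density 0 \<sigma> (0 + \<sigma> * y)))"
    unfolding synth_def using assms
    by (subst lborel_integral_real_affine[of \<sigma> _ 0]) auto
  also have "\<dots> = (LINT y|lborel. exp (\<i> * of_real (\<sigma> * x * y)) * of_real (std_normal_density y))"
  proof (subst integral_scaleR_right[symmetric], rule Bochner_Integration.integral_cong)
    fix y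
    have "\<sigma> * normal_density 0 \<sigma> (0 + \<sigma> * y) = std_normal_density y"
      using assms by (simp add: normal_density_def real_sqrt_mult power_mult_distrib field_simps)
    then have *: "complex_of_real \<sigma> * of_real (normal_density 0 \<sigma> (0 + \<sigma> * y)) = of_real (std_normal_density y)"
      by (metis of_real_mult)
    show "\<sigma> *\<^sub>R (exp (\<i> * of_real (x * (0 + \<sigma> * y))) * of_real (normal_density 0 \<sigma> (0 + \<sigma> * y))) =
       exp (\<i> * of_real (\<sigma> * x * y)) * of_real (std_normal_density y)"
      unfolding *[symmetric] by (simp add: scaleR_conv_of_real mult_ac)
  qed simp
  also have "\<dots> = char std_normal_distribution (\<sigma> * x)"
    unfolding char_def
    by (subst integral_density) (auto simp: normal_density_nonneg scaleR_conv_of_real mult_ac intro!: Bochner_Integration.integral_cong)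
  finally show ?thesis by (simp add: char_std_normal_distribution)
qed

lemma gauss_cut_normal_density:
  assumes "\<sigma> > 0"
  shows "gauss_cut \<sigma> \<xi> = of_real (sqrt (2 * pi) / \<sigma> * normal_density 0 (1 / \<sigma>) \<xi>)"
  using assms unfolding gauss_cut_def
  by (simp add: normal_density_def real_sqrt_divide real_sqrt_mult power_mult_distrib field_simps)

lemma integrable_gauss_cut: "\<sigma> > 0 \<Longrightarrow> integrable lborel (gauss_cut \<sigma>)"
  by (subst (asm) zero_less_divide_1_iff[symmetric], rule Bochner_Integration.integrable_cong[THEN iffD1, OF refl])
     (rule gauss_cut_normal_density[symmetric], auto intro!: integrable_of_real)

lemma synth_gauss_cut:
  assumes "\<sigma> > 0"
  shows "synth (gauss_cut \<sigma>) x = of_real (2 * pi * normal_density 0 \<sigma> x)"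
proof -
  have "synth (gauss_cut \<sigma>) x = of_real (sqrt (2 * pi) / \<sigma>) * synth (\<lambda>\<xi>. of_real (normal_density 0 (1 / \<sigma>) \<xi>)) x"
    unfolding synth_def by (subst integral_mult_right_zero[symmetric])
      (simp add: gauss_cut_normal_density[OF assms] mult_ac)
  also have "\<dots> = of_real (sqrt (2 * pi) / \<sigma> * exp (- (x / \<sigma>)\<^sup>2 / 2))"
    using assms by (subst synth_normal_density) auto
  also have "sqrt (2 * pi) / \<sigma> * exp (- (x / \<sigma>)\<^sup>2 / 2) = 2 * pi * normal_density 0 \<sigma> x"
  proof -
    have "sqrt (2 * pi) / \<sigma> = 2 * pi * (1 / sqrt (2 * pi * \<sigma>\<^sup>2))"
      using assms by (simp add: real_sqrt_mult field_simps)
    then show ?thesis unfolding normal_density_def by (simp add: power_divide field_simps)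
  qed
  finally show ?thesis .
qed
text \<open>The squared L^2 norm with values in \<open>ennreal\<close>: finiteness becomes a
  conclusion instead of a side condition, and Fatou's lemma applies directly.\<close>

definition sq_int :: "(real \<Rightarrow> complex) \<Rightarrow> ennreal" where
  "sq_int f = (\<integral>\<^sup>+x. ennreal ((cmod (f x))\<^sup>2) \<partial>lborel)"

lemma sq_int_add_le:
  assumes [measurable]: "f \<in> borel_measurable borel" "g \<in> borel_measurable borel"
  shows "sq_int (\<lambda>x. f x + g x) \<le> 2 * sq_int f + 2 * sq_int g"
proof -
  have "(cmod (f x + g x))\<^sup>2 \<le> 2 * (cmod (f x))\<^sup>2 + 2 * (cmod (g x))\<^sup>2" for x
    using power_mono[OF norm_triangle_ineq[of "f x" "g x"], of 2]
      sum_squares_bound[of "cmod (f x)" "cmod (g x)"]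
    by (simp add: power2_sum)
  then have "sq_int (\<lambda>x. f x + g x) \<le> (\<integral>\<^sup>+x. ennreal (2 * (cmod (f x))\<^sup>2 + 2 * (cmod (g x))\<^sup>2) \<partial>lborel)"
    unfolding sq_int_def by (intro nn_integral_mono ennreal_leI)
  also have "\<dots> = 2 * sq_int f + 2 * sq_int g"
    unfolding sq_int_def by (simp add: nn_integral_add nn_integral_cmult ennreal_plus ennreal_mult)
  finally show ?thesis .
qed

lemma sq_int_minus[simp]: "sq_int (\<lambda>x. - f x) = sq_int f"
  by (simp add: sq_int_def)

lemma sq_int_diff_commute: "sq_int (\<lambda>x. f x - g x) = sq_int (\<lambda>x. g x - f x)"
  by (simp add: sq_int_def norm_minus_commute)

lemma sq_int_reflect: 
  assumes [measurable]: "f \<in> borel_measurable borel"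
  shows "sq_int (\<lambda>x. f (- x)) = sq_int f"
  unfolding sq_int_def
  by (subst (2) nn_integral_real_affine[where c="-1" and t=0]) (auto simp: )

lemma square_integrable_iff:
  "square_integrable f \<longleftrightarrow> f \<in> borel_measurable borel \<and> sq_int f < \<infinity>"
  unfolding square_integrable_def sq_int_def
  by (auto simp: integrable_iff_bounded)

lemma nn_integral_normal_density_affine:
  assumes "\<sigma> > 0"
  shows "(\<integral>\<^sup>+y. ennreal (normal_density 0 \<sigma> (a + y)) \<partial>lborel) = 1"
proof -
  have "(\<integral>\<^sup>+y. ennreal (normal_density 0 \<sigma> y) \<partial>lborel) = 1"
    using assms by (subst nn_integral_eq_integral) auto
  then show ?thesis
    by (subst (asm) nn_integral_real_affine[where c=1 and t=a]) auto
qed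

text \<open>The Gaussian cut-off turns the left-hand side into a quadratic form in \<open>h\<close> with a
  probability kernel, so Young's inequality for products bounds it.\<close>

lemma bessel_gauss:
  assumes h: "integrable lborel h" and \<sigma>: "\<sigma> > 0"
  shows "(\<integral>\<^sup>+\<xi>. ennreal ((cmod (fourier_integral h \<xi>))\<^sup>2 * exp (- (\<sigma> * \<xi>)\<^sup>2 / 2)) \<partial>lborel) \<le> sq_int h"
proof -
  define c where "c = complex_of_real (1 / sqrt (2 * pi))"
  have cc: "c * c * (2 * of_real pi) = 1"
  proof -
    have "c * c = of_real (1 / sqrt (2 * pi) * (1 / sqrt (2 * pi)))"
      unfolding c_def by (rule of_real_mult[symmetric])
    also have "1 / sqrt (2 * pi) * (1 / sqrt (2 * pi)) = 1 / (2 * pi)" by simp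
    finally show ?thesis by simp
  qed
  \<comment> \<open>Conjugation turns \<open>synth h (- \<xi>)\<close> into
    \<open>synth k (- \<xi>)\<close>, so the squared modulus of the transform is a product of two
    transforms and the multiplication formula can be applied to each in turn.\<close>
  define k where "k = (\<lambda>y. cnj (h (- y)))"
  have [measurable]: "h \<in> borel_measurable borel" using borel_measurable_integrable[OF h] by simp
  then have [measurable]: "k \<in> borel_measurable borel" unfolding k_def by measurable
  have k: "integrable lborel k"
    using lborel_integrable_real_affine[OF h, of "-1" 0] unfolding k_def by simp
  have cnj_synth: "cnj (synth h (- \<xi>)) = synth k (- \<xi>)" for \<xi>
  proof -
    have "cnj (synth h (- \<xi>)) = (LINT x|lborel. cnj (exp (\<i> * of_real (- \<xi> * x)) * h x))"
      unfolding synth_def by (rule Bochner_Integration.integral_cnj[symmetric])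
    also have "\<dots> = (LINT x|lborel. cnj (exp (\<i> * of_real (- \<xi> * (0 + (-1) * x))) * h (0 + (-1) * x)))"
      by (subst lborel_integral_real_affine[of "-1" _ 0]) auto
    finally show ?thesis unfolding synth_def k_def by (simp add: exp_cnj)
  qed
  define g where "g = (\<lambda>\<xi>. synth k (- \<xi>) * gauss_cut \<sigma> \<xi>)"
  have gm[measurable]: "gauss_cut \<sigma> \<in> borel_measurable borel"
    unfolding gauss_cut_def by measurable
  have gi: "integrable lborel g"
  proof (rule Bochner_Integration.integrable_bound)
    show "integrable lborel (\<lambda>\<xi>. of_real (LINT \<xi>|lborel. cmod (k \<xi>)) * gauss_cut \<sigma> \<xi>)"
      using integrable_gauss_cut[OF \<sigma>] by simp
    show "AE x in lborel. norm (g x) \<le> norm (of_real (LINT \<xi>|lborel. cmod (k \<xi>)) * gauss_cut \<sigma> x)"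
      by (rule AE_I2) (use norm_synth_le in \<open>auto simp: g_def norm_mult intro!: mult_right_mono order_trans[OF norm_synth_le]\<close>)
  qed (simp add: g_def)
  \<comment> \<open>Multiplying \<open>synth k\<close> by the Gaussian amounts to averaging
    \<open>k\<close> against a normal density, whose total mass 1 yields the sharp constant at the
    end.\<close>
  have inner: "synth g (- x) = 2 * of_real pi * (LINT y|lborel. k y * of_real (normal_density 0 \<sigma> (x + y)))" for x
  proof -
    have "synth g (- x) = (LINT \<xi>|lborel. synth k (- \<xi>) * (exp (\<i> * of_real (- x * \<xi>)) * gauss_cut \<sigma> \<xi>))"
      by (subst synth_def) (simp add: g_def mult_ac)
    also have "\<dots> = (LINT \<xi>|lborel. (exp (\<i> * of_real (x * \<xi>)) * gauss_cut \<sigma> \<xi>) * synth k \<xi>)"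
      by (subst lborel_integral_real_affine[of "-1" _ 0]) (auto simp: gauss_cut_def mult_ac)
    also have "\<dots> = (LINT y|lborel. k y * synth (gauss_cut \<sigma>) (y + x))"
      unfolding synth_mult_formula[OF k integrable_exp_mult[OF integrable_gauss_cut[OF \<sigma>]]]
      by (simp only: synth_shift)
    finally show ?thesis
      by (subst integral_mult_right_zero[symmetric]) (simp add: synth_gauss_cut[OF \<sigma>] add.commute mult_ac)
  qed
  have "complex_of_real ((cmod (fourier_integral h \<xi>))\<^sup>2 * exp (- (\<sigma> * \<xi>)\<^sup>2 / 2)) = c * c * (g \<xi> * synth h (- \<xi>))" for \<xi>
    unfolding of_real_mult fourier_integral_synth c_def g_def gauss_cut_def
    by (subst complex_norm_square) (simp add: cnj_synth mult_ac)
  then have "complex_of_real (LINT \<xi>|lborel. (cmod (fourier_integral h \<xi>))\<^sup>2 * exp (- (\<sigma> * \<xi>)\<^sup>2 / 2)) =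
     c * c * (LINT \<xi>|lborel. g \<xi> * synth h (- \<xi>))"
    by (simp flip: integral_complex_of_real)
  also have "(LINT \<xi>|lborel. g \<xi> * synth h (- \<xi>)) = (LINT \<xi>|lborel. synth h \<xi> * g (- \<xi>))"
    by (subst lborel_integral_real_affine[of "-1" _ 0]) (auto simp: mult_ac)
  also have "\<dots> = (LINT x|lborel. h x * synth (\<lambda>\<xi>. g (- \<xi>)) x)"
    using synth_mult_formula[OF h, of "\<lambda>\<xi>. g (- \<xi>)"] lborel_integrable_real_affine[OF gi, of "-1" 0]
    by (simp add: mult_ac)
  also have "\<dots> = (LINT x|lborel. h x * synth g (- x))"
    unfolding synth_def
    by (subst (2) lborel_integral_real_affine[of "-1" _ 0]) auto
  also have "\<dots> = 2 * of_real pi * (LINT x|lborel. h x * (LINT y|lborel. k y * of_real (normal_density 0 \<sigma> (x + y))))"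
    unfolding inner by (subst integral_mult_right_zero[symmetric]) (simp only: mult_ac)
  finally have eq: "complex_of_real (LINT \<xi>|lborel. (cmod (fourier_integral h \<xi>))\<^sup>2 * exp (- (\<sigma> * \<xi>)\<^sup>2 / 2)) =
      (LINT x|lborel. h x * (LINT y|lborel. k y * of_real (normal_density 0 \<sigma> (x + y))))"
    using cc by (simp add: mult_ac)
  have int: "integrable lborel (\<lambda>\<xi>. (cmod (fourier_integral h \<xi>))\<^sup>2 * exp (- (\<sigma> * \<xi>)\<^sup>2 / 2))"
  proof (rule Bochner_Integration.integrable_bound)
    let ?B = "1 / sqrt (2 * pi) * (LINT \<xi>|lborel. cmod (h \<xi>))"
    show "integrable lborel (\<lambda>\<xi>. ?B\<^sup>2 * cmod (gauss_cut \<sigma> \<xi>))"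
      using integrable_gauss_cut[OF \<sigma>] by simp
    show "AE x in lborel. norm ((cmod (fourier_integral h x))\<^sup>2 * exp (- (\<sigma> * x)\<^sup>2 / 2)) \<le> norm (?B\<^sup>2 * cmod (gauss_cut \<sigma> x))"
      by (rule AE_I2) (use norm_fourier_integral_le[of h] in \<open>auto simp: gauss_cut_def abs_mult intro!: power_mono mult_right_mono\<close>)
  qed simp
  have "(\<integral>\<^sup>+\<xi>. ennreal ((cmod (fourier_integral h \<xi>))\<^sup>2 * exp (- (\<sigma> * \<xi>)\<^sup>2 / 2)) \<partial>lborel) =
     ennreal (cmod (LINT x|lborel. h x * (LINT y|lborel. k y * of_real (normal_density 0 \<sigma> (x + y)))))"
    unfolding eq[symmetric] using int by (subst nn_integral_eq_integral) (auto intro!: Bochner_Integration.integral_nonneg)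
  also have "\<dots> \<le> (\<integral>\<^sup>+x. ennreal (cmod (h x)) * (\<integral>\<^sup>+y. ennreal (cmod (k y) * normal_density 0 \<sigma> (x + y)) \<partial>lborel) \<partial>lborel)"
  proof -
    have "ennreal (cmod (LINT y|lborel. k y * of_real (normal_density 0 \<sigma> (x + y)))) \<le>
      (\<integral>\<^sup>+y. ennreal (cmod (k y) * normal_density 0 \<sigma> (x + y)) \<partial>lborel)" for x
      using integral_norm_bound_ennreal'[of lborel "\<lambda>y. k y * of_real (normal_density 0 \<sigma> (x + y))"]
      by (simp add: norm_mult)
    moreover have "ennreal (cmod (LINT x|lborel. f x)) \<le> (\<integral>\<^sup>+x. ennreal (cmod (f x)) \<partial>lborel)" for f :: "real \<Rightarrow> complex"
      by (rule integral_norm_bound_ennreal')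
    ultimately show ?thesis
      by (intro order_trans[OF integral_norm_bound_ennreal'] nn_integral_mono)
        (auto simp: norm_mult ennreal_mult intro!: mult_left_mono)
  qed
  also have "\<dots> = (\<integral>\<^sup>+x. \<integral>\<^sup>+y. ennreal (cmod (h x) * cmod (k y) * normal_density 0 \<sigma> (x + y)) \<partial>lborel \<partial>lborel)"
    by (subst nn_integral_cmult[symmetric]) (auto simp: ennreal_mult mult_ac)
  also have "\<dots> \<le> (\<integral>\<^sup>+x. \<integral>\<^sup>+y. ennreal (1/2 * (cmod (h x))\<^sup>2) * ennreal (normal_density 0 \<sigma> (x + y)) +
       ennreal (1/2 * (cmod (k y))\<^sup>2) * ennreal (normal_density 0 \<sigma> (y + x)) \<partial>lborel \<partial>lborel)"
  proof (intro nn_integral_mono)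
    fix x y
    have "cmod (h x) * cmod (k y) \<le> 1/2 * (cmod (h x))\<^sup>2 + 1/2 * (cmod (k y))\<^sup>2"
      using sum_squares_bound[of "cmod (h x)" "cmod (k y)"] by simp
    then have "cmod (h x) * cmod (k y) * normal_density 0 \<sigma> (x + y) \<le>
        (1/2 * (cmod (h x))\<^sup>2 + 1/2 * (cmod (k y))\<^sup>2) * normal_density 0 \<sigma> (x + y)"
      by (intro mult_right_mono) auto
    then show "ennreal (cmod (h x) * cmod (k y) * normal_density 0 \<sigma> (x + y)) \<le> ennreal (1/2 * (cmod (h x))\<^sup>2) * ennreal (normal_density 0 \<sigma> (x + y)) +
       ennreal (1/2 * (cmod (k y))\<^sup>2) * ennreal (normal_density 0 \<sigma> (y + x))"
      by (simp add: ennreal_mult[symmetric] ennreal_plus[symmetric] distrib_right add.commute ennreal_leI del: ennreal_plus)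
  qed
  also have "\<dots> = (\<integral>\<^sup>+x. \<integral>\<^sup>+y. ennreal (1/2 * (cmod (h x))\<^sup>2) * ennreal (normal_density 0 \<sigma> (x + y)) \<partial>lborel \<partial>lborel) +
      (\<integral>\<^sup>+x. \<integral>\<^sup>+y. ennreal (1/2 * (cmod (k y))\<^sup>2) * ennreal (normal_density 0 \<sigma> (y + x)) \<partial>lborel \<partial>lborel)"
    by (simp add: nn_integral_add)
  also have "(\<integral>\<^sup>+x. \<integral>\<^sup>+y. ennreal (1/2 * (cmod (k y))\<^sup>2) * ennreal (normal_density 0 \<sigma> (y + x)) \<partial>lborel \<partial>lborel) =
     (\<integral>\<^sup>+y. \<integral>\<^sup>+x. ennreal (1/2 * (cmod (k y))\<^sup>2) * ennreal (normal_density 0 \<sigma> (y + x)) \<partial>lborel \<partial>lborel)"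
    by (rule lborel_pair.Fubini') simp
  also have "(\<integral>\<^sup>+x. \<integral>\<^sup>+y. ennreal (1/2 * (cmod (h x))\<^sup>2) * ennreal (normal_density 0 \<sigma> (x + y)) \<partial>lborel \<partial>lborel) +
     (\<integral>\<^sup>+y. \<integral>\<^sup>+x. ennreal (1/2 * (cmod (k y))\<^sup>2) * ennreal (normal_density 0 \<sigma> (y + x)) \<partial>lborel \<partial>lborel) =
     (\<integral>\<^sup>+x. ennreal (1/2) * ennreal ((cmod (h x))\<^sup>2) \<partial>lborel) + (\<integral>\<^sup>+x. ennreal (1/2) * ennreal ((cmod (k x))\<^sup>2) \<partial>lborel)"
  proof -
    have aff: "(\<integral>\<^sup>+y. ennreal a * ennreal (normal_density 0 \<sigma> (x + y)) \<partial>lborel) = ennreal a" for a x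
      by (subst nn_integral_cmult) (simp_all add: nn_integral_normal_density_affine[OF \<sigma>])
    show ?thesis unfolding aff by (intro arg_cong2[where f="(+)"] nn_integral_cong ennreal_mult) auto
  qed
  also have "\<dots> = ennreal (1/2) * sq_int h + ennreal (1/2) * sq_int k"
    by (simp add: nn_integral_cmult sq_int_def)
  also have "sq_int k = sq_int h"
    using sq_int_reflect[of h] unfolding k_def sq_int_def by simp
  also have "ennreal (1/2) * sq_int h + ennreal (1/2) * sq_int h = sq_int h"
    unfolding distrib_right[symmetric] by (subst ennreal_plus[symmetric]) auto
  finally show ?thesis .
qed

text \<open>Fatou's lemma along \<sigma> = 1/(n+1) removes the cut-off. This is the inequality half
  of Plancherel; exact norms are obtained later by identifying the transform of
  \<open>synth F\<close> almost everywhere.\<close>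

lemma bessel_inequality:
  assumes h: "integrable lborel h"
  shows "sq_int (fourier_integral h) \<le> sq_int h"
proof -
  have [measurable]: "h \<in> borel_measurable borel" using borel_measurable_integrable[OF h] by simp
  let ?f = "\<lambda>n \<xi>. ennreal ((cmod (fourier_integral h \<xi>))\<^sup>2 * exp (- (1 / real (Suc n) * \<xi>)\<^sup>2 / 2))"
  have "(\<lambda>n. ?f n \<xi>) \<longlonglongrightarrow> ennreal ((cmod (fourier_integral h \<xi>))\<^sup>2)" for \<xi>
  proof (rule tendsto_ennrealI)
    have "(\<lambda>n. (cmod (fourier_integral h \<xi>))\<^sup>2 * exp (- (1 / real (Suc n) * \<xi>)\<^sup>2 / 2)) \<longlonglongrightarrow>
       (cmod (fourier_integral h \<xi>))\<^sup>2 * exp (- (0 * \<xi>)\<^sup>2 / 2)"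
      by (intro tendsto_intros LIMSEQ_Suc[OF lim_1_over_n]) auto
    then show "(\<lambda>n. (cmod (fourier_integral h \<xi>))\<^sup>2 * exp (- (1 / real (Suc n) * \<xi>)\<^sup>2 / 2)) \<longlonglongrightarrow>
       (cmod (fourier_integral h \<xi>))\<^sup>2" by simp
  qed
  then have "sq_int (fourier_integral h) = (\<integral>\<^sup>+\<xi>. liminf (\<lambda>n. ?f n \<xi>) \<partial>lborel)"
    unfolding sq_int_def by (intro nn_integral_cong lim_imp_Liminf[symmetric]) auto
  also have "\<dots> \<le> liminf (\<lambda>n. \<integral>\<^sup>+\<xi>. ?f n \<xi> \<partial>lborel)"
    by (rule nn_integral_liminf) simp
  also have "\<dots> \<le> liminf (\<lambda>n. sq_int h)"
    by (intro Liminf_mono always_eventually allI bessel_gauss h) auto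
  finally show ?thesis by (simp add: Liminf_const)
qed

lemma sq_int_synth_le:
  assumes F: "integrable lborel F"
  shows "sq_int (synth F) \<le> ennreal (2 * pi) * sq_int F"
proof -
  have [measurable]: "F \<in> borel_measurable borel" using borel_measurable_integrable[OF F] by simp
  have "sq_int (synth F) = sq_int (\<lambda>x. synth F (- x))"
    by (rule sq_int_reflect[symmetric]) simp
  also have "\<dots> = (\<integral>\<^sup>+x. ennreal (2 * pi) * ennreal ((cmod (fourier_integral F x))\<^sup>2) \<partial>lborel)"
    unfolding sq_int_def
    by (intro nn_integral_cong)
       (simp add: fourier_integral_synth norm_mult norm_divide power_mult_distrib power_divide ennreal_mult[symmetric])
  also have "\<dots> = ennreal (2 * pi) * sq_int (fourier_integral F)"
    unfolding sq_int_def by (rule nn_integral_cmult) simp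
  finally show ?thesis using bessel_inequality[OF F] by (simp add: mult_left_mono)
qed

subsection \<open>The Plancherel transform\<close>

lemma Cauchy_Schwarz_sq_int:
  assumes [measurable]: "f \<in> borel_measurable borel" "g \<in> borel_measurable borel"
  shows "ennreal ((cmod (LINT x|lborel. f x * g x))\<^sup>2) \<le> sq_int f * sq_int g"
proof -
  have "ennreal ((cmod (LINT x|lborel. f x * g x))\<^sup>2) = (ennreal (cmod (LINT x|lborel. f x * g x)))\<^sup>2"
    by (simp add: ennreal_power)
  also have "\<dots> \<le> (\<integral>\<^sup>+x. ennreal (cmod (f x * g x)) \<partial>lborel)\<^sup>2"
    by (intro power_mono integral_norm_bound_ennreal') auto
  also have "\<dots> = (\<integral>\<^sup>+x. ennreal (cmod (f x)) * ennreal (cmod (g x)) \<partial>lborel)\<^sup>2"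
    by (simp add: norm_mult ennreal_mult)
  also have "\<dots> \<le> (\<integral>\<^sup>+x. (ennreal (cmod (f x)))\<^sup>2 \<partial>lborel) * (\<integral>\<^sup>+x. (ennreal (cmod (g x)))\<^sup>2 \<partial>lborel)"
    by (rule Cauchy_Schwarz_nn_integral) auto
  finally show ?thesis by (simp add: sq_int_def ennreal_power)
qed

lemma integrable_mult_sq_int:
  assumes [measurable]: "f \<in> borel_measurable borel" "g \<in> borel_measurable borel"
    and "sq_int f < \<infinity>" "sq_int g < \<infinity>"
  shows "integrable lborel (\<lambda>x. f x * g x)"
proof (rule Bochner_Integration.integrable_bound)
  show "integrable lborel (\<lambda>x. (cmod (f x))\<^sup>2 + (cmod (g x))\<^sup>2)"
    using assms unfolding sq_int_def by (intro Bochner_Integration.integrable_add) (auto simp: integrable_iff_bounded)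
  show "AE x in lborel. norm (f x * g x) \<le> norm ((cmod (f x))\<^sup>2 + (cmod (g x))\<^sup>2)"
  proof (rule AE_I2)
    fix x
    have "0 \<le> cmod (f x) * cmod (g x)" by simp
    then show "norm (f x * g x) \<le> norm ((cmod (f x))\<^sup>2 + (cmod (g x))\<^sup>2)"
      using sum_squares_bound[of "cmod (f x)" "cmod (g x)"] unfolding norm_mult real_norm_def by linarith
  qed
qed simp

lemma sq_int_mono:
  assumes "\<And>x. cmod (f x) \<le> cmod (g x)"
  shows "sq_int f \<le> sq_int g"
  unfolding sq_int_def by (intro nn_integral_mono ennreal_leI power_mono assms) auto

lemma sq_int_cmult:
  assumes [measurable]: "f \<in> borel_measurable borel"
  shows "sq_int (\<lambda>x. c * f x) = ennreal ((cmod c)\<^sup>2) * sq_int f"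
  unfolding sq_int_def by (subst nn_integral_cmult[symmetric]) (auto simp: norm_mult power_mult_distrib ennreal_mult)

definition trunc :: "real \<Rightarrow> (real \<Rightarrow> complex) \<Rightarrow> real \<Rightarrow> complex" where
  "trunc R f = (\<lambda>x. indicator {- R..R} x *\<^sub>R f x)"

lemma borel_measurable_trunc[measurable]:
  "f \<in> borel_measurable borel \<Longrightarrow> trunc R f \<in> borel_measurable borel"
  unfolding trunc_def by measurable

lemma integrable_trunc:
  assumes "square_integrable f"
  shows "integrable lborel (trunc R f)"
proof (rule Bochner_Integration.integrable_bound)
  have f[measurable]: "f \<in> borel_measurable borel" "integrable lborel (\<lambda>x. (cmod (f x))\<^sup>2)"
    using assms by (auto simp: square_integrable_def)
  show "integrable lborel (\<lambda>x. indicator {- R..R} x + (cmod (f x))\<^sup>2)"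
    by (intro Bochner_Integration.integrable_add f) (auto simp: integrable_indicator_iff emeasure_lborel_Icc_eq)
  show "AE x in lborel. norm (trunc R f x) \<le> norm (indicator {- R..R} x + (cmod (f x))\<^sup>2)"
  proof (rule AE_I2)
    fix x
    have "2 * cmod (f x) \<le> 1 + (cmod (f x))\<^sup>2" using sum_squares_bound[of 1 "cmod (f x)"] by simp
    moreover have "0 \<le> cmod (f x)" by simp
    ultimately have "cmod (f x) \<le> 1 + (cmod (f x))\<^sup>2" by linarith
    then show "norm (trunc R f x) \<le> norm (indicator {- R..R} x + (cmod (f x))\<^sup>2)"
      by (auto simp: trunc_def indicator_def)
  qed
  show "trunc R f \<in> borel_measurable lborel" using f by simp
qed

lemma synth_diff:
  assumes "integrable lborel f" "integrable lborel g"
  shows "synth (\<lambda>x. f x - g x) x = synth f x - synth g x"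
  unfolding synth_def right_diff_distrib
  by (rule Bochner_Integration.integral_diff[OF integrable_exp_mult[OF assms(1)] integrable_exp_mult[OF assms(2)]])

lemma fourier_integral_diff:
  assumes "integrable lborel f" "integrable lborel g"
  shows "fourier_integral (\<lambda>x. f x - g x) \<xi> = fourier_integral f \<xi> - fourier_integral g \<xi>"
  unfolding fourier_integral_synth synth_diff[OF assms] by (rule right_diff_distrib)

lemma sq_int_tail_tendsto:
  assumes "square_integrable f"
  shows "((\<lambda>R. sq_int (\<lambda>x. f x - trunc R f x)) \<longlongrightarrow> 0) at_top"
proof -
  have f[measurable]: "f \<in> borel_measurable borel" "integrable lborel (\<lambda>x. (cmod (f x))\<^sup>2)"
    using assms by (auto simp: square_integrable_def)
  have le: "cmod (f x - trunc R f x) \<le> cmod (f x)" for R x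
    by (auto simp: trunc_def indicator_def)
  have int: "integrable lborel (\<lambda>x. (cmod (f x - trunc R f x))\<^sup>2)" for R
    by (rule Bochner_Integration.integrable_bound[OF f(2)]) (auto intro!: AE_I2 power_mono le)
  have "((\<lambda>R. LINT x|lborel. (cmod (f x - trunc R f x))\<^sup>2) \<longlongrightarrow> (LINT x|(lborel::real measure). 0)) at_top"
  proof (rule integral_dominated_convergence_at_top[OF _ _ f(2)])
    show "AE x in lborel. ((\<lambda>R. (cmod (f x - trunc R f x))\<^sup>2) \<longlongrightarrow> 0) at_top"
    proof (rule AE_I2)
      fix x
      have "eventually (\<lambda>R. (cmod (f x - trunc R f x))\<^sup>2 = 0) at_top"
        using eventually_ge_at_top[of "\<bar>x\<bar>"] by eventually_elim (auto simp: trunc_def indicator_def)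
      then show "((\<lambda>R. (cmod (f x - trunc R f x))\<^sup>2) \<longlongrightarrow> 0) at_top"
        by (simp add: tendsto_eventually)
    qed
    show "\<forall>\<^sub>F R in at_top. AE x in lborel. norm ((cmod (f x - trunc R f x))\<^sup>2) \<le> (cmod (f x))\<^sup>2"
      by (intro always_eventually allI AE_I2) (auto intro!: power_mono le)
  qed auto
  then have "((\<lambda>R. ennreal (LINT x|lborel. (cmod (f x - trunc R f x))\<^sup>2)) \<longlongrightarrow> ennreal 0) at_top"
    by (intro tendsto_ennrealI) simp
  then show ?thesis
    unfolding sq_int_def using nn_integral_eq_integral[OF int] by simp
qed

text \<open>The geometric decay leaves room for the weights 2^k: the sum of 2^k d_k^2 is finite
  almost everywhere, where d_k is the modulus of the k-th increment. Since d_k \<le> 2^{-k} + 2^k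
  d_k^2, the increments are then absolutely summable.\<close>

lemma AE_convergent_of_sq_int_fast:
  assumes [measurable]: "\<And>k. G k \<in> borel_measurable borel"
    and bd: "\<And>k::nat. sq_int (\<lambda>x. G (Suc k) x - G k x) \<le> ennreal ((1/8) ^ k)"
  shows "AE x in lborel. convergent (\<lambda>k. G k x)"
proof -
  define d where "d = (\<lambda>k x. cmod (G (Suc k) x - G k x))"
  have [measurable]: "d k \<in> borel_measurable borel" for k unfolding d_def by measurable
  have "(\<integral>\<^sup>+x. (\<Sum>k. ennreal (2 ^ k * (d k x)\<^sup>2)) \<partial>lborel) = (\<Sum>k. \<integral>\<^sup>+x. ennreal (2 ^ k * (d k x)\<^sup>2) \<partial>lborel)"
    by (rule nn_integral_suminf) simp
  also have "\<dots> = (\<Sum>k. ennreal (2 ^ k) * sq_int (\<lambda>x. G (Suc k) x - G k x))"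
    by (simp add: ennreal_mult nn_integral_cmult sq_int_def d_def)
  also have "\<dots> \<le> (\<Sum>k. ennreal ((1/4) ^ k))"
  proof (rule suminf_le)
    fix k :: nat
    have "ennreal (2 ^ k) * sq_int (\<lambda>x. G (Suc k) x - G k x) \<le> ennreal (2 ^ k) * ennreal ((1/8) ^ k)"
      by (intro mult_left_mono bd) auto
    also have "\<dots> = ennreal ((1/4) ^ k)"
      by (simp add: ennreal_mult[symmetric] power_mult_distrib[symmetric])
    finally show "ennreal (2 ^ k) * sq_int (\<lambda>x. G (Suc k) x - G k x) \<le> ennreal ((1/4) ^ k)" .
  qed auto
  also have "\<dots> = ennreal (\<Sum>k. (1/4) ^ k)"
    by (rule suminf_ennreal2) (auto intro: summable_geometric)
  also have "\<dots> < \<infinity>" by simp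
  finally have fin: "(\<integral>\<^sup>+x. (\<Sum>k. ennreal (2 ^ k * (d k x)\<^sup>2)) \<partial>lborel) < \<infinity>" .
  have "AE x in lborel. (\<Sum>k. ennreal (2 ^ k * (d k x)\<^sup>2)) \<noteq> \<infinity>"
  proof (rule nn_integral_PInf_AE)
    show "(\<lambda>x. \<Sum>k. ennreal (2 ^ k * (d k x)\<^sup>2)) \<in> borel_measurable lborel" by measurable
    show "(\<integral>\<^sup>+x. (\<Sum>k. ennreal (2 ^ k * (d k x)\<^sup>2)) \<partial>lborel) \<noteq> \<infinity>" using fin by (rule less_imp_neq)
  qed
  then show ?thesis
  proof eventually_elim
    case (elim x)
    then have "summable (\<lambda>k. 2 ^ k * (d k x)\<^sup>2)"
      by (intro summable_suminf_not_top) auto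
    moreover have "summable (\<lambda>k. (1/2::real) ^ k)" by (rule summable_geometric) simp
    ultimately have "summable (\<lambda>k. (1/2) ^ k + 2 ^ k * (d k x)\<^sup>2)" by (rule summable_add[rotated])
    then have "summable (\<lambda>k. G (Suc k) x - G k x)"
    proof (rule summable_comparison_test'[where N=0])
      fix k
      have *: "2 * ((1/2) ^ k * (2 ^ k * d k x)) \<le> (1/2) ^ k * 1 + (1/2)^k * (2 ^ k * d k x)\<^sup>2"
        using mult_left_mono[OF sum_squares_bound[of 1 "2 ^ k * d k x"], of "(1/2)^k"]
        by (simp add: algebra_simps)
      have e1: "(1/2) ^ k * (2 ^ k * d k x) = d k x"
        by (simp add: power_divide)
      have e2: "(1/2)^k * (2 ^ k * d k x)\<^sup>2 = 2 ^ k * (d k x)\<^sup>2"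
        by (simp add: power_divide power2_eq_square)
      have "0 \<le> d k x" by (simp add: d_def)
      then show "norm (G (Suc k) x - G k x) \<le> (1/2) ^ k + 2 ^ k * (d k x)\<^sup>2"
        using *[unfolded e1 e2] unfolding d_def by linarith
    qed
    then have "convergent (\<lambda>n. \<Sum>k<n. G (Suc k) x - G k x)"
      by (simp add: summable_iff_convergent)
    then have "convergent (\<lambda>n. G n x - G 0 x)"
      unfolding sum_lessThan_telescope[of "\<lambda>k. G k x"] .
    then have "convergent (\<lambda>n. (G n x - G 0 x) + G 0 x)"
      by (rule convergent_add) (rule convergent_const)
    then show ?case by simp
  qed
qed

text \<open>By Bessel's inequality the Fourier integrals of the truncations form a Cauchy family in
  L^2, with modulus given by the L^2 tail of \<open>f\<close>. Its limit is built as the almost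
  everywhere limit along a rapidly convergent sequence, as in the proof that L^2 is
  complete.\<close>

lemma fourier_L2_exists:
  assumes f: "square_integrable f"
  shows "\<exists>g. is_fourier_L2 f g"
proof -
  define F where "F = (\<lambda>R. fourier_integral (trunc R f))"
  define tail where "tail = (\<lambda>R. sq_int (\<lambda>x. f x - trunc R f x))"
  have fm[measurable]: "f \<in> borel_measurable borel" using f by (simp add: square_integrable_def)
  have [measurable]: "F R \<in> borel_measurable borel" for R unfolding F_def by measurable
  have sqt: "sq_int (trunc R f) < \<infinity>" for R
  proof -
    have "sq_int (trunc R f) \<le> sq_int f" by (rule sq_int_mono) (auto simp: trunc_def indicator_def)
    then show ?thesis using f by (simp add: square_integrable_iff)
  qed
  have F_diff: "sq_int (\<lambda>\<xi>. F R \<xi> - F R' \<xi>) \<le> tail R" if "R \<le> R'" for R R'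
  proof -
    have "(\<lambda>\<xi>. F R \<xi> - F R' \<xi>) = fourier_integral (\<lambda>x. trunc R f x - trunc R' f x)"
      unfolding F_def using fourier_integral_diff[OF integrable_trunc[OF f] integrable_trunc[OF f]] by auto
    then have "sq_int (\<lambda>\<xi>. F R \<xi> - F R' \<xi>) \<le> sq_int (\<lambda>x. trunc R f x - trunc R' f x)"
      using bessel_inequality[of "\<lambda>x. trunc R f x - trunc R' f x"] integrable_trunc[OF f] by simp
    also have "\<dots> \<le> tail R"
      unfolding tail_def using that by (intro sq_int_mono) (auto simp: trunc_def indicator_def)
    finally show ?thesis .
  qed
  have tail: "(tail \<longlongrightarrow> 0) at_top" unfolding tail_def by (rule sq_int_tail_tendsto[OF f])
  have "\<exists>r. \<forall>R\<ge>r. tail R \<le> ennreal ((1/8) ^ k)" for k :: nat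
  proof -
    have "eventually (\<lambda>R. tail R < ennreal ((1/8) ^ k)) at_top"
      by (rule order_tendstoD(2)[OF tail]) simp
    then show ?thesis unfolding eventually_at_top_linorder by (meson less_imp_le)
  qed
  then obtain r0 where r0: "\<And>k R. R \<ge> r0 k \<Longrightarrow> tail R \<le> ennreal ((1/8) ^ k)" by metis
  \<comment> \<open>The sum of absolute values makes \<open>r\<close> increasing and at least
    \<open>r0\<close>; the summand \<open>real k\<close> makes it unbounded, so that every
    \<open>R\<close> is eventually overtaken.\<close>
  define r where "r = (\<lambda>k. real k + (\<Sum>i\<le>k. \<bar>r0 i\<bar>))"
  have r_ge: "r k \<ge> r0 k" "r k \<ge> real k" "r k \<le> r (Suc k)" for k
  proof -
    have "\<bar>r0 k\<bar> \<le> (\<Sum>i\<le>k. \<bar>r0 i\<bar>)" by (rule member_le_sum) auto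
    then show "r k \<ge> r0 k" unfolding r_def by simp
  qed (auto simp: r_def intro!: sum_nonneg)
  have "AE x in lborel. convergent (\<lambda>k. F (r k) x)"
  proof (rule AE_convergent_of_sq_int_fast)
    fix k
    have "sq_int (\<lambda>x. F (r (Suc k)) x - F (r k) x) = sq_int (\<lambda>x. F (r k) x - F (r (Suc k)) x)"
      by (rule sq_int_diff_commute)
    also have "\<dots> \<le> tail (r k)" using r_ge(3) by (rule F_diff)
    also have "\<dots> \<le> ennreal ((1/8) ^ k)" using r_ge(1) by (rule r0)
    finally show "sq_int (\<lambda>x. F (r (Suc k)) x - F (r k) x) \<le> ennreal ((1/8) ^ k)" .
  qed simp
  then have conv: "AE x in lborel. (\<lambda>k. F (r k) x) \<longlonglongrightarrow> lim (\<lambda>k. F (r k) x)"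
    by eventually_elim (simp add: convergent_LIMSEQ_iff)
  define g where "g = (\<lambda>x. lim (\<lambda>k. F (r k) x))"
  have gm[measurable]: "g \<in> borel_measurable borel" unfolding g_def by (rule borel_measurable_lim_metric) simp
  \<comment> \<open>Fatou's lemma along \<open>r\<close> gives the bound for every \<open>R\<close>,
    so the whole family converges and not just the sequence.\<close>
  have Fg: "sq_int (\<lambda>\<xi>. F R \<xi> - g \<xi>) \<le> tail R" for R
  proof -
    have "sq_int (\<lambda>\<xi>. F R \<xi> - g \<xi>) = (\<integral>\<^sup>+\<xi>. liminf (\<lambda>k. ennreal ((cmod (F R \<xi> - F (r k) \<xi>))\<^sup>2)) \<partial>lborel)"
      unfolding sq_int_def
    proof (rule nn_integral_cong_AE)
      show "AE \<xi> in lborel. ennreal ((cmod (F R \<xi> - g \<xi>))\<^sup>2) = liminf (\<lambda>k. ennreal ((cmod (F R \<xi> - F (r k) \<xi>))\<^sup>2))"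
        using conv by eventually_elim (intro lim_imp_Liminf[symmetric] tendsto_ennrealI tendsto_intros, auto simp: g_def)
    qed
    also have "\<dots> \<le> liminf (\<lambda>k. sq_int (\<lambda>\<xi>. F R \<xi> - F (r k) \<xi>))"
      unfolding sq_int_def by (rule nn_integral_liminf) simp
    also have "\<dots> \<le> liminf (\<lambda>k::nat. tail R)"
    proof (rule Liminf_mono)
      have "eventually (\<lambda>k. real k \<ge> R) sequentially"
        using filterlim_real_sequentially by (simp add: filterlim_at_top)
      then show "\<forall>\<^sub>F k in sequentially. sq_int (\<lambda>\<xi>. F R \<xi> - F (r k) \<xi>) \<le> tail R"
        by eventually_elim (rule F_diff, rule order_trans[OF _ r_ge(2)])
    qed
    finally show ?thesis by (simp add: Liminf_const)
  qed
  have "sq_int g < \<infinity>"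
  proof -
    have "sq_int g = sq_int (\<lambda>\<xi>. (g \<xi> - F (r 0) \<xi>) + F (r 0) \<xi>)" by simp
    also have "\<dots> \<le> 2 * sq_int (\<lambda>\<xi>. g \<xi> - F (r 0) \<xi>) + 2 * sq_int (F (r 0))"
      by (rule sq_int_add_le) auto
    also have "sq_int (\<lambda>\<xi>. g \<xi> - F (r 0) \<xi>) = sq_int (\<lambda>\<xi>. F (r 0) \<xi> - g \<xi>)" by (rule sq_int_diff_commute)
    finally have 1: "sq_int g \<le> 2 * sq_int (\<lambda>\<xi>. F (r 0) \<xi> - g \<xi>) + 2 * sq_int (F (r 0))" .
    have 2: "sq_int (\<lambda>\<xi>. F (r 0) \<xi> - g \<xi>) < \<infinity>"
      by (rule le_less_trans[OF order_trans[OF Fg r0[OF r_ge(1)[of 0]]]]) simp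
    have 3: "sq_int (F (r 0)) < \<infinity>"
      unfolding F_def using bessel_inequality[OF integrable_trunc[OF f]] sqt by (rule le_less_trans)
    show ?thesis using 2 3 by (intro le_less_trans[OF 1]) (simp add: ennreal_mult_less_top)
  qed
  then have "square_integrable g" by (simp add: square_integrable_iff)
  moreover have "((\<lambda>R. sq_int (\<lambda>\<xi>. F R \<xi> - g \<xi>)) \<longlongrightarrow> 0) at_top"
    by (rule tendsto_sandwich[OF _ _ tendsto_const tail]) (auto intro!: always_eventually Fg)
  ultimately show ?thesis
    unfolding is_fourier_L2_def sq_int_def F_def trunc_def by blast
qed

lemma is_fourier_L2_iff:
  "is_fourier_L2 f g \<longleftrightarrow> square_integrable g \<and>
     ((\<lambda>R. sq_int (\<lambda>\<xi>. fourier_integral (trunc R f) \<xi> - g \<xi>)) \<longlongrightarrow> 0) at_top"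
  unfolding is_fourier_L2_def sq_int_def trunc_def ..

lemma is_fourier_fourier_L2: "square_integrable f \<Longrightarrow> is_fourier_L2 f (fourier_L2 f)"
  unfolding fourier_L2_def using fourier_L2_exists by (rule someI_ex)

lemma square_integrable_fourier_L2: "square_integrable f \<Longrightarrow> square_integrable (fourier_L2 f)"
  using is_fourier_fourier_L2 by (simp add: is_fourier_L2_iff)

lemma is_fourier_L2_unique:
  assumes f: "square_integrable f" and g: "is_fourier_L2 f g1" "is_fourier_L2 f g2"
  shows "AE \<xi> in lborel. g1 \<xi> = g2 \<xi>"
proof -
  have [measurable]: "f \<in> borel_measurable borel" "g1 \<in> borel_measurable borel" "g2 \<in> borel_measurable borel"
    using f g by (auto simp: is_fourier_L2_iff square_integrable_iff)
  let ?F = "\<lambda>R. fourier_integral (trunc R f)"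
  have le: "sq_int (\<lambda>\<xi>. g1 \<xi> - g2 \<xi>) \<le> 2 * sq_int (\<lambda>\<xi>. ?F R \<xi> - g1 \<xi>) + 2 * sq_int (\<lambda>\<xi>. ?F R \<xi> - g2 \<xi>)" for R
  proof -
    have "sq_int (\<lambda>\<xi>. g1 \<xi> - g2 \<xi>) = sq_int (\<lambda>\<xi>. (g1 \<xi> - ?F R \<xi>) + (?F R \<xi> - g2 \<xi>))" by simp
    also have "\<dots> \<le> 2 * sq_int (\<lambda>\<xi>. g1 \<xi> - ?F R \<xi>) + 2 * sq_int (\<lambda>\<xi>. ?F R \<xi> - g2 \<xi>)"
      by (rule sq_int_add_le) auto
    finally show ?thesis by (simp add: sq_int_diff_commute[of g1])
  qed
  have "((\<lambda>R. 2 * sq_int (\<lambda>\<xi>. ?F R \<xi> - g1 \<xi>) + 2 * sq_int (\<lambda>\<xi>. ?F R \<xi> - g2 \<xi>)) \<longlongrightarrow> 2 * 0 + 2 * 0) at_top"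
    using g by (intro tendsto_add ennreal_tendsto_cmult) (auto simp: is_fourier_L2_iff)
  then have "sq_int (\<lambda>\<xi>. g1 \<xi> - g2 \<xi>) \<le> 2 * 0 + 2 * 0"
    by (rule tendsto_lowerbound) (auto intro!: always_eventually le)
  then have "sq_int (\<lambda>\<xi>. g1 \<xi> - g2 \<xi>) = 0" by simp
  then have "AE \<xi> in lborel. ennreal ((cmod (g1 \<xi> - g2 \<xi>))\<^sup>2) = 0"
    unfolding sq_int_def by (subst (asm) nn_integral_0_iff_AE) auto
  then show ?thesis by eventually_elim (simp add: ennreal_eq_0_iff)
qed

lemma square_integrable_diff:
  assumes "square_integrable f" "square_integrable g"
  shows "square_integrable (\<lambda>x. f x - g x)"
proof -
  have [measurable]: "f \<in> borel_measurable borel" "g \<in> borel_measurable borel"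
    using assms by (auto simp: square_integrable_iff)
  have "sq_int (\<lambda>x. f x - g x) \<le> 2 * sq_int f + 2 * sq_int g"
    using sq_int_add_le[of f "\<lambda>x. - g x"] by simp
  also have "\<dots> < \<infinity>" using assms by (simp add: square_integrable_iff ennreal_mult_less_top)
  finally show ?thesis by (simp add: square_integrable_iff)
qed

text \<open>Linearity can hold only almost everywhere, because \<open>fourier_L2\<close> selects a
  representative for each function separately.\<close>

lemma fourier_L2_diff:
  assumes f: "square_integrable f" "square_integrable g"
  shows "AE \<xi> in lborel. fourier_L2 (\<lambda>x. f x - g x) \<xi> = fourier_L2 f \<xi> - fourier_L2 g \<xi>"
proof (rule is_fourier_L2_unique[OF square_integrable_diff[OF f]])
  show "is_fourier_L2 (\<lambda>x. f x - g x) (fourier_L2 (\<lambda>x. f x - g x))"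
    by (rule is_fourier_fourier_L2[OF square_integrable_diff[OF f]])
  let ?f = "fourier_L2 f" and ?g = "fourier_L2 g"
  have F: "is_fourier_L2 f ?f" "is_fourier_L2 g ?g" using f by (auto intro: is_fourier_fourier_L2)
  have [measurable]: "f \<in> borel_measurable borel" "g \<in> borel_measurable borel"
     "?f \<in> borel_measurable borel" "?g \<in> borel_measurable borel"
    using f F by (auto simp: square_integrable_iff is_fourier_L2_iff)
  have le: "sq_int (\<lambda>\<xi>. fourier_integral (trunc R (\<lambda>x. f x - g x)) \<xi> - (?f \<xi> - ?g \<xi>)) \<le>
     2 * sq_int (\<lambda>\<xi>. fourier_integral (trunc R f) \<xi> - ?f \<xi>) + 2 * sq_int (\<lambda>\<xi>. fourier_integral (trunc R g) \<xi> - ?g \<xi>)" for R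
  proof -
    have "trunc R (\<lambda>x. f x - g x) = (\<lambda>x. trunc R f x - trunc R g x)"
      by (auto simp: trunc_def algebra_simps)
    then have "fourier_integral (trunc R (\<lambda>x. f x - g x)) \<xi> = fourier_integral (trunc R f) \<xi> - fourier_integral (trunc R g) \<xi>" for \<xi>
      using fourier_integral_diff[OF integrable_trunc[OF f(1)] integrable_trunc[OF f(2)]] by simp
    then have "sq_int (\<lambda>\<xi>. fourier_integral (trunc R (\<lambda>x. f x - g x)) \<xi> - (?f \<xi> - ?g \<xi>)) =
       sq_int (\<lambda>\<xi>. (fourier_integral (trunc R f) \<xi> - ?f \<xi>) + - (fourier_integral (trunc R g) \<xi> - ?g \<xi>))"
      by (intro arg_cong[where f=sq_int] ext, simp only: \<open>\<And>\<xi>. fourier_integral (trunc R (\<lambda>x. f x - g x)) \<xi> = _\<close>, simp)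
    also have "\<dots> \<le> 2 * sq_int (\<lambda>\<xi>. fourier_integral (trunc R f) \<xi> - ?f \<xi>) + 2 * sq_int (\<lambda>\<xi>. - (fourier_integral (trunc R g) \<xi> - ?g \<xi>))"
      by (rule sq_int_add_le) auto
    finally show ?thesis by (simp only: sq_int_minus)
  qed
  have lim: "((\<lambda>R. 2 * sq_int (\<lambda>\<xi>. fourier_integral (trunc R f) \<xi> - ?f \<xi>) + 2 * sq_int (\<lambda>\<xi>. fourier_integral (trunc R g) \<xi> - ?g \<xi>)) \<longlongrightarrow> 2 * 0 + 2 * 0) at_top"
    using F by (intro tendsto_add ennreal_tendsto_cmult) (auto simp: is_fourier_L2_iff)
  have "((\<lambda>R. sq_int (\<lambda>\<xi>. fourier_integral (trunc R (\<lambda>x. f x - g x)) \<xi> - (?f \<xi> - ?g \<xi>))) \<longlongrightarrow> 0) at_top"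
    by (rule tendsto_sandwich[OF _ _ tendsto_const lim[simplified]]) (auto intro!: always_eventually le)
  then show "is_fourier_L2 (\<lambda>x. f x - g x) (\<lambda>\<xi>. ?f \<xi> - ?g \<xi>)"
    using F square_integrable_diff by (simp add: is_fourier_L2_iff)
qed

text \<open>The weak characterisation of the L^2 transform. For truncations it is the multiplication
  formula; the left side passes to the limit by Cauchy--Schwarz, the right side by dominated
  convergence. Injectivity and inversion below both test this identity with Gaussians.\<close>

lemma fourier_L2_pairing:
  assumes f: "square_integrable f" and \<phi>: "integrable lborel \<phi>" "sq_int \<phi> < \<infinity>"
  shows "(LINT \<xi>|lborel. fourier_L2 f \<xi> * \<phi> \<xi>) =
    of_real (1 / sqrt (2 * pi)) * (LINT x|lborel. f x * synth \<phi> (- x))"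
proof -
  let ?c = "complex_of_real (1 / sqrt (2 * pi))"
  define g where "g = fourier_L2 f"
  have g: "is_fourier_L2 f g" using is_fourier_fourier_L2[OF f] by (simp add: g_def)
  have [measurable]: "f \<in> borel_measurable borel" "g \<in> borel_measurable borel" "\<phi> \<in> borel_measurable borel"
    using f g borel_measurable_integrable[OF \<phi>(1)] by (auto simp: square_integrable_iff is_fourier_L2_iff)
  let ?F = "\<lambda>R. fourier_integral (trunc R f)"
  have Fsq: "sq_int (?F R) < \<infinity>" for R
  proof -
    have "sq_int (?F R) \<le> sq_int (trunc R f)" by (rule bessel_inequality[OF integrable_trunc[OF f]])
    also have "\<dots> \<le> sq_int f" by (rule sq_int_mono) (auto simp: trunc_def indicator_def)
    finally show ?thesis using f by (simp add: square_integrable_iff)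
  qed
  have gsq: "sq_int g < \<infinity>" using g by (simp add: is_fourier_L2_iff square_integrable_iff)
  have lim0: "((\<lambda>R. LINT \<xi>|lborel. (?F R \<xi> - g \<xi>) * \<phi> \<xi>) \<longlongrightarrow> 0) at_top"
  proof -
    have h0: "((\<lambda>R. sq_int (\<lambda>\<xi>. ?F R \<xi> - g \<xi>) * sq_int \<phi>) \<longlongrightarrow> 0 * sq_int \<phi>) at_top"
      using g \<phi>(2) by (intro tendsto_mult_ennreal tendsto_const) (auto simp: is_fourier_L2_iff)
    have "((\<lambda>R. ennreal ((cmod (LINT \<xi>|lborel. (?F R \<xi> - g \<xi>) * \<phi> \<xi>))\<^sup>2)) \<longlongrightarrow> 0) at_top"
    proof (rule tendsto_sandwich[OF _ _ tendsto_const h0[unfolded mult_zero_left]])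
      show "\<forall>\<^sub>F R in at_top. ennreal ((cmod (LINT \<xi>|lborel. (?F R \<xi> - g \<xi>) * \<phi> \<xi>))\<^sup>2) \<le> sq_int (\<lambda>\<xi>. ?F R \<xi> - g \<xi>) * sq_int \<phi>"
        by (rule always_eventually, rule allI, rule Cauchy_Schwarz_sq_int) auto
    qed auto
    then have "((\<lambda>R. (cmod (LINT \<xi>|lborel. (?F R \<xi> - g \<xi>) * \<phi> \<xi>))\<^sup>2) \<longlongrightarrow> 0) at_top"
      by (subst (asm) ennreal_0[symmetric], subst (asm) tendsto_ennreal_iff) auto
    then have "((\<lambda>R. sqrt ((cmod (LINT \<xi>|lborel. (?F R \<xi> - g \<xi>) * \<phi> \<xi>))\<^sup>2)) \<longlongrightarrow> sqrt 0) at_top"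
      by (rule tendsto_real_sqrt)
    then show ?thesis by (simp add: tendsto_norm_zero_iff)
  qed
  have reflect: "synth (\<lambda>\<xi>. \<phi> (- \<xi>)) x = synth \<phi> (- x)" for x
    unfolding synth_def by (subst lborel_integral_real_affine[of "-1" _ 0]) auto
  have eq: "(LINT \<xi>|lborel. (?F R \<xi> - g \<xi>) * \<phi> \<xi>) = ?c * (LINT x|lborel. trunc R f x * synth \<phi> (- x)) - (LINT \<xi>|lborel. g \<xi> * \<phi> \<xi>)" for R
  proof -
    have "(LINT \<xi>|lborel. (?F R \<xi> - g \<xi>) * \<phi> \<xi>) = (LINT \<xi>|lborel. ?F R \<xi> * \<phi> \<xi>) - (LINT \<xi>|lborel. g \<xi> * \<phi> \<xi>)"
      unfolding left_diff_distrib
      by (rule Bochner_Integration.integral_diff) (auto intro!: integrable_mult_sq_int Fsq gsq \<phi>(2))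
    also have "(LINT \<xi>|lborel. ?F R \<xi> * \<phi> \<xi>) = ?c * (LINT \<xi>|lborel. \<phi> \<xi> * synth (trunc R f) (- \<xi>))"
      by (subst integral_mult_right_zero[symmetric]) (simp only: fourier_integral_synth mult_ac)
    also have "(LINT \<xi>|lborel. \<phi> \<xi> * synth (trunc R f) (- \<xi>)) = (LINT \<xi>|lborel. \<phi> (- \<xi>) * synth (trunc R f) \<xi>)"
      by (subst lborel_integral_real_affine[of "-1" _ 0]) auto
    also have "\<dots> = (LINT x|lborel. trunc R f x * synth (\<lambda>\<xi>. \<phi> (- \<xi>)) x)"
      using lborel_integrable_real_affine[OF \<phi>(1), of "-1" 0]
      by (intro synth_mult_formula integrable_trunc f) simp
    finally show ?thesis unfolding reflect .
  qed
  have lim1: "((\<lambda>R. ?c * (LINT x|lborel. trunc R f x * synth \<phi> (- x)) - (LINT \<xi>|lborel. g \<xi> * \<phi> \<xi>)) \<longlongrightarrow> 0) at_top"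
    using lim0 unfolding eq .
  have sq: "sq_int (\<lambda>x. synth \<phi> (- x)) < \<infinity>"
  proof -
    have "sq_int (\<lambda>x. synth \<phi> (- x)) = sq_int (synth \<phi>)" by (rule sq_int_reflect) simp
    also have "\<dots> \<le> ennreal (2 * pi) * sq_int \<phi>" by (rule sq_int_synth_le[OF \<phi>(1)])
    also have "\<dots> < \<infinity>" using \<phi>(2) by (simp add: ennreal_mult_less_top)
    finally show ?thesis .
  qed
  have int: "integrable lborel (\<lambda>x. f x * synth \<phi> (- x))"
    using f by (intro integrable_mult_sq_int sq) (auto simp: square_integrable_iff)
  have lim2: "((\<lambda>R. LINT x|lborel. trunc R f x * synth \<phi> (- x)) \<longlongrightarrow> (LINT x|lborel. f x * synth \<phi> (- x))) at_top"
  proof (rule integral_dominated_convergence_at_top[OF _ _ integrable_norm[OF int]])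
    show "AE x in lborel. ((\<lambda>R. trunc R f x * synth \<phi> (- x)) \<longlongrightarrow> f x * synth \<phi> (- x)) at_top"
    proof (rule AE_I2)
      fix x
      have "eventually (\<lambda>R. trunc R f x * synth \<phi> (- x) = f x * synth \<phi> (- x)) at_top"
        using eventually_ge_at_top[of "\<bar>x\<bar>"] by eventually_elim (auto simp: trunc_def indicator_def)
      then show "((\<lambda>R. trunc R f x * synth \<phi> (- x)) \<longlongrightarrow> f x * synth \<phi> (- x)) at_top"
        by (simp add: tendsto_eventually)
    qed
    show "\<forall>\<^sub>F R in at_top. AE x in lborel. norm (trunc R f x * synth \<phi> (- x)) \<le> cmod (f x * synth \<phi> (- x))"
      by (intro always_eventually allI AE_I2) (auto simp: trunc_def indicator_def)
  qed auto
  have "((\<lambda>R. ?c * (LINT x|lborel. trunc R f x * synth \<phi> (- x)) - (LINT \<xi>|lborel. g \<xi> * \<phi> \<xi>)) \<longlongrightarrow>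
     ?c * (LINT x|lborel. f x * synth \<phi> (- x)) - (LINT \<xi>|lborel. g \<xi> * \<phi> \<xi>)) at_top"
    by (intro tendsto_intros lim2)
  from tendsto_unique[OF _ this lim1] show ?thesis by (simp add: g_def)
qed

subsection \<open>Injectivity and inversion\<close>

text \<open>Levy's uniqueness theorem for characteristic functions, applied to the positive and
  negative parts of \<open>h\<close> after normalising them to probability densities. Their masses
  agree because the transforms agree at 0; mass 0 is a separate case.\<close>

lemma synth_inj_real:
  fixes h :: "real \<Rightarrow> real"
  assumes h: "integrable lborel h" and z: "\<And>x. synth (\<lambda>\<xi>. of_real (h \<xi>)) x = 0"
  shows "AE \<xi> in lborel. h \<xi> = 0"
proof -
  define p where "p = (\<lambda>x. max 0 (h x))"
  define n where "n = (\<lambda>x. max 0 (- h x))"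
  have hm[measurable]: "h \<in> borel_measurable borel" using borel_measurable_integrable[OF h] by simp
  have [measurable]: "p \<in> borel_measurable borel" "n \<in> borel_measurable borel"
    unfolding p_def n_def by measurable
  have pn: "integrable lborel p" "integrable lborel n"
    unfolding p_def n_def using h by auto
  have hpn: "h x = p x - n x" for x by (auto simp: p_def n_def)
  have nonneg: "0 \<le> p x" "0 \<le> n x" for x by (auto simp: p_def n_def)
  have S: "synth (\<lambda>\<xi>. of_real (p \<xi>)) x = synth (\<lambda>\<xi>. of_real (n \<xi>)) x" for x
    using z[of x] synth_diff[of "\<lambda>\<xi>. of_real (p \<xi>)" "\<lambda>\<xi>. of_real (n \<xi>)" x] pn by (simp add: hpn)
  have "complex_of_real (integral\<^sup>L lborel p) = complex_of_real (integral\<^sup>L lborel n)"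
    using S[of 0] by (simp add: synth_def)
  then have eqI: "integral\<^sup>L lborel p = integral\<^sup>L lborel n" by (simp only: of_real_eq_iff)
  define m where "m = integral\<^sup>L lborel p"
  have "m \<ge> 0" unfolding m_def using nonneg by (intro Bochner_Integration.integral_nonneg) auto
  show ?thesis
  proof (cases "m = 0")
    case True
    then have "AE x in lborel. p x = 0" "AE x in lborel. n x = 0"
      using integral_nonneg_eq_0_iff_AE[OF pn(1)] integral_nonneg_eq_0_iff_AE[OF pn(2)] nonneg eqI
      by (auto simp: m_def)
    then show ?thesis by eventually_elim (simp add: hpn)
  next
    case False
    with \<open>m \<ge> 0\<close> have m: "m > 0" by simp
    have dist: "real_distribution (density lborel (\<lambda>x. ennreal (q x / m)))"
      if q: "integrable lborel q" "\<And>x. 0 \<le> q x" "integral\<^sup>L lborel q = m" for q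
    proof -
      have [measurable]: "q \<in> borel_measurable borel" using borel_measurable_integrable[OF q(1)] by simp
      have "(\<integral>\<^sup>+x. ennreal (q x / m) \<partial>lborel) = ennreal (LINT x|lborel. q x / m)"
        using q m by (intro nn_integral_eq_integral) auto
      also have "\<dots> = 1" using q m by simp
      finally have "prob_space (density lborel (\<lambda>x. ennreal (q x / m)))"
        by (intro prob_spaceI) (simp add: emeasure_density)
      then show ?thesis
        by (simp add: real_distribution_def real_distribution_axioms_def)
    qed
    have ch: "char (density lborel (\<lambda>x. ennreal (q x / m))) t = synth (\<lambda>\<xi>. of_real (q \<xi>)) t / of_real m"
      if q: "integrable lborel q" "\<And>x. 0 \<le> q x" for q t
    proof -
      have [measurable]: "q \<in> borel_measurable borel" using borel_measurable_integrable[OF q(1)] by simp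
      have "char (density lborel (\<lambda>x. ennreal (q x / m))) t = (LINT x|lborel. (q x / m) *\<^sub>R exp (\<i> * of_real (t * x)))"
        unfolding char_def using q m by (subst integral_density) auto
      also have "\<dots> = (LINT x|lborel. exp (\<i> * of_real (t * x)) * of_real (q x) / of_real m)"
        by (intro Bochner_Integration.integral_cong) (auto simp: scaleR_conv_of_real)
      finally show ?thesis unfolding synth_def by simp
    qed
    have "density lborel (\<lambda>x. ennreal (p x / m)) = density lborel (\<lambda>x. ennreal (n x / m))"
    proof (rule Levy_uniqueness)
      show "real_distribution (density lborel (\<lambda>x. ennreal (p x / m)))"
        by (rule dist[OF pn(1) nonneg(1)]) (simp add: m_def)
      show "real_distribution (density lborel (\<lambda>x. ennreal (n x / m)))"
        by (rule dist[OF pn(2) nonneg(2)]) (simp add: m_def eqI)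
      show "char (density lborel (\<lambda>x. ennreal (p x / m))) = char (density lborel (\<lambda>x. ennreal (n x / m)))"
        by (rule ext) (simp only: ch[OF pn(1) nonneg(1)] ch[OF pn(2) nonneg(2)] S)
    qed
    then have "AE x in lborel. ennreal (p x / m) = ennreal (n x / m)"
      by (subst (asm) sigma_finite_measure.density_unique_iff[OF lborel.sigma_finite_measure_axioms]) auto
    then show ?thesis
      by eventually_elim (use m nonneg in \<open>simp add: hpn\<close>)
  qed
qed

lemma synth_cnj:
  "cnj (synth h x) = synth (\<lambda>\<xi>. cnj (h (- \<xi>))) x"
proof -
  have "cnj (synth h x) = (LINT \<xi>|lborel. cnj (exp (\<i> * of_real (x * \<xi>)) * h \<xi>))"
    unfolding synth_def by (rule Bochner_Integration.integral_cnj[symmetric])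
  also have "\<dots> = (LINT \<xi>|lborel. cnj (exp (\<i> * of_real (x * (0 + (-1) * \<xi>))) * h (0 + (-1) * \<xi>)))"
    by (subst lborel_integral_real_affine[of "-1" _ 0]) auto
  finally show ?thesis unfolding synth_def by (simp add: exp_cnj)
qed

lemma synth_reflect: "synth (\<lambda>\<xi>. h (- \<xi>)) x = synth h (- x)"
  unfolding synth_def by (subst lborel_integral_real_affine[of "-1" _ 0]) auto

text \<open>If \<open>synth h\<close> vanishes then so does the transform of the conjugate of
  \<open>h\<close>, being the conjugate of \<open>synth h\<close> at the reflected point; hence real
  and imaginary parts fall under the real case.\<close>

lemma synth_inj:
  assumes h: "integrable lborel h" and z: "\<And>x. synth h x = 0"
  shows "AE \<xi> in lborel. h \<xi> = 0"
proof -
  have int: "integrable lborel (\<lambda>\<xi>. exp (\<i> * of_real (x * \<xi>)) * cnj (h \<xi>))" for x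
    using h by (intro integrable_exp_mult) simp
  have zc: "synth (\<lambda>\<xi>. cnj (h \<xi>)) x = 0" for x
    using synth_cnj[of "\<lambda>\<xi>. h (- \<xi>)" x] z[of "- x"] by (simp add: synth_reflect)
  have zero: "(LINT \<xi>|lborel. exp (\<i> * of_real (x * \<xi>)) * h \<xi>) = 0" "(LINT \<xi>|lborel. exp (\<i> * of_real (x * \<xi>)) * cnj (h \<xi>)) = 0" for x
    using z[of x] zc[of x] by (auto simp: synth_def)
  have Re: "complex_of_real (Re w) = (w + cnj w) / 2" and Im: "complex_of_real (Im w) = (w - cnj w) / (2 * \<i>)" for w
    by (auto simp: complex_eq_iff)
  have "AE \<xi> in lborel. Re (h \<xi>) = 0"
  proof (rule synth_inj_real)
    fix x
    have "synth (\<lambda>\<xi>. of_real (Re (h \<xi>))) x =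
       (LINT \<xi>|lborel. (exp (\<i> * of_real (x * \<xi>)) * h \<xi> + exp (\<i> * of_real (x * \<xi>)) * cnj (h \<xi>)) / 2)"
      unfolding synth_def Re by (intro Bochner_Integration.integral_cong) (auto simp: field_simps)
    also have "\<dots> = 0"
      unfolding integral_divide_zero
      by (subst Bochner_Integration.integral_add[OF integrable_exp_mult[OF h] int]) (simp only: zero, simp)
    finally show "synth (\<lambda>\<xi>. of_real (Re (h \<xi>))) x = 0" .
  qed (use h in simp)
  moreover have "AE \<xi> in lborel. Im (h \<xi>) = 0"
  proof (rule synth_inj_real)
    fix x
    have "synth (\<lambda>\<xi>. of_real (Im (h \<xi>))) x =
       (LINT \<xi>|lborel. (exp (\<i> * of_real (x * \<xi>)) * h \<xi> - exp (\<i> * of_real (x * \<xi>)) * cnj (h \<xi>)) / (2 * \<i>))"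
      unfolding synth_def Im by (intro Bochner_Integration.integral_cong) (auto simp: field_simps)
    also have "\<dots> = 0"
      unfolding integral_divide_zero
      by (subst Bochner_Integration.integral_diff[OF integrable_exp_mult[OF h] int]) (simp only: zero, simp)
    finally show "synth (\<lambda>\<xi>. of_real (Im (h \<xi>))) x = 0" .
  qed (use h in simp)
  ultimately show ?thesis by eventually_elim (simp add: complex_eq_iff)
qed

lemma borel_measurable_gauss_cut[measurable]: "gauss_cut \<sigma> \<in> borel_measurable borel"
  unfolding gauss_cut_def by measurable

lemma gauss_cut_le: "cmod (gauss_cut \<sigma> \<xi>) \<le> 1"
  by (simp add: gauss_cut_def)

lemma gauss_cut_nz: "gauss_cut \<sigma> \<xi> \<noteq> 0"
  by (simp add: gauss_cut_def)

lemma sq_int_bounded: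
  assumes "integrable lborel f" and B: "\<And>x. cmod (f x) \<le> B"
  shows "sq_int f < \<infinity>"
proof -
  have [measurable]: "f \<in> borel_measurable borel" using borel_measurable_integrable[OF assms(1)] by simp
  have "sq_int f \<le> (\<integral>\<^sup>+x. ennreal B * ennreal (cmod (f x)) \<partial>lborel)"
    unfolding sq_int_def
  proof (intro nn_integral_mono)
    fix x
    have "0 \<le> B" using B norm_ge_zero order_trans by blast
    then show "ennreal ((cmod (f x))\<^sup>2) \<le> ennreal B * ennreal (cmod (f x))"
      using B[of x] by (auto simp: power2_eq_square ennreal_mult[symmetric] intro!: ennreal_leI mult_right_mono)
  qed
  also have "\<dots> = ennreal B * (\<integral>\<^sup>+x. ennreal (cmod (f x)) \<partial>lborel)" by (rule nn_integral_cmult) simp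
  also have "\<dots> < \<infinity>" using assms(1) by (auto simp: integrable_iff_bounded ennreal_mult_less_top)
  finally show ?thesis .
qed

lemma sq_int_gauss_cut: "\<sigma> > 0 \<Longrightarrow> sq_int (gauss_cut \<sigma>) < \<infinity>"
  by (rule sq_int_bounded[OF integrable_gauss_cut gauss_cut_le])

text \<open>Pairing with translated Gaussians turns the hypothesis into the vanishing of the
  transform of \<open>f\<close> times a Gaussian. That product is integrable although
  \<open>f\<close> is only in L^2, and a Gaussian has no zeros.\<close>

lemma AE_zero_of_fourier_L2:
  assumes f: "square_integrable f" and z: "AE \<xi> in lborel. fourier_L2 f \<xi> = 0"
  shows "AE x in lborel. f x = 0"
proof -
  have fm[measurable]: "f \<in> borel_measurable borel" and fs: "sq_int f < \<infinity>" using f by (auto simp: square_integrable_iff)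
  have "AE x in lborel. f x * gauss_cut 1 x = 0"
  proof (rule synth_inj)
    show "integrable lborel (\<lambda>x. f x * gauss_cut 1 x)"
      by (intro integrable_mult_sq_int fs sq_int_gauss_cut) auto
    fix b
    define \<phi> where "\<phi> = (\<lambda>\<xi>. gauss_cut 1 (\<xi> + b))"
    have i\<phi>: "integrable lborel \<phi>"
      using lborel_integrable_real_affine[OF integrable_gauss_cut[of 1], of 1 b] by (simp add: \<phi>_def add.commute)
    have "0 = (LINT \<xi>|lborel. fourier_L2 f \<xi> * \<phi> \<xi>)"
      using z by (intro integral_eq_zero_AE[symmetric]) auto
    also have "\<dots> = of_real (1 / sqrt (2 * pi)) * (LINT x|lborel. f x * synth \<phi> (- x))"
      by (rule fourier_L2_pairing[OF f i\<phi> sq_int_bounded[OF i\<phi>, of 1]]) (simp add: \<phi>_def gauss_cut_le)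
    finally have "(LINT x|lborel. f x * synth \<phi> (- x)) = 0" by simp
    moreover have "synth \<phi> (- x) = (2 * of_real pi / of_real (sqrt (2 * pi))) * (exp (\<i> * of_real (b * x)) * gauss_cut 1 x)" for x
    proof -
      have "synth \<phi> (- x) = (LINT \<xi>|lborel. exp (\<i> * of_real (- x * (- b + 1 * \<xi>))) * gauss_cut 1 (- b + 1 * \<xi> + b))"
        unfolding synth_def \<phi>_def by (subst lborel_integral_real_affine[of 1 _ "- b"]) auto
      also have "\<dots> = (LINT \<xi>|lborel. exp (\<i> * of_real (b * x)) * (exp (\<i> * of_real (- x * \<xi>)) * gauss_cut 1 \<xi>))"
        by (intro Bochner_Integration.integral_cong) (auto simp: algebra_simps exp_add[symmetric])
      also have "\<dots> = exp (\<i> * of_real (b * x)) * synth (gauss_cut 1) (- x)"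
        unfolding synth_def by (rule integral_mult_right_zero)
      also have "\<dots> = exp (\<i> * of_real (b * x)) * ((2 * of_real pi / of_real (sqrt (2 * pi))) * gauss_cut 1 x)"
        by (simp add: synth_gauss_cut gauss_cut_def std_normal_density_def)
      finally show ?thesis by simp
    qed
    ultimately have "(2 * of_real pi / of_real (sqrt (2 * pi))) * (LINT x|lborel. exp (\<i> * of_real (b * x)) * (f x * gauss_cut 1 x)) = 0"
      by (subst integral_mult_right_zero[symmetric]) (simp add: mult_ac)
    then show "synth (\<lambda>x. f x * gauss_cut 1 x) b = 0"
      unfolding synth_def by simp
  qed
  then show ?thesis by eventually_elim (simp add: gauss_cut_nz)
qed

text \<open>Fourier inversion on the frequency side. Multiplication by a Gaussian makes the
  difference of both sides integrable, so \<open>synth_inj\<close> applies; the test functions are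
  modulated Gaussians, whose transforms are translated normal densities and can be transformed back
  explicitly.\<close>

lemma fourier_L2_synth:
  assumes F: "integrable lborel F" "sq_int F < \<infinity>"
  shows "square_integrable (synth F)"
    and "AE \<xi> in lborel. fourier_L2 (synth F) \<xi> = of_real (sqrt (2 * pi)) * F \<xi>"
proof -
  have [measurable]: "F \<in> borel_measurable borel" using borel_measurable_integrable[OF F(1)] by simp
  have "sq_int (synth F) < \<infinity>"
    using le_less_trans[OF sq_int_synth_le[OF F(1)]] F(2) by (simp add: ennreal_mult_less_top)
  then show si: "square_integrable (synth F)" by (simp add: square_integrable_iff)
  define g where "g = fourier_L2 (synth F)"
  have gm[measurable]: "g \<in> borel_measurable borel" and gs: "sq_int g < \<infinity>"
    using square_integrable_fourier_L2[OF si] by (auto simp: g_def square_integrable_iff)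
  have ig: "integrable lborel (\<lambda>\<xi>. g \<xi> * gauss_cut 1 \<xi>)" "integrable lborel (\<lambda>\<xi>. of_real (sqrt (2 * pi)) * (F \<xi> * gauss_cut 1 \<xi>))"
    by (intro integrable_mult_sq_int gs sq_int_gauss_cut integrable_mult_right F; simp)+
  have "AE \<xi> in lborel. g \<xi> * gauss_cut 1 \<xi> - of_real (sqrt (2 * pi)) * (F \<xi> * gauss_cut 1 \<xi>) = 0"
  proof (rule synth_inj)
    show "integrable lborel (\<lambda>\<xi>. g \<xi> * gauss_cut 1 \<xi> - of_real (sqrt (2 * pi)) * (F \<xi> * gauss_cut 1 \<xi>))"
      using ig by (rule Bochner_Integration.integrable_diff)
    fix x
    define \<phi> where "\<phi> = (\<lambda>\<xi>. exp (\<i> * of_real (x * \<xi>)) * gauss_cut 1 \<xi>)"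
    have i\<phi>: "integrable lborel \<phi>" unfolding \<phi>_def by (intro integrable_exp_mult integrable_gauss_cut) simp
    define \<psi> where "\<psi> = (\<lambda>y. complex_of_real (2 * pi * normal_density 0 1 (x - y)))"
    have i\<psi>: "integrable lborel \<psi>"
    proof -
      have "integrable lborel (\<lambda>y. normal_density 0 1 (x + (-1) * y))"
        by (rule lborel_integrable_real_affine) auto
      then have "integrable lborel (\<lambda>y. normal_density 0 1 (x - y))" by simp
      then show ?thesis unfolding \<psi>_def by (intro integrable_of_real integrable_mult_right)
    qed
    have \<phi>\<psi>: "synth \<phi> (- y) = \<psi> y" for y
      unfolding \<phi>_def synth_shift \<psi>_def by (subst synth_gauss_cut) auto
    have s\<psi>: "synth \<psi> \<xi> = 2 * of_real pi * \<phi> \<xi>" for \<xi>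
    proof -
      have "synth \<psi> \<xi> = (LINT y|lborel. exp (\<i> * of_real (\<xi> * (x + (-1) * y))) * \<psi> (x + (-1) * y))"
        unfolding synth_def by (subst lborel_integral_real_affine[of "-1" _ x]) auto
      also have "\<dots> = (LINT y|lborel. (2 * of_real pi * exp (\<i> * of_real (x * \<xi>))) * (exp (\<i> * of_real (- \<xi> * y)) * of_real (normal_density 0 1 y)))"
        by (intro Bochner_Integration.integral_cong) (auto simp: \<psi>_def algebra_simps exp_add[symmetric] exp_diff exp_minus field_simps)
      also have "\<dots> = (2 * of_real pi * exp (\<i> * of_real (x * \<xi>))) * synth (\<lambda>y. of_real (normal_density 0 1 y)) (- \<xi>)"
        unfolding synth_def by (rule integral_mult_right_zero)
      also have "\<dots> = 2 * of_real pi * \<phi> \<xi>"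
        by (subst synth_normal_density) (auto simp: \<phi>_def gauss_cut_def)
      finally show ?thesis .
    qed
    have "(LINT \<xi>|lborel. g \<xi> * \<phi> \<xi>) = of_real (1 / sqrt (2 * pi)) * (LINT y|lborel. synth F y * synth \<phi> (- y))"
      unfolding g_def
      by (rule fourier_L2_pairing[OF si i\<phi> sq_int_bounded[OF i\<phi>, of 1]]) (simp add: \<phi>_def norm_mult gauss_cut_le)
    also have "(LINT y|lborel. synth F y * synth \<phi> (- y)) = (LINT y|lborel. \<psi> y * synth F y)"
      unfolding \<phi>\<psi> by (simp add: mult.commute)
    also have "\<dots> = (LINT \<xi>|lborel. F \<xi> * synth \<psi> \<xi>)"
      by (rule synth_mult_formula[OF F(1) i\<psi>])
    also have "\<dots> = 2 * of_real pi * (LINT \<xi>|lborel. F \<xi> * \<phi> \<xi>)"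
      unfolding s\<psi> by (subst integral_mult_right_zero[symmetric]) (simp only: mult_ac)
    also have "of_real (1 / sqrt (2 * pi)) * (2 * of_real pi * (LINT \<xi>|lborel. F \<xi> * \<phi> \<xi>)) =
       of_real (1 / sqrt (2 * pi) * (2 * pi)) * (LINT \<xi>|lborel. F \<xi> * \<phi> \<xi>)" by simp
    also have "1 / sqrt (2 * pi) * (2 * pi) = sqrt (2 * pi)"
      by (simp add: real_div_sqrt)
    finally have eq: "(LINT \<xi>|lborel. g \<xi> * \<phi> \<xi>) = of_real (sqrt (2 * pi)) * (LINT \<xi>|lborel. F \<xi> * \<phi> \<xi>)" .
    have "synth (\<lambda>\<xi>. g \<xi> * gauss_cut 1 \<xi> - of_real (sqrt (2 * pi)) * (F \<xi> * gauss_cut 1 \<xi>)) x =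
       synth (\<lambda>\<xi>. g \<xi> * gauss_cut 1 \<xi>) x - synth (\<lambda>\<xi>. of_real (sqrt (2 * pi)) * (F \<xi> * gauss_cut 1 \<xi>)) x"
      by (rule synth_diff[OF ig])
    also have "synth (\<lambda>\<xi>. g \<xi> * gauss_cut 1 \<xi>) x = (LINT \<xi>|lborel. g \<xi> * \<phi> \<xi>)"
      unfolding synth_def \<phi>_def by (simp add: mult_ac)
    also have "synth (\<lambda>\<xi>. of_real (sqrt (2 * pi)) * (F \<xi> * gauss_cut 1 \<xi>)) x = of_real (sqrt (2 * pi)) * (LINT \<xi>|lborel. F \<xi> * \<phi> \<xi>)"
      unfolding synth_def \<phi>_def by (subst integral_mult_right_zero[symmetric]) (simp only: mult_ac)
    finally show "synth (\<lambda>\<xi>. g \<xi> * gauss_cut 1 \<xi> - of_real (sqrt (2 * pi)) * (F \<xi> * gauss_cut 1 \<xi>)) x = 0"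
      by (simp add: eq)
  qed
  then show "AE \<xi> in lborel. fourier_L2 (synth F) \<xi> = of_real (sqrt (2 * pi)) * F \<xi>"
    unfolding g_def
  proof eventually_elim
    case (elim \<xi>)
    then have "(fourier_L2 (synth F) \<xi> - of_real (sqrt (2 * pi)) * F \<xi>) * gauss_cut 1 \<xi> = 0"
      by (simp add: algebra_simps)
    then show ?case by (simp add: gauss_cut_nz)
  qed
qed

text \<open>The set of disagreement is open and null, hence empty. This upgrades identities between
  representatives to pointwise ones.\<close>

lemma continuous_AE_eq_imp_eq:
  fixes f g :: "real \<Rightarrow> complex"
  assumes "continuous_on UNIV f" "continuous_on UNIV g" and ae: "AE x in lborel. f x = g x"
  shows "f = g"
proof (rule ccontr)
  assume "f \<noteq> g"
  have op: "open {x. f x \<noteq> g x}" by (rule open_Collect_neq) (use assms in auto)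
  have "emeasure lborel {x. f x \<noteq> g x} = 0"
    using ae op by (subst (asm) AE_iff_measurable[OF _ refl]) auto
  then have "{x. f x \<noteq> g x} \<in> null_sets lborel" using op by (intro null_setsI) auto
  then have "negligible {x. f x \<noteq> g x}"
    using null_sets_completionI negligible_iff_null_sets by blast
  then show False using open_not_negligible[OF op] \<open>f \<noteq> g\<close> by auto
qed

text \<open>The factor converts the unitary transform into the amplitude that the unnormalised
  \<open>synth\<close> expects, so that \<open>synth (spec f)\<close> recovers
  \<open>f\<close>.\<close>

definition spec :: "(real \<Rightarrow> complex) \<Rightarrow> real \<Rightarrow> complex" where
  "spec f \<xi> = of_real (1 / sqrt (2 * pi)) * fourier_L2 f \<xi>"

text \<open>The difference of the two sides is in L^2 with transform zero almost everywhere;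
  continuity then removes the exceptional null set.\<close>

lemma synth_spec:
  assumes f: "square_integrable f" "continuous_on UNIV f" and G: "integrable lborel (spec f)"
  shows "f = synth (spec f)"
proof (rule continuous_AE_eq_imp_eq[OF f(2) continuous_synth[OF G]])
  have [measurable]: "fourier_L2 f \<in> borel_measurable borel"
    using square_integrable_fourier_L2[OF f(1)] by (simp add: square_integrable_iff)
  have sq: "sq_int (spec f) < \<infinity>"
    unfolding spec_def using square_integrable_fourier_L2[OF f(1)]
    by (subst sq_int_cmult) (auto simp: square_integrable_iff ennreal_mult_less_top)
  note S = fourier_L2_synth[OF G sq]
  have d: "square_integrable (\<lambda>x. f x - synth (spec f) x)" by (rule square_integrable_diff[OF f(1) S(1)])
  have "AE \<xi> in lborel. fourier_L2 (\<lambda>x. f x - synth (spec f) x) \<xi> = 0"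
    using fourier_L2_diff[OF f(1) S(1)] S(2) by eventually_elim (simp add: spec_def)
  from AE_zero_of_fourier_L2[OF d this] show "AE x in lborel. f x = synth (spec f) x"
    by eventually_elim simp
qed

subsection \<open>Smooth functions and Sobolev norms\<close>

lemma synth_has_vector_derivative:
  assumes F: "integrable lborel F" and F1: "integrable lborel (\<lambda>\<xi>. of_real \<xi> * F \<xi>)"
  shows "(synth F has_vector_derivative synth (\<lambda>\<xi>. \<i> * of_real \<xi> * F \<xi>) x) (at x)"
proof -
  have [measurable]: "F \<in> borel_measurable borel" using borel_measurable_integrable[OF F] by simp
  have "((\<lambda>x. LINT \<xi>|lborel. exp (\<i> * of_real (x * \<xi>)) * F \<xi>) has_vector_derivative
     (LINT \<xi>|lborel. exp (\<i> * of_real (x * \<xi>)) * (\<i> * of_real \<xi> * F \<xi>))) (at x within UNIV)"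
  proof (rule has_vector_derivative_lebesgue_integral[where w="\<lambda>\<xi>. cmod (of_real \<xi> * F \<xi>)"])
    fix t \<xi> :: real
    have "((\<lambda>t. exp (\<i> * of_real (t * \<xi>))) has_vector_derivative (\<i> * of_real \<xi>) * exp (\<i> * of_real (t * \<xi>))) (at t)"
    proof -
      have "((\<lambda>t. exp (t *\<^sub>R (\<i> * of_real \<xi>))) has_vector_derivative exp (t *\<^sub>R (\<i> * of_real \<xi>)) * (\<i> * of_real \<xi>)) (at t)"
        by (rule exp_scaleR_has_vector_derivative_right)
      then show ?thesis by (simp add: scaleR_conv_of_real mult_ac)
    qed
    then have "((\<lambda>t. exp (\<i> * of_real (t * \<xi>)) * F \<xi>) has_vector_derivative (\<i> * of_real \<xi>) * exp (\<i> * of_real (t * \<xi>)) * F \<xi>) (at t)"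
      by (rule has_vector_derivative_mult_left)
    then show "((\<lambda>t. exp (\<i> * of_real (t * \<xi>)) * F \<xi>) has_vector_derivative exp (\<i> * of_real (t * \<xi>)) * (\<i> * of_real \<xi> * F \<xi>)) (at t within UNIV)"
      by (simp add: mult_ac)
    show "integrable lborel (\<lambda>\<xi>. exp (\<i> * of_real (t * \<xi>)) * F \<xi>)" by (rule integrable_exp_mult[OF F])
    show "integrable lborel (\<lambda>\<xi>. cmod (of_real \<xi> * F \<xi>))" by (rule integrable_norm[OF F1])
  qed (auto simp: norm_mult)
  then show ?thesis unfolding synth_def by simp
qed

text \<open>Finiteness of all polynomial moments is what repeated differentiation under the integral
  of \<open>synth\<close> requires, and it holds for the spectrum of every function lying in all
  H^m.\<close>

definition rapid :: "(real \<Rightarrow> complex) \<Rightarrow> bool" where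
  "rapid F \<longleftrightarrow> (\<forall>j::nat. integrable lborel (\<lambda>\<xi>. of_real \<xi> ^ j * F \<xi>))"

lemma rapid_integrable: "rapid F \<Longrightarrow> integrable lborel F"
  unfolding rapid_def by (drule spec[where x=0]) simp

lemma rapid_mult:
  assumes "rapid F"
  shows "rapid (\<lambda>\<xi>. (\<i> * of_real \<xi>) ^ j * F \<xi>)"
  unfolding rapid_def
proof
  fix k
  have "integrable lborel (\<lambda>\<xi>. \<i> ^ j * (of_real \<xi> ^ (k + j) * F \<xi>))"
    using assms unfolding rapid_def by (intro integrable_mult_right) blast
  then show "integrable lborel (\<lambda>\<xi>. of_real \<xi> ^ k * ((\<i> * of_real \<xi>) ^ j * F \<xi>))"
    by (simp add: power_add power_mult_distrib mult_ac)
qed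

lemma synth_rapid_has_vector_derivative:
  assumes "rapid F"
  shows "(synth F has_vector_derivative synth (\<lambda>\<xi>. \<i> * of_real \<xi> * F \<xi>) x) (at x)"
  using assms unfolding rapid_def
  by (intro synth_has_vector_derivative) (auto dest: spec[where x=0] spec[where x=1])

lemma dx_iter_synth:
  assumes "rapid F"
  shows "(dx ^^ j) (synth F) = synth (\<lambda>\<xi>. (\<i> * of_real \<xi>) ^ j * F \<xi>)"
proof (induction j)
  case (Suc j)
  have "dx (synth (\<lambda>\<xi>. (\<i> * of_real \<xi>) ^ j * F \<xi>)) = synth (\<lambda>\<xi>. (\<i> * of_real \<xi>) ^ Suc j * F \<xi>)"
  proof
    fix x
    show "dx (synth (\<lambda>\<xi>. (\<i> * of_real \<xi>) ^ j * F \<xi>)) x = synth (\<lambda>\<xi>. (\<i> * of_real \<xi>) ^ Suc j * F \<xi>) x"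
      using vector_derivative_at[OF synth_rapid_has_vector_derivative[OF rapid_mult[OF assms, of j], of x]]
      unfolding dx_def by (simp add: mult_ac)
  qed
  with Suc show ?case by simp
qed simp

lemma smooth_fun_synth: "rapid F \<Longrightarrow> smooth_fun (synth F)"
  unfolding smooth_fun_def dx_iter_synth
  using synth_rapid_has_vector_derivative[OF rapid_mult] differentiableI_vector by blast

lemma smooth_fun_dx: "smooth_fun f \<Longrightarrow> smooth_fun (dx f)"
  unfolding smooth_fun_def
proof (intro allI)
  fix j x assume "\<forall>j x. (dx ^^ j) f differentiable at x"
  then have "(dx ^^ Suc j) f differentiable at x" by blast
  then show "(dx ^^ j) (dx f) differentiable at x" by (simp only: funpow_Suc_right comp_apply)
qed

lemma smooth_fun_iter: "smooth_fun f \<Longrightarrow> smooth_fun ((dx ^^ j) f)"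
  by (induction j) (auto intro: smooth_fun_dx)

lemma smooth_fun_has_derivative: "smooth_fun f \<Longrightarrow> (f has_vector_derivative dx f x) (at x)"
  unfolding smooth_fun_def dx_def by (drule spec[where x=0]) (simp add: vector_derivative_works)

lemma smooth_fun_continuous: "smooth_fun f \<Longrightarrow> continuous_on S f"
  by (meson continuous_at_imp_continuous_on has_vector_derivative_continuous smooth_fun_has_derivative)

lemma dx_iter_diff:
  assumes "smooth_fun f" "smooth_fun g"
  shows "(dx ^^ j) (\<lambda>x. f x - g x) = (\<lambda>x. (dx ^^ j) f x - (dx ^^ j) g x)"
proof (induction j)
  case (Suc j)
  have "dx (\<lambda>x. (dx ^^ j) f x - (dx ^^ j) g x) x = (dx ^^ Suc j) f x - (dx ^^ Suc j) g x" for x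
    using has_vector_derivative_diff[OF smooth_fun_has_derivative[OF smooth_fun_iter[OF assms(1), of j], of x]
        smooth_fun_has_derivative[OF smooth_fun_iter[OF assms(2), of j], of x]]
    by (subst dx_def) (simp add: vector_derivative_at)
  with Suc show ?case by auto
qed simp

lemma smooth_fun_diff:
  assumes "smooth_fun f" "smooth_fun g"
  shows "smooth_fun (\<lambda>x. f x - g x)"
  using assms unfolding smooth_fun_def dx_iter_diff[OF assms] by (auto intro: differentiable_diff)

section \<open>Sobolev norms on the Fourier side\<close>

lemma abs_power_square: "(\<bar>\<xi>::real\<bar> ^ j)\<^sup>2 = (\<xi>\<^sup>2) ^ j"
  by (metis power2_abs power_mult mult.commute)

lemma japanese_powr: "japanese_bracket \<xi> powr (2 * s) = (1 + \<xi>\<^sup>2) powr s"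
proof -
  have "japanese_bracket \<xi> = (1 + \<xi>\<^sup>2) powr (1/2)"
    unfolding japanese_bracket_def by (simp add: powr_half_sqrt add_nonneg_nonneg)
  then show ?thesis by (simp add: powr_powr)
qed

lemma one_plus_square_pos: "0 < 1 + (\<xi>::real)\<^sup>2"
  by (simp add: add_pos_nonneg)

lemma integrable_inverse_1_plus_square_lborel: "integrable lborel (\<lambda>x::real. 1 / (1 + x\<^sup>2))"
  and integral_inverse_1_plus_square_lborel: "(LINT x|lborel. 1 / (1 + x\<^sup>2)) = pi"
  using integrable_inverse_1_plus_square LBINT_inverse_1_plus_square
  by (auto simp: set_integrable_def interval_lebesgue_integral_def set_lebesgue_integral_def inverse_eq_divide)

lemma Hs_norm_nonneg: "0 \<le> Hs_norm s f"
  unfolding Hs_norm_def by (intro real_sqrt_ge_zero Bochner_Integration.integral_nonneg) auto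

lemma Hs_norm_square:
  "(Hs_norm s f)\<^sup>2 = (LINT \<xi>|lborel. (1 + \<xi>\<^sup>2) powr s * (cmod (fourier_L2 f \<xi>))\<^sup>2)"
  unfolding Hs_norm_def japanese_powr
  by (intro real_sqrt_pow2 Bochner_Integration.integral_nonneg) auto

lemma borel_measurable_spec:
  "square_integrable f \<Longrightarrow> spec f \<in> borel_measurable borel"
proof -
  assume "square_integrable f"
  then have [measurable]: "fourier_L2 f \<in> borel_measurable borel"
    using square_integrable_fourier_L2 by (auto simp: square_integrable_iff)
  show ?thesis unfolding spec_def[abs_def] by measurable
qed

lemma norm_spec: "(cmod (spec f \<xi>))\<^sup>2 = (cmod (fourier_L2 f \<xi>))\<^sup>2 / (2 * pi)"
  unfolding spec_def by (simp add: norm_mult norm_divide power_divide power_mult_distrib)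

lemma in_Hs_nn_integral:
  assumes "in_Hs s f"
  shows "(\<integral>\<^sup>+\<xi>. ennreal ((1 + \<xi>\<^sup>2) powr s * (cmod (spec f \<xi>))\<^sup>2) \<partial>lborel) = ennreal ((Hs_norm s f)\<^sup>2 / (2 * pi))"
proof -
  have i: "integrable lborel (\<lambda>\<xi>. (1 + \<xi>\<^sup>2) powr s * (cmod (fourier_L2 f \<xi>))\<^sup>2)"
    using assms by (simp add: in_Hs_def japanese_powr)
  have "(\<integral>\<^sup>+\<xi>. ennreal ((1 + \<xi>\<^sup>2) powr s * (cmod (spec f \<xi>))\<^sup>2) \<partial>lborel) =
     (\<integral>\<^sup>+\<xi>. ennreal ((1 + \<xi>\<^sup>2) powr s * (cmod (fourier_L2 f \<xi>))\<^sup>2 / (2 * pi)) \<partial>lborel)"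
    by (simp add: norm_spec)
  also have "\<dots> = ennreal (LINT \<xi>|lborel. (1 + \<xi>\<^sup>2) powr s * (cmod (fourier_L2 f \<xi>))\<^sup>2 / (2 * pi))"
    using i by (intro nn_integral_eq_integral) auto
  finally show ?thesis by (simp add: Hs_norm_square)
qed

lemma sq_int_spec_le:
  assumes "in_Hs (real j) f"
  shows "sq_int (\<lambda>\<xi>. (\<i> * of_real \<xi>) ^ j * spec f \<xi>) \<le> ennreal ((Hs_norm (real j) f)\<^sup>2 / (2 * pi))"
proof -
  have "sq_int (\<lambda>\<xi>. (\<i> * of_real \<xi>) ^ j * spec f \<xi>) \<le> (\<integral>\<^sup>+\<xi>. ennreal ((1 + \<xi>\<^sup>2) powr real j * (cmod (spec f \<xi>))\<^sup>2) \<partial>lborel)"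
    unfolding sq_int_def
  proof (intro nn_integral_mono ennreal_leI)
    fix \<xi> :: real
    have "(cmod ((\<i> * of_real \<xi>) ^ j * spec f \<xi>))\<^sup>2 = (\<xi>\<^sup>2) ^ j * (cmod (spec f \<xi>))\<^sup>2"
      by (simp add: norm_mult norm_power power_mult_distrib abs_power_square)
    also have "\<dots> \<le> (1 + \<xi>\<^sup>2) ^ j * (cmod (spec f \<xi>))\<^sup>2"
      by (intro mult_right_mono power_mono) auto
    finally show "(cmod ((\<i> * of_real \<xi>) ^ j * spec f \<xi>))\<^sup>2 \<le> (1 + \<xi>\<^sup>2) powr real j * (cmod (spec f \<xi>))\<^sup>2"
      by (simp add: powr_realpow one_plus_square_pos)
  qed
  then show ?thesis using in_Hs_nn_integral[OF assms] by simp
qed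

text \<open>Cauchy--Schwarz against (1 + \<xi>^2)^{-1/2}, whose square integrates to pi: one extra
  derivative in L^2 pays for integrability of the spectrum. The constant comes out as 1 / sqrt 2 and
  is rounded up to 1.\<close>

lemma spec_moment:
  assumes H: "in_Hs (real (Suc j)) f"
  shows "integrable lborel (\<lambda>\<xi>. of_real \<xi> ^ j * spec f \<xi>)"
    and "(LINT \<xi>|lborel. cmod (of_real \<xi> ^ j * spec f \<xi>)) \<le> Hs_norm (real (Suc j)) f"
proof -
  have [measurable]: "spec f \<in> borel_measurable borel"
    using H by (simp add: in_Hs_def borel_measurable_spec)
  define a where "a = (\<lambda>\<xi>::real. complex_of_real (1 / sqrt (1 + \<xi>\<^sup>2)))"
  define b where "b = (\<lambda>\<xi>::real. of_real (sqrt (1 + \<xi>\<^sup>2)) * (of_real \<xi> ^ j * spec f \<xi>))"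
  have [measurable]: "a \<in> borel_measurable borel" "b \<in> borel_measurable borel"
    unfolding a_def b_def by measurable
  have nz: "complex_of_real (sqrt (1 + \<xi>\<^sup>2)) \<noteq> 0" for \<xi>
    using one_plus_square_pos[of \<xi>] by simp
  have ab: "a \<xi> * b \<xi> = of_real \<xi> ^ j * spec f \<xi>" for \<xi>
    unfolding a_def b_def using nz[of \<xi>] by simp
  have "sq_int a = (\<integral>\<^sup>+\<xi>. ennreal (1 / (1 + \<xi>\<^sup>2)) \<partial>lborel)"
    unfolding sq_int_def a_def
    by (intro nn_integral_cong) (simp add: norm_divide power_divide add_nonneg_nonneg)
  also have "\<dots> = ennreal (LINT \<xi>|lborel. 1 / (1 + \<xi>\<^sup>2))"
    by (intro nn_integral_eq_integral integrable_inverse_1_plus_square_lborel) (simp add: add_nonneg_nonneg)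
  finally have a: "sq_int a = ennreal pi" by (simp only: integral_inverse_1_plus_square_lborel)
  have "sq_int b \<le> (\<integral>\<^sup>+\<xi>. ennreal ((1 + \<xi>\<^sup>2) powr real (Suc j) * (cmod (spec f \<xi>))\<^sup>2) \<partial>lborel)"
    unfolding sq_int_def
  proof (intro nn_integral_mono ennreal_leI)
    fix \<xi> :: real
    have "(cmod (b \<xi>))\<^sup>2 = (1 + \<xi>\<^sup>2) * ((\<xi>\<^sup>2) ^ j * (cmod (spec f \<xi>))\<^sup>2)"
    proof -
      show ?thesis
        by (simp add: b_def norm_mult norm_power power_mult_distrib add_nonneg_nonneg abs_power_square)
    qed
    also have "\<dots> \<le> (1 + \<xi>\<^sup>2) * ((1 + \<xi>\<^sup>2) ^ j * (cmod (spec f \<xi>))\<^sup>2)"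
      by (intro mult_left_mono mult_right_mono power_mono) auto
    also have "\<dots> = (1 + \<xi>\<^sup>2) ^ Suc j * (cmod (spec f \<xi>))\<^sup>2" by simp
    finally show "(cmod (b \<xi>))\<^sup>2 \<le> (1 + \<xi>\<^sup>2) powr real (Suc j) * (cmod (spec f \<xi>))\<^sup>2"
      by (simp only: powr_realpow[OF one_plus_square_pos])
  qed
  also have "\<dots> = ennreal ((Hs_norm (real (Suc j)) f)\<^sup>2 / (2 * pi))" by (rule in_Hs_nn_integral[OF H])
  finally have b: "sq_int b \<le> ennreal ((Hs_norm (real (Suc j)) f)\<^sup>2 / (2 * pi))" .
  have "integrable lborel (\<lambda>\<xi>. a \<xi> * b \<xi>)"
    by (intro integrable_mult_sq_int) (auto simp: a intro: le_less_trans[OF b])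
  then show i: "integrable lborel (\<lambda>\<xi>. of_real \<xi> ^ j * spec f \<xi>)" by (simp only: ab)
  let ?I = "LINT \<xi>|lborel. cmod (of_real \<xi> ^ j * spec f \<xi>)"
  have "ennreal (?I\<^sup>2) = (ennreal ?I)\<^sup>2" by (simp add: ennreal_power)
  also have "ennreal ?I = (\<integral>\<^sup>+\<xi>. ennreal (cmod (of_real \<xi> ^ j * spec f \<xi>)) \<partial>lborel)"
    using integrable_norm[OF i] by (intro nn_integral_eq_integral[symmetric]) auto
  also have "\<dots> = (\<integral>\<^sup>+\<xi>. ennreal (cmod (a \<xi>)) * ennreal (cmod (b \<xi>)) \<partial>lborel)"
    unfolding ab[symmetric] norm_mult by (intro nn_integral_cong ennreal_mult) auto
  also have "\<dots>\<^sup>2 \<le> (\<integral>\<^sup>+x. (ennreal (cmod (a x)))\<^sup>2 \<partial>lborel) * (\<integral>\<^sup>+x. (ennreal (cmod (b x)))\<^sup>2 \<partial>lborel)"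
    by (rule Cauchy_Schwarz_nn_integral) auto
  also have "\<dots> = sq_int a * sq_int b" by (simp add: sq_int_def ennreal_power)
  also have "\<dots> \<le> ennreal pi * ennreal ((Hs_norm (real (Suc j)) f)\<^sup>2 / (2 * pi))"
    unfolding a by (intro mult_left_mono b) auto
  also have "\<dots> = ennreal ((Hs_norm (real (Suc j)) f)\<^sup>2 / 2)"
    by (subst ennreal_mult[symmetric]) auto
  finally have "?I\<^sup>2 \<le> (Hs_norm (real (Suc j)) f)\<^sup>2 / 2" by (subst (asm) ennreal_le_iff) auto
  then have "?I\<^sup>2 \<le> (Hs_norm (real (Suc j)) f)\<^sup>2"
    using zero_le_power2[of "Hs_norm (real (Suc j)) f"] by linarith
  then show "?I \<le> Hs_norm (real (Suc j)) f" using Hs_norm_nonneg by (rule power2_le_imp_le)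
qed

lemma rapid_spec:
  assumes "\<And>m::nat. in_Hs (real m) f"
  shows "rapid (spec f)"
  unfolding rapid_def using spec_moment(1)[OF assms] by blast

lemma smooth_Hs_synth:
  assumes "\<And>m::nat. in_Hs (real m) f" "smooth_fun f"
  shows "f = synth (spec f)"
  using assms(1)[of 0] smooth_fun_continuous[OF assms(2)] rapid_integrable[OF rapid_spec[OF assms(1)]]
  by (intro synth_spec) (auto simp: in_Hs_def)

text \<open>The one-dimensional Sobolev embedding, read off from the L^1 norm of the
  spectrum.\<close>

lemma smooth_Hs_sup_bound:
  assumes H: "\<And>m::nat. in_Hs (real m) f" and f: "smooth_fun f"
  shows "cmod ((dx ^^ j) f x) \<le> Hs_norm (real (Suc j)) f"
proof -
  have "(dx ^^ j) f = (dx ^^ j) (synth (spec f))" using smooth_Hs_synth[OF H f] by simp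
  also have "\<dots> = synth (\<lambda>\<xi>. (\<i> * of_real \<xi>) ^ j * spec f \<xi>)" by (rule dx_iter_synth[OF rapid_spec[OF H]])
  finally have "cmod ((dx ^^ j) f x) \<le> (LINT \<xi>|lborel. cmod ((\<i> * of_real \<xi>) ^ j * spec f \<xi>))"
    using norm_synth_le by simp
  also have "\<dots> = (LINT \<xi>|lborel. cmod (of_real \<xi> ^ j * spec f \<xi>))"
    by (simp add: norm_mult norm_power)
  finally show ?thesis using spec_moment(2)[OF H, of j] by simp
qed

lemma smooth_Hs_sq_int:
  assumes H: "\<And>m::nat. in_Hs (real m) f" and f: "smooth_fun f"
  shows "sq_int ((dx ^^ j) f) \<le> ennreal ((Hs_norm (real j) f)\<^sup>2)"
proof -
  have "(dx ^^ j) f = (dx ^^ j) (synth (spec f))" using smooth_Hs_synth[OF H f] by simp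
  also have "\<dots> = synth (\<lambda>\<xi>. (\<i> * of_real \<xi>) ^ j * spec f \<xi>)" by (rule dx_iter_synth[OF rapid_spec[OF H]])
  finally have "sq_int ((dx ^^ j) f) \<le> ennreal (2 * pi) * sq_int (\<lambda>\<xi>. (\<i> * of_real \<xi>) ^ j * spec f \<xi>)"
    using sq_int_synth_le[OF rapid_integrable[OF rapid_mult[OF rapid_spec[OF H]]]] by simp
  also have "\<dots> \<le> ennreal (2 * pi) * ennreal ((Hs_norm (real j) f)\<^sup>2 / (2 * pi))"
    by (intro mult_left_mono sq_int_spec_le H) auto
  also have "\<dots> = ennreal ((Hs_norm (real j) f)\<^sup>2)" by (subst ennreal_mult[symmetric]) auto
  finally show ?thesis .
qed

text \<open>The second claim stands in for the triangle inequality of \<open>Hs_norm\<close>, at the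
  cost of a factor 2; it serves to bound norms near a given time.\<close>

lemma in_Hs_diff:
  assumes f: "in_Hs s f" and g: "in_Hs s g"
  shows "in_Hs s (\<lambda>x. f x - g x)"
    and "(Hs_norm s f)\<^sup>2 \<le> 2 * (Hs_norm s (\<lambda>x. f x - g x))\<^sup>2 + 2 * (Hs_norm s g)\<^sup>2"
proof -
  have si: "square_integrable f" "square_integrable g" using f g by (auto simp: in_Hs_def)
  note d = square_integrable_diff[OF si]
  have [measurable]: "fourier_L2 f \<in> borel_measurable borel" "fourier_L2 g \<in> borel_measurable borel"
     "fourier_L2 (\<lambda>x. f x - g x) \<in> borel_measurable borel"
    using square_integrable_fourier_L2[OF si(1)] square_integrable_fourier_L2[OF si(2)] square_integrable_fourier_L2[OF d]
    by (auto simp: square_integrable_iff)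
  have i: "integrable lborel (\<lambda>\<xi>. (1 + \<xi>\<^sup>2) powr s * (cmod (fourier_L2 f \<xi>))\<^sup>2)"
     "integrable lborel (\<lambda>\<xi>. (1 + \<xi>\<^sup>2) powr s * (cmod (fourier_L2 g \<xi>))\<^sup>2)"
    using f g by (auto simp: in_Hs_def japanese_powr)
  have tri: "(cmod (a - b))\<^sup>2 \<le> 2 * (cmod a)\<^sup>2 + 2 * (cmod b)\<^sup>2" for a b :: complex
    using power_mono[OF norm_triangle_ineq4[of a b], of 2] sum_squares_bound[of "cmod a" "cmod b"]
    by (simp add: power2_sum)
  have "integrable lborel (\<lambda>\<xi>. (1 + \<xi>\<^sup>2) powr s * (cmod (fourier_L2 (\<lambda>x. f x - g x) \<xi>))\<^sup>2)"
  proof (rule Bochner_Integration.integrable_bound)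
    show "integrable lborel (\<lambda>\<xi>. 2 * ((1 + \<xi>\<^sup>2) powr s * (cmod (fourier_L2 f \<xi>))\<^sup>2) + 2 * ((1 + \<xi>\<^sup>2) powr s * (cmod (fourier_L2 g \<xi>))\<^sup>2))"
      using i by (intro Bochner_Integration.integrable_add integrable_mult_right)
    show "AE \<xi> in lborel. norm ((1 + \<xi>\<^sup>2) powr s * (cmod (fourier_L2 (\<lambda>x. f x - g x) \<xi>))\<^sup>2) \<le>
       norm (2 * ((1 + \<xi>\<^sup>2) powr s * (cmod (fourier_L2 f \<xi>))\<^sup>2) + 2 * ((1 + \<xi>\<^sup>2) powr s * (cmod (fourier_L2 g \<xi>))\<^sup>2))"
      using fourier_L2_diff[OF si]
    proof eventually_elim
      case (elim \<xi>)
      have "(1 + \<xi>\<^sup>2) powr s * (cmod (fourier_L2 f \<xi> - fourier_L2 g \<xi>))\<^sup>2 \<le>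
          (1 + \<xi>\<^sup>2) powr s * (2 * (cmod (fourier_L2 f \<xi>))\<^sup>2 + 2 * (cmod (fourier_L2 g \<xi>))\<^sup>2)"
        by (intro mult_left_mono tri) auto
      then show ?case unfolding elim by (simp add: algebra_simps)
    qed
  qed simp
  then show H: "in_Hs s (\<lambda>x. f x - g x)" using d by (simp add: in_Hs_def japanese_powr)
  have id: "integrable lborel (\<lambda>\<xi>. (1 + \<xi>\<^sup>2) powr s * (cmod (fourier_L2 (\<lambda>x. f x - g x) \<xi>))\<^sup>2)"
    using H by (auto simp: in_Hs_def japanese_powr)
  have "(LINT \<xi>|lborel. (1 + \<xi>\<^sup>2) powr s * (cmod (fourier_L2 f \<xi>))\<^sup>2) \<le>
     (LINT \<xi>|lborel. 2 * ((1 + \<xi>\<^sup>2) powr s * (cmod (fourier_L2 (\<lambda>x. f x - g x) \<xi>))\<^sup>2) + 2 * ((1 + \<xi>\<^sup>2) powr s * (cmod (fourier_L2 g \<xi>))\<^sup>2))"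
  proof (rule integral_mono_AE)
    show "AE \<xi> in lborel. (1 + \<xi>\<^sup>2) powr s * (cmod (fourier_L2 f \<xi>))\<^sup>2 \<le>
       2 * ((1 + \<xi>\<^sup>2) powr s * (cmod (fourier_L2 (\<lambda>x. f x - g x) \<xi>))\<^sup>2) + 2 * ((1 + \<xi>\<^sup>2) powr s * (cmod (fourier_L2 g \<xi>))\<^sup>2)"
      using fourier_L2_diff[OF si]
    proof eventually_elim
      case (elim \<xi>)
      have "(1 + \<xi>\<^sup>2) powr s * (cmod ((fourier_L2 f \<xi> - fourier_L2 g \<xi>) - (- fourier_L2 g \<xi>)))\<^sup>2 \<le>
          (1 + \<xi>\<^sup>2) powr s * (2 * (cmod (fourier_L2 f \<xi> - fourier_L2 g \<xi>))\<^sup>2 + 2 * (cmod (- fourier_L2 g \<xi>))\<^sup>2)"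
        by (intro mult_left_mono tri) auto
      then show ?case unfolding elim by (simp add: algebra_simps)
    qed
    show "integrable lborel (\<lambda>\<xi>. 2 * ((1 + \<xi>\<^sup>2) powr s * (cmod (fourier_L2 (\<lambda>x. f x - g x) \<xi>))\<^sup>2) + 2 * ((1 + \<xi>\<^sup>2) powr s * (cmod (fourier_L2 g \<xi>))\<^sup>2))"
      using id i(2) by (intro Bochner_Integration.integrable_add integrable_mult_right)
  qed (rule i(1))
  also have "\<dots> = 2 * (Hs_norm s (\<lambda>x. f x - g x))\<^sup>2 + 2 * (Hs_norm s g)\<^sup>2"
    unfolding Hs_norm_square using id i(2) by simp
  finally show "(Hs_norm s f)\<^sup>2 \<le> 2 * (Hs_norm s (\<lambda>x. f x - g x))\<^sup>2 + 2 * (Hs_norm s g)\<^sup>2"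
    unfolding Hs_norm_square[of s f] .
qed

text \<open>Boundedness trades one factor of |F|^2 for a constant, and (1 + \<xi>^2)^s is at most
  2^m (1 + \<xi>^{2m}) for an integer m \<ge> s, so the moments of \<open>F\<close> suffice.\<close>

lemma rapid_weighted_square:
  assumes F: "rapid F" and B: "\<And>\<xi>. cmod (F \<xi>) \<le> B"
  shows "integrable lborel (\<lambda>\<xi>. (1 + \<xi>\<^sup>2) powr s * (cmod (F \<xi>))\<^sup>2)"
proof -
  obtain m :: nat where m: "s \<le> real m" using real_arch_simple by blast
  have [measurable]: "F \<in> borel_measurable borel" using borel_measurable_integrable[OF rapid_integrable[OF F]] by simp
  have i: "integrable lborel (\<lambda>\<xi>. of_real \<xi> ^ (2 * m) * F \<xi>)"
    using F unfolding rapid_def by blast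
  show ?thesis
  proof (rule Bochner_Integration.integrable_bound)
  from integrable_norm[OF i] integrable_norm[OF rapid_integrable[OF F]] show "integrable lborel (\<lambda>\<xi>. 2 ^ m * B * (cmod (F \<xi>) + cmod (of_real \<xi> ^ (2 * m) * F \<xi>)))"
    by (intro integrable_mult_right Bochner_Integration.integrable_add)
  show "AE \<xi> in lborel. norm ((1 + \<xi>\<^sup>2) powr s * (cmod (F \<xi>))\<^sup>2) \<le> norm (2 ^ m * B * (cmod (F \<xi>) + cmod (of_real \<xi> ^ (2 * m) * F \<xi>)))"
  proof (rule AE_I2)
    fix \<xi> :: real
    have B0: "0 \<le> B" using B norm_ge_zero order_trans by blast
    have "(1 + \<xi>\<^sup>2) powr s \<le> (1 + \<xi>\<^sup>2) powr real m" using m by (intro powr_mono) auto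
    also have "\<dots> = (1 + \<xi>\<^sup>2) ^ m" by (simp add: powr_realpow one_plus_square_pos)
    also have "\<dots> \<le> (2 * max 1 (\<xi>\<^sup>2)) ^ m" by (intro power_mono) auto
    also have "\<dots> = 2 ^ m * (max 1 (\<xi>\<^sup>2)) ^ m" by (rule power_mult_distrib)
    also have "\<dots> \<le> 2 ^ m * (1 + \<xi> ^ (2 * m))"
      by (intro mult_left_mono) (auto simp: max_def power_mult)
    finally have 1: "(1 + \<xi>\<^sup>2) powr s \<le> 2 ^ m * (1 + \<xi> ^ (2 * m))" .
    have 2: "(cmod (F \<xi>))\<^sup>2 \<le> B * cmod (F \<xi>)" unfolding power2_eq_square by (intro mult_right_mono B) auto
    have "(1 + \<xi>\<^sup>2) powr s * (cmod (F \<xi>))\<^sup>2 \<le> (2 ^ m * (1 + \<xi> ^ (2 * m))) * (B * cmod (F \<xi>))"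
      by (intro mult_mono 1 2) (auto simp: power_mult)
    then show "norm ((1 + \<xi>\<^sup>2) powr s * (cmod (F \<xi>))\<^sup>2) \<le> norm (2 ^ m * B * (cmod (F \<xi>) + cmod (of_real \<xi> ^ (2 * m) * F \<xi>)))"
      using B0 by (simp add: norm_mult norm_power abs_mult algebra_simps power_even_abs)
  qed
  show "(\<lambda>\<xi>. (1 + \<xi>\<^sup>2) powr s * (cmod (F \<xi>))\<^sup>2) \<in> borel_measurable lborel" by simp
  qed
qed

lemma Hs_synth:
  assumes F: "rapid F" and B: "\<And>\<xi>. cmod (F \<xi>) \<le> B"
  shows "in_Hs s (synth F)"
    and "(Hs_norm s (synth F))\<^sup>2 = 2 * pi * (LINT \<xi>|lborel. (1 + \<xi>\<^sup>2) powr s * (cmod (F \<xi>))\<^sup>2)"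
proof -
  have [measurable]: "F \<in> borel_measurable borel" using borel_measurable_integrable[OF rapid_integrable[OF F]] by simp
  note S = fourier_L2_synth[OF rapid_integrable[OF F] sq_int_bounded[OF rapid_integrable[OF F] B]]
  have [measurable]: "fourier_L2 (synth F) \<in> borel_measurable borel"
    using square_integrable_fourier_L2[OF S(1)] by (simp add: square_integrable_iff)
  have ae: "AE \<xi> in lborel. (1 + \<xi>\<^sup>2) powr s * (cmod (fourier_L2 (synth F) \<xi>))\<^sup>2 = 2 * pi * ((1 + \<xi>\<^sup>2) powr s * (cmod (F \<xi>))\<^sup>2)"
    using S(2) by eventually_elim (simp add: norm_mult power_mult_distrib)
  have i: "integrable lborel (\<lambda>\<xi>. 2 * pi * ((1 + \<xi>\<^sup>2) powr s * (cmod (F \<xi>))\<^sup>2))"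
    by (intro integrable_mult_right rapid_weighted_square[OF F B])
  then have "integrable lborel (\<lambda>\<xi>. (1 + \<xi>\<^sup>2) powr s * (cmod (fourier_L2 (synth F) \<xi>))\<^sup>2)"
    by (subst integrable_cong_AE[OF _ _ ae]) auto
  then show "in_Hs s (synth F)" using S(1) by (simp add: in_Hs_def japanese_powr)
  have "(LINT \<xi>|lborel. (1 + \<xi>\<^sup>2) powr s * (cmod (fourier_L2 (synth F) \<xi>))\<^sup>2) = (LINT \<xi>|lborel. 2 * pi * ((1 + \<xi>\<^sup>2) powr s * (cmod (F \<xi>))\<^sup>2))"
    by (rule integral_cong_AE[OF _ _ ae]) auto
  then show "(Hs_norm s (synth F))\<^sup>2 = 2 * pi * (LINT \<xi>|lborel. (1 + \<xi>\<^sup>2) powr s * (cmod (F \<xi>))\<^sup>2)"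
    unfolding Hs_norm_square by simp
qed

lemma rapid_bound:
  assumes G: "\<And>j::nat. integrable lborel (\<lambda>\<xi>. \<bar>\<xi>\<bar> ^ j * G \<xi>)" and F: "F \<in> borel_measurable borel" "\<And>\<xi>. cmod (F \<xi>) \<le> G \<xi>"
  shows "rapid F"
  unfolding rapid_def
proof
  fix j :: nat
  show "integrable lborel (\<lambda>\<xi>. of_real \<xi> ^ j * F \<xi>)"
    by (rule Bochner_Integration.integrable_bound[OF G[of j]])
       (use F in \<open>auto simp: norm_mult norm_power abs_mult intro!: AE_I2 mult_left_mono intro: order_trans[OF F(2)]\<close>)
qed

lemma rapid_diff:
  assumes "rapid F" "rapid G"
  shows "rapid (\<lambda>\<xi>. F \<xi> - G \<xi>)"
  using assms unfolding rapid_def right_diff_distrib by (auto intro: Bochner_Integration.integrable_diff)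

text \<open>A majorant independent of time reduces continuity in every H^s to continuity in time at
  each fixed frequency, by dominated convergence with the square of twice the majorant.\<close>

lemma continuous_in_Hs_synth:
  assumes meas: "\<And>t. t \<in> {0..T} \<Longrightarrow> U t \<in> borel_measurable borel"
    and bd: "\<And>t \<xi>. t \<in> {0..T} \<Longrightarrow> cmod (U t \<xi>) \<le> G \<xi>"
    and G: "\<And>j::nat. integrable lborel (\<lambda>\<xi>. \<bar>\<xi>\<bar> ^ j * G \<xi>)" "\<And>\<xi>. G \<xi> \<le> B"
    and cont: "\<And>\<xi>. continuous_on {0..T} (\<lambda>t. U t \<xi>)"
  shows "continuous_in_Hs T s (\<lambda>t. synth (U t))"
  unfolding continuous_in_Hs_def
proof (intro ballI conjI)
  fix t assume t: "t \<in> {0..T}"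
  have Ub: "cmod (U t \<xi>) \<le> B" if "t \<in> {0..T}" for t \<xi> using bd[OF that, of \<xi>] G(2)[of \<xi>] by simp
  have r: "rapid (U t)" if "t \<in> {0..T}" for t by (rule rapid_bound[OF G(1) meas[OF that] bd[OF that]])
  show "in_Hs s (synth (U t))" by (rule Hs_synth(1)[OF r[OF t] Ub[OF t]])
  have G0: "0 \<le> G \<xi>" for \<xi> using bd[OF t, of \<xi>] norm_ge_zero order_trans by blast
  have Gr: "rapid (\<lambda>\<xi>. complex_of_real (G \<xi>))"
    using G(1)[of 0] by (intro rapid_bound[OF G(1)]) (auto simp: G0 dest: borel_measurable_integrable)
  have lim: "((\<lambda>\<tau>. LINT \<xi>|lborel. (1 + \<xi>\<^sup>2) powr s * (cmod (U \<tau> \<xi> - U t \<xi>))\<^sup>2) \<longlongrightarrow> (LINT \<xi>|(lborel::real measure). 0)) (at t within {0..T})"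
  proof (rule tendsto_integral_at_within)
    show "integrable lborel (\<lambda>\<xi>. 4 * ((1 + \<xi>\<^sup>2) powr s * (cmod (complex_of_real (G \<xi>)))\<^sup>2))"
      using G0 G(2) by (intro integrable_mult_right rapid_weighted_square[OF Gr, of B]) auto
    fix \<xi> :: real
    have "((\<lambda>\<tau>. (1 + \<xi>\<^sup>2) powr s * (cmod (U \<tau> \<xi> - U t \<xi>))\<^sup>2) \<longlongrightarrow> (1 + \<xi>\<^sup>2) powr s * (cmod (U t \<xi> - U t \<xi>))\<^sup>2) (at t within {0..T})"
      using cont[of \<xi>] t by (intro tendsto_intros) (auto simp: continuous_on_def)
    then show "((\<lambda>\<tau>. (1 + \<xi>\<^sup>2) powr s * (cmod (U \<tau> \<xi> - U t \<xi>))\<^sup>2) \<longlongrightarrow> 0) (at t within {0..T})" by simp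
  next
    fix \<tau> \<xi> :: real assume "\<tau> \<in> {0..T} - {t}"
    then have "cmod (U \<tau> \<xi> - U t \<xi>) \<le> 2 * G \<xi>"
      using norm_triangle_ineq4[of "U \<tau> \<xi>" "U t \<xi>"] bd[of \<tau> \<xi>] bd[OF t, of \<xi>] by auto
    then have "(cmod (U \<tau> \<xi> - U t \<xi>))\<^sup>2 \<le> (2 * G \<xi>)\<^sup>2" by (intro power_mono) auto
    then have "(1 + \<xi>\<^sup>2) powr s * (cmod (U \<tau> \<xi> - U t \<xi>))\<^sup>2 \<le> (1 + \<xi>\<^sup>2) powr s * (4 * (G \<xi>)\<^sup>2)"
      by (intro mult_left_mono) (auto simp: power_mult_distrib)
    then show "norm ((1 + \<xi>\<^sup>2) powr s * (cmod (U \<tau> \<xi> - U t \<xi>))\<^sup>2) \<le> 4 * ((1 + \<xi>\<^sup>2) powr s * (cmod (complex_of_real (G \<xi>)))\<^sup>2)"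
      by simp
  qed (use meas t in auto)
  have "Hs_norm s (\<lambda>x. synth (U \<tau>) x - synth (U t) x) = sqrt (2 * pi * (LINT \<xi>|lborel. (1 + \<xi>\<^sup>2) powr s * (cmod (U \<tau> \<xi> - U t \<xi>))\<^sup>2))"
    if "\<tau> \<in> {0..T}" for \<tau>
  proof -
    have "(\<lambda>x. synth (U \<tau>) x - synth (U t) x) = synth (\<lambda>\<xi>. U \<tau> \<xi> - U t \<xi>)"
      using synth_diff[OF rapid_integrable[OF r[OF that]] rapid_integrable[OF r[OF t]]] by auto
    moreover have "cmod (U \<tau> \<xi> - U t \<xi>) \<le> 2 * B" for \<xi>
      using norm_triangle_ineq4[of "U \<tau> \<xi>" "U t \<xi>"] Ub[OF that, of \<xi>] Ub[OF t, of \<xi>] by linarith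
    ultimately have "(Hs_norm s (\<lambda>x. synth (U \<tau>) x - synth (U t) x))\<^sup>2 = 2 * pi * (LINT \<xi>|lborel. (1 + \<xi>\<^sup>2) powr s * (cmod (U \<tau> \<xi> - U t \<xi>))\<^sup>2)"
      using Hs_synth(2)[OF rapid_diff[OF r[OF that] r[OF t]], of "2 * B" s] by simp
    from real_sqrt_unique[OF this Hs_norm_nonneg] show ?thesis by simp
  qed
  then have "((\<lambda>\<tau>. Hs_norm s (\<lambda>x. synth (U \<tau>) x - synth (U t) x)) \<longlongrightarrow> 0) (at t within {0..T}) \<longleftrightarrow>
     ((\<lambda>\<tau>. sqrt (2 * pi * (LINT \<xi>|lborel. (1 + \<xi>\<^sup>2) powr s * (cmod (U \<tau> \<xi> - U t \<xi>))\<^sup>2))) \<longlongrightarrow> 0) (at t within {0..T})"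
    by (intro Lim_cong_within refl) auto
  moreover have "((\<lambda>\<tau>. sqrt (2 * pi * (LINT \<xi>|lborel. (1 + \<xi>\<^sup>2) powr s * (cmod (U \<tau> \<xi> - U t \<xi>))\<^sup>2))) \<longlongrightarrow> sqrt (2 * pi * 0)) (at t within {0..T})"
    using lim by (intro tendsto_intros) simp
  ultimately show "((\<lambda>\<tau>. Hs_norm s (\<lambda>x. synth (U \<tau>) x - synth (U t) x)) \<longlongrightarrow> 0) (at t within {0..T})"
    by simp
qed

subsection \<open>Regularity of smooth solutions\<close>

definition strip_cont :: "real \<Rightarrow> (real \<Rightarrow> real \<Rightarrow> 'a::topological_space) \<Rightarrow> bool" where
  "strip_cont T f \<longleftrightarrow> continuous_on ({0..T} \<times> UNIV) (\<lambda>p. f (fst p) (snd p))"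

lemma strip_cont_time: "strip_cont T f \<Longrightarrow> continuous_on {0..T} (\<lambda>t. f t x)"
  unfolding strip_cont_def
  by (rule continuous_on_compose2[where f="\<lambda>t. (t, x)", of _ "\<lambda>p. f (fst p) (snd p)", simplified])
     (auto intro!: continuous_intros)

lemma strip_cont_space: "strip_cont T f \<Longrightarrow> t \<in> {0..T} \<Longrightarrow> continuous_on UNIV (f t)"
  unfolding strip_cont_def
  by (rule continuous_on_compose2[where f="\<lambda>x. (t, x)", of _ "\<lambda>p. f (fst p) (snd p)", simplified])
     (auto intro!: continuous_intros)

text \<open>Compactness of [0,T]: times at which the norm exceeds k accumulate at some l, yet near l
  the norm is bounded by continuity at l.\<close>

lemma continuous_in_Hs_bounded:
  assumes "continuous_in_Hs T s f"
  shows "\<exists>M. \<forall>t\<in>{0..T}. Hs_norm s (f t) \<le> M"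
proof (rule ccontr)
  assume "\<not> ?thesis"
  then have "\<exists>t\<in>{0..T}. Hs_norm s (f t) > real k" for k :: nat by (meson not_le)
  then obtain t where t: "\<And>k. t k \<in> {0..T}" "\<And>k. Hs_norm s (f (t k)) > real k" by metis
  obtain l r where l: "l \<in> {0..T}" and r: "strict_mono r" "(t \<circ> r) \<longlonglongrightarrow> l"
    using compact_Icc[of 0 T] t(1) unfolding compact_def by blast
  have "((\<lambda>\<tau>. Hs_norm s (\<lambda>x. f \<tau> x - f l x)) \<longlongrightarrow> 0) (at l within {0..T})"
    using assms l by (auto simp: continuous_in_Hs_def)
  then have "eventually (\<lambda>\<tau>. Hs_norm s (\<lambda>x. f \<tau> x - f l x) < 1) (at l within {0..T})"
    by (rule order_tendstoD) simp
  then obtain d where d: "d > 0" "\<And>\<tau>. \<tau> \<in> {0..T} \<Longrightarrow> \<tau> \<noteq> l \<Longrightarrow> dist \<tau> l < d \<Longrightarrow> Hs_norm s (\<lambda>x. f \<tau> x - f l x) < 1"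
    unfolding eventually_at by blast
  have H: "in_Hs s (f \<tau>)" if "\<tau> \<in> {0..T}" for \<tau> using assms that by (auto simp: continuous_in_Hs_def)
  define M where "M = 2 + 2 * (Hs_norm s (f l))\<^sup>2"
  have bd: "(Hs_norm s (f \<tau>))\<^sup>2 \<le> M" if "\<tau> \<in> {0..T}" "dist \<tau> l < d" for \<tau>
  proof (cases "\<tau> = l")
    case True then show ?thesis unfolding M_def using zero_le_power2[of "Hs_norm s (f l)"] by simp
  next
    case False
    from d(2)[OF that(1) this that(2)] have "(Hs_norm s (\<lambda>x. f \<tau> x - f l x))\<^sup>2 \<le> 1"
      using Hs_norm_nonneg[of s] by (intro power_le_one) auto
    then show ?thesis using in_Hs_diff(2)[OF H[OF that(1)] H[OF l]] unfolding M_def by linarith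
  qed
  have "eventually (\<lambda>k. dist (t (r k)) l < d) sequentially"
    using tendstoD[OF r(2) d(1)] by (simp add: comp_def)
  moreover obtain k0 :: nat where k0: "M + 1 < real k0" using reals_Archimedean2 by blast
  moreover have "eventually (\<lambda>k. k \<ge> k0) sequentially" by (rule eventually_ge_at_top)
  ultimately have "eventually (\<lambda>k. dist (t (r k)) l < d \<and> k \<ge> k0) sequentially"
    by (auto intro: eventually_conj)
  then obtain k where k: "dist (t (r k)) l < d" "k \<ge> k0"
    using eventually_happens'[OF sequentially_bot] by blast
  have "(Hs_norm s (f (t (r k))))\<^sup>2 \<le> M" by (rule bd[OF t(1) k(1)])
  moreover have "real k0 \<le> real (r k)" using k(2) seq_suble[OF r(1), of k] by linarith
  moreover have "real (r k) < Hs_norm s (f (t (r k)))" by (rule t(2))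
  moreover have "M \<ge> 2" unfolding M_def by simp
  ultimately have "Hs_norm s (f (t (r k))) > M + 1" "(Hs_norm s (f (t (r k))))\<^sup>2 \<le> M" using k0 by linarith+
  moreover have "(M + 1) * 1 \<le> (Hs_norm s (f (t (r k)))) * (Hs_norm s (f (t (r k))))" if "Hs_norm s (f (t (r k))) > M + 1"
    using that \<open>M \<ge> 2\<close> by (intro mult_mono) auto
  ultimately show False by (auto simp: power2_eq_square)
qed

text \<open>Sobolev embedding makes the modulus of continuity in time uniform in x, so continuity in
  each variable combines to joint continuity.\<close>

lemma continuous_in_Hs_strip_cont:
  assumes C: "\<And>m::nat. continuous_in_Hs T (real m) f" and S: "\<And>t. t \<in> {0..T} \<Longrightarrow> smooth_fun (f t)"
  shows "strip_cont T (\<lambda>t. (dx ^^ j) (f t))"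
  unfolding strip_cont_def continuous_on_def
proof (clarify)
  fix t x :: real assume t: "t \<in> {0..T}"
  have H: "in_Hs (real m) (f \<tau>)" if "\<tau> \<in> {0..T}" for \<tau> m using C[of m] that by (auto simp: continuous_in_Hs_def)
  show "((\<lambda>p. (dx ^^ j) (f (fst p)) (snd p)) \<longlongrightarrow> (dx ^^ j) (f (fst (t, x))) (snd (t, x))) (at (t, x) within {0..T} \<times> UNIV)"
    unfolding fst_conv snd_conv
  proof (rule tendstoI)
    fix e :: real assume e: "e > 0"
    have "((\<lambda>\<tau>. Hs_norm (real (Suc j)) (\<lambda>x. f \<tau> x - f t x)) \<longlongrightarrow> 0) (at t within {0..T})"
      using C[of "Suc j"] t by (auto simp: continuous_in_Hs_def)
    then have "eventually (\<lambda>\<tau>. Hs_norm (real (Suc j)) (\<lambda>x. f \<tau> x - f t x) < e / 2) (at t within {0..T})"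
      by (rule order_tendstoD) (use e in simp)
    then obtain d1 where d1: "d1 > 0" "\<And>\<tau>. \<tau> \<in> {0..T} \<Longrightarrow> \<tau> \<noteq> t \<Longrightarrow> dist \<tau> t < d1 \<Longrightarrow> Hs_norm (real (Suc j)) (\<lambda>x. f \<tau> x - f t x) < e / 2"
      unfolding eventually_at by blast
    have "continuous_on UNIV ((dx ^^ j) (f t))" by (rule smooth_fun_continuous[OF smooth_fun_iter[OF S[OF t]]])
    then obtain d2 where d2: "d2 > 0" "\<And>y. dist y x < d2 \<Longrightarrow> dist ((dx ^^ j) (f t) y) ((dx ^^ j) (f t) x) < e / 2"
      unfolding continuous_on_iff using e by (metis half_gt_zero UNIV_I)
    have "dist ((dx ^^ j) (f \<tau>) y) ((dx ^^ j) (f t) x) < e"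
      if \<tau>: "\<tau> \<in> {0..T}" and d: "dist (\<tau>, y) (t, x) < min d1 d2" for \<tau> y
    proof -
      have d': "dist \<tau> t < d1" "dist y x < d2"
        using d dist_fst_le[of "(\<tau>, y)" "(t, x)"] dist_snd_le[of "(\<tau>, y)" "(t, x)"] by auto
      have "dist ((dx ^^ j) (f \<tau>) y) ((dx ^^ j) (f t) y) \<le> e / 2"
      proof (cases "\<tau> = t")
        case True then show ?thesis using e by simp
      next
        case False
        have "cmod ((dx ^^ j) (\<lambda>x. f \<tau> x - f t x) y) \<le> Hs_norm (real (Suc j)) (\<lambda>x. f \<tau> x - f t x)"
          by (rule smooth_Hs_sup_bound[OF in_Hs_diff(1)[OF H[OF \<tau>] H[OF t]] smooth_fun_diff[OF S[OF \<tau>] S[OF t]]])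
        then show ?thesis
          using d1(2)[OF \<tau> False d'(1)] unfolding dx_iter_diff[OF S[OF \<tau>] S[OF t]] by (simp add: dist_norm)
      qed
      then show ?thesis
        using d2(2)[OF d'(2)] dist_triangle[of "(dx ^^ j) (f \<tau>) y" "(dx ^^ j) (f t) x" "(dx ^^ j) (f t) y"] by linarith
    qed
    moreover have "min d1 d2 > 0" using d1(1) d2(1) by simp
    ultimately show "\<forall>\<^sub>F p in at (t, x) within {0..T} \<times> UNIV. dist ((dx ^^ j) (f (fst p)) (snd p)) ((dx ^^ j) (f t) x) < e"
      unfolding eventually_at by (intro exI[of _ "min d1 d2"]) auto
  qed
qed

lemma continuous_in_Hs_uniform_bound:
  assumes C: "\<And>m::nat. continuous_in_Hs T (real m) f" and S: "\<And>t. t \<in> {0..T} \<Longrightarrow> smooth_fun (f t)"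
  shows "\<exists>B. \<forall>i\<le>j. \<forall>t\<in>{0..T}. (\<forall>x. cmod ((dx ^^ i) (f t) x) \<le> B) \<and> sq_int ((dx ^^ i) (f t)) \<le> ennreal B"
proof (induction j)
  have H: "in_Hs (real m) (f \<tau>)" if "\<tau> \<in> {0..T}" for \<tau> m using C[of m] that by (auto simp: continuous_in_Hs_def)
  have one: "\<exists>B. \<forall>t\<in>{0..T}. (\<forall>x. cmod ((dx ^^ i) (f t) x) \<le> B) \<and> sq_int ((dx ^^ i) (f t)) \<le> ennreal B" for i
  proof -
    obtain M1 where M1: "\<And>t. t \<in> {0..T} \<Longrightarrow> Hs_norm (real (Suc i)) (f t) \<le> M1"
      using continuous_in_Hs_bounded[OF C[of "Suc i"]] by blast
    obtain M2 where M2: "\<And>t. t \<in> {0..T} \<Longrightarrow> Hs_norm (real i) (f t) \<le> M2"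
      using continuous_in_Hs_bounded[OF C[of i]] by blast
    have "cmod ((dx ^^ i) (f t) x) \<le> max M1 (M2\<^sup>2)" if t: "t \<in> {0..T}" for t x
      using smooth_Hs_sup_bound[OF H[OF t] S[OF t], of i x] M1[OF t] by linarith
    moreover have "sq_int ((dx ^^ i) (f t)) \<le> ennreal (max M1 (M2\<^sup>2))" if t: "t \<in> {0..T}" for t
    proof -
      have "(Hs_norm (real i) (f t))\<^sup>2 \<le> M2\<^sup>2" by (intro power_mono M2 t Hs_norm_nonneg)
      then have "ennreal ((Hs_norm (real i) (f t))\<^sup>2) \<le> ennreal (max M1 (M2\<^sup>2))" by (intro ennreal_leI) linarith
      then show ?thesis using smooth_Hs_sq_int[OF H[OF t] S[OF t], of i] by (rule order_trans[rotated])
    qed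
    ultimately show ?thesis by blast
  qed
  {
    case 0 show ?case using one[of 0] by auto
  next
    case (Suc j)
    then obtain B1 where B1: "\<forall>i\<le>j. \<forall>t\<in>{0..T}. (\<forall>x. cmod ((dx ^^ i) (f t) x) \<le> B1) \<and> sq_int ((dx ^^ i) (f t)) \<le> ennreal B1" by blast
    obtain B2 where B2: "\<forall>t\<in>{0..T}. (\<forall>x. cmod ((dx ^^ Suc j) (f t) x) \<le> B2) \<and> sq_int ((dx ^^ Suc j) (f t)) \<le> ennreal B2"
      using one by blast
    have "ennreal B1 \<le> ennreal (max B1 B2)" "ennreal B2 \<le> ennreal (max B1 B2)" by (auto intro: ennreal_leI)
    then have "(\<forall>x. cmod ((dx ^^ i) (f t) x) \<le> max B1 B2) \<and> sq_int ((dx ^^ i) (f t)) \<le> ennreal (max B1 B2)"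
      if "i \<le> Suc j" "t \<in> {0..T}" for i t
      using B1 B2 that by (cases "i = Suc j") (auto simp: le_max_iff_disj le_Suc_eq dest!: bspec intro: order_trans)
    then show ?case by blast
  }
qed

lemma has_vector_derivative_complex_of_real:
  "(g has_vector_derivative g') F \<Longrightarrow> ((\<lambda>x. complex_of_real (g x)) has_vector_derivative of_real g') F"
  by (rule bounded_linear.has_vector_derivative[OF bounded_linear_of_real])

lemma dx_iter_of_real:
  assumes "smooth_fun (g :: real \<Rightarrow> real)"
  shows "(dx ^^ j) (\<lambda>x. complex_of_real (g x)) = (\<lambda>x. complex_of_real ((dx ^^ j) g x))"
proof (induction j)
  case (Suc j)
  have "dx (\<lambda>x. complex_of_real ((dx ^^ j) g x)) x = complex_of_real ((dx ^^ Suc j) g x)" for x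
  proof -
    have "((\<lambda>x. complex_of_real ((dx ^^ j) g x)) has_vector_derivative complex_of_real (dx ((dx ^^ j) g) x)) (at x)"
      by (rule has_vector_derivative_complex_of_real[OF smooth_fun_has_derivative[OF smooth_fun_iter[OF assms]]])
    then show ?thesis unfolding dx_def[of "\<lambda>x. complex_of_real ((dx ^^ j) g x)"] by (simp add: vector_derivative_at)
  qed
  with Suc show ?case by auto
qed simp

lemma smooth_fun_of_real:
  assumes "smooth_fun (g :: real \<Rightarrow> real)"
  shows "smooth_fun (\<lambda>x. complex_of_real (g x))"
  unfolding smooth_fun_def dx_iter_of_real[OF assms]
  using has_vector_derivative_complex_of_real[OF smooth_fun_has_derivative[OF smooth_fun_iter[OF assms]]] differentiableI_vector by blast

lemma has_vector_derivative_cmod_square: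
  assumes "(f has_vector_derivative f') (at x within S)"
  shows "((\<lambda>x. (cmod (f x))\<^sup>2) has_vector_derivative 2 * Re (cnj (f x) * f')) (at x within S)"
proof -
  have R: "((\<lambda>x. Re (f x)) has_vector_derivative Re f') (at x within S)"
    by (rule bounded_linear.has_vector_derivative[OF bounded_linear_Re assms])
  have I: "((\<lambda>x. Im (f x)) has_vector_derivative Im f') (at x within S)"
    by (rule bounded_linear.has_vector_derivative[OF bounded_linear_Im assms])
  have "((\<lambda>x. (Re (f x))\<^sup>2 + (Im (f x))\<^sup>2) has_vector_derivative 2 * Re (cnj (f x) * f')) (at x within S)"
    using DERIV_add[OF DERIV_power[OF R[folded has_real_derivative_iff_has_vector_derivative], of 2]
        DERIV_power[OF I[folded has_real_derivative_iff_has_vector_derivative], of 2]]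
    unfolding has_real_derivative_iff_has_vector_derivative[symmetric] by (simp add: algebra_simps)
  then show ?thesis by (simp add: cmod_power2)
qed

lemma has_vector_derivative_Re_cnj_mult:
  assumes "(f has_vector_derivative f') (at x within S)" "(g has_vector_derivative g') (at x within S)"
  shows "((\<lambda>x. Re (cnj (f x) * g x)) has_vector_derivative Re (cnj f' * g x + cnj (f x) * g')) (at x within S)"
proof -
  have "((\<lambda>x. cnj (f x)) has_vector_derivative cnj f') (at x within S)"
    by (rule bounded_linear.has_vector_derivative[OF bounded_linear_cnj assms(1)])
  from has_vector_derivative_mult[OF this assms(2)] have
    "((\<lambda>x. cnj (f x) * g x) has_vector_derivative cnj (f x) * g' + cnj f' * g x) (at x within S)" .
  from bounded_linear.has_vector_derivative[OF bounded_linear_Re this] show ?thesis by (simp add: add.commute)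
qed

lemma dx2_cmod_square:
  assumes f: "smooth_fun (f :: real \<Rightarrow> complex)"
  shows "dx (\<lambda>y. (cmod (f y))\<^sup>2) x = 2 * Re (cnj (f x) * dx f x)"
    and "(dx ^^ 2) (\<lambda>y. (cmod (f y))\<^sup>2) x = 2 * (cmod (dx f x))\<^sup>2 + 2 * Re (cnj (f x) * (dx ^^ 2) f x)"
proof -
  note D1 = smooth_fun_has_derivative[OF f] and D2 = smooth_fun_has_derivative[OF smooth_fun_dx[OF f]]
  have 1: "dx (\<lambda>y. (cmod (f y))\<^sup>2) = (\<lambda>x. 2 * Re (cnj (f x) * dx f x))"
    unfolding dx_def[of "\<lambda>y. (cmod (f y))\<^sup>2"]
    by (rule ext, rule vector_derivative_at, rule has_vector_derivative_cmod_square[OF D1])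
  then show "dx (\<lambda>y. (cmod (f y))\<^sup>2) x = 2 * Re (cnj (f x) * dx f x)" by simp
  have "((\<lambda>x. 2 * Re (cnj (f x) * dx f x)) has_vector_derivative 2 * Re (cnj (dx f x) * dx f x + cnj (f x) * dx (dx f) x)) (at x)"
    by (rule has_vector_derivative_mult_right[OF has_vector_derivative_Re_cnj_mult[OF D1 D2]])
  then have "dx (\<lambda>x. 2 * Re (cnj (f x) * dx f x)) x = 2 * Re (cnj (dx f x) * dx f x + cnj (f x) * dx (dx f) x)"
    unfolding dx_def[of "\<lambda>x. 2 * Re (cnj (f x) * dx f x)"] by (rule vector_derivative_at)
  also have "\<dots> = 2 * (cmod (dx f x))\<^sup>2 + 2 * Re (cnj (f x) * (dx ^^ 2) f x)"
  proof -
    have "(dx ^^ 2) f x = dx (dx f) x" by (simp add: numeral_2_eq_2)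
    then show ?thesis by (simp add: cmod_power2) (simp add: power2_eq_square algebra_simps)
  qed
  finally show "(dx ^^ 2) (\<lambda>y. (cmod (f y))\<^sup>2) x = 2 * (cmod (dx f x))\<^sup>2 + 2 * Re (cnj (f x) * (dx ^^ 2) f x)"
    using 1 by (simp add: numeral_2_eq_2)
qed

text \<open>Everything that the uniqueness proof takes from a smooth solution: sup and L^2 bounds
  for up to three space derivatives with a common \<open>B\<close>, joint continuity, and the
  equations solved for the time derivatives. \<open>nt\<close> stands for the time derivative of
  \<open>n\<close>, and the last clause is the zero initial velocity.\<close>

definition zreg :: "real \<Rightarrow> real \<Rightarrow> (real \<Rightarrow> real \<Rightarrow> complex) \<Rightarrow> (real \<Rightarrow> real \<Rightarrow> real) \<Rightarrow> (real \<Rightarrow> real \<Rightarrow> real) \<Rightarrow> bool" where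
  "zreg T B u n nt \<longleftrightarrow>
    (\<forall>t\<in>{0..T}. smooth_fun (u t) \<and> smooth_fun (n t)) \<and>
    (\<forall>j\<le>3. \<forall>t\<in>{0..T}. (\<forall>x. cmod ((dx ^^ j) (u t) x) \<le> B) \<and> sq_int ((dx ^^ j) (u t)) \<le> ennreal B) \<and>
    (\<forall>j\<le>3. \<forall>t\<in>{0..T}. (\<forall>x. \<bar>(dx ^^ j) (n t) x\<bar> \<le> B) \<and> sq_int (\<lambda>x. complex_of_real ((dx ^^ j) (n t) x)) \<le> ennreal B) \<and>
    (\<forall>j. strip_cont T (\<lambda>t. (dx ^^ j) (u t))) \<and> (\<forall>j. strip_cont T (\<lambda>t. (dx ^^ j) (n t))) \<and>
    (\<forall>t\<in>{0..T}. \<forall>x.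
      ((\<lambda>\<tau>. u \<tau> x) has_vector_derivative \<i> * ((dx ^^ 2) (u t) x - of_real (n t x) * u t x)) (at t within {0..T}) \<and>
      ((\<lambda>\<tau>. n \<tau> x) has_vector_derivative nt t x) (at t within {0..T}) \<and>
      ((\<lambda>\<tau>. nt \<tau> x) has_vector_derivative
        (dx ^^ 2) (n t) x + (2 * (cmod (dx (u t) x))\<^sup>2 + 2 * Re (cnj (u t x) * (dx ^^ 2) (u t) x))) (at t within {0..T})) \<and>
    (\<forall>x. nt 0 x = 0)"

text \<open>The conclusion holds for all large \<open>B\<close>, so that two solutions can be
  compared with the same constant.\<close>

lemma zakharov_solution_zreg:
  assumes Z: "zakharov_solution T u0 n0 (\<lambda>x. 0) u n"
  shows "\<exists>B0. \<forall>B\<ge>B0. zreg T B u n (dt T n)"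
proof -
  have Cu: "\<And>m::nat. continuous_in_Hs T (real m) u"
    and Cn: "\<And>m::nat. continuous_in_Hs T (real m) (\<lambda>t x. complex_of_real (n t x))"
    and S: "\<And>t. t \<in> {0..T} \<Longrightarrow> smooth_fun (u t)" "\<And>t. t \<in> {0..T} \<Longrightarrow> smooth_fun (n t)"
    using Z by (auto simp: zakharov_solution_def)
  have Sc: "smooth_fun (\<lambda>x. complex_of_real (n t x))" if "t \<in> {0..T}" for t
    by (rule smooth_fun_of_real[OF S(2)[OF that]])
  obtain B1 where B1: "\<forall>i\<le>3. \<forall>t\<in>{0..T}. (\<forall>x. cmod ((dx ^^ i) (u t) x) \<le> B1) \<and> sq_int ((dx ^^ i) (u t)) \<le> ennreal B1"
    using continuous_in_Hs_uniform_bound[OF Cu S(1)] by blast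
  obtain B2 where B2: "\<forall>i\<le>3. \<forall>t\<in>{0..T}. (\<forall>x. cmod ((dx ^^ i) (\<lambda>x. complex_of_real (n t x)) x) \<le> B2) \<and>
      sq_int ((dx ^^ i) (\<lambda>x. complex_of_real (n t x))) \<le> ennreal B2"
    using continuous_in_Hs_uniform_bound[OF Cn Sc] by blast
  have scn: "strip_cont T (\<lambda>t. (dx ^^ j) (n t))" for j
  proof -
    have "strip_cont T (\<lambda>t. (dx ^^ j) (\<lambda>x. complex_of_real (n t x)))"
      by (rule continuous_in_Hs_strip_cont[OF Cn Sc])
    then have "continuous_on ({0..T} \<times> UNIV) (\<lambda>p. Re ((dx ^^ j) (\<lambda>x. complex_of_real (n (fst p) x)) (snd p)))"
      unfolding strip_cont_def by (rule continuous_on_Re)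
    moreover have "Re ((dx ^^ j) (\<lambda>x. complex_of_real (n (fst p) x)) (snd p)) = (dx ^^ j) (n (fst p)) (snd p)"
      if "p \<in> {0..T} \<times> UNIV" for p :: "real \<times> real"
      using that by (subst dx_iter_of_real[OF S(2)]) auto
    ultimately show ?thesis unfolding strip_cont_def
      by (subst (asm) continuous_on_cong[OF refl]) auto
  qed
  have eqs: "((\<lambda>\<tau>. u \<tau> x) has_vector_derivative \<i> * ((dx ^^ 2) (u t) x - of_real (n t x) * u t x)) (at t within {0..T})"
    "((\<lambda>\<tau>. n \<tau> x) has_vector_derivative dt T n t x) (at t within {0..T})"
    "((\<lambda>\<tau>. dt T n \<tau> x) has_vector_derivative
        (dx ^^ 2) (n t) x + (2 * (cmod (dx (u t) x))\<^sup>2 + 2 * Re (cnj (u t x) * (dx ^^ 2) (u t) x))) (at t within {0..T})"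
    if t: "t \<in> {0..T}" for t x
  proof -
    have d: "(\<lambda>\<tau>. u \<tau> x) differentiable (at t within {0..T})" "(\<lambda>\<tau>. n \<tau> x) differentiable (at t within {0..T})"
        "(\<lambda>\<tau>. dt T n \<tau> x) differentiable (at t within {0..T})"
      and e: "\<i> * dt T u t x + (dx ^^ 2) (u t) x = complex_of_real (n t x) * u t x"
        "dt T (dt T n) t x - (dx ^^ 2) (n t) x = (dx ^^ 2) (\<lambda>y. (cmod (u t y))\<^sup>2) x"
      using Z t unfolding zakharov_solution_def by blast+
    have "dt T u t x = \<i> * ((dx ^^ 2) (u t) x - of_real (n t x) * u t x)"
    proof -
      have "(dx ^^ 2) (u t) x - of_real (n t x) * u t x = - (\<i> * dt T u t x)" using e(1) by (simp add: algebra_simps)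
      then show ?thesis by (simp add: mult.assoc[symmetric])
    qed
    then show "((\<lambda>\<tau>. u \<tau> x) has_vector_derivative \<i> * ((dx ^^ 2) (u t) x - of_real (n t x) * u t x)) (at t within {0..T})"
      using d(1) unfolding vector_derivative_works dt_def by simp
    show "((\<lambda>\<tau>. n \<tau> x) has_vector_derivative dt T n t x) (at t within {0..T})"
      using d(2) unfolding vector_derivative_works dt_def by simp
    have "dt T (dt T n) t x = (dx ^^ 2) (n t) x + (2 * (cmod (dx (u t) x))\<^sup>2 + 2 * Re (cnj (u t x) * (dx ^^ 2) (u t) x))"
      using e(2) unfolding dx2_cmod_square(2)[OF S(1)[OF t]] by simp
    then show "((\<lambda>\<tau>. dt T n \<tau> x) has_vector_derivative
        (dx ^^ 2) (n t) x + (2 * (cmod (dx (u t) x))\<^sup>2 + 2 * Re (cnj (u t x) * (dx ^^ 2) (u t) x))) (at t within {0..T})"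
      using d(3) unfolding vector_derivative_works dt_def[of T "dt T n"] by simp
  qed
  have "zreg T B u n (dt T n)" if B: "B \<ge> max B1 B2" for B
  proof -
    have B': "ennreal B1 \<le> ennreal B" "ennreal B2 \<le> ennreal B" "B1 \<le> B" "B2 \<le> B" using B by (auto intro: ennreal_leI)
    have 1: "cmod ((dx ^^ j) (u t) x) \<le> B" "sq_int ((dx ^^ j) (u t)) \<le> ennreal B" if "j \<le> 3" "t \<in> {0..T}" for j t x
      using B1 that B' order_trans by blast+
    have 2: "\<bar>(dx ^^ j) (n t) x\<bar> \<le> B" "sq_int (\<lambda>x. complex_of_real ((dx ^^ j) (n t) x)) \<le> ennreal B" if "j \<le> 3" "t \<in> {0..T}" for j t x
    proof -
      have "cmod ((dx ^^ j) (\<lambda>x. complex_of_real (n t x)) x) \<le> B" "sq_int ((dx ^^ j) (\<lambda>x. complex_of_real (n t x))) \<le> ennreal B"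
        using B2 that B' order_trans by blast+
      then show "\<bar>(dx ^^ j) (n t) x\<bar> \<le> B" "sq_int (\<lambda>x. complex_of_real ((dx ^^ j) (n t) x)) \<le> ennreal B"
        unfolding dx_iter_of_real[OF S(2)[OF that(2)]] by auto
    qed
    show ?thesis
      unfolding zreg_def using S 1 2 eqs scn continuous_in_Hs_strip_cont[OF Cu S(1)] Z
      by (auto simp: zakharov_solution_def)
  qed
  then show ?thesis by blast
qed

subsection \<open>A weighted energy argument\<close>

lemma integral_derivative_eq_0:
  fixes F f :: "real \<Rightarrow> real"
  assumes F: "\<And>x. (F has_real_derivative f x) (at x)" and f: "continuous_on UNIV f" "integrable lborel f"
    and lim: "(F \<longlongrightarrow> 0) at_top" "(F \<longlongrightarrow> 0) at_bot"
  shows "(LINT x|lborel. f x) = 0"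
proof -
  have "(LBINT x=-\<infinity>..\<infinity>. f x) = 0 - 0"
  proof (rule interval_integral_FTC_integrable)
    show "(F has_vector_derivative f x) (at x)" for x
      using F by (simp add: has_real_derivative_iff_has_vector_derivative)
    show "isCont f x" for x using f(1) by (simp add: continuous_on_eq_continuous_at)
    show "set_integrable lborel (einterval (- \<infinity>) \<infinity>) f" using f(2) by (simp add: set_integrable_def)
  qed (use lim in \<open>auto simp: ereal_tendsto_simps\<close>)
  then show ?thesis by (simp add: interval_lebesgue_integral_def set_lebesgue_integral_def)
qed

definition cauchy_weight :: "real \<Rightarrow> real \<Rightarrow> real" where
  "cauchy_weight \<epsilon> x = 1 / (1 + (\<epsilon> * x)\<^sup>2)"

lemma cauchy_weight_props:
  shows cauchy_weight_pos: "0 < cauchy_weight \<epsilon> x"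
    and cauchy_weight_le_1: "cauchy_weight \<epsilon> x \<le> 1"
    and continuous_cauchy_weight: "continuous_on S (cauchy_weight \<epsilon>)"
proof -
  have p: "0 < 1 + (\<epsilon> * x)\<^sup>2" for x by (rule one_plus_square_pos)
  show "0 < cauchy_weight \<epsilon> x" "cauchy_weight \<epsilon> x \<le> 1" using p[of x] by (auto simp: cauchy_weight_def)
  have "1 + (\<epsilon> * x)\<^sup>2 \<noteq> 0" for x using p[of x] by linarith
  then show "continuous_on S (cauchy_weight \<epsilon>)"
    unfolding cauchy_weight_def[abs_def] by (intro continuous_intros) auto
qed

lemma integrable_cauchy_weight: "\<epsilon> > 0 \<Longrightarrow> integrable lborel (cauchy_weight \<epsilon>)"
  using lborel_integrable_real_affine[OF integrable_inverse_1_plus_square_lborel, of \<epsilon> 0]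
  by (simp add: cauchy_weight_def[abs_def])

text \<open>The bound on the derivative is 2 |y| \<le> 1 + y^2 with y = \<epsilon> x.\<close>

lemma cauchy_weight_deriv:
  assumes "\<epsilon> > 0"
  obtains \<chi>' where "\<And>x. (cauchy_weight \<epsilon> has_real_derivative \<chi>' x) (at x)"
    "\<And>x. \<bar>\<chi>' x\<bar> \<le> \<epsilon> * cauchy_weight \<epsilon> x" "continuous_on UNIV \<chi>'"
proof
  let ?d = "\<lambda>x. - (2 * \<epsilon>\<^sup>2 * x) / (1 + (\<epsilon> * x)\<^sup>2)\<^sup>2"
  have p: "0 < 1 + (\<epsilon> * x)\<^sup>2" for x by (rule one_plus_square_pos)
  then have nz: "1 + (\<epsilon> * x)\<^sup>2 \<noteq> 0" for x by (metis less_irrefl)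
  show "(cauchy_weight \<epsilon> has_real_derivative ?d x) (at x)" for x
    unfolding cauchy_weight_def[abs_def] using nz[of x]
    by (auto intro!: derivative_eq_intros simp: power2_eq_square field_simps)
  show "\<bar>?d x\<bar> \<le> \<epsilon> * cauchy_weight \<epsilon> x" for x
  proof -
    have "2 * \<bar>\<epsilon> * x\<bar> \<le> 1 + (\<epsilon> * x)\<^sup>2" using sum_squares_bound[of 1 "\<bar>\<epsilon> * x\<bar>"] by simp
    then have le: "\<epsilon> * (2 * \<bar>\<epsilon> * x\<bar>) \<le> \<epsilon> * (1 + (\<epsilon> * x)\<^sup>2)" using assms by (intro mult_left_mono) auto
    have eq: "\<bar>?d x\<bar> = \<epsilon> * (2 * \<bar>\<epsilon> * x\<bar>) / (1 + (\<epsilon> * x)\<^sup>2)\<^sup>2"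
      using assms by (simp add: abs_mult power2_eq_square)
    have "\<bar>?d x\<bar> \<le> \<epsilon> * (1 + (\<epsilon> * x)\<^sup>2) / (1 + (\<epsilon> * x)\<^sup>2)\<^sup>2"
      unfolding eq using le by (intro divide_right_mono) auto
    also have "\<dots> = \<epsilon> * cauchy_weight \<epsilon> x" unfolding cauchy_weight_def power2_eq_square[of "1 + (\<epsilon> * x)\<^sup>2"] by simp
    finally show ?thesis .
  qed
  show "continuous_on UNIV ?d" using nz by (intro continuous_intros) auto
qed

lemma cauchy_weight_tendsto:
  assumes "\<epsilon> > 0"
  shows "(cauchy_weight \<epsilon> \<longlongrightarrow> 0) at_top" "(cauchy_weight \<epsilon> \<longlongrightarrow> 0) at_bot"
  unfolding cauchy_weight_def[abs_def] using assms by real_asymp+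

text \<open>The weight is integrable, and its logarithmic derivative is at most \<open>\<epsilon>\<close>; hence the flux
  \<open>J\<close> contributes only \<open>O(\<epsilon>)\<close> to the growth of the weighted energy.\<close>

lemma weighted_energy_vanish:
  fixes e J Jx R q :: "real \<Rightarrow> real \<Rightarrow> real"
  assumes et: "\<And>t x. t \<in> {0..T} \<Longrightarrow> ((\<lambda>\<tau>. e \<tau> x) has_real_derivative Jx t x + R t x) (at t within {0..T})"
    and J: "\<And>t x. t \<in> {0..T} \<Longrightarrow> (J t has_real_derivative Jx t x) (at x)"
    and cont: "\<And>t. t \<in> {0..T} \<Longrightarrow> continuous_on UNIV (e t)" "\<And>t. t \<in> {0..T} \<Longrightarrow> continuous_on UNIV (J t)"
      "\<And>t. t \<in> {0..T} \<Longrightarrow> continuous_on UNIV (Jx t)" "\<And>t. t \<in> {0..T} \<Longrightarrow> continuous_on UNIV (R t)"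
      "\<And>t. t \<in> {0..T} \<Longrightarrow> continuous_on UNIV (q t)"
    and bd: "\<And>t x. t \<in> {0..T} \<Longrightarrow> \<bar>e t x\<bar> \<le> B" "\<And>t x. t \<in> {0..T} \<Longrightarrow> \<bar>J t x\<bar> \<le> B"
      "\<And>t x. t \<in> {0..T} \<Longrightarrow> \<bar>Jx t x\<bar> \<le> B" "\<And>t x. t \<in> {0..T} \<Longrightarrow> \<bar>R t x\<bar> \<le> B"
    and L1: "\<And>t. t \<in> {0..T} \<Longrightarrow> (\<integral>\<^sup>+x. ennreal \<bar>J t x\<bar> \<partial>lborel) \<le> ennreal B"
    and q: "\<And>t x. t \<in> {0..T} \<Longrightarrow> 0 \<le> q t x" "\<And>t x. t \<in> {0..T} \<Longrightarrow> q t x \<le> e t x"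
      "\<And>t x. t \<in> {0..T} \<Longrightarrow> \<bar>R t x\<bar> \<le> K * q t x"
    and K: "0 \<le> K" and e0: "\<And>x. e 0 x = 0" and t: "t \<in> {0..T}"
  shows "q t x = 0"
proof -
  have B0: "0 \<le> B" using bd(1)[OF t, of 0] by linarith
  have meas[measurable]: "e s \<in> borel_measurable borel" "J s \<in> borel_measurable borel" "Jx s \<in> borel_measurable borel"
    "R s \<in> borel_measurable borel" "q s \<in> borel_measurable borel" if "s \<in> {0..T}" for s
    using cont[OF that] by (auto intro: borel_measurable_continuous_onI)
  have wm[measurable]: "cauchy_weight \<epsilon> \<in> borel_measurable borel" for \<epsilon>
    by (intro borel_measurable_continuous_onI continuous_cauchy_weight)
  have Jint: "integrable lborel (J s)" if s: "s \<in> {0..T}" for s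
    using L1[OF s] meas(2)[OF s] by (auto simp: integrable_iff_bounded intro: le_less_trans)
  have wint: "integrable lborel (\<lambda>x. cauchy_weight \<epsilon> x * g x)"
    if "\<epsilon> > 0" "g \<in> borel_measurable borel" "\<And>x. \<bar>g x\<bar> \<le> C" for \<epsilon> g C
  proof (rule Bochner_Integration.integrable_bound)
    show "integrable lborel (\<lambda>x. C * cauchy_weight \<epsilon> x)" using integrable_cauchy_weight[OF that(1)] by simp
    show "AE x in lborel. norm (cauchy_weight \<epsilon> x * g x) \<le> norm (C * cauchy_weight \<epsilon> x)"
    proof (rule AE_I2)
      fix x
      have "\<bar>g x\<bar> * cauchy_weight \<epsilon> x \<le> \<bar>C\<bar> * cauchy_weight \<epsilon> x"
        using that(3)[of x] cauchy_weight_pos[of \<epsilon> x] by (intro mult_right_mono) auto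
      then show "norm (cauchy_weight \<epsilon> x * g x) \<le> norm (C * cauchy_weight \<epsilon> x)"
        using cauchy_weight_pos[of \<epsilon> x] by (simp add: abs_mult mult.commute)
    qed
  qed (use that in simp)
  define E where "E = (\<lambda>\<epsilon> s. LINT x|lborel. cauchy_weight \<epsilon> x * e s x)"
  have grow: "E \<epsilon> t \<le> \<epsilon> * (B * t * exp (K * t))" if \<epsilon>: "\<epsilon> > 0" for \<epsilon>
  proof -
    obtain \<chi>' where \<chi>': "\<And>x. (cauchy_weight \<epsilon> has_real_derivative \<chi>' x) (at x)"
      "\<And>x. \<bar>\<chi>' x\<bar> \<le> \<epsilon> * cauchy_weight \<epsilon> x" "continuous_on UNIV \<chi>'" using cauchy_weight_deriv[OF \<epsilon>] by blast
    have [measurable]: "\<chi>' \<in> borel_measurable borel" using \<chi>'(3) by (intro borel_measurable_continuous_onI)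
    define E' where "E' = (\<lambda>s. LINT x|lborel. cauchy_weight \<epsilon> x * (Jx s x + R s x))"
    have dE: "(E \<epsilon> has_real_derivative E' s) (at s within {0..T})" if s: "s \<in> {0..T}" for s
      unfolding E_def E'_def has_real_derivative_iff_has_vector_derivative
    proof (rule has_vector_derivative_lebesgue_integral[where w="\<lambda>x. cauchy_weight \<epsilon> x * (2 * B)" and h'="\<lambda>t x. cauchy_weight \<epsilon> x * (Jx t x + R t x)"])
      fix t x assume t': "t \<in> {0..T}"
      show "((\<lambda>t. cauchy_weight \<epsilon> x * e t x) has_vector_derivative cauchy_weight \<epsilon> x * (Jx t x + R t x)) (at t within {0..T})"
        using et[OF t', of x] unfolding has_real_derivative_iff_has_vector_derivative
        by (rule has_vector_derivative_mult_right)
      have "\<bar>Jx t x + R t x\<bar> \<le> 2 * B" using bd(3,4)[OF t', of x] by linarith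
      then have "cauchy_weight \<epsilon> x * \<bar>Jx t x + R t x\<bar> \<le> cauchy_weight \<epsilon> x * (2 * B)"
        using cauchy_weight_pos[of \<epsilon> x] by (intro mult_left_mono) auto
      then show "norm (cauchy_weight \<epsilon> x * (Jx t x + R t x)) \<le> cauchy_weight \<epsilon> x * (2 * B)"
        using cauchy_weight_pos[of \<epsilon> x] by (simp add: abs_mult)
    next
      show "integrable lborel (\<lambda>x. cauchy_weight \<epsilon> x * e t x)" if "t \<in> {0..T}" for t
        by (rule wint[OF \<epsilon> meas(1)[OF that] bd(1)[OF that]])
      show "(\<lambda>x. cauchy_weight \<epsilon> x * (Jx s x + R s x)) \<in> borel_measurable lborel" using meas[OF s] by simp
    qed (use s \<epsilon> integrable_cauchy_weight in auto)
    have E'le: "E' s \<le> \<epsilon> * B + K * E \<epsilon> s" if s: "s \<in> {0..T}" for s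
    proof -
      note m = meas[OF s]
      have i1: "integrable lborel (\<lambda>x. cauchy_weight \<epsilon> x * Jx s x)" by (rule wint[OF \<epsilon> m(3) bd(3)[OF s]])
      have i2: "integrable lborel (\<lambda>x. cauchy_weight \<epsilon> x * R s x)" by (rule wint[OF \<epsilon> m(4) bd(4)[OF s]])
      have i3: "integrable lborel (\<lambda>x. cauchy_weight \<epsilon> x * e s x)" by (rule wint[OF \<epsilon> m(1) bd(1)[OF s]])
      have \<chi>'le: "\<bar>\<chi>' x\<bar> \<le> \<epsilon>" for x
      proof -
        have "\<epsilon> * cauchy_weight \<epsilon> x \<le> \<epsilon> * 1" using cauchy_weight_le_1 \<epsilon> by (intro mult_left_mono) auto
        then show ?thesis using \<chi>'(2)[of x] by linarith
      qed
      have i4: "integrable lborel (\<lambda>x. \<chi>' x * J s x)"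
      proof (rule Bochner_Integration.integrable_bound)
        show "integrable lborel (\<lambda>x. \<epsilon> * J s x)" using Jint[OF s] by simp
        show "AE x in lborel. norm (\<chi>' x * J s x) \<le> norm (\<epsilon> * J s x)"
          using \<chi>'le \<epsilon> by (intro AE_I2) (auto simp: abs_mult intro!: mult_right_mono)
      qed (use m in simp)
      have "(LINT x|lborel. \<chi>' x * J s x + cauchy_weight \<epsilon> x * Jx s x) = 0"
      proof (rule integral_derivative_eq_0[where F="\<lambda>x. cauchy_weight \<epsilon> x * J s x"])
        show "((\<lambda>x. cauchy_weight \<epsilon> x * J s x) has_real_derivative \<chi>' x * J s x + cauchy_weight \<epsilon> x * Jx s x) (at x)" for x
          using DERIV_mult[OF \<chi>'(1)[of x] J[OF s, of x]] by (simp add: algebra_simps)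
        show "continuous_on UNIV (\<lambda>x. \<chi>' x * J s x + cauchy_weight \<epsilon> x * Jx s x)"
          by (intro continuous_intros \<chi>'(3) cont(2,3)[OF s] continuous_cauchy_weight)
        show "integrable lborel (\<lambda>x. \<chi>' x * J s x + cauchy_weight \<epsilon> x * Jx s x)"
          using i4 i1 by (rule Bochner_Integration.integrable_add)
        have *: "\<bar>cauchy_weight \<epsilon> x * J s x\<bar> \<le> B * cauchy_weight \<epsilon> x" for x
        proof -
          have "cauchy_weight \<epsilon> x * \<bar>J s x\<bar> \<le> cauchy_weight \<epsilon> x * B"
            using bd(2)[OF s] cauchy_weight_pos[of \<epsilon> x] by (intro mult_left_mono) auto
          then show ?thesis using cauchy_weight_pos[of \<epsilon> x] by (simp add: abs_mult mult.commute)
        qed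
        show "((\<lambda>x. cauchy_weight \<epsilon> x * J s x) \<longlongrightarrow> 0) at_top"
        proof (rule Lim_null_comparison)
          show "((\<lambda>x. B * cauchy_weight \<epsilon> x) \<longlongrightarrow> 0) at_top" using tendsto_mult_left[OF cauchy_weight_tendsto(1)[OF \<epsilon>], of B] by simp
        qed (use * in auto)
        show "((\<lambda>x. cauchy_weight \<epsilon> x * J s x) \<longlongrightarrow> 0) at_bot"
        proof (rule Lim_null_comparison)
          show "((\<lambda>x. B * cauchy_weight \<epsilon> x) \<longlongrightarrow> 0) at_bot" using tendsto_mult_left[OF cauchy_weight_tendsto(2)[OF \<epsilon>], of B] by simp
        qed (use * in auto)
      qed
      \<comment> \<open>Integration by parts moves the derivative from the flux onto the weight,
        where it costs a factor \<epsilon>; the L^1 bound on \<open>J\<close> then controls the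
        result.\<close>
      then have ibp: "(LINT x|lborel. cauchy_weight \<epsilon> x * Jx s x) = - (LINT x|lborel. \<chi>' x * J s x)"
        using i4 i1 by simp
      have "- (LINT x|lborel. \<chi>' x * J s x) \<le> (LINT x|lborel. \<epsilon> * \<bar>J s x\<bar>)"
      proof -
        have "- (LINT x|lborel. \<chi>' x * J s x) = (LINT x|lborel. - (\<chi>' x * J s x))" by simp
        also have "\<dots> \<le> (LINT x|lborel. \<epsilon> * \<bar>J s x\<bar>)"
        proof (rule integral_mono)
          show "- (\<chi>' x * J s x) \<le> \<epsilon> * \<bar>J s x\<bar>" for x
          proof -
            have "\<bar>\<chi>' x * J s x\<bar> \<le> \<epsilon> * \<bar>J s x\<bar>" unfolding abs_mult using \<chi>'le by (intro mult_right_mono) auto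
            then show ?thesis by linarith
          qed
        qed (use i4 Jint[OF s] in auto)
        finally show ?thesis .
      qed
      also have "\<dots> = \<epsilon> * (LINT x|lborel. \<bar>J s x\<bar>)" by simp
      also have "\<dots> \<le> \<epsilon> * B"
      proof (intro mult_left_mono)
        have "ennreal (LINT x|lborel. \<bar>J s x\<bar>) = (\<integral>\<^sup>+x. ennreal \<bar>J s x\<bar> \<partial>lborel)"
          using Jint[OF s] by (intro nn_integral_eq_integral[symmetric]) auto
        also have "\<dots> \<le> ennreal B" by (rule L1[OF s])
        finally show "(LINT x|lborel. \<bar>J s x\<bar>) \<le> B" using B0 by (simp add: ennreal_le_iff)
      qed (use \<epsilon> in simp)
      finally have 1: "(LINT x|lborel. cauchy_weight \<epsilon> x * Jx s x) \<le> \<epsilon> * B" unfolding ibp .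
      have 2: "(LINT x|lborel. cauchy_weight \<epsilon> x * R s x) \<le> (LINT x|lborel. K * (cauchy_weight \<epsilon> x * e s x))"
      proof (rule integral_mono[OF i2])
        show "cauchy_weight \<epsilon> x * R s x \<le> K * (cauchy_weight \<epsilon> x * e s x)" for x
        proof -
          have "K * q s x \<le> K * e s x" using q(2)[OF s] K by (intro mult_left_mono) auto
          then have "R s x \<le> K * e s x" using q(3)[OF s, of x] by linarith
          then have "cauchy_weight \<epsilon> x * R s x \<le> cauchy_weight \<epsilon> x * (K * e s x)"
            using cauchy_weight_pos[of \<epsilon> x] by (intro mult_left_mono) auto
          then show ?thesis by (simp add: mult_ac)
        qed
      qed (use i3 in simp)
      have "E' s = (LINT x|lborel. cauchy_weight \<epsilon> x * Jx s x) + (LINT x|lborel. cauchy_weight \<epsilon> x * R s x)"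
        unfolding E'_def distrib_left by (rule Bochner_Integration.integral_add[OF i1 i2])
      then show ?thesis using 1 2 by (simp add: E_def)
    qed
    \<comment> \<open>Gronwall's inequality by means of the integrating factor exp (- K s); the
      linear term absorbs the flux error \<epsilon> B.\<close>
    define g where "g = (\<lambda>s. E \<epsilon> s * exp (- K * s) - \<epsilon> * B * s)"
    have dg: "(g has_real_derivative (E' s - K * E \<epsilon> s) * exp (- K * s) - \<epsilon> * B) (at s within {0..T})" if "s \<in> {0..T}" for s
      unfolding g_def using dE[OF that] by (auto intro!: derivative_eq_intros simp: algebra_simps)
    have "g t \<le> g 0"
    proof (cases "t = 0")
      case False
      then have t0: "0 < t" using t by auto
      have "\<exists>y. (g has_real_derivative y) (at s) \<and> y \<le> 0" if s: "0 < s" "s < t" for s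
      proof -
        have s': "s \<in> {0..T}" "at s within {0..T} = at s" using s t by (auto intro!: at_within_interior)
        have "(E' s - K * E \<epsilon> s) * exp (- K * s) \<le> (\<epsilon> * B) * exp (- K * s)"
          using E'le[OF s'(1)] by (intro mult_right_mono) auto
        also have "\<dots> \<le> (\<epsilon> * B) * 1"
          using K s \<epsilon> B0 by (intro mult_left_mono) auto
        finally have "(E' s - K * E \<epsilon> s) * exp (- K * s) \<le> (\<epsilon> * B) * 1" .
        then show ?thesis using dg[OF s'(1)] unfolding s'(2) by (intro exI conjI) auto
      qed
      moreover have "continuous_on {0..t} g"
        using dg t by (intro continuous_on_subset[OF DERIV_continuous_on[of "{0..T}" g]]) auto
      ultimately show ?thesis using DERIV_nonpos_imp_decreasing_open[of 0 t g] t0 by auto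
    qed simp
    moreover have "g 0 = 0" unfolding g_def E_def by (simp add: e0)
    ultimately have "E \<epsilon> t * exp (- K * t) \<le> \<epsilon> * B * t" by (simp add: g_def)
    then have "E \<epsilon> t * exp (- K * t) * exp (K * t) \<le> \<epsilon> * B * t * exp (K * t)" by (intro mult_right_mono) auto
    then show ?thesis by (simp add: mult.assoc exp_minus_inverse flip: exp_add)
  qed
  have qb: "\<bar>q t x\<bar> \<le> B" for x using q(1,2)[OF t, of x] bd(1)[OF t, of x] by linarith
  have iq: "integrable lborel (\<lambda>x. cauchy_weight \<epsilon> x * q t x)" if "\<epsilon> > 0" for \<epsilon> by (rule wint[OF that meas(5)[OF t] qb])
  \<comment> \<open>The weights increase as \<epsilon> decreases, so the integral of
    \<open>q\<close> with the fixed weight for \<epsilon> = 1 lies below every weighted energy with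
    \<epsilon> < 1, and the bounds on these tend to 0.\<close>
  have qle: "(LINT x|lborel. cauchy_weight 1 x * q t x) \<le> \<epsilon> * (B * t * exp (K * t))" if \<epsilon>: "0 < \<epsilon>" "\<epsilon> < 1" for \<epsilon>
  proof -
    have "(LINT x|lborel. cauchy_weight 1 x * q t x) \<le> (LINT x|lborel. cauchy_weight \<epsilon> x * q t x)"
    proof (rule integral_mono[OF iq iq[OF \<epsilon>(1)]])
      fix x :: real
      have "(\<epsilon> * x)\<^sup>2 \<le> (1 * x)\<^sup>2" unfolding power_mult_distrib using \<epsilon> by (intro mult_right_mono power_mono) auto
      then have "cauchy_weight 1 x \<le> cauchy_weight \<epsilon> x" unfolding cauchy_weight_def
        using one_plus_square_pos[of "\<epsilon> * x"] by (intro divide_left_mono) (auto intro!: mult_pos_pos add_pos_nonneg)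
      then show "cauchy_weight 1 x * q t x \<le> cauchy_weight \<epsilon> x * q t x" by (intro mult_right_mono q(1) t)
    qed simp
    also have "\<dots> \<le> E \<epsilon> t" unfolding E_def
    proof (rule integral_mono[OF iq[OF \<epsilon>(1)] wint[OF \<epsilon>(1) meas(1)[OF t] bd(1)[OF t]]])
      show "cauchy_weight \<epsilon> x * q t x \<le> cauchy_weight \<epsilon> x * e t x" for x
        using q(2)[OF t, of x] cauchy_weight_pos[of \<epsilon> x] by (intro mult_left_mono) auto
    qed
    also have "\<dots> \<le> \<epsilon> * (B * t * exp (K * t))" by (rule grow[OF \<epsilon>(1)])
    finally show ?thesis .
  qed
  have "(LINT x|lborel. cauchy_weight 1 x * q t x) \<le> 0"
  proof (rule tendsto_lowerbound)
    show "((\<lambda>\<epsilon>. \<epsilon> * (B * t * exp (K * t))) \<longlongrightarrow> 0) (at_right 0)" by (auto intro!: tendsto_eq_intros)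
    show "\<forall>\<^sub>F \<epsilon> in at_right 0. (LINT x|lborel. cauchy_weight 1 x * q t x) \<le> \<epsilon> * (B * t * exp (K * t))"
    proof -
      have "eventually (\<lambda>\<epsilon>. \<epsilon> \<in> {0<..<1::real}) (at_right 0)" by (rule eventually_at_right_real) simp
      then show ?thesis by eventually_elim (auto intro!: qle)
    qed
  qed simp
  moreover have "0 \<le> (LINT x|lborel. cauchy_weight 1 x * q t x)"
    using q(1)[OF t] cauchy_weight_pos[of 1] by (intro Bochner_Integration.integral_nonneg mult_nonneg_nonneg) (auto intro: less_imp_le)
  ultimately have "(LINT x|lborel. cauchy_weight 1 x * q t x) = 0" by linarith
  then have "AE x in lborel. cauchy_weight 1 x * q t x = 0"
    using q(1)[OF t] cauchy_weight_pos[of 1] iq[of 1]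
    by (subst (asm) integral_nonneg_eq_0_iff_AE) (auto intro!: AE_I2 mult_nonneg_nonneg less_imp_le[OF cauchy_weight_pos])
  then have "AE x in lborel. complex_of_real (q t x) = 0"
    by eventually_elim (use cauchy_weight_pos[of 1] in \<open>auto simp: less_le\<close>)
  then have "(\<lambda>x. complex_of_real (q t x)) = (\<lambda>x. 0)"
    by (intro continuous_AE_eq_imp_eq continuous_on_of_real cont(5)[OF t]) auto
  then have "complex_of_real (q t x) = 0" by (rule fun_cong)
  then show ?thesis by simp
qed

subsection \<open>Uniqueness of smooth solutions\<close>

definition strip_bdd :: "real \<Rightarrow> (real \<Rightarrow> real \<Rightarrow> 'a::real_normed_vector) \<Rightarrow> bool" where
  "strip_bdd T f \<longleftrightarrow> (\<exists>C. \<forall>t\<in>{0..T}. \<forall>x. norm (f t x) \<le> C)"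

lemma strip_bddI: "(\<And>t x. t \<in> {0..T} \<Longrightarrow> norm (f t x) \<le> C) \<Longrightarrow> strip_bdd T f"
  unfolding strip_bdd_def by blast

lemma strip_bdd_add: "strip_bdd T f \<Longrightarrow> strip_bdd T g \<Longrightarrow> strip_bdd T (\<lambda>t x. f t x + g t x)"
  unfolding strip_bdd_def by (meson norm_triangle_mono)

lemma strip_bdd_minus: "strip_bdd T f \<Longrightarrow> strip_bdd T (\<lambda>t x. - f t x)"
  unfolding strip_bdd_def by simp

lemma strip_bdd_diff: "strip_bdd T f \<Longrightarrow> strip_bdd T g \<Longrightarrow> strip_bdd T (\<lambda>t x. f t x - g t x)"
  using strip_bdd_add[OF _ strip_bdd_minus, of T f g] by simp

lemma strip_bdd_mult:
  fixes f g :: "real \<Rightarrow> real \<Rightarrow> 'a::real_normed_algebra"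
  assumes "strip_bdd T f" "strip_bdd T g" shows "strip_bdd T (\<lambda>t x. f t x * g t x)"
proof -
  obtain C D where C: "\<And>t x. t \<in> {0..T} \<Longrightarrow> norm (f t x) \<le> C" and D: "\<And>t x. t \<in> {0..T} \<Longrightarrow> norm (g t x) \<le> D"
    using assms unfolding strip_bdd_def by blast
  show ?thesis
  proof (rule strip_bddI)
    fix t x assume t: "t \<in> {0..T}"
    have "norm (f t x * g t x) \<le> norm (f t x) * norm (g t x)" by (rule norm_mult_ineq)
    also have "\<dots> \<le> C * D" using C[OF t, of x] D[OF t, of x] by (intro mult_mono) (auto intro: order_trans[OF norm_ge_zero])
    finally show "norm (f t x * g t x) \<le> C * D" .
  qed
qed

lemma strip_bdd_const: "strip_bdd T (\<lambda>t x. c)"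
  by (rule strip_bddI) (rule order_refl)

lemma strip_bdd_power: 
  fixes f :: "real \<Rightarrow> real \<Rightarrow> 'a::real_normed_div_algebra"
  assumes "strip_bdd T f" shows "strip_bdd T (\<lambda>t x. f t x ^ k)"
  by (induction k) (auto intro: strip_bdd_mult assms strip_bdd_const)

lemma strip_bdd_Re: "strip_bdd T f \<Longrightarrow> strip_bdd T (\<lambda>t x. Re (f t x))"
  unfolding strip_bdd_def using abs_Re_le_cmod order_trans by (metis real_norm_def)

lemma strip_bdd_cnj: "strip_bdd T f \<Longrightarrow> strip_bdd T (\<lambda>t x. cnj (f t x))"
  unfolding strip_bdd_def by simp

lemma strip_bdd_cmod: "strip_bdd T f \<Longrightarrow> strip_bdd T (\<lambda>t x. cmod (f t x))"
  unfolding strip_bdd_def by simp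

lemma strip_bdd_of_real: "strip_bdd T f \<Longrightarrow> strip_bdd T (\<lambda>t x. complex_of_real (f t x))"
  unfolding strip_bdd_def by simp

lemmas strip_bdd_intros = strip_bdd_add strip_bdd_minus strip_bdd_diff strip_bdd_mult strip_bdd_const
  strip_bdd_power strip_bdd_Re strip_bdd_cnj strip_bdd_cmod strip_bdd_of_real

definition strip_L2 :: "real \<Rightarrow> (real \<Rightarrow> real \<Rightarrow> 'a::{real_normed_vector, second_countable_topology}) \<Rightarrow> bool" where
  "strip_L2 T f \<longleftrightarrow> (\<forall>t\<in>{0..T}. f t \<in> borel_measurable borel) \<and>
     (\<exists>C. \<forall>t\<in>{0..T}. (\<integral>\<^sup>+x. ennreal ((norm (f t x))\<^sup>2) \<partial>lborel) \<le> ennreal C)"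

lemma strip_L2I:
  "(\<And>t. t \<in> {0..T} \<Longrightarrow> (\<integral>\<^sup>+x. ennreal ((norm (f t x))\<^sup>2) \<partial>lborel) \<le> ennreal C) \<Longrightarrow>
   (\<And>t. t \<in> {0..T} \<Longrightarrow> f t \<in> borel_measurable borel) \<Longrightarrow> strip_L2 T f"
  unfolding strip_L2_def by blast

lemma strip_L2_bound:
  assumes f: "strip_L2 T f" and g: "\<And>t. t \<in> {0..T} \<Longrightarrow> g t \<in> borel_measurable borel"
    and le: "\<And>t x. t \<in> {0..T} \<Longrightarrow> norm (g t x) \<le> K * norm (f t x)"
  shows "strip_L2 T g"
proof -
  obtain C where C: "\<And>t. t \<in> {0..T} \<Longrightarrow> (\<integral>\<^sup>+x. ennreal ((norm (f t x))\<^sup>2) \<partial>lborel) \<le> ennreal C"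
    using f unfolding strip_L2_def by blast
  have "(\<integral>\<^sup>+x. ennreal ((norm (g t x))\<^sup>2) \<partial>lborel) \<le> ennreal (K\<^sup>2 * C)" if t: "t \<in> {0..T}" for t
  proof -
    have [measurable]: "f t \<in> borel_measurable borel" using f t by (simp add: strip_L2_def)
    have "(\<integral>\<^sup>+x. ennreal ((norm (g t x))\<^sup>2) \<partial>lborel) \<le> (\<integral>\<^sup>+x. ennreal (K\<^sup>2) * ennreal ((norm (f t x))\<^sup>2) \<partial>lborel)"
    proof (intro nn_integral_mono)
      fix x
      have "(norm (g t x))\<^sup>2 \<le> (K * norm (f t x))\<^sup>2" using le[OF t] by (intro power_mono) auto
      then show "ennreal ((norm (g t x))\<^sup>2) \<le> ennreal (K\<^sup>2) * ennreal ((norm (f t x))\<^sup>2)"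
        by (simp add: power_mult_distrib ennreal_mult[symmetric] ennreal_leI)
    qed
    also have "\<dots> = ennreal (K\<^sup>2) * (\<integral>\<^sup>+x. ennreal ((norm (f t x))\<^sup>2) \<partial>lborel)" by (rule nn_integral_cmult) simp
    also have "\<dots> \<le> ennreal (K\<^sup>2) * ennreal C" by (intro mult_left_mono C t) auto
    finally show ?thesis by (simp add: ennreal_mult')
  qed
  then show ?thesis unfolding strip_L2_def using g by blast
qed

lemma strip_L2_add:
  assumes f: "strip_L2 T f" and g: "strip_L2 T g"
  shows "strip_L2 T (\<lambda>t x. f t x + g t x)"
proof -
  obtain C where C: "\<And>t. t \<in> {0..T} \<Longrightarrow> (\<integral>\<^sup>+x. ennreal ((norm (f t x))\<^sup>2) \<partial>lborel) \<le> ennreal C"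
    using f unfolding strip_L2_def by blast
  obtain D where D: "\<And>t. t \<in> {0..T} \<Longrightarrow> (\<integral>\<^sup>+x. ennreal ((norm (g t x))\<^sup>2) \<partial>lborel) \<le> ennreal D"
    using g unfolding strip_L2_def by blast
  have "(\<integral>\<^sup>+x. ennreal ((norm (f t x + g t x))\<^sup>2) \<partial>lborel) \<le> ennreal (2 * max 0 C + 2 * max 0 D)" if t: "t \<in> {0..T}" for t
  proof -
    have [measurable]: "f t \<in> borel_measurable borel" "g t \<in> borel_measurable borel" using f g t by (auto simp: strip_L2_def)
    have "(\<integral>\<^sup>+x. ennreal ((norm (f t x + g t x))\<^sup>2) \<partial>lborel) \<le> (\<integral>\<^sup>+x. ennreal 2 * ennreal ((norm (f t x))\<^sup>2) + ennreal 2 * ennreal ((norm (g t x))\<^sup>2) \<partial>lborel)"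
    proof (intro nn_integral_mono)
      fix x
      have "(norm (f t x + g t x))\<^sup>2 \<le> 2 * (norm (f t x))\<^sup>2 + 2 * (norm (g t x))\<^sup>2"
        using power_mono[OF norm_triangle_ineq[of "f t x" "g t x"], of 2] sum_squares_bound[of "norm (f t x)" "norm (g t x)"]
        by (simp add: power2_sum)
      then show "ennreal ((norm (f t x + g t x))\<^sup>2) \<le> ennreal 2 * ennreal ((norm (f t x))\<^sup>2) + ennreal 2 * ennreal ((norm (g t x))\<^sup>2)"
        by (simp add: ennreal_mult[symmetric] ennreal_plus[symmetric] ennreal_leI del: ennreal_plus ennreal_numeral)
    qed
    also have "\<dots> = ennreal 2 * (\<integral>\<^sup>+x. ennreal ((norm (f t x))\<^sup>2) \<partial>lborel) + ennreal 2 * (\<integral>\<^sup>+x. ennreal ((norm (g t x))\<^sup>2) \<partial>lborel)"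
      by (subst nn_integral_add) (auto simp: nn_integral_cmult)
    also have "\<dots> \<le> ennreal 2 * ennreal (max 0 C) + ennreal 2 * ennreal (max 0 D)"
      using C[OF t] D[OF t] by (intro add_mono mult_left_mono) (auto simp: max_def ennreal_neg)
    also have "\<dots> = ennreal (2 * max 0 C + 2 * max 0 D)"
      by (subst (1 2) ennreal_mult[symmetric], auto simp del: ennreal_numeral) 
    finally show ?thesis .
  qed
  then show ?thesis by (rule strip_L2I) (use f g in \<open>auto simp: strip_L2_def intro!: borel_measurable_add\<close>)
qed

lemma strip_L2_mult_bdd:
  fixes f g :: "real \<Rightarrow> real \<Rightarrow> 'a::{real_normed_algebra, second_countable_topology}"
  assumes f: "strip_L2 T f" and g: "strip_bdd T g" "\<And>t. t \<in> {0..T} \<Longrightarrow> g t \<in> borel_measurable borel"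
  shows "strip_L2 T (\<lambda>t x. g t x * f t x)"
proof -
  obtain K where K: "\<And>t x. t \<in> {0..T} \<Longrightarrow> norm (g t x) \<le> K" using g(1) unfolding strip_bdd_def by blast
  show ?thesis
  proof (rule strip_L2_bound[OF f])
    fix t x assume t: "t \<in> {0..T}"
    have [measurable]: "f t \<in> borel_measurable borel" "g t \<in> borel_measurable borel" using f g t by (auto simp: strip_L2_def)
    show "(\<lambda>x. g t x * f t x) \<in> borel_measurable borel" by measurable
    show "norm (g t x * f t x) \<le> K * norm (f t x)"
      by (rule order_trans[OF norm_mult_ineq mult_right_mono[OF K[OF t]]]) auto
  qed
qed

definition strip_L1 :: "real \<Rightarrow> (real \<Rightarrow> real \<Rightarrow> 'a::{real_normed_vector, second_countable_topology}) \<Rightarrow> bool" where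
  "strip_L1 T f \<longleftrightarrow> (\<forall>t\<in>{0..T}. f t \<in> borel_measurable borel) \<and>
     (\<exists>C. \<forall>t\<in>{0..T}. (\<integral>\<^sup>+x. ennreal (norm (f t x)) \<partial>lborel) \<le> ennreal C)"

lemma strip_L1I:
  "(\<And>t. t \<in> {0..T} \<Longrightarrow> (\<integral>\<^sup>+x. ennreal (norm (f t x)) \<partial>lborel) \<le> ennreal C) \<Longrightarrow>
   (\<And>t. t \<in> {0..T} \<Longrightarrow> f t \<in> borel_measurable borel) \<Longrightarrow> strip_L1 T f"
  unfolding strip_L1_def by blast

lemma strip_L1_add:
  assumes f: "strip_L1 T f" and g: "strip_L1 T g"
  shows "strip_L1 T (\<lambda>t x. f t x + g t x)"
proof -
  obtain C where C: "\<And>t. t \<in> {0..T} \<Longrightarrow> (\<integral>\<^sup>+x. ennreal (norm (f t x)) \<partial>lborel) \<le> ennreal C"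
    using f unfolding strip_L1_def by blast
  obtain D where D: "\<And>t. t \<in> {0..T} \<Longrightarrow> (\<integral>\<^sup>+x. ennreal (norm (g t x)) \<partial>lborel) \<le> ennreal D"
    using g unfolding strip_L1_def by blast
  have "(\<integral>\<^sup>+x. ennreal (norm (f t x + g t x)) \<partial>lborel) \<le> ennreal (max 0 C + max 0 D)" if t: "t \<in> {0..T}" for t
  proof -
    have [measurable]: "f t \<in> borel_measurable borel" "g t \<in> borel_measurable borel" using f g t by (auto simp: strip_L1_def)
    have "(\<integral>\<^sup>+x. ennreal (norm (f t x + g t x)) \<partial>lborel) \<le> (\<integral>\<^sup>+x. ennreal (norm (f t x)) + ennreal (norm (g t x)) \<partial>lborel)"
      by (intro nn_integral_mono) (simp add: ennreal_plus[symmetric] ennreal_leI norm_triangle_ineq del: ennreal_plus)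
    also have "\<dots> = (\<integral>\<^sup>+x. ennreal (norm (f t x)) \<partial>lborel) + (\<integral>\<^sup>+x. ennreal (norm (g t x)) \<partial>lborel)"
      by (subst nn_integral_add) auto
    also have "\<dots> \<le> ennreal (max 0 C) + ennreal (max 0 D)"
      using C[OF t] D[OF t] by (intro add_mono) (auto simp: max_def ennreal_neg)
    finally show ?thesis by simp
  qed
  then show ?thesis by (rule strip_L1I) (use f g in \<open>auto simp: strip_L1_def intro!: borel_measurable_add\<close>)
qed

lemma strip_L1_mult:
  fixes f g :: "real \<Rightarrow> real \<Rightarrow> 'a::{real_normed_algebra, second_countable_topology}"
  assumes f: "strip_L2 T f" and g: "strip_L2 T g"
  shows "strip_L1 T (\<lambda>t x. f t x * g t x)"
proof -
  obtain C where C: "\<And>t. t \<in> {0..T} \<Longrightarrow> (\<integral>\<^sup>+x. ennreal ((norm (f t x))\<^sup>2) \<partial>lborel) \<le> ennreal C"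
    using f unfolding strip_L2_def by blast
  obtain D where D: "\<And>t. t \<in> {0..T} \<Longrightarrow> (\<integral>\<^sup>+x. ennreal ((norm (g t x))\<^sup>2) \<partial>lborel) \<le> ennreal D"
    using g unfolding strip_L2_def by blast
  have "(\<integral>\<^sup>+x. ennreal (norm (f t x * g t x)) \<partial>lborel) \<le> ennreal (max 0 C + max 0 D)" if t: "t \<in> {0..T}" for t
  proof -
    have [measurable]: "f t \<in> borel_measurable borel" "g t \<in> borel_measurable borel" using f g t by (auto simp: strip_L2_def)
    have "(\<integral>\<^sup>+x. ennreal (norm (f t x * g t x)) \<partial>lborel) \<le> (\<integral>\<^sup>+x. ennreal ((norm (f t x))\<^sup>2) + ennreal ((norm (g t x))\<^sup>2) \<partial>lborel)"
    proof (intro nn_integral_mono)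
      fix x
      have "norm (f t x * g t x) \<le> norm (f t x) * norm (g t x)" by (rule norm_mult_ineq)
      moreover have "0 \<le> norm (f t x) * norm (g t x)" by simp
      ultimately have "norm (f t x * g t x) \<le> (norm (f t x))\<^sup>2 + (norm (g t x))\<^sup>2"
        using sum_squares_bound[of "norm (f t x)" "norm (g t x)"] by linarith
      then show "ennreal (norm (f t x * g t x)) \<le> ennreal ((norm (f t x))\<^sup>2) + ennreal ((norm (g t x))\<^sup>2)"
        by (simp add: ennreal_plus[symmetric] ennreal_leI del: ennreal_plus)
    qed
    also have "\<dots> = (\<integral>\<^sup>+x. ennreal ((norm (f t x))\<^sup>2) \<partial>lborel) + (\<integral>\<^sup>+x. ennreal ((norm (g t x))\<^sup>2) \<partial>lborel)"
      by (subst nn_integral_add) auto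
    also have "\<dots> \<le> ennreal (max 0 C) + ennreal (max 0 D)"
      using C[OF t] D[OF t] by (intro add_mono) (auto simp: max_def ennreal_neg)
    finally show ?thesis by simp
  qed
  then show ?thesis by (rule strip_L1I) (use f g in \<open>auto simp: strip_L2_def intro!: borel_measurable_times\<close>)
qed

lemma strip_L1_Re:
  assumes f: "strip_L1 T f" shows "strip_L1 T (\<lambda>t x. Re (f t x))"
proof -
  obtain C where C: "\<And>t. t \<in> {0..T} \<Longrightarrow> (\<integral>\<^sup>+x. ennreal (norm (f t x)) \<partial>lborel) \<le> ennreal C"
    using f unfolding strip_L1_def by blast
  have "(\<integral>\<^sup>+x. ennreal (norm (Re (f t x))) \<partial>lborel) \<le> ennreal C" if "t \<in> {0..T}" for t
    by (rule order_trans[OF nn_integral_mono C[OF that]]) (simp add: ennreal_leI abs_Re_le_cmod)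
  then show ?thesis by (rule strip_L1I) (use f in \<open>auto simp: strip_L1_def intro: measurable_compose[OF _ borel_measurable_Re]\<close>)
qed

lemma strip_L1_cmult:
  fixes f :: "real \<Rightarrow> real \<Rightarrow> 'a::{real_normed_field, second_countable_topology}"
  assumes f: "strip_L1 T f" shows "strip_L1 T (\<lambda>t x. c * f t x)"
proof -
  obtain C where C: "\<And>t. t \<in> {0..T} \<Longrightarrow> (\<integral>\<^sup>+x. ennreal (norm (f t x)) \<partial>lborel) \<le> ennreal C"
    using f unfolding strip_L1_def by blast
  have "(\<integral>\<^sup>+x. ennreal (norm (c * f t x)) \<partial>lborel) \<le> ennreal (norm c * C)" if t: "t \<in> {0..T}" for t
  proof -
    have [measurable]: "f t \<in> borel_measurable borel" using f t by (auto simp: strip_L1_def)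
    have "(\<integral>\<^sup>+x. ennreal (norm (c * f t x)) \<partial>lborel) = ennreal (norm c) * (\<integral>\<^sup>+x. ennreal (norm (f t x)) \<partial>lborel)"
      by (subst nn_integral_cmult[symmetric]) (auto simp: norm_mult ennreal_mult)
    also have "\<dots> \<le> ennreal (norm c) * ennreal C" by (intro mult_left_mono C t) auto
    finally show ?thesis by (simp add: ennreal_mult')
  qed
  then show ?thesis by (rule strip_L1I) (use f in \<open>auto simp: strip_L1_def intro!: borel_measurable_times\<close>)
qed

section \<open>Time integrals of functions on the strip, and mixed derivatives\<close>

lemma strip_cont_swap:
  assumes g: "strip_cont T g" and t: "t \<in> {0..T}"
  shows "continuous_on (UNIV \<times> cbox 0 t) (\<lambda>(x, \<tau>). g \<tau> x)"
proof -
  have "continuous_on (UNIV \<times> cbox 0 t) (\<lambda>p. (\<lambda>p. g (fst p) (snd p)) (snd p, fst p))"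
    by (rule continuous_on_compose2[OF g[unfolded strip_cont_def]]) (use t in \<open>auto intro!: continuous_intros\<close>)
  then show ?thesis by (simp add: case_prod_beta')
qed

lemma strip_cont_integral:
  fixes g :: "real \<Rightarrow> real \<Rightarrow> 'a::banach"
  assumes g: "strip_cont T g" and t: "t \<in> {0..T}"
  shows "continuous_on UNIV (\<lambda>x. integral {0..t} (\<lambda>\<tau>. g \<tau> x))"
proof -
  from integral_continuous_on_param[OF strip_cont_swap[OF g t]] show ?thesis by simp
qed

lemma strip_integral_space_derivative:
  fixes g gx :: "real \<Rightarrow> real \<Rightarrow> 'a::banach"
  assumes g: "strip_cont T g" "strip_cont T gx" and d: "\<And>t x. t \<in> {0..T} \<Longrightarrow> (g t has_vector_derivative gx t x) (at x)"
    and t: "t \<in> {0..T}"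
  shows "((\<lambda>x. integral {0..t} (\<lambda>\<tau>. g \<tau> x)) has_vector_derivative integral {0..t} (\<lambda>\<tau>. gx \<tau> x)) (at x)"
proof -
  have "((\<lambda>x. integral (cbox 0 t) (\<lambda>\<tau>. g \<tau> x)) has_vector_derivative integral (cbox 0 t) (\<lambda>\<tau>. gx \<tau> x)) (at x within UNIV)"
  proof (rule leibniz_rule_vector_derivative)
    show "((\<lambda>x. g \<tau> x) has_vector_derivative gx \<tau> x) (at x within UNIV)" if "\<tau> \<in> cbox 0 t" for x \<tau>
      using d[of \<tau> x] that t by simp
    show "(\<lambda>\<tau>. g \<tau> x) integrable_on cbox 0 t" for x
      using strip_cont_time[OF g(1), of x] t
      by (intro integrable_continuous) (auto intro: continuous_on_subset)
    show "continuous_on (UNIV \<times> cbox 0 t) (\<lambda>(x, \<tau>). gx \<tau> x)"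
      by (rule strip_cont_swap[OF g(2) t])
  qed auto
  then show ?thesis by simp
qed

lemma strip_FTC:
  fixes f :: "real \<Rightarrow> real \<Rightarrow> 'a::banach"
  assumes "\<And>t. t \<in> {0..T} \<Longrightarrow> ((\<lambda>\<tau>. f \<tau> x) has_vector_derivative ft t x) (at t within {0..T})" and t: "t \<in> {0..T}"
  shows "integral {0..t} (\<lambda>\<tau>. ft \<tau> x) = f t x - f 0 x"
proof (rule integral_unique, rule fundamental_theorem_of_calculus)
  show "((\<lambda>\<tau>. f \<tau> x) has_vector_derivative ft s x) (at s within {0..t})" if "s \<in> {0..t}" for s
    using assms(1)[of s] that t by (auto intro: has_vector_derivative_within_subset)
qed (use t in auto)

text \<open>A solution comes with pointwise time derivatives of u, not of its space derivatives.
  Writing the increment of f in time as an integral of \<open>ft\<close> and differentiating under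
  it in x shows that the two orders of differentiation agree.\<close>

lemma strip_mixed_derivative:
  fixes f :: "real \<Rightarrow> real \<Rightarrow> 'a::banach"
  assumes ft: "\<And>t x. t \<in> {0..T} \<Longrightarrow> ((\<lambda>\<tau>. f \<tau> x) has_vector_derivative ft t x) (at t within {0..T})"
    and fx: "\<And>t x. t \<in> {0..T} \<Longrightarrow> (f t has_vector_derivative fx t x) (at x)"
    and ftx: "\<And>t x. t \<in> {0..T} \<Longrightarrow> (ft t has_vector_derivative ftx t x) (at x)"
    and c: "strip_cont T ft" "strip_cont T ftx" and t: "t \<in> {0..T}"
  shows "((\<lambda>\<tau>. fx \<tau> x) has_vector_derivative ftx t x) (at t within {0..T})"
proof -
  have z: "0 \<in> {0..T}" using t by auto
  have eq: "fx 0 x + integral {0..s} (\<lambda>\<tau>. ftx \<tau> x) = fx s x" if s: "s \<in> {0..T}" for s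
  proof -
    have "integral {0..s} (\<lambda>\<tau>. ft \<tau> y) = f s y - f 0 y" for y by (rule strip_FTC[OF ft s])
    then have "(\<lambda>x. integral {0..s} (\<lambda>\<tau>. ft \<tau> x)) = (\<lambda>x. f s x - f 0 x)" by (rule ext)
    with strip_integral_space_derivative[OF c ftx s, of x]
    have "((\<lambda>x. f s x - f 0 x) has_vector_derivative integral {0..s} (\<lambda>\<tau>. ftx \<tau> x)) (at x)" by simp
    moreover have "((\<lambda>x. f s x - f 0 x) has_vector_derivative fx s x - fx 0 x) (at x)"
      by (intro has_vector_derivative_diff fx s z)
    ultimately have "integral {0..s} (\<lambda>\<tau>. ftx \<tau> x) = fx s x - fx 0 x"
      by (metis vector_derivative_at)
    then show ?thesis by simp
  qed
  have "((\<lambda>s. fx 0 x + integral {0..s} (\<lambda>\<tau>. ftx \<tau> x)) has_vector_derivative ftx t x) (at t within {0..T})"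
    using integral_has_vector_derivative[OF strip_cont_time[OF c(2)] t, of x]
    by (auto intro!: derivative_eq_intros)
  then show ?thesis by (rule has_vector_derivative_transform[rotated 2]) (use eq t in auto)
qed

text \<open>Young's inequality under the time integral and Tonelli on the strip: the product is
  dominated by the time integral of g^2 + h^2. This yields the L^1 bound for the flux terms that
  contain a potential given as a time integral of L^2 functions.\<close>

lemma strip_L1_integral_mult:
  fixes g h :: "real \<Rightarrow> real \<Rightarrow> real"
  assumes gc: "strip_cont T g" and g: "strip_L2 T g" and h: "strip_L2 T h"
  shows "strip_L1 T (\<lambda>t x. integral {0..t} (\<lambda>\<tau>. g \<tau> x) * h t x)"
proof -
  obtain C where C: "\<And>t. t \<in> {0..T} \<Longrightarrow> (\<integral>\<^sup>+x. ennreal ((norm (g t x))\<^sup>2) \<partial>lborel) \<le> ennreal C"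
    using g unfolding strip_L2_def by blast
  obtain D where D: "\<And>t. t \<in> {0..T} \<Longrightarrow> (\<integral>\<^sup>+x. ennreal ((norm (h t x))\<^sup>2) \<partial>lborel) \<le> ennreal D"
    using h unfolding strip_L2_def by blast
  have meas: "(\<lambda>x. integral {0..t} (\<lambda>\<tau>. g \<tau> x)) \<in> borel_measurable borel" if "t \<in> {0..T}" for t
    by (rule borel_measurable_continuous_onI[OF strip_cont_integral[OF gc that]])
  \<comment> \<open>Extension by zero outside the strip makes the integrand measurable on the whole
    plane, as Tonelli requires.\<close>
  define G where "G = (\<lambda>p::real \<times> real. indicator ({0..T} \<times> UNIV) p *\<^sub>R g (fst p) (snd p))"
  have "G \<in> borel_measurable borel"
    unfolding G_def using gc unfolding strip_cont_def
    by (intro borel_measurable_continuous_on_indicator) (auto intro!: borel_closed closed_Times)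
  then have Gm[measurable]: "G \<in> borel_measurable (lborel \<Otimes>\<^sub>M lborel)"
    by (simp add: borel_prod[symmetric] lborel_prod)
  have "(\<integral>\<^sup>+x. ennreal (norm (integral {0..t} (\<lambda>\<tau>. g \<tau> x) * h t x)) \<partial>lborel) \<le> ennreal (T * (max 0 C + max 0 D))" if t: "t \<in> {0..T}" for t
  proof -
    have hm[measurable]: "h t \<in> borel_measurable borel" using h t by (simp add: strip_L2_def)
    have "ennreal (norm (integral {0..t} (\<lambda>\<tau>. g \<tau> x) * h t x)) \<le> (\<integral>\<^sup>+\<tau>. ennreal (indicator {0..T} \<tau> * ((G (\<tau>, x))\<^sup>2 + (h t x)\<^sup>2)) \<partial>lborel)" for x
    proof -
      have gi: "set_integrable lborel {0..t} (\<lambda>\<tau>. g \<tau> x)"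
        using strip_cont_time[OF gc, of x] t by (intro borel_integrable_atLeastAtMost') (auto intro: continuous_on_subset)
      have eq: "integral {0..t} (\<lambda>\<tau>. g \<tau> x) * h t x = (LINT \<tau>|lborel. indicator {0..t} \<tau> * g \<tau> x * h t x)"
        using set_borel_integral_eq_integral(2)[OF gi] by (simp add: set_lebesgue_integral_def)
      have "ennreal (norm (integral {0..t} (\<lambda>\<tau>. g \<tau> x) * h t x)) \<le> (\<integral>\<^sup>+\<tau>. ennreal (norm (indicator {0..t} \<tau> * g \<tau> x * h t x)) \<partial>lborel)"
        unfolding eq by (rule integral_norm_bound_ennreal')
      also have "\<dots> \<le> (\<integral>\<^sup>+\<tau>. ennreal (indicator {0..T} \<tau> * ((G (\<tau>, x))\<^sup>2 + (h t x)\<^sup>2)) \<partial>lborel)"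
      proof (intro nn_integral_mono ennreal_leI)
        fix \<tau>
        have "\<bar>g \<tau> x\<bar> * \<bar>h t x\<bar> \<le> (g \<tau> x)\<^sup>2 + (h t x)\<^sup>2"
          using sum_squares_bound[of "\<bar>g \<tau> x\<bar>" "\<bar>h t x\<bar>"] mult_nonneg_nonneg[OF abs_ge_zero[of "g \<tau> x"] abs_ge_zero[of "h t x"]] by (simp only: power2_abs)
        then show "norm (indicator {0..t} \<tau> * g \<tau> x * h t x) \<le> indicator {0..T} \<tau> * ((G (\<tau>, x))\<^sup>2 + (h t x)\<^sup>2)"
          using t by (auto simp: indicator_def G_def abs_mult)
      qed
      finally show ?thesis .
    qed
    then have "(\<integral>\<^sup>+x. ennreal (norm (integral {0..t} (\<lambda>\<tau>. g \<tau> x) * h t x)) \<partial>lborel) \<le>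
       (\<integral>\<^sup>+x. \<integral>\<^sup>+\<tau>. ennreal (indicator {0..T} \<tau> * ((G (\<tau>, x))\<^sup>2 + (h t x)\<^sup>2)) \<partial>lborel \<partial>lborel)"
      by (intro nn_integral_mono)
    also have "\<dots> = (\<integral>\<^sup>+\<tau>. \<integral>\<^sup>+x. ennreal (indicator {0..T} \<tau> * ((G (\<tau>, x))\<^sup>2 + (h t x)\<^sup>2)) \<partial>lborel \<partial>lborel)"
      by (rule lborel_pair.Fubini') measurable
    also have "\<dots> \<le> (\<integral>\<^sup>+\<tau>. ennreal (max 0 C + max 0 D) * indicator {0..T} \<tau> \<partial>lborel)"
    proof (intro nn_integral_mono)
      fix \<tau> :: real
      show "(\<integral>\<^sup>+x. ennreal (indicator {0..T} \<tau> * ((G (\<tau>, x))\<^sup>2 + (h t x)\<^sup>2)) \<partial>lborel) \<le> ennreal (max 0 C + max 0 D) * indicator {0..T} \<tau>"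
      proof (cases "\<tau> \<in> {0..T}")
        case True
        have [measurable]: "g \<tau> \<in> borel_measurable borel" using g True by (simp add: strip_L2_def)
        have "(\<integral>\<^sup>+x. ennreal (indicator {0..T} \<tau> * ((G (\<tau>, x))\<^sup>2 + (h t x)\<^sup>2)) \<partial>lborel) =
           (\<integral>\<^sup>+x. ennreal ((norm (g \<tau> x))\<^sup>2) + ennreal ((norm (h t x))\<^sup>2) \<partial>lborel)"
          using True by (intro nn_integral_cong) (simp add: G_def)
        also have "\<dots> = (\<integral>\<^sup>+x. ennreal ((norm (g \<tau> x))\<^sup>2) \<partial>lborel) + (\<integral>\<^sup>+x. ennreal ((norm (h t x))\<^sup>2) \<partial>lborel)"
          by (rule nn_integral_add) auto
        also have "\<dots> \<le> ennreal (max 0 C) + ennreal (max 0 D)"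
          using C[OF True] D[OF t] by (intro add_mono) (auto simp: max_def ennreal_neg)
        finally show ?thesis using True by simp
      qed simp
    qed
    also have "\<dots> = ennreal (max 0 C + max 0 D) * ennreal T"
      using t by (subst nn_integral_cmult_indicator) auto
    also have "\<dots> = ennreal (T * (max 0 C + max 0 D))"
      using t by (subst ennreal_mult[symmetric]) (auto simp: mult.commute)
    finally show ?thesis .
  qed
  moreover have "(\<lambda>x. integral {0..t} (\<lambda>\<tau>. g \<tau> x) * h t x) \<in> borel_measurable borel" if "t \<in> {0..T}" for t
    using meas[OF that] h that by (auto simp: strip_L2_def intro: borel_measurable_times)
  ultimately show ?thesis unfolding strip_L1_def by blast
qed

text \<open>The algebra at one point of the balance e_t = J_x + R: on the left the product rule for
  the energy density, on the right the flux derivative and then the remainder. \<open>a0\<close>,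
  \<open>a1\<close>, \<open>a2\<close> and \<open>b0\<close>, \<open>b1\<close>, \<open>b2\<close>
  stand for u and its x-derivatives in the two solutions, \<open>p0\<close> and \<open>r0\<close>
  for the two n, \<open>mt\<close> and \<open>nbt\<close> for the time derivatives of the difference
  and of the mean of the n, \<open>g\<close> for the x-derivative of the difference of n + |u|^2.
  The product of \<open>a2 - b2\<close> with the difference of the time derivatives loses no
  derivative: its top-order part is the real part of an imaginary number.\<close>

lemma energy_identity:
  fixes a0 a1 a2 b0 b1 b2 vxt :: complex and p0 r0 mt W g nbt K0 :: real
  defines "at1 \<equiv> \<i> * (a2 - of_real p0 * a0)" and "bt1 \<equiv> \<i> * (b2 - of_real r0 * b0)"
  shows "2 * Re (cnj (a1 - b1) * vxt) + (p0 - r0) * mt + W * g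
     + (mt * ((cmod a0)\<^sup>2 - (cmod b0)\<^sup>2) + (p0 - r0) * (2 * Re (cnj a0 * at1) - 2 * Re (cnj b0 * bt1)))
     + (nbt * (cmod (a0 - b0))\<^sup>2 + (p0 + r0) / 2 * (2 * Re (cnj (a0 - b0) * (at1 - bt1))))
     + K0 * (2 * Re (cnj (a0 - b0) * (at1 - bt1)))
   = (2 * Re (cnj (a2 - b2) * (at1 - bt1) + cnj (a1 - b1) * vxt)
       + (mt * (p0 - r0 + ((cmod a0)\<^sup>2 - (cmod b0)\<^sup>2)) + W * g)
       + K0 * (2 * Re (cnj (a1 - b1) * (\<i> * (a1 - b1)) + cnj (a0 - b0) * (\<i> * (a2 - b2)))))
     + ((p0 - r0) * Re (cnj (a0 - b0) * (at1 + bt1)) + nbt * (cmod (a0 - b0))\<^sup>2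
        + K0 * (p0 - r0) * Re (- \<i> * (cnj (a0 - b0) * (a0 + b0))))"
  unfolding at1_def bt1_def
  by (simp add: cmod_power2 power2_eq_square) algebra

text \<open>The time derivative as given by the Schroedinger equation, an expression in space
  derivatives only, which can therefore be differentiated further in x.\<close>

definition zut :: "(real \<Rightarrow> real \<Rightarrow> complex) \<Rightarrow> (real \<Rightarrow> real \<Rightarrow> real) \<Rightarrow> real \<Rightarrow> real \<Rightarrow> complex" where
  "zut u n t x = \<i> * ((dx ^^ 2) (u t) x - of_real (n t x) * u t x)"

definition zuxt :: "(real \<Rightarrow> real \<Rightarrow> complex) \<Rightarrow> (real \<Rightarrow> real \<Rightarrow> real) \<Rightarrow> real \<Rightarrow> real \<Rightarrow> complex" where
  "zuxt u n t x = \<i> * ((dx ^^ 3) (u t) x - (of_real (dx (n t) x) * u t x + of_real (n t x) * dx (u t) x))"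

text \<open>\<open>zh\<close> is $\partial_x(n + |u|^2)$ and \<open>zhx\<close> its $x$-derivative.\<close>

definition zh :: "(real \<Rightarrow> real \<Rightarrow> complex) \<Rightarrow> (real \<Rightarrow> real \<Rightarrow> real) \<Rightarrow> real \<Rightarrow> real \<Rightarrow> real" where
  "zh u n t x = dx (n t) x + 2 * Re (cnj (u t x) * dx (u t) x)"

definition zhx :: "(real \<Rightarrow> real \<Rightarrow> complex) \<Rightarrow> (real \<Rightarrow> real \<Rightarrow> real) \<Rightarrow> real \<Rightarrow> real \<Rightarrow> real" where
  "zhx u n t x = (dx ^^ 2) (n t) x + (2 * (cmod (dx (u t) x))\<^sup>2 + 2 * Re (cnj (u t x) * (dx ^^ 2) (u t) x))"

lemma dx2_eq: "(dx ^^ 2) f = dx (dx f)" and dx3_eq: "(dx ^^ 3) f = dx (dx (dx f))"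
  by (simp_all add: numeral_2_eq_2 numeral_3_eq_3)

lemma strip_bdd_integral:
  fixes g :: "real \<Rightarrow> real \<Rightarrow> 'a::banach"
  assumes g: "strip_bdd T g" "strip_cont T g"
  shows "strip_bdd T (\<lambda>t x. integral {0..t} (\<lambda>\<tau>. g \<tau> x))"
proof -
  obtain C where C: "\<And>t x. t \<in> {0..T} \<Longrightarrow> norm (g t x) \<le> C" using g(1) unfolding strip_bdd_def by blast
  show ?thesis
  proof (rule strip_bddI)
    fix t x assume t: "t \<in> {0..T}"
    have C0: "0 \<le> C" using C[OF t, of x] norm_ge_zero order_trans by blast
    have "norm (integral {0..t} (\<lambda>\<tau>. g \<tau> x)) \<le> C * (t - 0)"
      using t strip_cont_time[OF g(2), of x] by (intro integral_bound C) (auto intro: continuous_on_subset)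
    also have "\<dots> \<le> C * T" using t C0 by (intro mult_left_mono) auto
    finally show "norm (integral {0..t} (\<lambda>\<tau>. g \<tau> x)) \<le> C * T" .
  qed
qed

lemma strip_L2_sq_int:
  assumes "\<And>t. t \<in> {0..T} \<Longrightarrow> continuous_on UNIV (f t)" "\<And>t. t \<in> {0..T} \<Longrightarrow> sq_int (f t) \<le> ennreal B"
  shows "strip_L2 T f"
  by (rule strip_L2I[of T f B]) (use assms in \<open>auto simp: sq_int_def intro: borel_measurable_continuous_onI\<close>)

lemma strip_L2_minus: "strip_L2 T f \<Longrightarrow> strip_L2 T (\<lambda>t x. - f t x)"
  unfolding strip_L2_def by (auto intro: borel_measurable_uminus)

lemma strip_L2_diff: "strip_L2 T f \<Longrightarrow> strip_L2 T g \<Longrightarrow> strip_L2 T (\<lambda>t x. f t x - g t x)"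
  using strip_L2_add[OF _ strip_L2_minus, of T f g] by simp

lemma strip_L2_Re: "strip_L2 T f \<Longrightarrow> strip_L2 T (\<lambda>t x. Re (f t x))"
  by (rule strip_L2_bound[of T f _ 1])
     (auto simp: strip_L2_def abs_Re_le_cmod intro: measurable_compose[OF _ borel_measurable_Re])

lemma strip_L2_cnj: "strip_L2 T f \<Longrightarrow> strip_L2 T (\<lambda>t x. cnj (f t x))"
  by (rule strip_L2_bound[of T f _ 1]) (auto simp: strip_L2_def intro: borel_measurable_cnj)

lemma strip_L2_cmult:
  fixes f :: "real \<Rightarrow> real \<Rightarrow> 'a::{real_normed_algebra, second_countable_topology}"
  shows "strip_L2 T f \<Longrightarrow> strip_L2 T (\<lambda>t x. c * f t x)"
  by (rule strip_L2_mult_bdd[OF _ strip_bdd_const]) auto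

text \<open>The facts about a single solution, interpreted once for each of the two that are
  compared.\<close>

locale zreg_field =
  fixes T B :: real and u :: "real \<Rightarrow> real \<Rightarrow> complex" and n nt :: "real \<Rightarrow> real \<Rightarrow> real"
  assumes Z: "zreg T B u n nt"
begin

lemma smooth: "t \<in> {0..T} \<Longrightarrow> smooth_fun (u t)" "t \<in> {0..T} \<Longrightarrow> smooth_fun (n t)"
  using Z by (auto simp: zreg_def)

lemma u_x: assumes t: "t \<in> {0..T}"
  shows "(u t has_vector_derivative dx (u t) x) (at x)"
    "(dx (u t) has_vector_derivative (dx ^^ 2) (u t) x) (at x)"
    "((dx ^^ 2) (u t) has_vector_derivative (dx ^^ 3) (u t) x) (at x)"
  unfolding dx2_eq dx3_eq
  by (intro smooth_fun_has_derivative smooth_fun_dx smooth t)+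

lemma n_x: assumes t: "t \<in> {0..T}"
  shows "(n t has_vector_derivative dx (n t) x) (at x)"
    "(dx (n t) has_vector_derivative (dx ^^ 2) (n t) x) (at x)"
  unfolding dx2_eq
  by (intro smooth_fun_has_derivative smooth_fun_dx smooth t)+

lemma u_bound: "j \<le> 3 \<Longrightarrow> t \<in> {0..T} \<Longrightarrow> cmod ((dx ^^ j) (u t) x) \<le> B"
  and n_bound: "j \<le> 3 \<Longrightarrow> t \<in> {0..T} \<Longrightarrow> \<bar>(dx ^^ j) (n t) x\<bar> \<le> B"
  using Z by (auto simp: zreg_def)

lemma u_bound0: "t \<in> {0..T} \<Longrightarrow> cmod (u t x) \<le> B"
  and n_bound0: "t \<in> {0..T} \<Longrightarrow> \<bar>n t x\<bar> \<le> B"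
  using u_bound[of 0] n_bound[of 0] by auto

lemma sb: "strip_bdd T u" "strip_bdd T (\<lambda>t. dx (u t))" "strip_bdd T (\<lambda>t. (dx ^^ 2) (u t))" "strip_bdd T (\<lambda>t. (dx ^^ 3) (u t))"
  "strip_bdd T n" "strip_bdd T (\<lambda>t. dx (n t))" "strip_bdd T (\<lambda>t. (dx ^^ 2) (n t))"
  using u_bound[of 0] u_bound[of 1] u_bound[of 2] u_bound[of 3] n_bound[of 0] n_bound[of 1] n_bound[of 2]
  by (auto intro!: strip_bddI[of T _ B])

lemma sc: "strip_cont T u" "strip_cont T (\<lambda>t. dx (u t))" "strip_cont T (\<lambda>t. (dx ^^ 2) (u t))" "strip_cont T (\<lambda>t. (dx ^^ 3) (u t))"
  "strip_cont T n" "strip_cont T (\<lambda>t. dx (n t))" "strip_cont T (\<lambda>t. (dx ^^ 2) (n t))"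
proof -
  have "strip_cont T (\<lambda>t. (dx ^^ j) (u t))" "strip_cont T (\<lambda>t. (dx ^^ j) (n t))" for j using Z by (auto simp: zreg_def)
  from this(1)[of 0] this(1)[of 1] this(1)[of 2] this(1)[of 3] this(2)[of 0] this(2)[of 1] this(2)[of 2]
  show "strip_cont T u" "strip_cont T (\<lambda>t. dx (u t))" "strip_cont T (\<lambda>t. (dx ^^ 2) (u t))" "strip_cont T (\<lambda>t. (dx ^^ 3) (u t))"
  "strip_cont T n" "strip_cont T (\<lambda>t. dx (n t))" "strip_cont T (\<lambda>t. (dx ^^ 2) (n t))" by auto
qed

lemma sL2: "strip_L2 T u" "strip_L2 T (\<lambda>t. dx (u t))" "strip_L2 T (\<lambda>t. (dx ^^ 2) (u t))"
  "strip_L2 T n" "strip_L2 T (\<lambda>t. dx (n t))"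
proof -
  have 1: "strip_L2 T (\<lambda>t. (dx ^^ j) (u t))" if "j \<le> 3" for j
    using Z that by (intro strip_L2_sq_int[where B=B] smooth_fun_continuous smooth_fun_iter smooth) (auto simp: zreg_def)
  have "strip_L2 T (\<lambda>t x. complex_of_real ((dx ^^ j) (n t) x))" if "j \<le> 3" for j
    using Z that by (intro strip_L2_sq_int[where B=B] continuous_on_of_real smooth_fun_continuous smooth_fun_iter smooth) (auto simp: zreg_def)
  then have 2: "strip_L2 T (\<lambda>t. (dx ^^ j) (n t))" if "j \<le> 3" for j
    using strip_L2_Re[of T "\<lambda>t x. complex_of_real ((dx ^^ j) (n t) x)"] that by simp
  from 1[of 0] 1[of 1] 1[of 2] 2[of 0] 2[of 1]
  show "strip_L2 T u" "strip_L2 T (\<lambda>t. dx (u t))" "strip_L2 T (\<lambda>t. (dx ^^ 2) (u t))"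
    "strip_L2 T n" "strip_L2 T (\<lambda>t. dx (n t))" by auto
qed

lemma sc_derived: "strip_cont T (zut u n)" "strip_cont T (zuxt u n)" "strip_cont T (zh u n)" "strip_cont T (zhx u n)"
  using sc unfolding strip_cont_def zut_def zuxt_def zh_def zhx_def by (auto intro!: continuous_intros)

lemma sb_derived: "strip_bdd T (zut u n)" "strip_bdd T (zuxt u n)" "strip_bdd T (zh u n)" "strip_bdd T (zhx u n)"
  unfolding zut_def[abs_def] zuxt_def[abs_def] zh_def[abs_def] zhx_def[abs_def]
  by (intro strip_bdd_intros sb)+

lemma u_t: "t \<in> {0..T} \<Longrightarrow> ((\<lambda>\<tau>. u \<tau> x) has_vector_derivative zut u n t x) (at t within {0..T})"
  and n_t: "t \<in> {0..T} \<Longrightarrow> ((\<lambda>\<tau>. n \<tau> x) has_vector_derivative nt t x) (at t within {0..T})"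
  and nt_t: "t \<in> {0..T} \<Longrightarrow> ((\<lambda>\<tau>. nt \<tau> x) has_vector_derivative zhx u n t x) (at t within {0..T})"
  and nt_0: "nt 0 x = 0"
  using Z by (auto simp: zreg_def zut_def zhx_def)

lemma ut_x: assumes t: "t \<in> {0..T}" shows "(zut u n t has_vector_derivative zuxt u n t x) (at x)"
  unfolding zut_def[abs_def] zuxt_def
  by (rule has_vector_derivative_mult_right has_vector_derivative_diff u_x[OF t])+
     (rule has_vector_derivative_eq_rhs[OF has_vector_derivative_mult[OF has_vector_derivative_complex_of_real[OF n_x(1)[OF t]] u_x(1)[OF t]]], simp)

lemma ux_t: "t \<in> {0..T} \<Longrightarrow> ((\<lambda>\<tau>. dx (u \<tau>) x) has_vector_derivative zuxt u n t x) (at t within {0..T})"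
  by (rule strip_mixed_derivative[of T u "zut u n" "\<lambda>t. dx (u t)"]) (use u_t u_x(1) ut_x sc_derived in auto)

lemma h_x: assumes t: "t \<in> {0..T}" shows "(zh u n t has_vector_derivative zhx u n t x) (at x)"
proof -
  have "((\<lambda>x. dx (n t) x + 2 * Re (cnj (u t x) * dx (u t) x)) has_vector_derivative
     (dx ^^ 2) (n t) x + 2 * Re (cnj (dx (u t) x) * dx (u t) x + cnj (u t x) * (dx ^^ 2) (u t) x)) (at x)"
    by (intro has_vector_derivative_add n_x[OF t] has_vector_derivative_mult_right has_vector_derivative_Re_cnj_mult u_x[OF t])
  then show ?thesis unfolding zh_def[abs_def] zhx_def
    by (rule has_vector_derivative_eq_rhs) (simp add: cmod_power2, simp add: power2_eq_square algebra_simps)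
qed

lemma nt_integral: "t \<in> {0..T} \<Longrightarrow> integral {0..t} (\<lambda>\<tau>. zhx u n \<tau> x) = nt t x"
  by (subst strip_FTC[OF nt_t]) (auto simp: nt_0)

lemma sb_nt: "strip_bdd T nt"
proof -
  obtain C where C: "\<And>t x. t \<in> {0..T} \<Longrightarrow> norm (integral {0..t} (\<lambda>\<tau>. zhx u n \<tau> x)) \<le> C"
    using strip_bdd_integral[OF sb_derived(4) sc_derived(4)] unfolding strip_bdd_def by blast
  show ?thesis
  proof (rule strip_bddI)
    show "norm (nt t x) \<le> C" if "t \<in> {0..T}" for t x using C[OF that, of x] nt_integral[OF that, of x] by simp
  qed
qed

text \<open>A potential for the wave equation, with W_x = n_t and W_t = (n + |u|^2)_x. It is an
  antiderivative of n_t in x obtained without dividing by the frequency, which is possible because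
  n_t vanishes initially.\<close>

definition W :: "real \<Rightarrow> real \<Rightarrow> real" where "W t x = integral {0..t} (\<lambda>\<tau>. zh u n \<tau> x)"

lemma W_x: assumes t: "t \<in> {0..T}" shows "(W t has_vector_derivative nt t x) (at x)"
  using strip_integral_space_derivative[OF sc_derived(3,4) h_x t, of x]
  unfolding W_def[abs_def] nt_integral[OF t, of x] by simp

lemma W_t: "t \<in> {0..T} \<Longrightarrow> ((\<lambda>\<tau>. W \<tau> x) has_vector_derivative zh u n t x) (at t within {0..T})"
  unfolding W_def by (rule integral_has_vector_derivative[OF strip_cont_time[OF sc_derived(3)]])

lemma W_0: "W 0 x = 0" by (simp add: W_def)

lemma sb_W: "strip_bdd T W"
  unfolding W_def[abs_def] by (rule strip_bdd_integral[OF sb_derived(3) sc_derived(3)])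

lemma space_cont:
  assumes t: "t \<in> {0..T}"
  shows "continuous_on UNIV (u t)" "continuous_on UNIV (dx (u t))" "continuous_on UNIV ((dx ^^ 2) (u t))"
    "continuous_on UNIV (n t)" "continuous_on UNIV (zut u n t)" "continuous_on UNIV (zuxt u n t)"
    "continuous_on UNIV (zh u n t)" "continuous_on UNIV (W t)" "continuous_on UNIV (nt t)"
proof -
  show "continuous_on UNIV (W t)" unfolding W_def[abs_def] by (rule strip_cont_integral[OF sc_derived(3) t])
  have "continuous_on UNIV (\<lambda>x. integral {0..t} (\<lambda>\<tau>. zhx u n \<tau> x))" by (rule strip_cont_integral[OF sc_derived(4) t])
  then show "continuous_on UNIV (nt t)" by (simp add: nt_integral[OF t])
qed (intro strip_cont_space[OF _ t] sc sc_derived)+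

lemma sL2_derived: "strip_L2 T (zut u n)" "strip_L2 T (zh u n)"
proof -
  show "strip_L2 T (zut u n)" unfolding zut_def[abs_def]
    by (intro strip_L2_cmult strip_L2_diff sL2 strip_L2_mult_bdd strip_bdd_of_real sb)
       (auto intro!: borel_measurable_continuous_onI continuous_on_of_real space_cont)
  have "strip_L2 T (\<lambda>t x. cnj (u t x) * dx (u t) x)"
    by (intro strip_L2_mult_bdd sL2 strip_bdd_cnj sb)
       (auto intro!: borel_measurable_continuous_onI continuous_on_cnj space_cont)
  then show "strip_L2 T (zh u n)" unfolding zh_def[abs_def]
    by (intro strip_L2_add sL2 strip_L2_cmult strip_L2_Re)
qed

end
lemma energy_time_derivative:
  assumes "(A has_real_derivative A') (at t within S)" "(m has_real_derivative m') (at t within S)"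
    "(W has_real_derivative W') (at t within S)" "(f has_real_derivative f') (at t within S)"
    "(N has_real_derivative N') (at t within S)" "(V has_real_derivative V') (at t within S)"
  shows "((\<lambda>\<tau>. A \<tau> + 1 / 2 * (m \<tau>)\<^sup>2 + 1 / 2 * (W \<tau>)\<^sup>2 + m \<tau> * f \<tau> + N \<tau> * V \<tau> + K0 * V \<tau>) has_real_derivative
    (A' + m t * m' + W t * W' + (m' * f t + m t * f') + (N' * V t + N t * V') + K0 * V')) (at t within S)"
  using assms by (auto intro!: derivative_eq_intros simp: algebra_simps)

lemma energy_flux_derivative:
  assumes "(P has_real_derivative P') (at t within S)" "(m has_real_derivative m') (at t within S)"
    "(W has_real_derivative W') (at t within S)" "(f has_real_derivative f') (at t within S)"
    "(Q has_real_derivative Q') (at t within S)"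
  shows "((\<lambda>\<tau>. 2 * P \<tau> + W \<tau> * (m \<tau> + f \<tau>) + K0 * (2 * Q \<tau>)) has_real_derivative
    (2 * P' + (W' * (m t + f t) + W t * (m' + f')) + K0 * (2 * Q'))) (at t within S)"
  using assms by (auto intro!: derivative_eq_intros simp: algebra_simps)

lemma cmod_square_diff_bound:
  assumes "cmod a \<le> B" "cmod b \<le> B"
  shows "\<bar>(cmod a)\<^sup>2 - (cmod b)\<^sup>2\<bar> \<le> 2 * B * cmod (a - b)"
proof -
  have "(cmod a)\<^sup>2 - (cmod b)\<^sup>2 = (cmod a + cmod b) * (cmod a - cmod b)" by (simp add: power2_eq_square algebra_simps)
  then have "\<bar>(cmod a)\<^sup>2 - (cmod b)\<^sup>2\<bar> = (cmod a + cmod b) * \<bar>cmod a - cmod b\<bar>" by (simp add: abs_mult)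
  also have "\<dots> \<le> (B + B) * cmod (a - b)"
    using assms norm_triangle_ineq3[of a b] order_trans[OF norm_ge_zero assms(1)] by (intro mult_mono) auto
  finally show ?thesis by simp
qed

text \<open>The quantity below is the difference of two copies of the conserved Hamiltonian, symmetrised so that
  every term that would lose a derivative is either a total derivative or cancels.\<close>

theorem zreg_unique:
  assumes Z1: "zreg T B u1 n1 nt1" and Z2: "zreg T B u2 n2 nt2"
    and init: "\<And>x. u1 0 x = u2 0 x" "\<And>x. n1 0 x = n2 0 x" and t: "t \<in> {0..T}"
  shows "u1 t x = u2 t x" "n1 t x = n2 t x"
proof -
  interpret F: zreg_field T B u1 n1 nt1 using Z1 by unfold_locales
  interpret G: zreg_field T B u2 n2 nt2 using Z2 by unfold_locales
  have B0: "0 \<le> B" using F.n_bound0[OF t, of 0] by linarith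
  \<comment> \<open>4 B^2 absorbs the cross term of \<open>m\<close> and \<open>f\<close>, since f^2
    \<le> 4 B^2 |v|^2; B absorbs the term with the mean of the two n, which has no sign; the
    remaining 1 makes the energy coercive in \<open>v\<close>.\<close>
  define K0 where "K0 = 4 * B\<^sup>2 + B + 1"
  define v where "v = (\<lambda>t x. u1 t x - u2 t x)"
  define vx where "vx = (\<lambda>t x. dx (u1 t) x - dx (u2 t) x)"
  define vxx where "vxx = (\<lambda>t x. (dx ^^ 2) (u1 t) x - (dx ^^ 2) (u2 t) x)"
  define vt where "vt = (\<lambda>t x. zut u1 n1 t x - zut u2 n2 t x)"
  define vxt where "vxt = (\<lambda>t x. zuxt u1 n1 t x - zuxt u2 n2 t x)"
  define m where "m = (\<lambda>t x. n1 t x - n2 t x)"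
  define mt where "mt = (\<lambda>t x. nt1 t x - nt2 t x)"
  define f where "f = (\<lambda>t x. (cmod (u1 t x))\<^sup>2 - (cmod (u2 t x))\<^sup>2)"
  define ft where "ft = (\<lambda>t x. 2 * Re (cnj (u1 t x) * zut u1 n1 t x) - 2 * Re (cnj (u2 t x) * zut u2 n2 t x))"
  define fx where "fx = (\<lambda>t x. 2 * Re (cnj (u1 t x) * dx (u1 t) x) - 2 * Re (cnj (u2 t x) * dx (u2 t) x))"
  define W where "W = (\<lambda>t x. F.W t x - G.W t x)"
  define g where "g = (\<lambda>t x. zh u1 n1 t x - zh u2 n2 t x)"
  define N where "N = (\<lambda>t x. (n1 t x + n2 t x) / 2)"
  define Nt where "Nt = (\<lambda>t x. (nt1 t x + nt2 t x) / 2)"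
  define e where "e = (\<lambda>t x. (cmod (vx t x))\<^sup>2 + 1 / 2 * (m t x)\<^sup>2 + 1 / 2 * (W t x)\<^sup>2 + m t x * f t x
      + N t x * (cmod (v t x))\<^sup>2 + K0 * (cmod (v t x))\<^sup>2)"
  define J where "J = (\<lambda>t x. 2 * Re (cnj (vx t x) * vt t x) + W t x * (m t x + f t x) + K0 * (2 * Re (cnj (v t x) * (\<i> * vx t x))))"
  define Jx where "Jx = (\<lambda>t x. 2 * Re (cnj (vxx t x) * vt t x + cnj (vx t x) * vxt t x)
      + (mt t x * (m t x + f t x) + W t x * g t x)
      + K0 * (2 * Re (cnj (vx t x) * (\<i> * vx t x) + cnj (v t x) * (\<i> * vxx t x))))"
  define R where "R = (\<lambda>t x. m t x * Re (cnj (v t x) * (zut u1 n1 t x + zut u2 n2 t x)) + Nt t x * (cmod (v t x))\<^sup>2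
      + K0 * m t x * Re (- \<i> * (cnj (v t x) * (u1 t x + u2 t x))))"
  \<comment> \<open>\<open>q\<close> omits the derivative of \<open>v\<close>: the remainder
    \<open>R\<close> can be bounded by \<open>v\<close> and \<open>m\<close> alone, so the Gronwall
    argument closes on these two.\<close>
  define q where "q = (\<lambda>t x. 1 / 4 * ((cmod (v t x))\<^sup>2 + (m t x)\<^sup>2))"
  note defs = v_def vx_def vxx_def vt_def vxt_def m_def mt_def f_def ft_def fx_def W_def g_def N_def Nt_def e_def J_def Jx_def R_def q_def
  have g_eq: "g t x = (dx (n1 t) x - dx (n2 t) x) + fx t x" for t x unfolding g_def fx_def zh_def by simp
  have hrd: "\<And>h h' s S. (h has_real_derivative h') (at s within S) \<longleftrightarrow> (h has_vector_derivative h') (at s within S)"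
    by (rule has_real_derivative_iff_has_vector_derivative)
  note sbs = F.sb G.sb F.sb_derived G.sb_derived F.sb_W G.sb_W F.sb_nt G.sb_nt
  have sbd: "strip_bdd T v" "strip_bdd T vx" "strip_bdd T vxx" "strip_bdd T vt" "strip_bdd T vxt" "strip_bdd T m" "strip_bdd T mt"
    "strip_bdd T f" "strip_bdd T W" "strip_bdd T g" "strip_bdd T N" "strip_bdd T Nt"
    unfolding v_def vx_def vxx_def vt_def vxt_def m_def mt_def f_def W_def g_def N_def Nt_def divide_inverse
    by (intro strip_bdd_intros sbs)+
  have sbe: "strip_bdd T e" "strip_bdd T J" "strip_bdd T Jx" "strip_bdd T R"
    unfolding e_def J_def Jx_def R_def by (intro strip_bdd_intros sbd sbs)+
  have L2: "strip_L2 T v" "strip_L2 T vx" "strip_L2 T vt" "strip_L2 T m"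
    unfolding v_def vx_def vt_def m_def by (intro strip_L2_diff F.sL2 G.sL2 F.sL2_derived G.sL2_derived)+
  have fc: "continuous_on UNIV (f s)" "continuous_on UNIV (v s)" "continuous_on UNIV (vx s)" if "s \<in> {0..T}" for s
    unfolding f_def v_def vx_def by (intro continuous_intros F.space_cont[OF that] G.space_cont[OF that])+
  have L2f: "strip_L2 T f"
  proof (rule strip_L2_bound[OF L2(1)])
    show "f s \<in> borel_measurable borel" if "s \<in> {0..T}" for s by (rule borel_measurable_continuous_onI[OF fc(1)[OF that]])
    show "norm (f s x) \<le> 2 * B * norm (v s x)" if "s \<in> {0..T}" for s x
      using cmod_square_diff_bound[OF F.u_bound0[OF that] G.u_bound0[OF that]] by (simp add: f_def v_def)
  qed
  have L2mf: "strip_L2 T (\<lambda>t x. m t x + f t x)" by (intro strip_L2_add L2 L2f)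
  \<comment> \<open>The two potentials are treated separately, because the L^1 estimate takes an
    explicit time integral as its first factor.\<close>
  have L1J: "strip_L1 T J"
  proof -
    have "strip_L1 T (\<lambda>t x. F.W t x * (m t x + f t x))" "strip_L1 T (\<lambda>t x. G.W t x * (m t x + f t x))"
      unfolding F.W_def[abs_def] G.W_def[abs_def]
      by (intro strip_L1_integral_mult F.sc_derived G.sc_derived F.sL2_derived G.sL2_derived L2mf)+
    then have "strip_L1 T (\<lambda>t x. F.W t x * (m t x + f t x) + (-1) * (G.W t x * (m t x + f t x)))"
      by (intro strip_L1_add strip_L1_cmult)
    then have 1: "strip_L1 T (\<lambda>t x. W t x * (m t x + f t x))" by (simp add: W_def algebra_simps)
    show ?thesis unfolding J_def
      by (intro strip_L1_add 1 strip_L1_cmult strip_L1_Re strip_L1_mult strip_L2_cnj strip_L2_cmult L2)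
  qed
  obtain Be where Be: "\<And>t x. t \<in> {0..T} \<Longrightarrow> \<bar>e t x\<bar> \<le> Be" using sbe(1) unfolding strip_bdd_def real_norm_def by blast
  obtain BJ where BJ: "\<And>t x. t \<in> {0..T} \<Longrightarrow> \<bar>J t x\<bar> \<le> BJ" using sbe(2) unfolding strip_bdd_def real_norm_def by blast
  obtain BJx where BJx: "\<And>t x. t \<in> {0..T} \<Longrightarrow> \<bar>Jx t x\<bar> \<le> BJx" using sbe(3) unfolding strip_bdd_def real_norm_def by blast
  obtain BR where BR: "\<And>t x. t \<in> {0..T} \<Longrightarrow> \<bar>R t x\<bar> \<le> BR" using sbe(4) unfolding strip_bdd_def real_norm_def by blast
  obtain BL where BL: "\<And>t. t \<in> {0..T} \<Longrightarrow> (\<integral>\<^sup>+x. ennreal \<bar>J t x\<bar> \<partial>lborel) \<le> ennreal BL"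
    using L1J unfolding strip_L1_def real_norm_def by blast
  have "strip_bdd T (\<lambda>t x. zut u1 n1 t x + zut u2 n2 t x)" by (intro strip_bdd_intros sbs)
  then obtain C1 where C1: "\<And>t x. t \<in> {0..T} \<Longrightarrow> cmod (zut u1 n1 t x + zut u2 n2 t x) \<le> C1"
    unfolding strip_bdd_def by blast
  obtain C2 where C2: "\<And>t x. t \<in> {0..T} \<Longrightarrow> \<bar>Nt t x\<bar> \<le> C2" using sbd(12) unfolding strip_bdd_def real_norm_def by blast
  have C0: "0 \<le> C1" "0 \<le> C2" using C1[OF t, of 0] C2[OF t, of 0] norm_ge_zero order_trans by (blast, linarith)
  define BB where "BB = max (max (max Be BJ) (max BJx BR)) (max 0 BL)"
  have K0: "0 \<le> K0" unfolding K0_def using B0 by simp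
  \<comment> \<open>The factor 4 undoes the 1/4 in \<open>q\<close>; the three summands bound the
    three terms of \<open>R\<close>.\<close>
  define K where "K = 4 * (C1 + C2 + K0 * (2 * B))"
  have "q t x = 0"
  proof (rule weighted_energy_vanish[of T e Jx R J q BB K])
    fix t x assume t: "t \<in> {0..T}"
    show "((\<lambda>\<tau>. e \<tau> x) has_real_derivative Jx t x + R t x) (at t within {0..T})"
    proof -
      have "((\<lambda>\<tau>. e \<tau> x) has_real_derivative
         (2 * Re (cnj (vx t x) * vxt t x) + m t x * mt t x + W t x * g t x + (mt t x * f t x + m t x * ft t x)
           + (Nt t x * (cmod (v t x))\<^sup>2 + N t x * (2 * Re (cnj (v t x) * vt t x))) + K0 * (2 * Re (cnj (v t x) * vt t x)))) (at t within {0..T})"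
        unfolding e_def
      proof (rule energy_time_derivative)
        show "((\<lambda>\<tau>. (cmod (vx \<tau> x))\<^sup>2) has_real_derivative 2 * Re (cnj (vx t x) * vxt t x)) (at t within {0..T})"
          unfolding hrd vx_def vxt_def by (intro has_vector_derivative_cmod_square has_vector_derivative_diff F.ux_t G.ux_t t)
        show "((\<lambda>\<tau>. (cmod (v \<tau> x))\<^sup>2) has_real_derivative 2 * Re (cnj (v t x) * vt t x)) (at t within {0..T})"
          unfolding hrd v_def vt_def by (intro has_vector_derivative_cmod_square has_vector_derivative_diff F.u_t G.u_t t)
        show "((\<lambda>\<tau>. m \<tau> x) has_real_derivative mt t x) (at t within {0..T})"
          unfolding hrd m_def mt_def by (intro has_vector_derivative_diff F.n_t G.n_t t)
        show "((\<lambda>\<tau>. W \<tau> x) has_real_derivative g t x) (at t within {0..T})"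
          unfolding hrd W_def g_def by (intro has_vector_derivative_diff F.W_t G.W_t t)
        show "((\<lambda>\<tau>. f \<tau> x) has_real_derivative ft t x) (at t within {0..T})"
          unfolding hrd f_def ft_def by (intro has_vector_derivative_diff has_vector_derivative_cmod_square F.u_t G.u_t t)
        show "((\<lambda>\<tau>. N \<tau> x) has_real_derivative Nt t x) (at t within {0..T})"
          unfolding hrd N_def Nt_def by (intro has_vector_derivative_divide has_vector_derivative_add F.n_t G.n_t t)
      qed
      also have "2 * Re (cnj (vx t x) * vxt t x) + m t x * mt t x + W t x * g t x + (mt t x * f t x + m t x * ft t x)
           + (Nt t x * (cmod (v t x))\<^sup>2 + N t x * (2 * Re (cnj (v t x) * vt t x))) + K0 * (2 * Re (cnj (v t x) * vt t x)) = Jx t x + R t x"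
        unfolding vx_def m_def v_def f_def ft_def N_def vt_def Jx_def R_def vxx_def zut_def by (rule energy_identity)
      finally show ?thesis .
    qed
    show "(J t has_real_derivative Jx t x) (at x)"
    proof -
      have "(J t has_real_derivative (2 * Re (cnj (vxx t x) * vt t x + cnj (vx t x) * vxt t x)
        + (mt t x * (m t x + f t x) + W t x * ((dx (n1 t) x - dx (n2 t) x) + fx t x))
        + K0 * (2 * Re (cnj (vx t x) * (\<i> * vx t x) + cnj (v t x) * (\<i> * vxx t x))))) (at x)"
        unfolding J_def
      proof (rule energy_flux_derivative)
        have dv: "(v t has_vector_derivative vx t x) (at x)" "(vx t has_vector_derivative vxx t x) (at x)" "(vt t has_vector_derivative vxt t x) (at x)"
          unfolding v_def vx_def vxx_def vt_def vxt_def by (intro has_vector_derivative_diff F.u_x G.u_x F.ut_x G.ut_x t)+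
        show "((\<lambda>x. Re (cnj (vx t x) * vt t x)) has_real_derivative Re (cnj (vxx t x) * vt t x + cnj (vx t x) * vxt t x)) (at x)"
          unfolding hrd by (intro has_vector_derivative_Re_cnj_mult dv)
        show "((\<lambda>x. Re (cnj (v t x) * (\<i> * vx t x))) has_real_derivative Re (cnj (vx t x) * (\<i> * vx t x) + cnj (v t x) * (\<i> * vxx t x))) (at x)"
          unfolding hrd by (intro has_vector_derivative_Re_cnj_mult has_vector_derivative_mult_right dv)
        show "(m t has_real_derivative dx (n1 t) x - dx (n2 t) x) (at x)"
          unfolding hrd m_def by (intro has_vector_derivative_diff F.n_x G.n_x t)
        show "(W t has_real_derivative mt t x) (at x)"
          unfolding hrd W_def mt_def by (intro has_vector_derivative_diff F.W_x G.W_x t)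
        show "(f t has_real_derivative fx t x) (at x)"
          unfolding hrd f_def fx_def by (intro has_vector_derivative_diff has_vector_derivative_cmod_square F.u_x G.u_x t)
      qed
      then show ?thesis unfolding Jx_def g_eq .
    qed
    show "\<bar>e t x\<bar> \<le> BB" "\<bar>J t x\<bar> \<le> BB" "\<bar>Jx t x\<bar> \<le> BB" "\<bar>R t x\<bar> \<le> BB"
      using Be[OF t, of x] BJ[OF t, of x] BJx[OF t, of x] BR[OF t, of x] unfolding BB_def by linarith+
    show "0 \<le> q t x" unfolding q_def by simp
    have fb: "\<bar>f t x\<bar> \<le> 2 * B * cmod (v t x)"
      using cmod_square_diff_bound[OF F.u_bound0[OF t, of x] G.u_bound0[OF t, of x]] by (simp add: f_def v_def)
    show "q t x \<le> e t x"
    proof -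
      define V M X Y BV BBV where "V = (cmod (v t x))\<^sup>2" and "M = (m t x)\<^sup>2" and "X = (cmod (vx t x))\<^sup>2"
        and "Y = (W t x)\<^sup>2" and "BV = B * V" and "BBV = B\<^sup>2 * V"
      have 1: "- (m t x * f t x) \<le> 1 / 4 * M + (f t x)\<^sup>2"
        using zero_le_power2[of "1 / 2 * m t x + f t x"] unfolding M_def by (simp add: power2_eq_square field_simps)
      have 2: "(f t x)\<^sup>2 \<le> 4 * BBV"
        using power_mono[OF fb abs_ge_zero, of 2] unfolding BBV_def V_def by (simp add: power_mult_distrib)
      have "- B * V \<le> N t x * V"
        using F.n_bound0[OF t, of x] G.n_bound0[OF t, of x] unfolding N_def V_def by (intro mult_right_mono) auto
      then have 3: "- BV \<le> N t x * V" unfolding BV_def by simp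
      have 4: "K0 * V = 4 * BBV + BV + V"
        unfolding K0_def BV_def BBV_def by (simp add: algebra_simps)
      have 5: "0 \<le> X" "0 \<le> Y" "0 \<le> V" unfolding V_def X_def Y_def by auto
      show ?thesis unfolding e_def q_def V_def[symmetric] M_def[symmetric] X_def[symmetric] Y_def[symmetric] 4 distrib_left
        using 1 2 3 5 by linarith
    qed
    show "\<bar>R t x\<bar> \<le> K * q t x"
    proof -
      have mv: "\<bar>m t x\<bar> * cmod (v t x) \<le> (cmod (v t x))\<^sup>2 + (m t x)\<^sup>2"
        using sum_squares_bound[of "\<bar>m t x\<bar>" "cmod (v t x)"] mult_nonneg_nonneg[OF abs_ge_zero[of "m t x"] norm_ge_zero[of "v t x"]]
        unfolding power2_abs by linarith
      have r1: "\<bar>m t x * Re (cnj (v t x) * z)\<bar> \<le> c * ((cmod (v t x))\<^sup>2 + (m t x)\<^sup>2)" if "cmod z \<le> c" for z c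
      proof -
        have c0: "0 \<le> c" using that norm_ge_zero order_trans by blast
        have "\<bar>Re (cnj (v t x) * z)\<bar> \<le> cmod (v t x) * c"
          by (rule order_trans[OF abs_Re_le_cmod]) (use that in \<open>auto simp: norm_mult intro: mult_left_mono\<close>)
        then have "\<bar>m t x * Re (cnj (v t x) * z)\<bar> \<le> \<bar>m t x\<bar> * (cmod (v t x) * c)"
          unfolding abs_mult by (intro mult_left_mono) auto
        also have "\<dots> = c * (\<bar>m t x\<bar> * cmod (v t x))" by simp
        also have "\<dots> \<le> c * ((cmod (v t x))\<^sup>2 + (m t x)\<^sup>2)" by (intro mult_left_mono mv c0)
        finally show ?thesis .
      qed
      have t1: "\<bar>m t x * Re (cnj (v t x) * (zut u1 n1 t x + zut u2 n2 t x))\<bar> \<le> C1 * ((cmod (v t x))\<^sup>2 + (m t x)\<^sup>2)"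
        by (rule r1[OF C1[OF t]])
      have "\<bar>Nt t x * (cmod (v t x))\<^sup>2\<bar> \<le> C2 * (cmod (v t x))\<^sup>2"
        unfolding abs_mult using C2[OF t, of x] by (intro mult_mono) auto
      also have "\<dots> \<le> C2 * ((cmod (v t x))\<^sup>2 + (m t x)\<^sup>2)" using C0 by (intro mult_left_mono) auto
      finally have t2: "\<bar>Nt t x * (cmod (v t x))\<^sup>2\<bar> \<le> C2 * ((cmod (v t x))\<^sup>2 + (m t x)\<^sup>2)" .
      have "cmod (- \<i> * (u1 t x + u2 t x)) \<le> 2 * B"
        using norm_triangle_ineq[of "u1 t x" "u2 t x"] F.u_bound0[OF t, of x] G.u_bound0[OF t, of x] by (simp add: norm_mult)
      from r1[OF this] have "\<bar>m t x * Re (- \<i> * (cnj (v t x) * (u1 t x + u2 t x)))\<bar> \<le> 2 * B * ((cmod (v t x))\<^sup>2 + (m t x)\<^sup>2)"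
        by (simp add: mult_ac)
      then have "K0 * \<bar>m t x * Re (- \<i> * (cnj (v t x) * (u1 t x + u2 t x)))\<bar> \<le> K0 * (2 * B * ((cmod (v t x))\<^sup>2 + (m t x)\<^sup>2))"
        using K0 by (intro mult_left_mono)
      then have t3: "\<bar>K0 * m t x * Re (- \<i> * (cnj (v t x) * (u1 t x + u2 t x)))\<bar> \<le> K0 * (2 * B) * ((cmod (v t x))\<^sup>2 + (m t x)\<^sup>2)"
        using K0 by (simp add: abs_mult mult.assoc)
      have "\<bar>R t x\<bar> \<le> C1 * ((cmod (v t x))\<^sup>2 + (m t x)\<^sup>2) + C2 * ((cmod (v t x))\<^sup>2 + (m t x)\<^sup>2) + K0 * (2 * B) * ((cmod (v t x))\<^sup>2 + (m t x)\<^sup>2)"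
        unfolding R_def using t1 t2 t3 by linarith
      also have "\<dots> = K * q t x" unfolding K_def q_def by (simp add: algebra_simps)
      finally show ?thesis .
    qed
  next
    fix t assume t: "t \<in> {0..T}"
    have c: "continuous_on UNIV (v t)" "continuous_on UNIV (vx t)" "continuous_on UNIV (vxx t)" "continuous_on UNIV (vt t)"
      "continuous_on UNIV (vxt t)" "continuous_on UNIV (m t)" "continuous_on UNIV (mt t)" "continuous_on UNIV (f t)"
      "continuous_on UNIV (W t)" "continuous_on UNIV (g t)" "continuous_on UNIV (N t)" "continuous_on UNIV (Nt t)"
      unfolding v_def vx_def vxx_def vt_def vxt_def m_def mt_def f_def W_def g_def N_def Nt_def
      by (intro continuous_intros F.space_cont[OF t] G.space_cont[OF t]; simp)+
    show "continuous_on UNIV (e t)" "continuous_on UNIV (J t)" "continuous_on UNIV (Jx t)" "continuous_on UNIV (R t)" "continuous_on UNIV (q t)"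
      unfolding e_def J_def Jx_def R_def q_def
      by (intro continuous_intros c F.space_cont[OF t] G.space_cont[OF t])+
    have "ennreal BL \<le> ennreal BB" unfolding BB_def by (intro ennreal_leI) linarith
    with BL[OF t] show "(\<integral>\<^sup>+x. ennreal \<bar>J t x\<bar> \<partial>lborel) \<le> ennreal BB" by (rule order_trans)
  next
    show "0 \<le> K" unfolding K_def using C0 K0 B0 by simp
    have z: "0 \<in> {0..T}" using t by auto
    have i1: "u1 0 = u2 0" "n1 0 = n2 0" using init by auto
    show "e 0 x = 0" for x unfolding e_def vx_def v_def m_def f_def W_def by (simp add: i1 F.W_0 G.W_0)
    show "t \<in> {0..T}" by (rule t)
  qed
  then have "(cmod (v t x))\<^sup>2 + (m t x)\<^sup>2 = 0" unfolding q_def by simp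
  then have "cmod (v t x) = 0 \<and> m t x = 0" by (simp add: sum_power2_eq_zero_iff)
  then show "u1 t x = u2 t x" "n1 t x = n2 t x" by (auto simp: v_def m_def)
qed

theorem zakharov_solution_unique:
  assumes Z1: "zakharov_solution T u0 n0 (\<lambda>x. 0) u1 n1" and Z2: "zakharov_solution T u0 n0 (\<lambda>x. 0) u2 n2"
    and t: "t \<in> {0..T}"
  shows "n1 t = n2 t"
proof
  fix x
  obtain B1 where B1: "\<And>B. B \<ge> B1 \<Longrightarrow> zreg T B u1 n1 (dt T n1)" using zakharov_solution_zreg[OF Z1] by blast
  obtain B2 where B2: "\<And>B. B \<ge> B2 \<Longrightarrow> zreg T B u2 n2 (dt T n2)" using zakharov_solution_zreg[OF Z2] by blast
  show "n1 t x = n2 t x"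
    by (rule zreg_unique(2)[OF B1[of "max B1 B2"] B2[of "max B1 B2"] _ _ t])
       (use Z1 Z2 in \<open>auto simp: zakharov_solution_def\<close>)
qed

subsection \<open>A fixed point in a scale of weighted spaces\<close>

definition tint :: "(real \<Rightarrow> real \<Rightarrow> complex) \<Rightarrow> real \<Rightarrow> real \<Rightarrow> complex" where
  "tint g t \<xi> = integral {0..t} (\<lambda>\<tau>. g \<tau> \<xi>)"

lemma tint_derivative:
  assumes "strip_cont T g" "t \<in> {0..T}"
  shows "((\<lambda>s. tint g s \<xi>) has_vector_derivative g t \<xi>) (at t within {0..T})"
  unfolding tint_def by (rule integral_has_vector_derivative[OF strip_cont_time[OF assms(1)] assms(2)])

text \<open>The substitution \<tau> = t \<sigma> fixes the interval of integration, so that joint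
  continuity of \<open>tint\<close> follows from continuity of integrals in a parameter.\<close>

lemma tint_rescale:
  assumes g: "strip_cont T g" and t: "t \<in> {0..T}"
  shows "tint g t \<xi> = integral {0..1} (\<lambda>\<sigma>. t *\<^sub>R g (t * \<sigma>) \<xi>)"
proof -
  have "((\<lambda>\<sigma>. t *\<^sub>R g (t * \<sigma>) \<xi>) has_integral (tint g (t * 1) \<xi> - tint g (t * 0) \<xi>)) {0..1}"
  proof (rule fundamental_theorem_of_calculus)
    fix \<sigma> :: real assume \<sigma>: "\<sigma> \<in> {0..1}"
    have *: "t * s \<in> {0..T}" if "s \<in> {0..1}" for s using t that mult_left_le[of s t] by auto
    have "((\<lambda>\<sigma>. tint g \<sigma> \<xi>) \<circ> (\<lambda>\<sigma>. t * \<sigma>) has_vector_derivative t *\<^sub>R g (t * \<sigma>) \<xi>) (at \<sigma> within {0..1})"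
    proof (rule vector_diff_chain_within)
      show "((\<lambda>\<sigma>. t * \<sigma>) has_vector_derivative t) (at \<sigma> within {0..1})"
        by (auto intro!: derivative_eq_intros simp: has_real_derivative_iff_has_vector_derivative[symmetric])
      show "((\<lambda>\<sigma>. tint g \<sigma> \<xi>) has_vector_derivative g (t * \<sigma>) \<xi>) (at (t * \<sigma>) within (\<lambda>\<sigma>. t * \<sigma>) ` {0..1})"
        by (rule has_vector_derivative_within_subset[OF tint_derivative[OF g *[OF \<sigma>]]]) (use * in auto)
    qed
    then show "((\<lambda>\<sigma>. tint g (t * \<sigma>) \<xi>) has_vector_derivative t *\<^sub>R g (t * \<sigma>) \<xi>) (at \<sigma> within {0..1})"
      by (simp add: comp_def)
  qed simp
  from integral_unique[OF this] show ?thesis by (simp add: tint_def)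
qed

lemma strip_cont_tint:
  assumes g: "strip_cont T g" shows "strip_cont T (tint g)"
proof -
  have "continuous_on (({0..T} \<times> UNIV) \<times> cbox 0 1) (\<lambda>q. (\<lambda>p. g (fst p) (snd p)) (fst (fst q) * snd q, snd (fst q)))"
  proof (rule continuous_on_compose2[OF g[unfolded strip_cont_def]])
    have "x * s \<in> {0..T}" if "x \<in> {0..T}" "s \<in> {0..1}" for x s
      using that mult_left_le[of s x] by auto
    then show "(\<lambda>q. (fst (fst q) * snd q, snd (fst q))) ` (({0..T} \<times> UNIV) \<times> cbox 0 1) \<subseteq> {0..T} \<times> UNIV" by auto
  qed (intro continuous_intros)
  then have "continuous_on (({0..T} \<times> UNIV) \<times> cbox 0 1) (\<lambda>q. fst (fst q) *\<^sub>R g (fst (fst q) * snd q) (snd (fst q)))"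
    by (intro continuous_intros) simp
  then have "continuous_on (({0..T} \<times> UNIV) \<times> cbox (0::real) 1) (\<lambda>(p, \<sigma>). fst p *\<^sub>R g (fst p * \<sigma>) (snd p))"
    by (simp add: case_prod_beta')
  from integral_continuous_on_param[OF this]
  have "continuous_on ({0..T} \<times> UNIV) (\<lambda>p. integral {0..1} (\<lambda>\<sigma>. fst p *\<^sub>R g (fst p * \<sigma>) (snd p)))" by simp
  then show ?thesis unfolding strip_cont_def
    by (rule continuous_on_cong[THEN iffD1, rotated 2, OF _ refl]) (use tint_rescale[OF g] in auto)
qed

lemma tint_bound:
  assumes g: "strip_cont T g" and t: "t \<in> {0..T}"
    and b: "\<And>\<tau>. \<tau> \<in> {0..t} \<Longrightarrow> cmod (g \<tau> \<xi>) \<le> h \<tau>" "h integrable_on {0..t}"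
  shows "cmod (tint g t \<xi>) \<le> integral {0..t} h"
  unfolding tint_def
proof (rule integral_norm_bound_integral)
  show "(\<lambda>\<tau>. g \<tau> \<xi>) integrable_on {0..t}"
    using strip_cont_time[OF g, of \<xi>] t by (intro integrable_continuous_real) (auto intro: continuous_on_subset)
qed (use b in auto)

lemma tint_diff:
  assumes "strip_cont T f" "strip_cont T g" "t \<in> {0..T}"
  shows "tint (\<lambda>\<tau> \<xi>. f \<tau> \<xi> - g \<tau> \<xi>) t \<xi> = tint f t \<xi> - tint g t \<xi>"
  unfolding tint_def
  using strip_cont_time[OF assms(1), of \<xi>] strip_cont_time[OF assms(2), of \<xi>] assms(3)
  by (intro Henstock_Kurzweil_Integration.integral_diff integrable_continuous_real) (auto intro: continuous_on_subset)

text \<open>The correlation of two spectra, which is the spectrum of one function times the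
  conjugate of the other; with equal arguments it is the spectrum of |u|^2.\<close>

definition Yb :: "(real \<Rightarrow> real \<Rightarrow> complex) \<Rightarrow> (real \<Rightarrow> real \<Rightarrow> complex) \<Rightarrow> real \<Rightarrow> real \<Rightarrow> complex" where
  "Yb U V t \<xi> = (LINT \<eta>|lborel. U t (\<xi> + \<eta>) * cnj (V t \<eta>))"

text \<open>The spectrum of the complex conjugate. Placed in the second slot of \<open>Yb\<close> it
  cancels the conjugation there, which yields the spectrum of the plain product n u.\<close>

definition refl :: "(real \<Rightarrow> real \<Rightarrow> complex) \<Rightarrow> real \<Rightarrow> real \<Rightarrow> complex" where
  "refl U t \<eta> = cnj (U t (- \<eta>))"

text \<open>The Duhamel formula for the wave equation, with $\sin((t-\tau)\xi)$ expanded so that only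
  integrals of the form \<open>tint\<close> occur.\<close>

definition Nb :: "(real \<Rightarrow> real \<Rightarrow> complex) \<Rightarrow> real \<Rightarrow> real \<Rightarrow> complex" where
  "Nb Y t \<xi> = - of_real \<xi> * (of_real (sin (t * \<xi>)) * tint (\<lambda>\<tau> \<xi>. of_real (cos (\<tau> * \<xi>)) * Y \<tau> \<xi>) t \<xi>
      - of_real (cos (t * \<xi>)) * tint (\<lambda>\<tau> \<xi>. of_real (sin (\<tau> * \<xi>)) * Y \<tau> \<xi>) t \<xi>)"

text \<open>Duhamel's formula for the Schroedinger equation, with datum spectrum \<open>p\<close>
  and forcing spectrum \<open>G\<close>.\<close>

definition Sb :: "(real \<Rightarrow> complex) \<Rightarrow> (real \<Rightarrow> real \<Rightarrow> complex) \<Rightarrow> real \<Rightarrow> real \<Rightarrow> complex" where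
  "Sb p G t \<xi> = exp (- \<i> * of_real (t * \<xi>\<^sup>2)) * (p \<xi> - \<i> * tint (\<lambda>\<tau> \<xi>. exp (\<i> * of_real (\<tau> * \<xi>\<^sup>2)) * G \<tau> \<xi>) t \<xi>)"

lemma strip_cont_Nb:
  assumes Y: "strip_cont T Y" shows "strip_cont T (Nb Y)"
proof -
  have "strip_cont T (\<lambda>\<tau> \<xi>. of_real (cos (\<tau> * \<xi>)) * Y \<tau> \<xi>)" "strip_cont T (\<lambda>\<tau> \<xi>. of_real (sin (\<tau> * \<xi>)) * Y \<tau> \<xi>)"
    using Y unfolding strip_cont_def by (auto intro!: continuous_intros)
  from strip_cont_tint[OF this(1)] strip_cont_tint[OF this(2)]
  show ?thesis unfolding strip_cont_def Nb_def by (auto intro!: continuous_intros)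
qed

text \<open>The addition formula read backwards: the kernel at lag t - \<tau> is convenient for
  estimates, the expanded definition for differentiation in t.\<close>

lemma Nb_eq:
  assumes Y: "strip_cont T Y" and t: "t \<in> {0..T}"
  shows "Nb Y t \<xi> = - of_real \<xi> * tint (\<lambda>\<tau> \<xi>. of_real (sin ((t - \<tau>) * \<xi>)) * Y \<tau> \<xi>) t \<xi>"
proof -
  have c: "continuous_on {0..t} (\<lambda>\<tau>. Y \<tau> \<xi>)" using strip_cont_time[OF Y, of \<xi>] t by (auto intro: continuous_on_subset)
  have i: "(\<lambda>\<tau>. of_real (cos (\<tau> * \<xi>)) * Y \<tau> \<xi>) integrable_on {0..t}" "(\<lambda>\<tau>. of_real (sin (\<tau> * \<xi>)) * Y \<tau> \<xi>) integrable_on {0..t}"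
    by (intro integrable_continuous_real continuous_intros c)+
  have "tint (\<lambda>\<tau> \<xi>. of_real (sin ((t - \<tau>) * \<xi>)) * Y \<tau> \<xi>) t \<xi> =
     integral {0..t} (\<lambda>\<tau>. of_real (sin (t * \<xi>)) * (of_real (cos (\<tau> * \<xi>)) * Y \<tau> \<xi>) - of_real (cos (t * \<xi>)) * (of_real (sin (\<tau> * \<xi>)) * Y \<tau> \<xi>))"
    unfolding tint_def left_diff_distrib sin_diff by (intro Henstock_Kurzweil_Integration.integral_cong) (simp add: algebra_simps)
  also have "\<dots> = of_real (sin (t * \<xi>)) * tint (\<lambda>\<tau> \<xi>. of_real (cos (\<tau> * \<xi>)) * Y \<tau> \<xi>) t \<xi>
      - of_real (cos (t * \<xi>)) * tint (\<lambda>\<tau> \<xi>. of_real (sin (\<tau> * \<xi>)) * Y \<tau> \<xi>) t \<xi>"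
    unfolding tint_def using i
    by (subst Henstock_Kurzweil_Integration.integral_diff) (auto intro: integrable_on_cmult_left)
  finally show ?thesis unfolding Nb_def by simp
qed

lemma Nb_diff:
  assumes "strip_cont T Y" "strip_cont T Y'" "t \<in> {0..T}"
  shows "Nb (\<lambda>\<tau> \<xi>. Y \<tau> \<xi> - Y' \<tau> \<xi>) t \<xi> = Nb Y t \<xi> - Nb Y' t \<xi>"
proof -
  have c: "strip_cont T (\<lambda>\<tau> \<xi>. of_real (cos (\<tau> * \<xi>)) * Z \<tau> \<xi>)" "strip_cont T (\<lambda>\<tau> \<xi>. of_real (sin (\<tau> * \<xi>)) * Z \<tau> \<xi>)"
    if "strip_cont T Z" for Z :: "real \<Rightarrow> real \<Rightarrow> complex"
    using that unfolding strip_cont_def by (auto intro!: continuous_intros)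
  show ?thesis unfolding Nb_def right_diff_distrib[of "of_real (cos _)"] right_diff_distrib[of "of_real (sin _)"]
    by (simp only: tint_diff[OF c(1)[OF assms(1)] c(1)[OF assms(2)] assms(3)] tint_diff[OF c(2)[OF assms(1)] c(2)[OF assms(2)] assms(3)])
       (simp add: algebra_simps)
qed

lemma strip_cont_Sb:
  assumes p: "continuous_on UNIV p" and G: "strip_cont T G" shows "strip_cont T (Sb p G)"
proof -
  have "strip_cont T (\<lambda>\<tau> \<xi>. exp (\<i> * of_real (\<tau> * \<xi>\<^sup>2)) * G \<tau> \<xi>)"
    using G unfolding strip_cont_def by (auto intro!: continuous_intros)
  from strip_cont_tint[OF this] show ?thesis
    unfolding strip_cont_def Sb_def by (auto intro!: continuous_intros continuous_on_compose2[OF p])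
qed

section \<open>The scale of weighted spaces with shrinking radius\<close>

locale ck_scale =
  fixes T b :: real
  assumes T: "T > 0" and b: "b > 0"
begin

text \<open>The radius falls linearly from b at time 0 to b/2 at time T: the constant rate is what
  gets converted into powers of |\<xi>|, and the surviving half keeps all moments finite uniformly
  in time.\<close>

definition a :: "real \<Rightarrow> real" where "a t = b * (1 - t / (2 * T))"

lemma a_mono: "s \<le> t \<Longrightarrow> a t \<le> a s"
  unfolding a_def using T b by (intro mult_left_mono) (auto simp: divide_right_mono)

lemma a_bounds: "t \<in> {0..T} \<Longrightarrow> b / 2 \<le> a t" "t \<in> {0..T} \<Longrightarrow> a t \<le> b"
proof -
  assume t: "t \<in> {0..T}"
  have "t / (2 * T) \<le> 1 / 2" "0 \<le> t / (2 * T)" using t T by (auto simp: field_simps)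
  then have "b * (1 / 2) \<le> b * (1 - t / (2 * T))" "b * (1 - t / (2 * T)) \<le> b * 1" using b by (intro mult_left_mono; simp)+
  then show "b / 2 \<le> a t" "a t \<le> b" unfolding a_def by auto
qed

lemma a_pos: "t \<in> {0..T} \<Longrightarrow> 0 < a t" using a_bounds(1)[of t] b by auto

text \<open>The constant \<open>K\<close> takes the place of a norm, so that estimates are composed
  by composing explicit constants.\<close>

definition adm :: "(real \<Rightarrow> real) \<Rightarrow> real \<Rightarrow> (real \<Rightarrow> real \<Rightarrow> complex) \<Rightarrow> bool" where
  "adm W K U \<longleftrightarrow> strip_cont T U \<and> (\<forall>t\<in>{0..T}. \<forall>\<xi>. cmod (U t \<xi>) \<le> K * W \<xi> * exp (- a t * \<bar>\<xi>\<bar>))"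

lemma admD: "adm W K U \<Longrightarrow> strip_cont T U" "adm W K U \<Longrightarrow> t \<in> {0..T} \<Longrightarrow> cmod (U t \<xi>) \<le> K * W \<xi> * exp (- a t * \<bar>\<xi>\<bar>)"
  unfolding adm_def by auto

lemma adm_le:
  assumes U: "adm W K U" and W: "0 \<le> W \<xi>" and K: "0 \<le> K" and t: "t \<in> {0..T}"
  shows "cmod (U t \<xi>) \<le> K * W \<xi>"
proof -
  have "K * W \<xi> * exp (- a t * \<bar>\<xi>\<bar>) \<le> K * W \<xi> * 1"
    using W K a_pos[OF t] by (intro mult_left_mono) auto
  then show ?thesis using admD(2)[OF U t, of \<xi>] by simp
qed

lemma adm_refl: "adm W K U \<Longrightarrow> adm (\<lambda>\<xi>. W (- \<xi>)) K (refl U)"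
  unfolding adm_def
proof (intro conjI ballI allI)
  assume U: "strip_cont T U \<and> (\<forall>t\<in>{0..T}. \<forall>\<xi>. cmod (U t \<xi>) \<le> K * W \<xi> * exp (- a t * \<bar>\<xi>\<bar>))"
  have "continuous_on ({0..T} \<times> UNIV) (\<lambda>p. (\<lambda>p. U (fst p) (snd p)) (fst p, - snd p))"
    by (rule continuous_on_compose2[OF conjunct1[OF U, unfolded strip_cont_def]]) (auto intro!: continuous_intros)
  then show "strip_cont T (refl U)" unfolding strip_cont_def refl_def by (intro continuous_intros) simp
  show "cmod (refl U t \<xi>) \<le> K * W (- \<xi>) * exp (- a t * \<bar>\<xi>\<bar>)" if "t \<in> {0..T}" for t \<xi>
    using conjunct2[OF U] that by (metis refl_def complex_mod_cnj abs_minus_cancel)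
qed

text \<open>The exponential weights are submultiplicative under convolution because
  $|\xi| \le |\xi+\eta| + |\eta|$.\<close>

lemma Yb_adm:
  assumes U: "adm Wa K U" and V: "adm Wb L V" and K: "0 \<le> K" "0 \<le> L"
    and Wa: "\<And>\<xi>. 0 \<le> Wa \<xi>" "\<And>\<xi>. Wa \<xi> \<le> Ba" "continuous_on UNIV Wa"
    and Wb: "\<And>\<xi>. 0 \<le> Wb \<xi>" "integrable lborel Wb"
    and conv: "\<And>\<xi>. (LINT \<eta>|lborel. Wa (\<xi> + \<eta>) * Wb \<eta>) \<le> C * Wc \<xi>"
  shows "adm Wc (K * L * C) (Yb U V)"
    and "t \<in> {0..T} \<Longrightarrow> integrable lborel (\<lambda>\<eta>. U t (\<xi> + \<eta>) * cnj (V t \<eta>))"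
proof -
  have [measurable]: "Wb \<in> borel_measurable borel" "Wa \<in> borel_measurable borel"
    using Wb(2) Wa(3) by (auto dest: borel_measurable_integrable intro: borel_measurable_continuous_onI)
  have Um[measurable]: "U t \<in> borel_measurable borel" "V t \<in> borel_measurable borel" if "t \<in> {0..T}" for t
    using strip_cont_space[OF admD(1)[OF U] that] strip_cont_space[OF admD(1)[OF V] that] by (auto intro: borel_measurable_continuous_onI)
  have bound: "cmod (U t (\<xi> + \<eta>) * cnj (V t \<eta>)) \<le> (K * Ba) * (L * Wb \<eta>)" if t: "t \<in> {0..T}" for t \<xi> \<eta>
  proof -
    have "cmod (U t (\<xi> + \<eta>)) \<le> K * Ba"
      using adm_le[OF U Wa(1) K(1) t, of "\<xi> + \<eta>"] mult_left_mono[OF Wa(2)[of "\<xi> + \<eta>"] K(1)] by linarith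
    moreover have "cmod (V t \<eta>) \<le> L * Wb \<eta>" by (rule adm_le[OF V Wb(1) K(2) t])
    ultimately show ?thesis unfolding norm_mult complex_mod_cnj
      using K Wb(1)[of \<eta>] by (intro mult_mono) (auto intro: order_trans[OF norm_ge_zero])
  qed
  have int: "integrable lborel (\<lambda>\<eta>. U t (\<xi> + \<eta>) * cnj (V t \<eta>))" if t: "t \<in> {0..T}" for t \<xi>
  proof (rule Bochner_Integration.integrable_bound)
    show "integrable lborel (\<lambda>\<eta>. (K * Ba) * (L * Wb \<eta>))" using Wb(2) by simp
    show "AE \<eta> in lborel. norm (U t (\<xi> + \<eta>) * cnj (V t \<eta>)) \<le> norm ((K * Ba) * (L * Wb \<eta>))"
      by (rule AE_I2) (rule order_trans[OF bound[OF t]], simp)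
    show "(\<lambda>\<eta>. U t (\<xi> + \<eta>) * cnj (V t \<eta>)) \<in> borel_measurable lborel" using Um[OF t] by simp
  qed
  then show "t \<in> {0..T} \<Longrightarrow> integrable lborel (\<lambda>\<eta>. U t (\<xi> + \<eta>) * cnj (V t \<eta>))" .
  show "adm Wc (K * L * C) (Yb U V)"
    unfolding adm_def
  proof (intro conjI ballI allI)
    show "strip_cont T (Yb U V)"
      unfolding strip_cont_def Yb_def
    proof (rule continuous_on_lebesgue_integral[where w="\<lambda>\<eta>. (K * Ba) * (L * Wb \<eta>)"])
      fix \<eta> :: real
      have "continuous_on ({0..T} \<times> UNIV) (\<lambda>p. (\<lambda>p. U (fst p) (snd p)) (fst p, snd p + \<eta>))"
        by (rule continuous_on_compose2[OF admD(1)[OF U, unfolded strip_cont_def]]) (auto intro!: continuous_intros)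
      moreover have "continuous_on ({0..T} \<times> UNIV) (\<lambda>p::real\<times>real. (\<lambda>p. V (fst p) (snd p)) (fst p, \<eta>))"
        by (rule continuous_on_compose2[OF admD(1)[OF V, unfolded strip_cont_def]]) (auto intro!: continuous_intros)
      ultimately show "continuous_on ({0..T} \<times> UNIV) (\<lambda>p. U (fst p) (snd p + \<eta>) * cnj (V (fst p) \<eta>))"
        by (intro continuous_intros) auto
    next
      show "integrable lborel (\<lambda>\<eta>. (K * Ba) * (L * Wb \<eta>))" using Wb(2) by simp
      show "(\<lambda>\<eta>. U (fst p) (snd p + \<eta>) * cnj (V (fst p) \<eta>)) \<in> borel_measurable lborel" if "p \<in> {0..T} \<times> UNIV" for p :: "real \<times> real"
        using Um[of "fst p"] that by auto
    qed (use bound in auto)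
    fix t \<xi> :: real assume t: "t \<in> {0..T}"
    have "cmod (Yb U V t \<xi>) \<le> (LINT \<eta>|lborel. cmod (U t (\<xi> + \<eta>) * cnj (V t \<eta>)))"
      unfolding Yb_def by (rule integral_norm_bound)
    also have "\<dots> \<le> (LINT \<eta>|lborel. (K * L * exp (- a t * \<bar>\<xi>\<bar>)) * (Wa (\<xi> + \<eta>) * Wb \<eta>))"
    proof (rule integral_mono)
      show "integrable lborel (\<lambda>\<eta>. cmod (U t (\<xi> + \<eta>) * cnj (V t \<eta>)))" by (rule integrable_norm[OF int[OF t]])
      have "integrable lborel (\<lambda>\<eta>. Wa (\<xi> + \<eta>) * Wb \<eta>)"
      proof (rule Bochner_Integration.integrable_bound)
        show "integrable lborel (\<lambda>\<eta>. Ba * Wb \<eta>)" using Wb(2) by simp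
        show "AE \<eta> in lborel. norm (Wa (\<xi> + \<eta>) * Wb \<eta>) \<le> norm (Ba * Wb \<eta>)"
        proof (rule AE_I2)
          fix \<eta>
          have "0 \<le> Ba" using Wa(1,2)[of 0] by linarith
          then show "norm (Wa (\<xi> + \<eta>) * Wb \<eta>) \<le> norm (Ba * Wb \<eta>)"
            using Wa(1,2)[of "\<xi> + \<eta>"] Wb(1)[of \<eta>] by (simp add: abs_mult mult_right_mono)
        qed
      qed simp
      then show "integrable lborel (\<lambda>\<eta>. (K * L * exp (- a t * \<bar>\<xi>\<bar>)) * (Wa (\<xi> + \<eta>) * Wb \<eta>))" by simp
      fix \<eta> :: real
      have "exp (- a t * \<bar>\<xi> + \<eta>\<bar>) * exp (- a t * \<bar>\<eta>\<bar>) \<le> exp (- a t * \<bar>\<xi>\<bar>)"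
      proof -
        have "a t * \<bar>\<xi>\<bar> \<le> a t * (\<bar>\<xi> + \<eta>\<bar> + \<bar>\<eta>\<bar>)" using a_pos[OF t] by (intro mult_left_mono) auto
        then show ?thesis by (simp add: exp_add[symmetric] algebra_simps)
      qed
      then have e: "(K * Wa (\<xi> + \<eta>) * (L * Wb \<eta>)) * (exp (- a t * \<bar>\<xi> + \<eta>\<bar>) * exp (- a t * \<bar>\<eta>\<bar>)) \<le> (K * Wa (\<xi> + \<eta>) * (L * Wb \<eta>)) * exp (- a t * \<bar>\<xi>\<bar>)"
        using K Wa(1) Wb(1) by (intro mult_left_mono) auto
      have "cmod (U t (\<xi> + \<eta>) * cnj (V t \<eta>)) \<le> (K * Wa (\<xi> + \<eta>) * exp (- a t * \<bar>\<xi> + \<eta>\<bar>)) * (L * Wb \<eta> * exp (- a t * \<bar>\<eta>\<bar>))"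
        unfolding norm_mult complex_mod_cnj using K Wa(1) Wb(1)
        by (intro mult_mono admD(2)[OF U t] admD(2)[OF V t]) auto
      then show "cmod (U t (\<xi> + \<eta>) * cnj (V t \<eta>)) \<le> (K * L * exp (- a t * \<bar>\<xi>\<bar>)) * (Wa (\<xi> + \<eta>) * Wb \<eta>)"
        using e by (simp add: mult_ac)
    qed
    also have "\<dots> = (K * L * exp (- a t * \<bar>\<xi>\<bar>)) * (LINT \<eta>|lborel. Wa (\<xi> + \<eta>) * Wb \<eta>)" by simp
    also have "\<dots> \<le> (K * L * exp (- a t * \<bar>\<xi>\<bar>)) * (C * Wc \<xi>)"
      using K by (intro mult_left_mono conv) auto
    finally show "cmod (Yb U V t \<xi>) \<le> K * L * C * Wc \<xi> * exp (- a t * \<bar>\<xi>\<bar>)" by (simp add: mult_ac)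
  qed
qed

text \<open>Since a(\<tau>) decreases at the rate b/(2T), the integrand times |\<xi>| b/(2T) is the
  exact time derivative of the exponential; hence one factor |\<xi>| costs 2T/b.\<close>

lemma exp_time_integral:
  assumes t: "t \<in> {0..T}"
  shows "(\<lambda>\<tau>. exp (- a \<tau> * \<bar>\<xi>\<bar>)) integrable_on {0..t}"
    and "\<bar>\<xi>\<bar> * integral {0..t} (\<lambda>\<tau>. exp (- a \<tau> * \<bar>\<xi>\<bar>)) \<le> 2 * T / b * exp (- a t * \<bar>\<xi>\<bar>)"
proof -
  show i: "(\<lambda>\<tau>. exp (- a \<tau> * \<bar>\<xi>\<bar>)) integrable_on {0..t}"
    unfolding a_def using T by (intro integrable_continuous_real continuous_intros) auto
  have "((\<lambda>\<tau>. b * \<bar>\<xi>\<bar> / (2 * T) * exp (- a \<tau> * \<bar>\<xi>\<bar>)) has_integral exp (- a t * \<bar>\<xi>\<bar>) - exp (- a 0 * \<bar>\<xi>\<bar>)) {0..t}"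
  proof (rule fundamental_theorem_of_calculus)
    show "((\<lambda>\<tau>. exp (- a \<tau> * \<bar>\<xi>\<bar>)) has_vector_derivative b * \<bar>\<xi>\<bar> / (2 * T) * exp (- a \<tau> * \<bar>\<xi>\<bar>)) (at \<tau> within {0..t})" for \<tau>
      unfolding a_def has_real_derivative_iff_has_vector_derivative[symmetric] using T
      by (auto intro!: derivative_eq_intros simp: field_simps)
  qed (use t in auto)
  from integral_unique[OF this]
  have "b * \<bar>\<xi>\<bar> / (2 * T) * integral {0..t} (\<lambda>\<tau>. exp (- a \<tau> * \<bar>\<xi>\<bar>)) \<le> exp (- a t * \<bar>\<xi>\<bar>)" by simp
  then have "2 * T / b * (b * \<bar>\<xi>\<bar> / (2 * T) * integral {0..t} (\<lambda>\<tau>. exp (- a \<tau> * \<bar>\<xi>\<bar>))) \<le> 2 * T / b * exp (- a t * \<bar>\<xi>\<bar>)"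
    using T b by (intro mult_left_mono) auto
  then show "\<bar>\<xi>\<bar> * integral {0..t} (\<lambda>\<tau>. exp (- a \<tau> * \<bar>\<xi>\<bar>)) \<le> 2 * T / b * exp (- a t * \<bar>\<xi>\<bar>)"
    using T b by simp
qed

text \<open>Shrinking the analyticity radius in time pays for the derivative \<open>\<xi>\<close> in \<open>Nb\<close>
  (Cauchy--Kovalevskaya).\<close>

lemma Nb_adm:
  assumes Y: "adm W K Y" and K: "0 \<le> K" and W: "\<And>\<xi>. 0 \<le> W \<xi>"
  shows "adm W (K * (2 * T / b)) (Nb Y)"
  unfolding adm_def
proof (intro conjI ballI allI)
  show "strip_cont T (Nb Y)" by (rule strip_cont_Nb[OF admD(1)[OF Y]])
  fix t \<xi> :: real assume t: "t \<in> {0..T}"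
  have "cmod (Nb Y t \<xi>) = \<bar>\<xi>\<bar> * cmod (tint (\<lambda>\<tau> \<xi>. of_real (sin ((t - \<tau>) * \<xi>)) * Y \<tau> \<xi>) t \<xi>)"
    unfolding Nb_eq[OF admD(1)[OF Y] t] by (simp add: norm_mult)
  also have "\<dots> \<le> \<bar>\<xi>\<bar> * integral {0..t} (\<lambda>\<tau>. K * W \<xi> * exp (- a \<tau> * \<bar>\<xi>\<bar>))"
  proof (intro mult_left_mono tint_bound)
    show "strip_cont T (\<lambda>\<tau> \<xi>. of_real (sin ((t - \<tau>) * \<xi>)) * Y \<tau> \<xi>)"
      using admD(1)[OF Y] unfolding strip_cont_def by (auto intro!: continuous_intros)
    show "cmod (of_real (sin ((t - \<tau>) * \<xi>)) * Y \<tau> \<xi>) \<le> K * W \<xi> * exp (- a \<tau> * \<bar>\<xi>\<bar>)" if "\<tau> \<in> {0..t}" for \<tau>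
    proof -
      have "\<bar>sin ((t - \<tau>) * \<xi>)\<bar> * cmod (Y \<tau> \<xi>) \<le> 1 * (K * W \<xi> * exp (- a \<tau> * \<bar>\<xi>\<bar>))"
        using admD(2)[OF Y, of \<tau> \<xi>] that t by (intro mult_mono) auto
      then show ?thesis by (simp add: norm_mult)
    qed
    show "(\<lambda>\<tau>. K * W \<xi> * exp (- a \<tau> * \<bar>\<xi>\<bar>)) integrable_on {0..t}"
      using exp_time_integral(1)[OF t] by (intro integrable_on_mult_right)
  qed (use t in auto)
  also have "\<dots> = K * W \<xi> * (\<bar>\<xi>\<bar> * integral {0..t} (\<lambda>\<tau>. exp (- a \<tau> * \<bar>\<xi>\<bar>)))" by simp
  also have "\<dots> \<le> K * W \<xi> * (2 * T / b * exp (- a t * \<bar>\<xi>\<bar>))"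
    using K W by (intro mult_left_mono exp_time_integral(2)[OF t]) auto
  finally show "cmod (Nb Y t \<xi>) \<le> K * (2 * T / b) * W \<xi> * exp (- a t * \<bar>\<xi>\<bar>)" by (simp add: mult_ac)
qed

text \<open>The Schroedinger term loses no derivative: the exponential weight at an earlier time is
  dominated by the one at time t, and the time integral contributes a factor T.\<close>

lemma Sb_bound:
  assumes G: "adm W K G" and K: "0 \<le> K" and W: "\<And>\<xi>. 0 \<le> W \<xi>" and t: "t \<in> {0..T}"
  shows "cmod (Sb p G t \<xi> - exp (- \<i> * of_real (t * \<xi>\<^sup>2)) * p \<xi>) \<le> T * K * W \<xi> * exp (- a t * \<bar>\<xi>\<bar>)"
proof -
  have Gc: "strip_cont T (\<lambda>\<tau> \<xi>. exp (\<i> * of_real (\<tau> * \<xi>\<^sup>2)) * G \<tau> \<xi>)"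
    using admD(1)[OF G] unfolding strip_cont_def by (auto intro!: continuous_intros)
  have "cmod (Sb p G t \<xi> - exp (- \<i> * of_real (t * \<xi>\<^sup>2)) * p \<xi>) = cmod (tint (\<lambda>\<tau> \<xi>. exp (\<i> * of_real (\<tau> * \<xi>\<^sup>2)) * G \<tau> \<xi>) t \<xi>)"
  proof -
    have "Sb p G t \<xi> - exp (- \<i> * of_real (t * \<xi>\<^sup>2)) * p \<xi> = exp (\<i> * of_real (- (t * \<xi>\<^sup>2))) * (- \<i> * tint (\<lambda>\<tau> \<xi>. exp (\<i> * of_real (\<tau> * \<xi>\<^sup>2)) * G \<tau> \<xi>) t \<xi>)"
      unfolding Sb_def by (simp add: algebra_simps)
    then show ?thesis by (simp only: norm_mult norm_exp_i_real) simp
  qed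
  also have "\<dots> \<le> integral {0..t} (\<lambda>\<tau>. K * W \<xi> * exp (- a t * \<bar>\<xi>\<bar>))"
  proof (rule tint_bound[OF Gc t])
    fix \<tau> assume \<tau>: "\<tau> \<in> {0..t}"
    have "cmod (G \<tau> \<xi>) \<le> K * W \<xi> * exp (- a \<tau> * \<bar>\<xi>\<bar>)" using admD(2)[OF G] \<tau> t by auto
    also have "\<dots> \<le> K * W \<xi> * exp (- a t * \<bar>\<xi>\<bar>)"
      using K W a_mono[of \<tau> t] \<tau> by (intro mult_left_mono) (auto intro: mult_right_mono)
    finally show "cmod (exp (\<i> * of_real (\<tau> * \<xi>\<^sup>2)) * G \<tau> \<xi>) \<le> K * W \<xi> * exp (- a t * \<bar>\<xi>\<bar>)"
      by (simp only: norm_mult norm_exp_i_real)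
  qed auto
  also have "\<dots> = t * (K * W \<xi> * exp (- a t * \<bar>\<xi>\<bar>))" using t by simp
  also have "\<dots> \<le> T * (K * W \<xi> * exp (- a t * \<bar>\<xi>\<bar>))" using t K W by (intro mult_right_mono) auto
  finally show ?thesis by (simp add: mult_ac)
qed

end

context ck_scale
begin

lemma adm_add:
  assumes "adm W K U" "adm W L V" shows "adm W (K + L) (\<lambda>t \<xi>. U t \<xi> + V t \<xi>)"
  unfolding adm_def
proof (intro conjI ballI allI)
  show "strip_cont T (\<lambda>t \<xi>. U t \<xi> + V t \<xi>)"
    using assms[THEN admD(1)] unfolding strip_cont_def by (auto intro!: continuous_intros)
  show "cmod (U t \<xi> + V t \<xi>) \<le> (K + L) * W \<xi> * exp (- a t * \<bar>\<xi>\<bar>)" if "t \<in> {0..T}" for t \<xi>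
    using norm_triangle_ineq[of "U t \<xi>" "V t \<xi>"] admD(2)[OF assms(1) that, of \<xi>] admD(2)[OF assms(2) that, of \<xi>]
    by (simp add: algebra_simps)
qed

lemma adm_cong:
  assumes "adm W K U" "\<And>t \<xi>. t \<in> {0..T} \<Longrightarrow> U t \<xi> = V t \<xi>" shows "adm W K V"
  using assms unfolding adm_def strip_cont_def
  by (auto cong: continuous_on_cong_simp) (subst (asm) continuous_on_cong[OF refl], auto)

end

text \<open>\<open>W1\<close> weighs u and \<open>W2\<close> weighs n; the two convolution bounds
  say that |u|^2 falls under \<open>W2\<close> and n u under \<open>W1\<close>. The reflected
  argument in the second one stems from \<open>refl\<close>. \<open>A\<close> is the size of the
  datum, and the number 48 makes the fixed-point map a contraction with factor 1/2.\<close>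

locale ck_system = ck_scale +
  fixes W1 W2 :: "real \<Rightarrow> real" and B C A :: real and p :: "real \<Rightarrow> complex"
  assumes W1: "\<And>\<xi>. 0 < W1 \<xi>" "\<And>\<xi>. W1 \<xi> \<le> B" "continuous_on UNIV W1" "integrable lborel W1"
    and W2: "\<And>\<xi>. 0 < W2 \<xi>" "\<And>\<xi>. W2 \<xi> \<le> B" "continuous_on UNIV W2" "integrable lborel W2"
    and conv1: "\<And>\<xi>. (LINT \<eta>|lborel. W1 (\<xi> + \<eta>) * W1 \<eta>) \<le> C * W2 \<xi>"
    and conv2: "\<And>\<xi>. (LINT \<eta>|lborel. W2 (\<xi> + \<eta>) * W1 (- \<eta>)) \<le> C * W1 \<xi>"
    and A: "0 < A" and C: "0 \<le> C"
    and p: "continuous_on UNIV p" "\<And>\<xi>. cmod (p \<xi>) \<le> A * W1 \<xi> * exp (- b * \<bar>\<xi>\<bar>)"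
    and small: "48 * A\<^sup>2 * C\<^sup>2 * T\<^sup>2 \<le> b"
begin

lemma W_nonneg: "0 \<le> W1 \<xi>" "0 \<le> W2 \<xi>"
  using W1(1) W2(1) by (auto intro: less_imp_le)

lemma W1_reflect: "integrable lborel (\<lambda>\<xi>. W1 (- \<xi>))"
  using lborel_integrable_real_affine[OF W1(4), of "-1" 0] by simp

lemmas Y_adm = Yb_adm(1)[OF _ _ _ _ W_nonneg(1) W1(2,3) W_nonneg(1) W1(4) conv1]
lemmas Y_int = Yb_adm(2)[OF _ _ _ _ W_nonneg(1) W1(2,3) W_nonneg(1) W1(4) conv1]
lemmas N_adm = Nb_adm[OF _ _ W_nonneg(2)]
lemmas G_adm = Yb_adm(1)[OF _ adm_refl _ _ W_nonneg(2) W2(2,3) W_nonneg(1) W1_reflect conv2]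
lemmas G_int = Yb_adm(2)[OF _ adm_refl _ _ W_nonneg(2) W2(2,3) W_nonneg(1) W1_reflect conv2]

text \<open>Solving the wave equation for n in terms of u reduces the system to a single equation
  for u, whose nonlinearity \<open>GG\<close> is cubic.\<close>

definition NN :: "(real \<Rightarrow> real \<Rightarrow> complex) \<Rightarrow> real \<Rightarrow> real \<Rightarrow> complex" where
  "NN U = Nb (Yb U U)"

definition GG :: "(real \<Rightarrow> real \<Rightarrow> complex) \<Rightarrow> real \<Rightarrow> real \<Rightarrow> complex" where
  "GG U = Yb (NN U) (refl U)"

lemma const_nonneg: "0 \<le> 2 * T / b" using T b by simp

lemma NN_adm: "adm W1 K U \<Longrightarrow> 0 \<le> K \<Longrightarrow> adm W2 (K * K * C * (2 * T / b)) (NN U)"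
  unfolding NN_def by (intro N_adm Y_adm mult_nonneg_nonneg C) auto

lemma GG_adm: "adm W1 K U \<Longrightarrow> 0 \<le> K \<Longrightarrow> adm W1 (K * K * C * (2 * T / b) * K * C) (GG U)"
  unfolding GG_def by (intro G_adm NN_adm mult_nonneg_nonneg C const_nonneg) auto

text \<open>The difference of the two correlations is split into one with U - V in the first slot
  and one with U - V in the second, which accounts for the factor 2.\<close>

lemma NN_diff:
  assumes U: "adm W1 K U" and V: "adm W1 K V" and D: "adm W1 D (\<lambda>t \<xi>. U t \<xi> - V t \<xi>)" and K: "0 \<le> K" "0 \<le> D"
  shows "adm W2 (2 * (K * D * C) * (2 * T / b)) (\<lambda>t \<xi>. NN U t \<xi> - NN V t \<xi>)"
proof -
  let ?D = "\<lambda>t \<xi>. U t \<xi> - V t \<xi>"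
  have 1: "adm W2 (D * K * C + K * D * C) (\<lambda>t \<xi>. Yb ?D U t \<xi> + Yb V ?D t \<xi>)"
    by (intro adm_add Y_adm D U V K)
  have "Yb ?D U t \<xi> + Yb V ?D t \<xi> = Yb U U t \<xi> - Yb V V t \<xi>" if t: "t \<in> {0..T}" for t \<xi>
  proof -
    note i = Y_int[OF D U K(2,1) t, of \<xi>] Y_int[OF V D K t, of \<xi>] Y_int[OF U U K(1,1) t, of \<xi>] Y_int[OF V V K(1,1) t, of \<xi>]
    have "Yb ?D U t \<xi> + Yb V ?D t \<xi> = (LINT \<eta>|lborel. (U t (\<xi> + \<eta>) - V t (\<xi> + \<eta>)) * cnj (U t \<eta>) + V t (\<xi> + \<eta>) * cnj (U t \<eta> - V t \<eta>))"
      unfolding Yb_def by (rule Bochner_Integration.integral_add[OF i(1,2), symmetric])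
    also have "\<dots> = (LINT \<eta>|lborel. U t (\<xi> + \<eta>) * cnj (U t \<eta>) - V t (\<xi> + \<eta>) * cnj (V t \<eta>))"
      by (intro Bochner_Integration.integral_cong) (auto simp: algebra_simps)
    also have "\<dots> = Yb U U t \<xi> - Yb V V t \<xi>"
      unfolding Yb_def by (rule Bochner_Integration.integral_diff[OF i(3,4)])
    finally show ?thesis .
  qed
  then have 2: "adm W2 (D * K * C + K * D * C) (\<lambda>t \<xi>. Yb U U t \<xi> - Yb V V t \<xi>)" by (rule adm_cong[OF 1])
  have 3: "adm W2 ((D * K * C + K * D * C) * (2 * T / b)) (Nb (\<lambda>t \<xi>. Yb U U t \<xi> - Yb V V t \<xi>))"
    by (rule N_adm[OF 2]) (use K C in auto)
  have "adm W2 ((D * K * C + K * D * C) * (2 * T / b)) (\<lambda>t \<xi>. NN U t \<xi> - NN V t \<xi>)"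
    unfolding NN_def
    by (rule adm_cong[OF 3]) (rule Nb_diff[OF admD(1)[OF Y_adm[OF U U K(1,1)]] admD(1)[OF Y_adm[OF V V K(1,1)]]])
  then show ?thesis by (simp add: mult_ac)
qed

text \<open>Two contributions come from the difference inside \<open>NN\<close> and one from the
  outer factor, which makes the 3 of a trilinear expression.\<close>

lemma GG_diff:
  assumes U: "adm W1 K U" and V: "adm W1 K V" and D: "adm W1 D (\<lambda>t \<xi>. U t \<xi> - V t \<xi>)" and K: "0 \<le> K" "0 \<le> D"
  shows "adm W1 (3 * (K * K * D * C * C * (2 * T / b))) (\<lambda>t \<xi>. GG U t \<xi> - GG V t \<xi>)"
proof -
  let ?D = "\<lambda>t \<xi>. U t \<xi> - V t \<xi>" and ?N = "\<lambda>t \<xi>. NN U t \<xi> - NN V t \<xi>"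
  let ?c = "2 * (K * D * C) * (2 * T / b)" and ?d = "K * K * C * (2 * T / b)"
  have c: "0 \<le> ?c" "0 \<le> ?d" by (intro mult_nonneg_nonneg const_nonneg; use K C in simp)+
  note N = NN_diff[OF assms]
  have 1: "adm W1 (?c * K * C + ?d * D * C) (\<lambda>t \<xi>. Yb ?N (refl U) t \<xi> + Yb (NN V) (refl ?D) t \<xi>)"
    by (intro adm_add G_adm[OF N U c(1) K(1)] G_adm[OF NN_adm[OF V K(1)] D c(2) K(2)])
  have "Yb ?N (refl U) t \<xi> + Yb (NN V) (refl ?D) t \<xi> = GG U t \<xi> - GG V t \<xi>" if t: "t \<in> {0..T}" for t \<xi>
  proof -
    note i = G_int[OF N U c(1) K(1) t, of \<xi>] G_int[OF NN_adm[OF V K(1)] D c(2) K(2) t, of \<xi>]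
      G_int[OF NN_adm[OF U K(1)] U c(2) K(1) t, of \<xi>] G_int[OF NN_adm[OF V K(1)] V c(2) K(1) t, of \<xi>]
    have "Yb ?N (refl U) t \<xi> + Yb (NN V) (refl ?D) t \<xi> =
       (LINT \<eta>|lborel. (NN U t (\<xi> + \<eta>) - NN V t (\<xi> + \<eta>)) * cnj (refl U t \<eta>) + NN V t (\<xi> + \<eta>) * cnj (refl ?D t \<eta>))"
      unfolding Yb_def by (rule Bochner_Integration.integral_add[OF i(1,2), symmetric])
    also have "\<dots> = (LINT \<eta>|lborel. NN U t (\<xi> + \<eta>) * cnj (refl U t \<eta>) - NN V t (\<xi> + \<eta>) * cnj (refl V t \<eta>))"
      by (intro Bochner_Integration.integral_cong) (auto simp: algebra_simps refl_def)
    also have "\<dots> = GG U t \<xi> - GG V t \<xi>"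
      unfolding Yb_def GG_def by (rule Bochner_Integration.integral_diff[OF i(3,4)])
    finally show ?thesis .
  qed
  then have "adm W1 (?c * K * C + ?d * D * C) (\<lambda>t \<xi>. GG U t \<xi> - GG V t \<xi>)" by (rule adm_cong[OF 1])
  then show ?thesis by (simp add: algebra_simps)
qed

definition w :: "real \<Rightarrow> real \<Rightarrow> real" where "w t \<xi> = W1 \<xi> * exp (- a t * \<bar>\<xi>\<bar>)"

lemma w_pos: "0 < w t \<xi>" unfolding w_def using W1(1) by simp

lemma w_cont: "continuous_on UNIV (\<lambda>q. w (fst q) (snd q))"
  unfolding w_def a_def using T by (auto intro!: continuous_intros continuous_on_compose2[OF W1(3)])

lemma adm_w: "adm W1 K U \<longleftrightarrow> strip_cont T U \<and> (\<forall>t\<in>{0..T}. \<forall>\<xi>. cmod (U t \<xi>) \<le> K * w t \<xi>)"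
  unfolding adm_def w_def by (simp add: mult.assoc)

text \<open>Bounded continuous functions are taken on the whole plane; outside [0,T] the image of
  the fixed-point map is continued constantly in time.\<close>

definition clamp_time :: "real \<Rightarrow> real" where "clamp_time t = max 0 (min T t)"

lemma clamp_time: "clamp_time t \<in> {0..T}" "t \<in> {0..T} \<Longrightarrow> clamp_time t = t"
  unfolding clamp_time_def using T by auto

text \<open>The unknown \<open>V\<close> is the spectrum divided by \<open>A\<close> and by its
  weight. In this form the weighted norm is the sup norm, and the space of bounded continuous
  functions supplies completeness.\<close>

definition UV :: "((real \<times> real) \<Rightarrow>\<^sub>C complex) \<Rightarrow> real \<Rightarrow> real \<Rightarrow> complex" where
  "UV V t \<xi> = of_real (A * w t \<xi>) * apply_bcontfun V (t, \<xi>)"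

definition Psi :: "((real \<times> real) \<Rightarrow>\<^sub>C complex) \<Rightarrow> real \<Rightarrow> real \<Rightarrow> complex" where
  "Psi V t \<xi> = Sb p (GG (UV V)) t \<xi> / of_real (A * w t \<xi>)"

lemma UV_cont: "strip_cont T (UV V)"
  unfolding strip_cont_def UV_def
  by (intro continuous_intros continuous_on_subset[OF w_cont] continuous_on_compose2[OF continuous_on_apply_bcontfun[of UNIV V]]) auto

lemma UV_adm:
  assumes "\<And>q. cmod (apply_bcontfun V q) \<le> 2" shows "adm W1 (2 * A) (UV V)"
  unfolding adm_w
proof (intro conjI ballI allI UV_cont)
  fix t \<xi> show "cmod (UV V t \<xi>) \<le> 2 * A * w t \<xi>"
    using mult_left_mono[OF assms[of "(t, \<xi>)"], of "A * w t \<xi>"] A w_pos[of t \<xi>] unfolding UV_def by (simp add: norm_mult abs_mult mult_ac)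
qed

lemma UV_diff_adm: "adm W1 (A * dist V V') (\<lambda>t \<xi>. UV V t \<xi> - UV V' t \<xi>)"
  unfolding adm_w
proof (intro conjI ballI allI)
  show "strip_cont T (\<lambda>t \<xi>. UV V t \<xi> - UV V' t \<xi>)"
    using UV_cont[of V] UV_cont[of V'] unfolding strip_cont_def by (intro continuous_intros)
  fix t \<xi>
  have "UV V t \<xi> - UV V' t \<xi> = of_real (A * w t \<xi>) * (apply_bcontfun V (t, \<xi>) - apply_bcontfun V' (t, \<xi>))"
    unfolding UV_def by (simp add: algebra_simps)
  then have "cmod (UV V t \<xi> - UV V' t \<xi>) = A * w t \<xi> * dist (apply_bcontfun V (t, \<xi>)) (apply_bcontfun V' (t, \<xi>))"
    using A w_pos[of t \<xi>] by (simp add: norm_mult dist_norm abs_mult)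
  also have "\<dots> \<le> A * w t \<xi> * dist V V'" using A w_pos[of t \<xi>] by (intro mult_left_mono dist_bounded) auto
  finally show "cmod (UV V t \<xi> - UV V' t \<xi>) \<le> A * dist V V' * w t \<xi>" by (simp add: mult_ac)
qed

text \<open>The bound T (2A)^3 C^2 (2T/b) on the nonlinear Duhamel term, for a spectrum with
  constant 2A, divided by A. It also measures how far the solution strays from the free
  evolution.\<close>

definition \<kappa> :: real where "\<kappa> = 16 * A\<^sup>2 * C\<^sup>2 * T\<^sup>2 / b"

lemma \<kappa>_bounds: "0 \<le> \<kappa>" "\<kappa> \<le> 1 / 3"
  using small b unfolding \<kappa>_def by (auto simp: field_simps)

lemma p_le: "t \<in> {0..T} \<Longrightarrow> cmod (p \<xi>) \<le> A * w t \<xi>"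
proof -
  assume t: "t \<in> {0..T}"
  have "a t * \<bar>\<xi>\<bar> \<le> b * \<bar>\<xi>\<bar>" using a_bounds(2)[OF t] by (intro mult_right_mono) auto
  then have "A * W1 \<xi> * exp (- b * \<bar>\<xi>\<bar>) \<le> A * W1 \<xi> * exp (- a t * \<bar>\<xi>\<bar>)"
    using A W_nonneg(1)[of \<xi>] by (intro mult_left_mono) auto
  then show ?thesis using p(2)[of \<xi>] unfolding w_def by (simp add: mult.assoc)
qed

lemma Sb_GG_bound:
  assumes U: "adm W1 (2 * A) U" and t: "t \<in> {0..T}"
  shows "cmod (Sb p (GG U) t \<xi> - exp (- \<i> * of_real (t * \<xi>\<^sup>2)) * p \<xi>) \<le> \<kappa> * A * w t \<xi>"
proof -
  have "cmod (Sb p (GG U) t \<xi> - exp (- \<i> * of_real (t * \<xi>\<^sup>2)) * p \<xi>) \<le>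
     T * (2 * A * (2 * A) * C * (2 * T / b) * (2 * A) * C) * W1 \<xi> * exp (- a t * \<bar>\<xi>\<bar>)"
    by (rule Sb_bound[OF GG_adm[OF U] _ W_nonneg(1) t]) (intro mult_nonneg_nonneg const_nonneg; use A C in simp)+
  also have "\<dots> = \<kappa> * A * w t \<xi>"
    unfolding \<kappa>_def w_def using b by (simp add: power2_eq_square field_simps)
  finally show ?thesis .
qed

lemma Psi_bound:
  assumes V: "\<And>q. cmod (apply_bcontfun V q) \<le> 2" and t: "t \<in> {0..T}"
  shows "cmod (Psi V t \<xi>) \<le> 2"
proof -
  have "cmod (Sb p (GG (UV V)) t \<xi>) \<le> cmod (Sb p (GG (UV V)) t \<xi> - exp (- \<i> * of_real (t * \<xi>\<^sup>2)) * p \<xi>) + cmod (exp (\<i> * of_real (- (t * \<xi>\<^sup>2))) * p \<xi>)"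
    using norm_triangle_ineq[of "Sb p (GG (UV V)) t \<xi> - exp (- \<i> * of_real (t * \<xi>\<^sup>2)) * p \<xi>" "exp (- \<i> * of_real (t * \<xi>\<^sup>2)) * p \<xi>"] by simp
  also have "\<dots> \<le> \<kappa> * A * w t \<xi> + A * w t \<xi>"
    unfolding norm_mult norm_exp_i_real using p_le[OF t, of \<xi>] Sb_GG_bound[OF UV_adm[OF V] t, of \<xi>] by simp
  also have "\<dots> = (\<kappa> + 1) * (A * w t \<xi>)" by (simp add: algebra_simps)
  also have "\<dots> \<le> 2 * (A * w t \<xi>)" using \<kappa>_bounds A w_pos[of t \<xi>] by (intro mult_right_mono) auto
  finally show ?thesis unfolding Psi_def norm_divide norm_of_real using A w_pos[of t \<xi>] by (simp add: divide_simps abs_mult)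
qed

lemma Psi_cont:
  assumes V: "\<And>q. cmod (apply_bcontfun V q) \<le> 2" shows "strip_cont T (Psi V)"
proof -
  have "strip_cont T (Sb p (GG (UV V)))"
    by (rule strip_cont_Sb[OF p(1) admD(1)[OF GG_adm[OF UV_adm[OF V]]]]) (use A in auto)
  then show ?thesis unfolding strip_cont_def Psi_def
    using A w_pos by (intro continuous_intros continuous_on_subset[OF w_cont]) (auto simp: less_imp_neq[symmetric] dest: less_imp_neq)
qed

definition Phi :: "((real \<times> real) \<Rightarrow>\<^sub>C complex) \<Rightarrow> ((real \<times> real) \<Rightarrow>\<^sub>C complex)" where
  "Phi V = Bcontfun (\<lambda>q. Psi V (clamp_time (fst q)) (snd q))"

lemma Phi_apply:
  assumes V: "\<And>q. cmod (apply_bcontfun V q) \<le> 2"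
  shows "apply_bcontfun (Phi V) q = Psi V (clamp_time (fst q)) (snd q)"
proof -
  have "continuous_on UNIV (\<lambda>q. (\<lambda>p. Psi V (fst p) (snd p)) (clamp_time (fst q), snd q))"
    by (rule continuous_on_compose2[OF Psi_cont[OF V, unfolded strip_cont_def]])
       (use clamp_time in \<open>auto simp: clamp_time_def intro!: continuous_intros\<close>)
  then have "(\<lambda>q. Psi V (clamp_time (fst q)) (snd q)) \<in> bcontfun"
    by (intro bcontfun_normI[where b=2] Psi_bound[OF V] clamp_time) simp
  then show ?thesis unfolding Phi_def by (simp add: Bcontfun_inverse)
qed

text \<open>\<open>GG_diff\<close> with the constants 2A, 2A and A times the distance gives the
  factor 24 A^2 C^2 T^2 / b, which is at most 1/2 by \<open>small\<close>.\<close>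

lemma Psi_lipschitz:
  assumes V: "\<And>q. cmod (apply_bcontfun V q) \<le> 2" and V': "\<And>q. cmod (apply_bcontfun V' q) \<le> 2" and t: "t \<in> {0..T}"
  shows "cmod (Psi V t \<xi> - Psi V' t \<xi>) \<le> 1 / 2 * dist V V'"
proof -
  note U = UV_adm[OF V] and U' = UV_adm[OF V'] and D = UV_diff_adm[of V V']
  have A0: "0 \<le> 2 * A" "0 \<le> A * dist V V'" using A by auto
  let ?K = "3 * (2 * A * (2 * A) * (A * dist V V') * C * C * (2 * T / b))"
  have G: "adm W1 ?K (\<lambda>t \<xi>. GG (UV V) t \<xi> - GG (UV V') t \<xi>)" by (rule GG_diff[OF U U' D A0])
  have K0: "0 \<le> ?K" by (intro mult_nonneg_nonneg const_nonneg; use A C in simp)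
  have gc: "strip_cont T (\<lambda>\<tau> \<xi>. exp (\<i> * of_real (\<tau> * \<xi>\<^sup>2)) * GG (UV V) \<tau> \<xi>)" "strip_cont T (\<lambda>\<tau> \<xi>. exp (\<i> * of_real (\<tau> * \<xi>\<^sup>2)) * GG (UV V') \<tau> \<xi>)"
    using admD(1)[OF GG_adm[OF U A0(1)]] admD(1)[OF GG_adm[OF U' A0(1)]] unfolding strip_cont_def
    by (auto intro!: continuous_intros)
  have eq: "Sb p (GG (UV V)) t \<xi> - Sb p (GG (UV V')) t \<xi> = Sb (\<lambda>_. 0) (\<lambda>t \<xi>. GG (UV V) t \<xi> - GG (UV V') t \<xi>) t \<xi>"
    unfolding Sb_def right_diff_distrib[of "exp (\<i> * of_real (_ * _\<^sup>2))"] tint_diff[OF gc t] by (simp add: algebra_simps)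
  have "cmod (Sb p (GG (UV V)) t \<xi> - Sb p (GG (UV V')) t \<xi>) \<le> T * ?K * W1 \<xi> * exp (- a t * \<bar>\<xi>\<bar>)"
    unfolding eq using Sb_bound[OF G K0 W_nonneg(1) t, of "\<lambda>_. 0" \<xi>] by simp
  also have "\<dots> = (24 * A\<^sup>2 * C\<^sup>2 * T\<^sup>2 / b) * dist V V' * (A * w t \<xi>)"
    unfolding w_def using b by (simp add: power2_eq_square field_simps)
  also have "\<dots> \<le> 1 / 2 * dist V V' * (A * w t \<xi>)"
  proof (intro mult_right_mono)
    show "24 * A\<^sup>2 * C\<^sup>2 * T\<^sup>2 / b \<le> 1 / 2" using small b by (simp add: field_simps)
  qed (use A w_pos[of t \<xi>] in auto)
  finally have "cmod ((Sb p (GG (UV V)) t \<xi> - Sb p (GG (UV V')) t \<xi>) / of_real (A * w t \<xi>)) \<le> 1 / 2 * dist V V'"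
    unfolding norm_divide norm_of_real using A w_pos[of t \<xi>] by (simp add: divide_simps abs_mult)
  then show ?thesis unfolding Psi_def by (simp add: diff_divide_distrib)
qed

text \<open>Banach's theorem in the ball of radius 2: the free part contributes at most 1 and the
  nonlinear part at most \<kappa>. The third conclusion, closeness to the free evolution up to a
  relative error \<kappa>, is the quantitative input of the lower bound.\<close>

theorem fixed_point:
  obtains U where "adm W1 (2 * A) U" "\<And>t \<xi>. t \<in> {0..T} \<Longrightarrow> U t \<xi> = Sb p (GG U) t \<xi>"
    "\<And>t \<xi>. t \<in> {0..T} \<Longrightarrow> cmod (U t \<xi> - exp (- \<i> * of_real (t * \<xi>\<^sup>2)) * p \<xi>) \<le> \<kappa> * A * W1 \<xi>"
proof -
  let ?S = "cball (0 :: (real \<times> real) \<Rightarrow>\<^sub>C complex) 2"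
  have in_S: "cmod (apply_bcontfun V q) \<le> 2" if "V \<in> ?S" for V q
    using norm_bounded[of V q] that by simp
  have "\<exists>!V\<in>?S. Phi V = V"
  proof (rule Banach_fix[OF complete_eq_closed[THEN iffD2, OF closed_cball]])
    show "?S \<noteq> {}" by simp
    show "Phi ` ?S \<subseteq> ?S"
    proof clarify
      fix V assume V: "V \<in> ?S"
      have "norm (Phi V) \<le> 2" by (rule norm_bound) (simp add: Phi_apply[OF in_S[OF V]] Psi_bound[OF in_S[OF V] clamp_time(1)])
      then show "Phi V \<in> ?S" by simp
    qed
    show "dist (Phi V) (Phi V') \<le> 1 / 2 * dist V V'" if "V \<in> ?S" "V' \<in> ?S" for V V'
      by (rule dist_bound)
         (simp only: Phi_apply[OF in_S[OF that(1)]] Phi_apply[OF in_S[OF that(2)]] dist_norm[of "Psi _ _ _"] Psi_lipschitz[OF in_S[OF that(1)] in_S[OF that(2)] clamp_time(1)])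
  qed auto
  then obtain V where V: "V \<in> ?S" "Phi V = V" by blast
  define U where "U = UV V"
  have adm: "adm W1 (2 * A) U" unfolding U_def by (rule UV_adm[OF in_S[OF V(1)]])
  have eq: "U t \<xi> = Sb p (GG U) t \<xi>" if t: "t \<in> {0..T}" for t \<xi>
  proof -
    have "apply_bcontfun V (t, \<xi>) = Psi V t \<xi>"
      using Phi_apply[OF in_S[OF V(1)], of "(t, \<xi>)"] V(2) clamp_time(2)[OF t] by simp
    then show ?thesis unfolding U_def UV_def Psi_def using A w_pos[of t \<xi>] by simp
  qed
  have "cmod (U t \<xi> - exp (- \<i> * of_real (t * \<xi>\<^sup>2)) * p \<xi>) \<le> \<kappa> * A * W1 \<xi>" if t: "t \<in> {0..T}" for t \<xi>
  proof -
    have "cmod (U t \<xi> - exp (- \<i> * of_real (t * \<xi>\<^sup>2)) * p \<xi>) \<le> \<kappa> * A * w t \<xi>"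
      using Sb_GG_bound[OF adm t, of \<xi>] by (simp add: eq[OF t, symmetric])
    also have "\<dots> \<le> \<kappa> * A * (W1 \<xi> * 1)"
      unfolding w_def using \<kappa>_bounds A W_nonneg(1)[of \<xi>] a_pos[OF t] by (intro mult_left_mono) auto
    finally show ?thesis by simp
  qed
  with adm eq that show thesis by blast
qed

end

subsection \<open>From the fixed point to a smooth solution\<close>

text \<open>The inequality y \<le> e^y for y = c x / (j + 1), raised to the power j; the successor
  keeps the quotient meaningful for j = 0.\<close>

lemma power_le_exp:
  fixes x c :: real
  assumes c: "c > 0" and x: "x \<ge> 0"
  shows "x ^ j * exp (- c * x) \<le> (real (Suc j) / c) ^ j"
proof -
  define d where "d = c / real (Suc j)"
  have d: "d > 0" unfolding d_def using c by simp
  have "d * x \<le> exp (d * x)" using exp_ge_add_one_self[of "d * x"] by linarith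
  then have "x \<le> (1 / d) * exp (d * x)" using d by (simp add: field_simps)
  then have "x ^ j \<le> ((1 / d) * exp (d * x)) ^ j" using x by (rule power_mono)
  also have "\<dots> = (1 / d) ^ j * exp (real j * (d * x))" unfolding power_mult_distrib exp_of_nat_mult ..
  also have "\<dots> \<le> (1 / d) ^ j * exp (c * x)"
  proof (intro mult_left_mono)
    have "real j * d \<le> c" unfolding d_def using c by (simp add: field_simps)
    then have "real j * d * x \<le> c * x" using x by (rule mult_right_mono)
    then show "exp (real j * (d * x)) \<le> exp (c * x)" by (simp add: mult.assoc)
  qed (use d in simp)
  finally have "x ^ j * exp (- c * x) \<le> (1 / d) ^ j * exp (c * x) * exp (- c * x)" by (intro mult_right_mono) auto
  also have "\<dots> = (1 / d) ^ j" by (simp add: mult.assoc flip: exp_add)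
  finally show ?thesis unfolding d_def by simp
qed

lemma integrable_weight_moment:
  fixes W :: "real \<Rightarrow> real" and c K :: real
  assumes W: "\<And>\<xi>. 0 \<le> W \<xi>" "integrable lborel W" and c: "c > 0"
  shows "integrable lborel (\<lambda>\<xi>. \<bar>\<xi>\<bar> ^ j * (K * W \<xi> * exp (- c * \<bar>\<xi>\<bar>)))"
proof (rule Bochner_Integration.integrable_bound)
  show "integrable lborel (\<lambda>\<xi>. (K * (real (Suc j) / c) ^ j) * W \<xi>)" using W(2) by simp
  have [measurable]: "W \<in> borel_measurable borel" using borel_measurable_integrable[OF W(2)] by simp
  show "(\<lambda>\<xi>. \<bar>\<xi>\<bar> ^ j * (K * W \<xi> * exp (- c * \<bar>\<xi>\<bar>))) \<in> borel_measurable lborel" by simp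
  show "AE \<xi> in lborel. norm (\<bar>\<xi>\<bar> ^ j * (K * W \<xi> * exp (- c * \<bar>\<xi>\<bar>))) \<le> norm ((K * (real (Suc j) / c) ^ j) * W \<xi>)"
  proof (rule AE_I2)
    fix \<xi> :: real
    have "(\<bar>\<xi>\<bar> ^ j * exp (- c * \<bar>\<xi>\<bar>)) * (\<bar>K\<bar> * W \<xi>) \<le> (real (Suc j) / c) ^ j * (\<bar>K\<bar> * W \<xi>)"
      using W(1) by (intro mult_right_mono power_le_exp c) auto
    then show "norm (\<bar>\<xi>\<bar> ^ j * (K * W \<xi> * exp (- c * \<bar>\<xi>\<bar>))) \<le> norm ((K * (real (Suc j) / c) ^ j) * W \<xi>)"
      using W(1)[of \<xi>] c by (simp add: abs_mult mult_ac)
  qed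
qed

text \<open>The convolution theorem in correlation form: Fubini and a shift of \<xi> by \<eta>,
  which leaves behind the conjugate phase that belongs to \<open>V\<close>.\<close>

lemma synth_correlation:
  assumes U: "integrable lborel U" and V: "integrable lborel V"
  shows "synth (\<lambda>\<xi>. LINT \<eta>|lborel. U (\<xi> + \<eta>) * cnj (V \<eta>)) x = synth U x * cnj (synth V x)"
proof -
  have [measurable]: "U \<in> borel_measurable borel" "V \<in> borel_measurable borel"
    using borel_measurable_integrable[OF U] borel_measurable_integrable[OF V] by auto
  have Ush: "integrable lborel (\<lambda>\<xi>. U (\<xi> + \<eta>))" for \<eta>
    using lborel_integrable_real_affine[OF U, of 1 \<eta>] by (simp add: add.commute)
  have nU: "(LINT \<xi>|lborel. cmod (U (\<xi> + \<eta>))) = (LINT \<xi>|lborel. cmod (U \<xi>))" for \<eta>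
    by (subst (2) lborel_integral_real_affine[of 1 _ \<eta>]) (auto simp: add.commute)
  define f where "f = (\<lambda>(\<eta>::real) (\<xi>::real). exp (\<i> * of_real (x * \<xi>)) * (U (\<xi> + \<eta>) * cnj (V \<eta>)))"
  have fi: "integrable (lborel \<Otimes>\<^sub>M lborel) (\<lambda>(\<eta>, \<xi>). f \<eta> \<xi>)"
  proof (rule lborel_pair.Fubini_integrable)
    show "(\<lambda>(\<eta>, \<xi>). f \<eta> \<xi>) \<in> borel_measurable (lborel \<Otimes>\<^sub>M lborel)" unfolding f_def by measurable
    have "(\<lambda>\<eta>. LINT \<xi>|lborel. norm (case (\<eta>, \<xi>) of (\<eta>, \<xi>) \<Rightarrow> f \<eta> \<xi>)) = (\<lambda>\<eta>. (LINT \<xi>|lborel. cmod (U \<xi>)) * cmod (V \<eta>))"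
      unfolding f_def prod.case by (simp add: norm_mult nU)
    then show "integrable lborel (\<lambda>\<eta>. LINT \<xi>|lborel. norm (case (\<eta>, \<xi>) of (\<eta>, \<xi>) \<Rightarrow> f \<eta> \<xi>))" using V by simp
    show "AE \<eta> in lborel. integrable lborel (\<lambda>\<xi>. case (\<eta>, \<xi>) of (\<eta>, \<xi>) \<Rightarrow> f \<eta> \<xi>)"
      unfolding f_def prod.case by (intro AE_I2 integrable_exp_mult integrable_mult_left Ush)
  qed
  have "synth (\<lambda>\<xi>. LINT \<eta>|lborel. U (\<xi> + \<eta>) * cnj (V \<eta>)) x = (LINT \<xi>|lborel. LINT \<eta>|lborel. f \<eta> \<xi>)"
    unfolding synth_def f_def integral_mult_right_zero ..
  also have "\<dots> = (LINT \<eta>|lborel. LINT \<xi>|lborel. f \<eta> \<xi>)" by (rule lborel_pair.Fubini_integral[OF fi])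
  also have "\<dots> = (LINT \<eta>|lborel. synth U x * (cnj (exp (\<i> * of_real (x * \<eta>)) * V \<eta>)))"
  proof (rule Bochner_Integration.integral_cong[OF refl])
    fix \<eta> :: real
    have "(LINT \<xi>|lborel. f \<eta> \<xi>) = (LINT \<xi>|lborel. exp (\<i> * of_real (x * \<xi>)) * U (\<xi> + \<eta>)) * cnj (V \<eta>)"
      unfolding f_def mult.assoc[symmetric] by (rule integral_mult_left_zero)
    also have "(LINT \<xi>|lborel. exp (\<i> * of_real (x * \<xi>)) * U (\<xi> + \<eta>)) = (LINT \<xi>|lborel. exp (\<i> * of_real (x * (- \<eta> + 1 * \<xi>))) * U (- \<eta> + 1 * \<xi> + \<eta>))"
      by (subst lborel_integral_real_affine[of 1 _ "- \<eta>"]) auto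
    also have "\<dots> = (LINT \<xi>|lborel. exp (\<i> * of_real (- x * \<eta>)) * (exp (\<i> * of_real (x * \<xi>)) * U \<xi>))"
      by (intro Bochner_Integration.integral_cong) (auto simp: algebra_simps exp_add[symmetric])
    also have "\<dots> = exp (\<i> * of_real (- x * \<eta>)) * synth U x" unfolding synth_def by (rule integral_mult_right_zero)
    finally show "(LINT \<xi>|lborel. f \<eta> \<xi>) = synth U x * (cnj (exp (\<i> * of_real (x * \<eta>)) * V \<eta>))"
      by (simp add: exp_cnj)
  qed
  also have "\<dots> = synth U x * (LINT \<eta>|lborel. cnj (exp (\<i> * of_real (x * \<eta>)) * V \<eta>))" by (rule integral_mult_right_zero)
  also have "\<dots> = synth U x * cnj (synth V x)" unfolding synth_def by (subst Bochner_Integration.integral_cnj) (rule refl)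
  finally show ?thesis .
qed

lemma synth_time_derivative:
  assumes d: "\<And>t \<xi>. t \<in> {0..T} \<Longrightarrow> ((\<lambda>\<tau>. U \<tau> \<xi>) has_vector_derivative Ut t \<xi>) (at t within {0..T})"
    and U: "\<And>t. t \<in> {0..T} \<Longrightarrow> integrable lborel (U t)" and Ut: "\<And>t. t \<in> {0..T} \<Longrightarrow> Ut t \<in> borel_measurable borel"
    and G: "integrable lborel G" "\<And>t \<xi>. t \<in> {0..T} \<Longrightarrow> cmod (Ut t \<xi>) \<le> G \<xi>" and t: "t \<in> {0..T}"
  shows "((\<lambda>\<tau>. synth (U \<tau>) x) has_vector_derivative synth (Ut t) x) (at t within {0..T})"
  unfolding synth_def
proof (rule has_vector_derivative_lebesgue_integral[where w=G])
  fix t \<xi> assume "t \<in> {0..T}"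
  then show "((\<lambda>\<tau>. exp (\<i> * of_real (x * \<xi>)) * U \<tau> \<xi>) has_vector_derivative exp (\<i> * of_real (x * \<xi>)) * Ut t \<xi>) (at t within {0..T})"
    by (intro has_vector_derivative_mult_right d)
next
  show "integrable lborel (\<lambda>\<xi>. exp (\<i> * of_real (x * \<xi>)) * U t \<xi>)" if "t \<in> {0..T}" for t by (rule integrable_exp_mult[OF U[OF that]])
  show "(\<lambda>\<xi>. exp (\<i> * of_real (x * \<xi>)) * Ut t \<xi>) \<in> borel_measurable lborel" using Ut[OF t] by simp
  show "norm (exp (\<i> * of_real (x * \<xi>)) * Ut t \<xi>) \<le> G \<xi>" if "t \<in> {0..T}" for t \<xi>
    unfolding norm_mult norm_exp_i_real using G(2)[OF that] by simp
qed (use G t in auto)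

text \<open>For T > 0 each point of [0,T] is a limit point of it, so derivatives within the interval
  are unique, at the ends as well.\<close>

lemma dt_eqI:
  assumes T: "T > 0" and t: "t \<in> {0..T}" and d: "((\<lambda>\<tau>. f \<tau> x) has_vector_derivative d) (at t within {0..T})"
  shows "dt T f t x = d"
  unfolding dt_def
proof (rule vector_derivative_within[OF _ d])
  have "t islimpt {0..T}" by (rule connected_imp_perfect) (use T t in auto)
  then show "at t within {0..T} \<noteq> bot" by (simp add: trivial_limit_within)
qed

lemma dx_iter_Re:
  assumes "smooth_fun (f :: real \<Rightarrow> complex)"
  shows "(dx ^^ j) (\<lambda>x. Re (f x)) = (\<lambda>x. Re ((dx ^^ j) f x))"
proof (induction j)
  case (Suc j)
  have "dx (\<lambda>x. Re ((dx ^^ j) f x)) x = Re ((dx ^^ Suc j) f x)" for x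
    using bounded_linear.has_vector_derivative[OF bounded_linear_Re smooth_fun_has_derivative[OF smooth_fun_iter[OF assms, of j], of x]]
    by (subst dx_def) (simp add: vector_derivative_at)
  with Suc show ?case by auto
qed simp

lemma smooth_fun_Re:
  assumes "smooth_fun (f :: real \<Rightarrow> complex)" shows "smooth_fun (\<lambda>x. Re (f x))"
  unfolding smooth_fun_def dx_iter_Re[OF assms]
  using bounded_linear.has_vector_derivative[OF bounded_linear_Re smooth_fun_has_derivative[OF smooth_fun_iter[OF assms]]]
    differentiableI_vector by blast

lemma continuous_in_Hs_cong:
  assumes "\<And>t. t \<in> {0..T} \<Longrightarrow> f t = g t" "continuous_in_Hs T s f" shows "continuous_in_Hs T s g"
  unfolding continuous_in_Hs_def
proof (intro ballI conjI)
  fix t assume t: "t \<in> {0..T}"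
  show "in_Hs s (g t)" using assms t by (auto simp: continuous_in_Hs_def)
  have "((\<lambda>\<tau>. Hs_norm s (\<lambda>x. f \<tau> x - f t x)) \<longlongrightarrow> 0) (at t within {0..T})" using assms(2) t by (auto simp: continuous_in_Hs_def)
  moreover have "((\<lambda>\<tau>. Hs_norm s (\<lambda>x. f \<tau> x - f t x)) \<longlongrightarrow> 0) (at t within {0..T}) \<longleftrightarrow> ((\<lambda>\<tau>. Hs_norm s (\<lambda>x. g \<tau> x - g t x)) \<longlongrightarrow> 0) (at t within {0..T})"
    by (intro Lim_cong_within) (use assms(1) t in auto)
  ultimately show "((\<lambda>\<tau>. Hs_norm s (\<lambda>x. g \<tau> x - g t x)) \<longlongrightarrow> 0) (at t within {0..T})" by simp
qed

lemma tint_cnj: "tint (\<lambda>\<tau> \<xi>. cnj (g \<tau> \<xi>)) t \<xi> = cnj (tint g t \<xi>)"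
  unfolding tint_def
proof (cases "(\<lambda>\<tau>. g \<tau> \<xi>) integrable_on {0..t}")
  case True
  from integral_linear[OF True bounded_linear_cnj]
  show "integral {0..t} (\<lambda>\<tau>. cnj (g \<tau> \<xi>)) = cnj (integral {0..t} (\<lambda>\<tau>. g \<tau> \<xi>))" by (simp add: comp_def)
next
  case False
  moreover have "\<not> (\<lambda>\<tau>. cnj (g \<tau> \<xi>)) integrable_on {0..t}"
  proof
    assume "(\<lambda>\<tau>. cnj (g \<tau> \<xi>)) integrable_on {0..t}"
    from integrable_linear[OF this bounded_linear_cnj] False show False by (simp add: comp_def)
  qed
  ultimately show "integral {0..t} (\<lambda>\<tau>. cnj (g \<tau> \<xi>)) = cnj (integral {0..t} (\<lambda>\<tau>. g \<tau> \<xi>))"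
    by (simp add: not_integrable_integral)
qed

text \<open>The time derivative of \<open>Nb\<close>; the two terms that come from the moving
  endpoints of the integrals cancel.\<close>

definition Ntb :: "(real \<Rightarrow> real \<Rightarrow> complex) \<Rightarrow> real \<Rightarrow> real \<Rightarrow> complex" where
  "Ntb Y t \<xi> = - (of_real \<xi>)\<^sup>2 * (of_real (cos (t * \<xi>)) * tint (\<lambda>\<tau> \<xi>. of_real (cos (\<tau> * \<xi>)) * Y \<tau> \<xi>) t \<xi>
      + of_real (sin (t * \<xi>)) * tint (\<lambda>\<tau> \<xi>. of_real (sin (\<tau> * \<xi>)) * Y \<tau> \<xi>) t \<xi>)"

lemma trig_Y_cont:
  fixes Y :: "real \<Rightarrow> real \<Rightarrow> complex"
  assumes "strip_cont T Y"
  shows "strip_cont T (\<lambda>\<tau> \<xi>. of_real (cos (\<tau> * \<xi>)) * Y \<tau> \<xi>)" "strip_cont T (\<lambda>\<tau> \<xi>. of_real (sin (\<tau> * \<xi>)) * Y \<tau> \<xi>)"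
  using assms unfolding strip_cont_def by (auto intro!: continuous_intros)

lemma strip_cont_Ntb: "strip_cont T Y \<Longrightarrow> strip_cont T (Ntb Y)"
  using strip_cont_tint[OF trig_Y_cont(1)] strip_cont_tint[OF trig_Y_cont(2)]
  unfolding strip_cont_def Ntb_def by (auto intro!: continuous_intros)

text \<open>In the second derivative the endpoint terms add up to sin^2 + cos^2 = 1 times the
  forcing, which is how the source of the wave equation appears.\<close>

lemma wave_derivatives:
  assumes Y: "strip_cont T Y" and t: "t \<in> {0..T}"
  shows "((\<lambda>\<tau>. Nb Y \<tau> \<xi>) has_vector_derivative Ntb Y t \<xi>) (at t within {0..T})"
    and "((\<lambda>\<tau>. Ntb Y \<tau> \<xi>) has_vector_derivative - (of_real \<xi>)\<^sup>2 * Nb Y t \<xi> - (of_real \<xi>)\<^sup>2 * Y t \<xi>) (at t within {0..T})"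
proof -
  define C where "C = (\<lambda>t. tint (\<lambda>\<tau> \<xi>. of_real (cos (\<tau> * \<xi>)) * Y \<tau> \<xi>) t \<xi>)"
  define S where "S = (\<lambda>t. tint (\<lambda>\<tau> \<xi>. of_real (sin (\<tau> * \<xi>)) * Y \<tau> \<xi>) t \<xi>)"
  have CS: "tint (\<lambda>\<tau> \<xi>. of_real (cos (\<tau> * \<xi>)) * Y \<tau> \<xi>) s \<xi> = C s" "tint (\<lambda>\<tau> \<xi>. of_real (sin (\<tau> * \<xi>)) * Y \<tau> \<xi>) s \<xi> = S s" for s
    unfolding C_def S_def by auto
  have dC: "(C has_vector_derivative of_real (cos (t * \<xi>)) * Y t \<xi>) (at t within {0..T})"
    unfolding C_def by (rule tint_derivative[OF trig_Y_cont(1)[OF Y] t])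
  have dS: "(S has_vector_derivative of_real (sin (t * \<xi>)) * Y t \<xi>) (at t within {0..T})"
    unfolding S_def by (rule tint_derivative[OF trig_Y_cont(2)[OF Y] t])
  have dc: "((\<lambda>t. complex_of_real (cos (t * \<xi>))) has_vector_derivative of_real (- sin (t * \<xi>) * \<xi>)) (at t within {0..T})"
    by (rule has_vector_derivative_complex_of_real) (auto intro!: derivative_eq_intros simp: has_real_derivative_iff_has_vector_derivative[symmetric])
  have ds: "((\<lambda>t. complex_of_real (sin (t * \<xi>))) has_vector_derivative of_real (cos (t * \<xi>) * \<xi>)) (at t within {0..T})"
    by (rule has_vector_derivative_complex_of_real) (auto intro!: derivative_eq_intros simp: has_real_derivative_iff_has_vector_derivative[symmetric])
  have cs: "(complex_of_real (sin (t * \<xi>)))\<^sup>2 + (complex_of_real (cos (t * \<xi>)))\<^sup>2 = 1"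
    by (metis of_real_1 of_real_add of_real_power sin_cos_squared_add)
  have "((\<lambda>t. - of_real \<xi> * (of_real (sin (t * \<xi>)) * C t - of_real (cos (t * \<xi>)) * S t)) has_vector_derivative
     - of_real \<xi> * ((of_real (sin (t * \<xi>)) * (of_real (cos (t * \<xi>)) * Y t \<xi>) + of_real (cos (t * \<xi>) * \<xi>) * C t)
       - (of_real (cos (t * \<xi>)) * (of_real (sin (t * \<xi>)) * Y t \<xi>) + of_real (- sin (t * \<xi>) * \<xi>) * S t))) (at t within {0..T})"
    by (intro has_vector_derivative_mult_right has_vector_derivative_diff has_vector_derivative_mult dC dS dc ds)
  then show "((\<lambda>\<tau>. Nb Y \<tau> \<xi>) has_vector_derivative Ntb Y t \<xi>) (at t within {0..T})"
    unfolding Nb_def Ntb_def CS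
    by (rule has_vector_derivative_eq_rhs) (simp add: power2_eq_square algebra_simps)
  have "((\<lambda>t. - (of_real \<xi>)\<^sup>2 * (of_real (cos (t * \<xi>)) * C t + of_real (sin (t * \<xi>)) * S t)) has_vector_derivative
     - (of_real \<xi>)\<^sup>2 * ((of_real (cos (t * \<xi>)) * (of_real (cos (t * \<xi>)) * Y t \<xi>) + of_real (- sin (t * \<xi>) * \<xi>) * C t)
       + (of_real (sin (t * \<xi>)) * (of_real (sin (t * \<xi>)) * Y t \<xi>) + of_real (cos (t * \<xi>) * \<xi>) * S t))) (at t within {0..T})"
    by (intro has_vector_derivative_mult_right has_vector_derivative_add has_vector_derivative_mult dC dS dc ds)
  moreover have "- (of_real \<xi>)\<^sup>2 * ((of_real (cos (t * \<xi>)) * (of_real (cos (t * \<xi>)) * Y t \<xi>) + of_real (- sin (t * \<xi>) * \<xi>) * C t)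
       + (of_real (sin (t * \<xi>)) * (of_real (sin (t * \<xi>)) * Y t \<xi>) + of_real (cos (t * \<xi>) * \<xi>) * S t))
     = - (of_real \<xi>)\<^sup>2 * (- of_real \<xi> * (of_real (sin (t * \<xi>)) * C t - of_real (cos (t * \<xi>)) * S t))
       - (of_real \<xi>)\<^sup>2 * (((of_real (sin (t * \<xi>)))\<^sup>2 + (of_real (cos (t * \<xi>)))\<^sup>2) * Y t \<xi>)"
    by (simp add: power2_eq_square algebra_simps)
  ultimately show "((\<lambda>\<tau>. Ntb Y \<tau> \<xi>) has_vector_derivative - (of_real \<xi>)\<^sup>2 * Nb Y t \<xi> - (of_real \<xi>)\<^sup>2 * Y t \<xi>) (at t within {0..T})"
    unfolding Nb_def Ntb_def CS cs by simp
qed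

lemma Sb_derivative:
  assumes G: "strip_cont T G" and t: "t \<in> {0..T}"
  shows "((\<lambda>\<tau>. Sb p G \<tau> \<xi>) has_vector_derivative - \<i> * ((of_real \<xi>)\<^sup>2 * Sb p G t \<xi> + G t \<xi>)) (at t within {0..T})"
proof -
  define I where "I = (\<lambda>t. tint (\<lambda>\<tau> \<xi>. exp (\<i> * of_real (\<tau> * \<xi>\<^sup>2)) * G \<tau> \<xi>) t \<xi>)"
  have I: "tint (\<lambda>\<tau> \<xi>. exp (\<i> * of_real (\<tau> * \<xi>\<^sup>2)) * G \<tau> \<xi>) s \<xi> = I s" for s unfolding I_def ..
  have "strip_cont T (\<lambda>\<tau> \<xi>. exp (\<i> * of_real (\<tau> * \<xi>\<^sup>2)) * G \<tau> \<xi>)"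
    using G unfolding strip_cont_def by (auto intro!: continuous_intros)
  from tint_derivative[OF this t] have dI: "(I has_vector_derivative exp (\<i> * of_real (t * \<xi>\<^sup>2)) * G t \<xi>) (at t within {0..T})"
    unfolding I_def .
  have de: "((\<lambda>t. exp (- \<i> * of_real (t * \<xi>\<^sup>2))) has_vector_derivative exp (- \<i> * of_real (t * \<xi>\<^sup>2)) * (- \<i> * (of_real \<xi>)\<^sup>2)) (at t within {0..T})"
  proof -
    have "((\<lambda>t. exp (t *\<^sub>R (- \<i> * (of_real \<xi>)\<^sup>2))) has_vector_derivative exp (t *\<^sub>R (- \<i> * (of_real \<xi>)\<^sup>2)) * (- \<i> * (of_real \<xi>)\<^sup>2)) (at t within {0..T})"
      by (rule exp_scaleR_has_vector_derivative_right)
    then show ?thesis by (simp add: scaleR_conv_of_real mult_ac)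
  qed
  have d1: "((\<lambda>t. p \<xi> - \<i> * I t) has_vector_derivative 0 - \<i> * (exp (\<i> * of_real (t * \<xi>\<^sup>2)) * G t \<xi>)) (at t within {0..T})"
    by (intro has_vector_derivative_diff has_vector_derivative_const has_vector_derivative_mult_right dI)
  have ee: "exp (- \<i> * of_real (t * \<xi>\<^sup>2)) * exp (\<i> * of_real (t * \<xi>\<^sup>2)) = 1"
    by (simp add: exp_add[symmetric])
  have "exp (- \<i> * of_real (t * \<xi>\<^sup>2)) * (0 - \<i> * (exp (\<i> * of_real (t * \<xi>\<^sup>2)) * G t \<xi>)) + exp (- \<i> * of_real (t * \<xi>\<^sup>2)) * (- \<i> * (of_real \<xi>)\<^sup>2) * (p \<xi> - \<i> * I t)
     = - \<i> * ((of_real \<xi>)\<^sup>2 * (exp (- \<i> * of_real (t * \<xi>\<^sup>2)) * (p \<xi> - \<i> * I t)) + (exp (- \<i> * of_real (t * \<xi>\<^sup>2)) * exp (\<i> * of_real (t * \<xi>\<^sup>2))) * G t \<xi>)"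
    by (simp add: algebra_simps)
  with has_vector_derivative_mult[OF de d1] show ?thesis
    unfolding Sb_def I ee by simp
qed

context ck_scale
begin

text \<open>The smallest radius b/2 gives a majorant independent of time, which every exchange of
  limits and integrals below relies on.\<close>

lemma adm_dominated:
  assumes U: "adm W K U" and K: "0 \<le> K" and W: "\<And>\<xi>. 0 \<le> W \<xi>" and t: "t \<in> {0..T}"
  shows "cmod (U t \<xi>) \<le> K * W \<xi> * exp (- (b / 2) * \<bar>\<xi>\<bar>)"
proof -
  have "b / 2 * \<bar>\<xi>\<bar> \<le> a t * \<bar>\<xi>\<bar>" using a_bounds(1)[OF t] by (intro mult_right_mono) auto
  then have "K * W \<xi> * exp (- a t * \<bar>\<xi>\<bar>) \<le> K * W \<xi> * exp (- (b / 2) * \<bar>\<xi>\<bar>)"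
    using K W by (intro mult_left_mono) auto
  then show ?thesis using admD(2)[OF U t, of \<xi>] by linarith
qed

lemma adm_measurable: "adm W K U \<Longrightarrow> t \<in> {0..T} \<Longrightarrow> U t \<in> borel_measurable borel"
  by (rule borel_measurable_continuous_onI[OF strip_cont_space[OF admD(1)]])

lemma adm_rapid:
  assumes U: "adm W K U" and K: "0 \<le> K" and W: "\<And>\<xi>. 0 \<le> W \<xi>" "integrable lborel W" and t: "t \<in> {0..T}"
  shows "rapid (U t)"
  by (rule rapid_bound[OF integrable_weight_moment[OF W] adm_measurable[OF U t] adm_dominated[OF U K W(1) t]]) (use b in simp)

lemma adm_continuous_in_Hs:
  assumes U: "adm W K U" and K: "0 \<le> K" and W: "\<And>\<xi>. 0 \<le> W \<xi>" "integrable lborel W" "\<And>\<xi>. W \<xi> \<le> B"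
  shows "continuous_in_Hs T s (\<lambda>t. synth (U t))"
proof (rule continuous_in_Hs_synth[where B="K * B", OF adm_measurable[OF U] adm_dominated[OF U K W(1)] integrable_weight_moment[OF W(1,2)]])
  show "K * W \<xi> * exp (- (b / 2) * \<bar>\<xi>\<bar>) \<le> K * B" for \<xi>
  proof -
    have "K * W \<xi> * exp (- (b / 2) * \<bar>\<xi>\<bar>) \<le> K * W \<xi> * 1" using K W b by (intro mult_left_mono) auto
    also have "\<dots> \<le> K * B" using K W(3)[of \<xi>] by (simp add: mult_left_mono)
    finally show ?thesis .
  qed
  show "continuous_on {0..T} (\<lambda>t. U t \<xi>)" for \<xi> by (rule strip_cont_time[OF admD(1)[OF U]])
qed (use b in auto)

text \<open>Here the factor \<xi>^2 is simply kept: it matters for regularity only, and the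
  exponential absorbs it when moments are taken.\<close>

lemma Ntb_bound:
  assumes Y: "adm W K Y" and K: "0 \<le> K" and W: "\<And>\<xi>. 0 \<le> W \<xi>" and t: "t \<in> {0..T}"
  shows "cmod (Ntb Y t \<xi>) \<le> \<xi>\<^sup>2 * (2 * T * K * W \<xi> * exp (- (b / 2) * \<bar>\<xi>\<bar>))"
proof -
  let ?D = "K * W \<xi> * exp (- (b / 2) * \<bar>\<xi>\<bar>)"
  have D0: "0 \<le> ?D" using K W by simp
  have i: "cmod (tint (\<lambda>\<tau> \<xi>. of_real (f (\<tau> * \<xi>)) * Y \<tau> \<xi>) t \<xi>) \<le> T * ?D"
    if f: "strip_cont T (\<lambda>\<tau> \<xi>. of_real (f (\<tau> * \<xi>)) * Y \<tau> \<xi>)" "\<And>x. \<bar>f x\<bar> \<le> 1" for f :: "real \<Rightarrow> real"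
  proof -
    have "cmod (tint (\<lambda>\<tau> \<xi>. of_real (f (\<tau> * \<xi>)) * Y \<tau> \<xi>) t \<xi>) \<le> integral {0..t} (\<lambda>\<tau>. ?D)"
    proof (rule tint_bound[OF f(1) t])
      fix \<tau> assume "\<tau> \<in> {0..t}"
      then have "\<bar>f (\<tau> * \<xi>)\<bar> * cmod (Y \<tau> \<xi>) \<le> 1 * ?D"
        using t by (intro mult_mono f adm_dominated[OF Y K W]) auto
      then show "cmod (of_real (f (\<tau> * \<xi>)) * Y \<tau> \<xi>) \<le> ?D" by (simp add: norm_mult)
    qed auto
    also have "\<dots> = t * ?D" using t by simp
    also have "\<dots> \<le> T * ?D" using t D0 by (intro mult_right_mono) auto
    finally show ?thesis .
  qed
  note i1 = i[OF trig_Y_cont(1)[OF admD(1)[OF Y]] abs_cos_le_one] and i2 = i[OF trig_Y_cont(2)[OF admD(1)[OF Y]] abs_sin_le_one]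
  let ?x = "of_real (cos (t * \<xi>)) * tint (\<lambda>\<tau> \<xi>. of_real (cos (\<tau> * \<xi>)) * Y \<tau> \<xi>) t \<xi>"
  let ?y = "of_real (sin (t * \<xi>)) * tint (\<lambda>\<tau> \<xi>. of_real (sin (\<tau> * \<xi>)) * Y \<tau> \<xi>) t \<xi>"
  have "cmod ?x \<le> 1 * (T * ?D)" unfolding norm_mult norm_of_real by (intro mult_mono i1) auto
  moreover have "cmod ?y \<le> 1 * (T * ?D)" unfolding norm_mult norm_of_real by (intro mult_mono i2) auto
  ultimately have "cmod (?x + ?y) \<le> 1 * (T * ?D) + 1 * (T * ?D)" by (rule norm_triangle_mono)
  then have "cmod (Ntb Y t \<xi>) \<le> \<xi>\<^sup>2 * (1 * (T * ?D) + 1 * (T * ?D))"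
    unfolding Ntb_def norm_mult[of "- (of_real \<xi>)\<^sup>2"] norm_minus_cancel norm_power norm_of_real power2_abs
    by (intro mult_left_mono) auto
  then show ?thesis by (simp add: mult_ac)
qed

end

lemma synth_add:
  assumes "integrable lborel f" "integrable lborel g"
  shows "synth (\<lambda>x. f x + g x) x = synth f x + synth g x"
  unfolding synth_def distrib_left
  by (rule Bochner_Integration.integral_add[OF integrable_exp_mult[OF assms(1)] integrable_exp_mult[OF assms(2)]])

lemma synth_cmult: "synth (\<lambda>\<xi>. c * F \<xi>) x = c * synth F x"
  unfolding synth_def by (subst integral_mult_right_zero[symmetric]) (simp only: mult_ac)

lemma synth_zero: "synth (\<lambda>\<xi>. 0) x = 0"
  unfolding synth_def by simp

text \<open>Hermitian symmetry of the source passes to its wave evolution by the parity of sine,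
  cosine and the powers of \<xi>; this makes n real.\<close>

lemma Nb_cnj:
  assumes "\<And>t \<xi>. Y t (- \<xi>) = cnj (Y t \<xi>)"
  shows "Nb Y t (- \<xi>) = cnj (Nb Y t \<xi>)" "Ntb Y t (- \<xi>) = cnj (Ntb Y t \<xi>)"
proof -
  have 1: "tint (\<lambda>\<tau> \<xi>. of_real (cos (\<tau> * \<xi>)) * Y \<tau> \<xi>) t (- \<xi>) = cnj (tint (\<lambda>\<tau> \<xi>. of_real (cos (\<tau> * \<xi>)) * Y \<tau> \<xi>) t \<xi>)"
    unfolding tint_cnj[symmetric] unfolding tint_def by (simp add: assms)
  have 2: "tint (\<lambda>\<tau> \<xi>. of_real (sin (\<tau> * \<xi>)) * Y \<tau> \<xi>) t (- \<xi>) = - cnj (tint (\<lambda>\<tau> \<xi>. of_real (sin (\<tau> * \<xi>)) * Y \<tau> \<xi>) t \<xi>)"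
    unfolding tint_cnj[symmetric] unfolding tint_def by (simp add: assms)
  show "Nb Y t (- \<xi>) = cnj (Nb Y t \<xi>)" "Ntb Y t (- \<xi>) = cnj (Ntb Y t \<xi>)"
    unfolding Nb_def Ntb_def 1 2 by (simp_all add: algebra_simps)
qed

lemma Yb_cnj: "Yb U U t (- \<xi>) = cnj (Yb U U t \<xi>)"
proof -
  have "Yb U U t (- \<xi>) = (LINT \<eta>|lborel. U t (- \<xi> + (\<xi> + 1 * \<eta>)) * cnj (U t (\<xi> + 1 * \<eta>)))"
    unfolding Yb_def by (subst lborel_integral_real_affine[of 1 _ \<xi>]) auto
  also have "\<dots> = (LINT \<eta>|lborel. cnj (U t (\<xi> + \<eta>) * cnj (U t \<eta>)))"
    by (intro Bochner_Integration.integral_cong) (auto simp: mult.commute)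
  finally show ?thesis unfolding Yb_def by (subst (asm) Bochner_Integration.integral_cnj)
qed

lemma synth_real:
  assumes "\<And>\<xi>. F (- \<xi>) = cnj (F \<xi>)"
  shows "of_real (Re (synth F x)) = synth F x"
proof -
  have "cnj (synth F x) = synth F x" unfolding synth_cnj assms by simp
  then show ?thesis by (metis Reals_cnj_iff complex_is_Real_iff of_real_Re)
qed

context ck_system
begin

text \<open>The fixed-point equation is differentiated in time at each frequency and then
  synthesised, with majorants of the form |\<xi>|^j W e^{-b|\<xi>|/2} independent of time. The
  remaining conclusions keep the spectral form of n and the closeness of \<open>U\<close> to the
  free evolution for the lower bound.\<close>

theorem zakharov_solution_exists:
  obtains u n U where "zakharov_solution T (synth p) (\<lambda>x. 0) (\<lambda>x. 0) u n"
    "\<And>t x. t \<in> {0..T} \<Longrightarrow> complex_of_real (n t x) = synth (NN U t) x"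
    "adm W1 (2 * A) U"
    "\<And>t \<xi>. t \<in> {0..T} \<Longrightarrow> cmod (U t \<xi> - exp (- \<i> * of_real (t * \<xi>\<^sup>2)) * p \<xi>) \<le> \<kappa> * A * W1 \<xi>"
proof -
  obtain U where U: "adm W1 (2 * A) U" "\<And>t \<xi>. t \<in> {0..T} \<Longrightarrow> U t \<xi> = Sb p (GG U) t \<xi>"
    "\<And>t \<xi>. t \<in> {0..T} \<Longrightarrow> cmod (U t \<xi> - exp (- \<i> * of_real (t * \<xi>\<^sup>2)) * p \<xi>) \<le> \<kappa> * A * W1 \<xi>"
    by (rule fixed_point) blast
  define Y where "Y = Yb U U"
  define N where "N = NN U"
  define G where "G = GG U"
  have NY: "N = Nb Y" unfolding N_def NN_def Y_def ..
  have A0: "0 \<le> 2 * A" using A by simp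
  define KY where "KY = 2 * A * (2 * A) * C"
  define KN where "KN = KY * (2 * T / b)"
  define KG where "KG = KN * (2 * A) * C"
  have K0: "0 \<le> KY" "0 \<le> KN" "0 \<le> KG"
    unfolding KG_def KN_def KY_def by (intro mult_nonneg_nonneg const_nonneg; use A C in simp)+
  have Y: "adm W2 KY Y" unfolding Y_def KY_def by (rule Y_adm[OF U(1) U(1) A0 A0])
  have N: "adm W2 KN N" unfolding N_def KN_def KY_def by (rule NN_adm[OF U(1) A0])
  have G: "adm W1 KG G" unfolding G_def KG_def KN_def KY_def by (rule GG_adm[OF U(1) A0])
  note rU = adm_rapid[OF U(1) A0 W_nonneg(1) W1(4)] and rY = adm_rapid[OF Y K0(1) W_nonneg(2) W2(4)]
    and rN = adm_rapid[OF N K0(2) W_nonneg(2) W2(4)] and rG = adm_rapid[OF G K0(3) W_nonneg(1) W1(4)]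
  have b2: "b / 2 > 0" using b by simp
  note mom1 = integrable_weight_moment[OF W_nonneg(1) W1(4) b2] and mom2 = integrable_weight_moment[OF W_nonneg(2) W2(4) b2]
  note dom = adm_dominated[OF U(1) A0 W_nonneg(1)] adm_dominated[OF Y K0(1) W_nonneg(2)] adm_dominated[OF N K0(2) W_nonneg(2)]
    adm_dominated[OF G K0(3) W_nonneg(1)]
  note meas = adm_measurable[OF U(1)] adm_measurable[OF Y] adm_measurable[OF N] adm_measurable[OF G]
  have z: "0 \<in> {0..T}" using T by simp
  have Ycnj: "Y t (- \<xi>) = cnj (Y t \<xi>)" for t \<xi> unfolding Y_def by (rule Yb_cnj)
  have Ncnj: "N t (- \<xi>) = cnj (N t \<xi>)" and Ntcnj: "Ntb Y t (- \<xi>) = cnj (Ntb Y t \<xi>)" for t \<xi>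
    unfolding NY using Nb_cnj[of Y, OF Ycnj] by auto
  define u where "u = (\<lambda>t. synth (U t))"
  \<comment> \<open>The real part makes \<open>n\<close> real-valued by type; by the Hermitian
    symmetry of \<open>N\<close> the imaginary part is zero.\<close>
  define n where "n = (\<lambda>t x. Re (synth (N t) x))"
  define nt where "nt = (\<lambda>t x. Re (synth (Ntb Y t) x))"
  have nN: "complex_of_real (n t x) = synth (N t) x" for t x unfolding n_def by (rule synth_real[of "N t"]) (rule Ncnj)
  have ntN: "complex_of_real (nt t x) = synth (Ntb Y t) x" for t x unfolding nt_def by (rule synth_real[of "Ntb Y t"]) (rule Ntcnj)
  define Ut where "Ut = (\<lambda>t \<xi>. - \<i> * ((of_real \<xi>)\<^sup>2 * U t \<xi> + G t \<xi>))"
  define Ntt where "Ntt = (\<lambda>t \<xi>. - (of_real \<xi>)\<^sup>2 * N t \<xi> - (of_real \<xi>)\<^sup>2 * Y t \<xi>)"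
  have dU: "((\<lambda>\<tau>. U \<tau> \<xi>) has_vector_derivative Ut t \<xi>) (at t within {0..T})" if t: "t \<in> {0..T}" for t \<xi>
  proof -
    have "((\<lambda>\<tau>. Sb p G \<tau> \<xi>) has_vector_derivative Ut t \<xi>) (at t within {0..T})"
      unfolding Ut_def U(2)[OF t] G_def by (rule Sb_derivative[OF admD(1)[OF G, unfolded G_def] t])
    then show ?thesis by (rule has_vector_derivative_transform[rotated 2]) (use U(2) t in \<open>auto simp: G_def\<close>)
  qed
  have Ut_le: "cmod (Ut t \<xi>) \<le> \<bar>\<xi>\<bar> ^ 2 * (2 * A * W1 \<xi> * exp (- (b / 2) * \<bar>\<xi>\<bar>)) + \<bar>\<xi>\<bar> ^ 0 * (KG * W1 \<xi> * exp (- (b / 2) * \<bar>\<xi>\<bar>))"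
    if t: "t \<in> {0..T}" for t \<xi>
  proof -
    have "cmod (Ut t \<xi>) \<le> cmod ((of_real \<xi>)\<^sup>2 * U t \<xi>) + cmod (G t \<xi>)"
      unfolding Ut_def norm_mult[of "- \<i>"] using norm_triangle_ineq by simp
    also have "cmod ((of_real \<xi>)\<^sup>2 * U t \<xi>) = \<bar>\<xi>\<bar> ^ 2 * cmod (U t \<xi>)" by (simp add: norm_mult norm_power)
    also have "\<dots> + cmod (G t \<xi>) \<le> \<bar>\<xi>\<bar> ^ 2 * (2 * A * W1 \<xi> * exp (- (b / 2) * \<bar>\<xi>\<bar>)) + KG * W1 \<xi> * exp (- (b / 2) * \<bar>\<xi>\<bar>)"
      by (intro add_mono mult_left_mono dom t) auto
    finally show ?thesis by simp
  qed
  have u_t: "((\<lambda>\<tau>. u \<tau> x) has_vector_derivative synth (Ut t) x) (at t within {0..T})" if t: "t \<in> {0..T}" for t x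
    unfolding u_def
  proof (rule synth_time_derivative[OF dU rapid_integrable[OF rU] _ _ Ut_le t])
    show "Ut t \<in> borel_measurable borel" if "t \<in> {0..T}" for t unfolding Ut_def using meas that by measurable
  qed (assumption | intro Bochner_Integration.integrable_add mom1)+
  have n_t: "((\<lambda>\<tau>. n \<tau> x) has_vector_derivative nt t x) (at t within {0..T})" if t: "t \<in> {0..T}" for t x
    unfolding n_def nt_def
  proof (rule bounded_linear.has_vector_derivative[OF bounded_linear_Re])
    show "((\<lambda>\<tau>. synth (N \<tau>) x) has_vector_derivative synth (Ntb Y t) x) (at t within {0..T})"
    proof (rule synth_time_derivative[OF _ rapid_integrable[OF rN] _ _ _ t])
      show "((\<lambda>\<tau>. N \<tau> \<xi>) has_vector_derivative Ntb Y t \<xi>) (at t within {0..T})" if "t \<in> {0..T}" for t \<xi>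
        unfolding NY by (rule wave_derivatives(1)[OF admD(1)[OF Y] that])
      show "Ntb Y t \<in> borel_measurable borel" if "t \<in> {0..T}" for t
        by (rule borel_measurable_continuous_onI[OF strip_cont_space[OF strip_cont_Ntb[OF admD(1)[OF Y]] that]])
      show "cmod (Ntb Y t \<xi>) \<le> \<bar>\<xi>\<bar> ^ 2 * (2 * T * KY * W2 \<xi> * exp (- (b / 2) * \<bar>\<xi>\<bar>))" if "t \<in> {0..T}" for t \<xi>
        using Ntb_bound[OF Y K0(1) W_nonneg(2) that, of \<xi>] by simp
    qed (assumption | rule mom2)+
  qed
  have Ntt_le: "cmod (Ntt t \<xi>) \<le> \<bar>\<xi>\<bar> ^ 2 * ((KN + KY) * W2 \<xi> * exp (- (b / 2) * \<bar>\<xi>\<bar>))" if t: "t \<in> {0..T}" for t \<xi>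
  proof -
    have "cmod (Ntt t \<xi>) \<le> cmod (- (of_real \<xi>)\<^sup>2 * N t \<xi>) + cmod ((of_real \<xi>)\<^sup>2 * Y t \<xi>)"
      unfolding Ntt_def by (rule norm_triangle_ineq4)
    also have "\<dots> = \<bar>\<xi>\<bar> ^ 2 * (cmod (N t \<xi>) + cmod (Y t \<xi>))" by (simp add: norm_mult norm_power algebra_simps)
    also have "\<dots> \<le> \<bar>\<xi>\<bar> ^ 2 * (KN * W2 \<xi> * exp (- (b / 2) * \<bar>\<xi>\<bar>) + KY * W2 \<xi> * exp (- (b / 2) * \<bar>\<xi>\<bar>))"
      by (intro add_mono mult_left_mono dom t) auto
    finally show ?thesis by (simp add: algebra_simps)
  qed
  have Nttm: "Ntt t \<in> borel_measurable borel" if "t \<in> {0..T}" for t unfolding Ntt_def using meas that by measurable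
  have Ntbc: "strip_cont T (Ntb Y)" by (rule strip_cont_Ntb[OF admD(1)[OF Y]])
  have Ntbm: "Ntb Y t \<in> borel_measurable borel" if "t \<in> {0..T}" for t
    by (rule borel_measurable_continuous_onI[OF strip_cont_space[OF Ntbc that]])
  have momN: "integrable lborel (\<lambda>\<xi>. \<bar>\<xi>\<bar> ^ j * (\<xi>\<^sup>2 * (2 * T * KY * W2 \<xi> * exp (- (b / 2) * \<bar>\<xi>\<bar>))))" for j
    using mom2[of "j + 2" "2 * T * KY"] unfolding power_add power2_abs mult.assoc .
  have Ntb_le: "cmod (Ntb Y t \<xi>) \<le> \<xi>\<^sup>2 * (2 * T * KY * W2 \<xi> * exp (- (b / 2) * \<bar>\<xi>\<bar>))" if "t \<in> {0..T}" for t \<xi>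
    by (rule Ntb_bound[OF Y K0(1) W_nonneg(2) that])
  have rNt: "rapid (Ntb Y t)" if t: "t \<in> {0..T}" for t
    by (rule rapid_bound[OF momN Ntbm[OF t] Ntb_le[OF t]])
  have nt_t: "((\<lambda>\<tau>. nt \<tau> x) has_vector_derivative Re (synth (Ntt t) x)) (at t within {0..T})" if t: "t \<in> {0..T}" for t x
    unfolding nt_def
  proof (rule bounded_linear.has_vector_derivative[OF bounded_linear_Re])
    show "((\<lambda>\<tau>. synth (Ntb Y \<tau>) x) has_vector_derivative synth (Ntt t) x) (at t within {0..T})"
    proof (rule synth_time_derivative[OF _ rapid_integrable[OF rNt] Nttm mom2 Ntt_le t])
      show "((\<lambda>\<tau>. Ntb Y \<tau> \<xi>) has_vector_derivative Ntt t \<xi>) (at t within {0..T})" if "t \<in> {0..T}" for t \<xi>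
        unfolding Ntt_def NY by (rule wave_derivatives(2)[OF admD(1)[OF Y] that])
    qed
  qed
  have dtn: "dt T n t x = nt t x" if "t \<in> {0..T}" for t x by (rule dt_eqI[OF T that n_t[OF that]])
  have dtn_t: "((\<lambda>\<tau>. dt T n \<tau> x) has_vector_derivative Re (synth (Ntt t) x)) (at t within {0..T})" if t: "t \<in> {0..T}" for t x
    using nt_t[OF t] by (rule has_vector_derivative_transform[rotated 2]) (use dtn t in auto)
  have smN: "smooth_fun (synth (N t))" "smooth_fun (synth (Y t))" "smooth_fun (synth (U t))" if "t \<in> {0..T}" for t
    by (intro smooth_fun_synth rN rY rU that)+
  have n_fun: "n t = (\<lambda>x. Re (synth (N t) x))" for t unfolding n_def ..
  have u2: "(\<lambda>y. (cmod (u t y))\<^sup>2) = (\<lambda>y. Re (synth (Y t) y))" if t: "t \<in> {0..T}" for t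
  proof
    fix y
    have "synth (Y t) y = synth (U t) y * cnj (synth (U t) y)"
      unfolding Y_def Yb_def using rapid_integrable[OF rU[OF t]] by (intro synth_correlation)
    then show "(cmod (u t y))\<^sup>2 = Re (synth (Y t) y)" unfolding u_def by (simp add: complex_mult_cnj cmod_power2)
  qed
  \<comment> \<open>Correlating with the reflected conjugate spectrum undoes both conjugations, so
    \<open>G\<close> is the spectrum of n u.\<close>
  have nu: "synth (G t) x = complex_of_real (n t x) * u t x" if t: "t \<in> {0..T}" for t x
  proof -
    have rr: "integrable lborel (refl U t)" unfolding refl_def
      using lborel_integrable_real_affine[OF rapid_integrable[OF rU[OF t]], of "-1" 0] by simp
    have "synth (G t) x = synth (N t) x * cnj (synth (refl U t) x)"
      unfolding G_def GG_def Yb_def N_def[symmetric] by (rule synth_correlation[OF rapid_integrable[OF rN[OF t]] rr])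
    also have "cnj (synth (refl U t) x) = synth (U t) x" unfolding synth_cnj refl_def by simp
    finally show ?thesis by (simp add: nN u_def)
  qed
  have ii: "integrable lborel (\<lambda>\<xi>. (\<i> * of_real \<xi>)\<^sup>2 * F \<xi>)" if "rapid F" for F
    using rapid_integrable[OF rapid_mult[OF that, of 2]] by simp
  have "zakharov_solution T (synth p) (\<lambda>x. 0) (\<lambda>x. 0) u n"
    unfolding zakharov_solution_def
  proof (intro conjI allI ballI)
    fix m :: nat
    show "continuous_in_Hs T (real m) u"
      unfolding u_def by (rule adm_continuous_in_Hs[OF U(1) A0 W_nonneg(1) W1(4) W1(2)])
    show "continuous_in_Hs T (real m) (\<lambda>t x. complex_of_real (n t x))"
      unfolding nN by (rule adm_continuous_in_Hs[OF N K0(2) W_nonneg(2) W2(4) W2(2)])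
    show "continuous_in_Hs T (real m - 1) (\<lambda>t x. complex_of_real (dt T n t x))"
    proof (rule continuous_in_Hs_cong)
      show "synth (Ntb Y t) = (\<lambda>x. complex_of_real (dt T n t x))" if "t \<in> {0..T}" for t
        using dtn[OF that] ntN by auto
      have "\<xi>\<^sup>2 * (2 * T * KY * W2 \<xi> * exp (- (b / 2) * \<bar>\<xi>\<bar>)) \<le> (real (Suc 2) / (b / 2)) ^ 2 * (2 * T * KY * B)" for \<xi>
      proof -
        have "(\<bar>\<xi>\<bar> ^ 2 * exp (- (b / 2) * \<bar>\<xi>\<bar>)) * (2 * T * KY * W2 \<xi>) \<le> (real (Suc 2) / (b / 2)) ^ 2 * (2 * T * KY * B)"
          using T K0(1) W2(2)[of \<xi>] W_nonneg(2)[of \<xi>] b2 by (intro mult_mono power_le_exp) auto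
        then show ?thesis by (simp add: mult_ac)
      qed
      note le = this
      show "continuous_in_Hs T (real m - 1) (\<lambda>t. synth (Ntb Y t))"
        by (rule continuous_in_Hs_synth[OF Ntbm Ntb_le momN le strip_cont_time[OF Ntbc]])
    qed
  next
    fix t assume t: "t \<in> {0..T}"
    show "smooth_fun (u t)" unfolding u_def by (rule smN(3)[OF t])
    show "smooth_fun (n t)" unfolding n_fun by (rule smooth_fun_Re[OF smN(1)[OF t]])
    fix x
    show "(\<lambda>\<tau>. u \<tau> x) differentiable at t within {0..T}" using u_t[OF t] by (rule differentiableI_vector)
    show "(\<lambda>\<tau>. n \<tau> x) differentiable at t within {0..T}" using n_t[OF t] by (rule differentiableI_vector)
    show "(\<lambda>\<tau>. dt T n \<tau> x) differentiable at t within {0..T}" using dtn_t[OF t] by (rule differentiableI_vector)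
    have dtu: "dt T u t x = synth (Ut t) x" by (rule dt_eqI[OF T t u_t[OF t]])
    have uxx: "(dx ^^ 2) (u t) x = synth (\<lambda>\<xi>. (\<i> * of_real \<xi>)\<^sup>2 * U t \<xi>) x" unfolding u_def dx_iter_synth[OF rU[OF t]] ..
    have iUt: "integrable lborel (\<lambda>\<xi>. \<i> * Ut t \<xi>)"
    proof -
      have "integrable lborel (\<lambda>\<xi>. - ((\<i> * of_real \<xi>)\<^sup>2 * U t \<xi>) + G t \<xi>)"
        using ii[OF rU[OF t]] rapid_integrable[OF rG[OF t]] by simp
      then show ?thesis unfolding Ut_def by (simp add: power_mult_distrib mult.assoc[symmetric] add.commute)
    qed
    have "\<i> * dt T u t x + (dx ^^ 2) (u t) x = synth (\<lambda>\<xi>. \<i> * Ut t \<xi> + (\<i> * of_real \<xi>)\<^sup>2 * U t \<xi>) x"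
      unfolding dtu uxx synth_cmult[symmetric] by (rule synth_add[OF iUt ii[OF rU[OF t]], symmetric])
    also have "(\<lambda>\<xi>. \<i> * Ut t \<xi> + (\<i> * of_real \<xi>)\<^sup>2 * U t \<xi>) = G t"
      unfolding Ut_def by (rule ext) (simp add: power_mult_distrib mult.assoc[symmetric])
    finally show "\<i> * dt T u t x + (dx ^^ 2) (u t) x = complex_of_real (n t x) * u t x" unfolding nu[OF t] .
    have dtt: "dt T (dt T n) t x = Re (synth (Ntt t) x)" by (rule dt_eqI[of T t "dt T n" x, OF T t dtn_t[OF t]])
    have nxx: "(dx ^^ 2) (n t) x = Re (synth (\<lambda>\<xi>. (\<i> * of_real \<xi>)\<^sup>2 * N t \<xi>) x)"
      unfolding n_fun dx_iter_Re[OF smN(1)[OF t]] dx_iter_synth[OF rN[OF t]] ..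
    have yxx: "(dx ^^ 2) (\<lambda>y. (cmod (u t y))\<^sup>2) x = Re (synth (\<lambda>\<xi>. (\<i> * of_real \<xi>)\<^sup>2 * Y t \<xi>) x)"
      unfolding u2[OF t] dx_iter_Re[OF smN(2)[OF t]] dx_iter_synth[OF rY[OF t]] ..
    have "(\<lambda>\<xi>. (\<i> * of_real \<xi>)\<^sup>2 * N t \<xi> + (\<i> * of_real \<xi>)\<^sup>2 * Y t \<xi>) = Ntt t"
      unfolding Ntt_def by (rule ext) (simp add: power_mult_distrib)
    then have "synth (Ntt t) x = synth (\<lambda>\<xi>. (\<i> * of_real \<xi>)\<^sup>2 * N t \<xi>) x + synth (\<lambda>\<xi>. (\<i> * of_real \<xi>)\<^sup>2 * Y t \<xi>) x"
      using synth_add[OF ii[OF rN[OF t]] ii[OF rY[OF t]], of x] by simp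
    then show "dt T (dt T n) t x - (dx ^^ 2) (n t) x = (dx ^^ 2) (\<lambda>y. (cmod (u t y))\<^sup>2) x"
      unfolding dtt nxx yxx by simp
  next
    fix x
    have "U 0 = p" using U(2)[OF z] by (auto simp: Sb_def tint_def)
    then show "u 0 x = synth p x" unfolding u_def by simp
    have "N 0 = (\<lambda>\<xi>. 0)" "Ntb Y 0 = (\<lambda>\<xi>. 0)" unfolding NY Nb_def Ntb_def tint_def by auto
    then have "n 0 x = 0" "nt 0 x = 0" unfolding n_def nt_def by (simp_all add: synth_zero)
    then show "n 0 x = 0" "dt T n 0 x = 0" unfolding dtn[OF z] by auto
  qed
  with nN U(1,3) that show thesis unfolding N_def by blast
qed

end

subsection \<open>A weight concentrated near the lattice \<open>N\<int>\<close>\<close>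

definition cden :: "real \<Rightarrow> real" where "cden x = 1 / (1 + x\<^sup>2)"

lemma cden_pos: "0 < cden x" and cden_le_1: "cden x \<le> 1" and cden_even: "cden (- x) = cden x"
  and cden_nonneg: "0 \<le> cden x"
  using one_plus_square_pos[of x] unfolding cden_def by (auto intro: less_imp_le)

lemma borel_measurable_cden[measurable]: "cden \<in> borel_measurable borel"
  unfolding cden_def[abs_def] by measurable

lemma continuous_on_cden[continuous_intros]: "continuous_on S f \<Longrightarrow> continuous_on S (\<lambda>x. cden (f x))"
  unfolding cden_def using one_plus_square_pos
  by (intro continuous_intros) (auto simp: less_imp_neq[symmetric])

lemma cden_antimono: "\<bar>x\<bar> \<le> \<bar>y\<bar> \<Longrightarrow> cden y \<le> cden x"
  unfolding cden_def using one_plus_square_pos[of x] by (intro divide_left_mono) (auto simp: abs_le_square_iff one_plus_square_pos)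

text \<open>From c^2 \<le> 2 x^2 + 2 y^2 follows 1 + c^2 \<le> 2 (1 + x^2) + 2 (1 + y^2), and
  division by the three brackets gives the claim. It is the pointwise form of the stability of
  Cauchy kernels under convolution.\<close>

lemma cden_mult_le:
  assumes "\<bar>c\<bar> \<le> \<bar>x\<bar> + \<bar>y\<bar>"
  shows "cden x * cden y \<le> 2 * cden c * (cden x + cden y)"
proof -
  have "c\<^sup>2 \<le> (\<bar>x\<bar> + \<bar>y\<bar>)\<^sup>2" using assms by (metis abs_ge_zero power2_abs power_mono)
  also have "\<dots> \<le> 2 * x\<^sup>2 + 2 * y\<^sup>2" using sum_squares_bound[of "\<bar>x\<bar>" "\<bar>y\<bar>"] by (simp add: power2_sum)
  finally have "1 + c\<^sup>2 \<le> 2 * ((1 + x\<^sup>2) + (1 + y\<^sup>2))" by simp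
  then have "(1 + c\<^sup>2) * (cden x * cden y) \<le> 2 * ((1 + x\<^sup>2) + (1 + y\<^sup>2)) * (cden x * cden y)"
    by (intro mult_right_mono mult_nonneg_nonneg cden_nonneg)
  also have "\<dots> = 2 * (cden x + cden y)"
    using one_plus_square_pos[of x] one_plus_square_pos[of y] unfolding cden_def by (simp add: field_simps)
  finally show ?thesis using one_plus_square_pos[of c] unfolding cden_def[of c] by (simp add: field_simps)
qed

lemma nn_integral_cden:
  assumes "c > 0" shows "(\<integral>\<^sup>+x. ennreal (cden (c * (x - d))) \<partial>lborel) = ennreal (pi / c)"
proof -
  have "(\<integral>\<^sup>+x. ennreal (cden (c * (x - d))) \<partial>lborel) = ennreal (1 / c) * (\<integral>\<^sup>+x. ennreal (cden x) \<partial>lborel)"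
    using assms by (subst nn_integral_real_affine[of _ "1 / c" d]) auto
  also have "(\<integral>\<^sup>+x. ennreal (cden x) \<partial>lborel) = ennreal pi"
    using nn_integral_eq_integral[OF integrable_inverse_1_plus_square_lborel] one_plus_square_pos
    unfolding cden_def integral_inverse_1_plus_square_lborel by (auto intro: less_imp_le)
  finally show ?thesis using assms by (simp add: ennreal_mult[symmetric])
qed

text \<open>Up to pi/3 the cosine is at least 1/2, so the difference increases; beyond it sin y is
  at least sqrt 3 / 2 \<ge> 4/5, while y/2 < 4/5.\<close>

lemma sin_ge_half: 
  assumes "0 \<le> y" "y \<le> pi / 2" shows "y / 2 \<le> sin (y::real)"
proof (cases "y \<le> pi / 3")
  case True
  have "(\<lambda>y. sin y - y / 2) 0 \<le> (\<lambda>y. sin y - y / 2) y"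
  proof (rule DERIV_nonneg_imp_nondecreasing[OF assms(1)])
    fix x assume x: "0 \<le> x" "x \<le> y"
    have "cos (pi / 3) \<le> cos x" using x True pi_gt_zero by (intro cos_monotone_0_pi_le) auto
    then have "0 \<le> cos x - 1 / 2" by (simp add: cos_60)
    moreover have "((\<lambda>y. sin y - y / 2) has_real_derivative (cos x - 1 / 2)) (at x)"
      by (auto intro!: derivative_eq_intros)
    ultimately show "\<exists>D. ((\<lambda>y. sin y - y / 2) has_real_derivative D) (at x) \<and> 0 \<le> D" by blast
  qed
  then show ?thesis by simp
next
  case False
  have "sin (pi / 3) \<le> sin y" using False assms by (intro sin_monotone_2pi_le) auto
  moreover have "(8 / 5::real) \<le> sqrt 3" by (rule real_le_rsqrt) (simp add: power2_eq_square)
  moreover have "y < 8 / 5" using assms pi_approx by simp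
  ultimately show ?thesis by (simp add: sin_60)
qed

text \<open>Subtracting the nearest integer changes the sine at most by a sign; then
  \<open>sin_ge_half\<close> and pi \<ge> 2 give the constant 1.\<close>

lemma abs_sin_pi_ge:
  fixes w :: real shows "\<bar>w - of_int (round w)\<bar> \<le> \<bar>sin (pi * w)\<bar>"
proof -
  define c where "c = round w"
  define d where "d = w - of_int c"
  have d: "\<bar>d\<bar> \<le> 1 / 2" using of_int_round_abs_le[of w] unfolding d_def c_def by (simp add: abs_minus_commute)
  have s0: "sin (pi * of_int c) = 0" by (metis mult.commute sin_zero_iff_int2)
  then have c1: "\<bar>cos (pi * of_int c)\<bar> = 1" using sin_zero_abs_cos_one by blast
  have "sin (pi * w) = sin (pi * d + pi * of_int c)" unfolding d_def by (simp add: algebra_simps)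
  then have "\<bar>sin (pi * w)\<bar> = \<bar>sin (pi * d)\<bar>" unfolding sin_add s0 by (simp add: abs_mult c1)
  also have "\<dots> = \<bar>sin (pi * \<bar>d\<bar>)\<bar>" by (cases "d \<ge> 0") auto
  also have "\<dots> \<ge> pi * \<bar>d\<bar> / 2"
    using sin_ge_half[of "pi * \<bar>d\<bar>"] d by simp
  also have "pi * \<bar>d\<bar> / 2 \<ge> \<bar>d\<bar>" using pi_ge_two mult_right_mono[of 2 pi "\<bar>d\<bar>"] by simp
  finally show ?thesis unfolding d_def c_def .
qed

text \<open>As u runs over [0,1] the integer nearest to z + u is one of three consecutive ones, and
  for each of them the integrand is below a Cauchy kernel of mass pi / M.\<close>

lemma nn_integral_period:
  assumes "M > 0"
  shows "(\<integral>\<^sup>+u. ennreal (indicator {0..1} u * cden (M * sin (pi * (z + u)))) \<partial>lborel) \<le> ennreal (3 * pi / M)"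
proof -
  define m where "m = \<lfloor>z\<rfloor>"
  have "indicator {0..1} u * cden (M * sin (pi * (z + u)))
    \<le> cden (M * (u - (of_int m - z))) + cden (M * (u - (of_int m + 1 - z))) + cden (M * (u - (of_int m + 2 - z)))" for u
  proof (cases "u \<in> {0..1}")
    case True
    define c where "c = round (z + u)"
    have "m \<le> c" "c \<le> m + 2" unfolding c_def m_def round_def using True by (simp_all add: floor_mono) linarith+
    then have c: "c \<in> {m, m + 1, m + 2}" by auto
    have "\<bar>M * (z + u - of_int c)\<bar> \<le> \<bar>M * sin (pi * (z + u))\<bar>"
      unfolding abs_mult c_def by (intro mult_left_mono abs_sin_pi_ge) auto
    from cden_antimono[OF this] have "cden (M * sin (pi * (z + u))) \<le> cden (M * (u - (of_int c - z)))" by (simp add: algebra_simps)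
    with c True show ?thesis using cden_nonneg by (auto simp: algebra_simps add_increasing add_increasing2)
  qed (simp add: cden_nonneg)
  then have "(\<integral>\<^sup>+u. ennreal (indicator {0..1} u * cden (M * sin (pi * (z + u)))) \<partial>lborel)
    \<le> (\<integral>\<^sup>+u. ennreal (cden (M * (u - (of_int m - z)))) + ennreal (cden (M * (u - (of_int m + 1 - z)))) + ennreal (cden (M * (u - (of_int m + 2 - z)))) \<partial>lborel)"
    by (intro nn_integral_mono) (simp add: cden_nonneg ennreal_leI flip: ennreal_plus)
  also have "\<dots> = ennreal (pi / M) + ennreal (pi / M) + ennreal (pi / M)"
    by (simp add: nn_integral_add nn_integral_cden[OF assms])
  also have "\<dots> = ennreal (3 * pi / M)" using assms by (simp flip: ennreal_plus)
  finally show ?thesis .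
qed

lemma cden_shift_le:
  assumes "u \<in> {0..1}" shows "cden y \<le> 3 * cden (y + u)"
proof -
  have "(y + u)\<^sup>2 \<le> 2 * y\<^sup>2 + 2 * u\<^sup>2" using sum_squares_bound[of y u] by (simp add: power2_sum)
  also have "u\<^sup>2 \<le> 1" using assms by (simp add: power_le_one)
  finally have "(y + u)\<^sup>2 \<le> 2 * y\<^sup>2 + 2" by simp
  moreover have "0 \<le> y\<^sup>2" by (rule zero_le_power2)
  moreover have "1 + p \<le> 3 * (1 + q)" if "p \<le> 2 * q + 2" "0 \<le> q" for p q :: real using that by simp
  ultimately have "1 + (y + u)\<^sup>2 \<le> 3 * (1 + y\<^sup>2)" by blast
  then show ?thesis unfolding cden_def using one_plus_square_pos[of y] one_plus_square_pos[of "y + u"] by (simp add: field_simps)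
qed

text \<open>Since \<open>cden\<close> varies slowly, the periodic factor can be averaged over a period.\<close>

lemma nn_integral_cden_periodic:
  assumes M: "M > 0"
  shows "(\<integral>\<^sup>+y. ennreal (cden y * cden (M * sin (pi * (x - y)))) \<partial>lborel) \<le> ennreal (9 * pi\<^sup>2 / M)"
proof -
  let ?q = "\<lambda>z. cden (M * sin (pi * z))"
  let ?I = "indicator {0..1::real} :: real \<Rightarrow> real"
  have "(\<integral>\<^sup>+y. ennreal (cden y * ?q (x - y)) \<partial>lborel) = (\<integral>\<^sup>+u. ennreal (?I u) * (\<integral>\<^sup>+y. ennreal (cden y * ?q (x - y)) \<partial>lborel) \<partial>lborel)"
    by (simp add: nn_integral_multc ennreal_indicator)
  also have "\<dots> \<le> (\<integral>\<^sup>+u. ennreal (?I u) * (\<integral>\<^sup>+v. ennreal (3 * cden v * ?q (x - v + u)) \<partial>lborel) \<partial>lborel)"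
  proof (rule nn_integral_mono)
    fix u :: real
    have "(\<integral>\<^sup>+y. ennreal (cden y * ?q (x - y)) \<partial>lborel) \<le> (\<integral>\<^sup>+v. ennreal (3 * cden v * ?q (x - v + u)) \<partial>lborel)" if u: "u \<in> {0..1}"
    proof -
      have "(\<integral>\<^sup>+y. ennreal (cden y * ?q (x - y)) \<partial>lborel) \<le> (\<integral>\<^sup>+y. ennreal (3 * cden (y + u) * ?q (x - y)) \<partial>lborel)"
        by (intro nn_integral_mono ennreal_leI mult_right_mono cden_shift_le u cden_nonneg)
      also have "\<dots> = (\<integral>\<^sup>+v. ennreal (3 * cden v * ?q (x - v + u)) \<partial>lborel)"
        by (subst nn_integral_real_affine[of _ 1 "-u"]) (auto simp: algebra_simps)
      finally show ?thesis .
    qed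
    then show "ennreal (?I u) * (\<integral>\<^sup>+y. ennreal (cden y * ?q (x - y)) \<partial>lborel) \<le> ennreal (?I u) * (\<integral>\<^sup>+v. ennreal (3 * cden v * ?q (x - v + u)) \<partial>lborel)"
      by (cases "u \<in> {0..1}") auto
  qed
  also have "\<dots> = (\<integral>\<^sup>+u. (\<integral>\<^sup>+v. ennreal (?I u) * ennreal (3 * cden v * ?q (x - v + u)) \<partial>lborel) \<partial>lborel)"
    by (subst nn_integral_cmult) auto
  also have "\<dots> = (\<integral>\<^sup>+v. (\<integral>\<^sup>+u. ennreal (?I u) * ennreal (3 * cden v * ?q (x - v + u)) \<partial>lborel) \<partial>lborel)"
    by (rule lborel_pair.Fubini') measurable
  also have "\<dots> = (\<integral>\<^sup>+v. ennreal (3 * cden v) * (\<integral>\<^sup>+u. ennreal (?I u * ?q (x - v + u)) \<partial>lborel) \<partial>lborel)"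
    by (subst nn_integral_cmult[symmetric]) (auto intro!: nn_integral_cong simp: ennreal_mult[symmetric] cden_nonneg mult_ac)
  also have "\<dots> \<le> (\<integral>\<^sup>+v. ennreal (3 * cden v) * ennreal (3 * pi / M) \<partial>lborel)"
    by (intro nn_integral_mono mult_left_mono nn_integral_period M) auto
  also have "\<dots> = (\<integral>\<^sup>+v. ennreal (9 * pi / M) * ennreal (cden (1 * (v - 0))) \<partial>lborel)"
    using M by (intro nn_integral_cong) (simp add: ennreal_mult[symmetric] cden_nonneg)
  also have "\<dots> = ennreal (9 * pi / M) * ennreal (pi / 1)" by (subst nn_integral_cmult) (simp_all only: nn_integral_cden[OF zero_less_one], measurable)
  finally show ?thesis using M by (simp add: ennreal_mult[symmetric] power2_eq_square mult.assoc)
qed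

text \<open>The weight has peaks of width \<open>1/N\<close> at the multiples of \<open>N\<close>, the only places where the
  iterates of the datum are large. Both factors have the form $1/(1+D^2)$ with $D$ subadditive, which makes
  the weight stable under convolution.\<close>

definition lattice_weight :: "real \<Rightarrow> real \<Rightarrow> real" where
  "lattice_weight N \<xi> = N * cden (\<xi> / N) * cden (N\<^sup>2 * sin (pi * (\<xi> / N)))"

lemma lattice_weight_even: "lattice_weight N (- \<xi>) = lattice_weight N \<xi>"
  unfolding lattice_weight_def by (simp add: cden_even)

text \<open>144 = 4 * 36: the 4 comes from using \<open>cden_mult_le\<close> twice, the 36 from four
  cross terms of 9 pi^2 / N^2 each.\<close>

definition conv_const :: real where "conv_const = 144 * pi\<^sup>2"

lemma conv_const_nonneg: "0 \<le> conv_const" unfolding conv_const_def by simp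

context
  fixes N :: real assumes N: "N > 0"
begin

lemma lattice_weight_pos: "0 < lattice_weight N \<xi>" and lattice_weight_le: "lattice_weight N \<xi> \<le> N"
proof -
  show "0 < lattice_weight N \<xi>" unfolding lattice_weight_def by (intro mult_pos_pos cden_pos N)
  have "N * cden (\<xi> / N) * cden (N\<^sup>2 * sin (pi * (\<xi> / N))) \<le> N * 1 * 1"
    using N by (intro mult_mono cden_le_1) (auto simp: cden_nonneg)
  then show "lattice_weight N \<xi> \<le> N" unfolding lattice_weight_def by simp
qed

lemma lattice_weight_continuous: "continuous_on S (lattice_weight N)"
  unfolding lattice_weight_def[abs_def] using N by (intro continuous_intros) auto

lemma borel_measurable_lattice_weight[measurable]: "lattice_weight N \<in> borel_measurable borel"
  unfolding lattice_weight_def[abs_def] by measurable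

lemma lattice_weight_integrable: "integrable lborel (lattice_weight N)"
proof (rule Bochner_Integration.integrable_bound)
  show "integrable lborel (\<lambda>\<xi>. N * cden (\<xi> / N))"
    using integrable_mult_right[OF lborel_integrable_real_affine[OF integrable_inverse_1_plus_square_lborel, of "1 / N" 0], of N] N
    unfolding cden_def by simp
  have "lattice_weight N \<xi> \<le> N * cden (\<xi> / N) * 1" for \<xi>
    unfolding lattice_weight_def using N by (intro mult_left_mono cden_le_1) (auto simp: cden_nonneg)
  then show "AE x in lborel. norm (lattice_weight N x) \<le> norm (N * cden (x / N))"
    using lattice_weight_pos by (intro AE_I2) (auto simp: abs_of_pos intro: order_trans[OF _ abs_ge_self])
qed auto

text \<open>\<open>cden_mult_le\<close> is applied to the slow factor and to the periodic one, |sin|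
  being subadditive. Each of the four cross terms retains one slow and one periodic factor, whose
  integral is of order N^{-2}; this offsets the N^2 from the two prefactors, and the Jacobian N
  restores the prefactor of the weight. Hence a constant independent of N.\<close>

lemma lattice_weight_convolution: "(LINT \<eta>|lborel. lattice_weight N (\<xi> - \<eta>) * lattice_weight N \<eta>) \<le> conv_const * lattice_weight N \<xi>"
proof -
  define x where "x = \<xi> / N"
  define q where "q = (\<lambda>z. cden (N\<^sup>2 * sin (pi * z)))"
  have qm[measurable]: "q \<in> borel_measurable borel" unfolding q_def by measurable
  have q0: "0 \<le> q z" for z unfolding q_def by (rule cden_nonneg)
  have q_even: "q (- z) = q z" for z unfolding q_def by (simp add: cden_even)
  have J: "(\<integral>\<^sup>+y. ennreal (cden y * q (x - y)) \<partial>lborel) \<le> ennreal (9 * pi\<^sup>2 / N\<^sup>2)" for x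
    unfolding q_def by (rule nn_integral_cden_periodic) (use N in simp)
  have flip: "(\<integral>\<^sup>+y. ennreal (f (x - y)) \<partial>lborel) = (\<integral>\<^sup>+y. ennreal (f y) \<partial>lborel)" if [measurable]: "f \<in> borel_measurable borel" for f :: "real \<Rightarrow> real"
    by (subst (2) nn_integral_real_affine[of _ "-1" x]) auto
  have J0: "(\<integral>\<^sup>+y. ennreal (cden y * q y) \<partial>lborel) \<le> ennreal (9 * pi\<^sup>2 / N\<^sup>2)" using J[of 0] by (simp add: q_even)
  have J1: "(\<integral>\<^sup>+y. ennreal (cden (x - y) * q y) \<partial>lborel) \<le> ennreal (9 * pi\<^sup>2 / N\<^sup>2)"
    using J[of x] flip[of "\<lambda>y. cden y * q (x - y)"] by simp
  have J2: "(\<integral>\<^sup>+y. ennreal (cden (x - y) * q (x - y)) \<partial>lborel) \<le> ennreal (9 * pi\<^sup>2 / N\<^sup>2)"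
    using J0 flip[of "\<lambda>y. cden y * q y"] by simp
  let ?c = "4 * N\<^sup>2 * cden x * q x"
  have c0: "0 \<le> ?c" using q0 cden_nonneg by simp
  have pt: "lattice_weight N (\<xi> - N * y) * lattice_weight N (N * y)
      \<le> ?c * (cden y * q (x - y) + cden y * q y + cden (x - y) * q y + cden (x - y) * q (x - y))" for y
  proof -
    have "\<bar>sin (pi * x)\<bar> = \<bar>sin (pi * (x - y) + pi * y)\<bar>" by (simp add: algebra_simps)
    also have "\<dots> \<le> \<bar>sin (pi * (x - y))\<bar> * \<bar>cos (pi * y)\<bar> + \<bar>cos (pi * (x - y))\<bar> * \<bar>sin (pi * y)\<bar>"
      unfolding sin_add abs_mult[symmetric] by (rule abs_triangle_ineq)
    also have "\<dots> \<le> \<bar>sin (pi * (x - y))\<bar> * 1 + 1 * \<bar>sin (pi * y)\<bar>"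
      by (intro add_mono mult_left_mono mult_right_mono) auto
    finally have "\<bar>N\<^sup>2 * sin (pi * x)\<bar> \<le> \<bar>N\<^sup>2 * sin (pi * (x - y))\<bar> + \<bar>N\<^sup>2 * sin (pi * y)\<bar>"
      using mult_left_mono[of "\<bar>sin (pi * x)\<bar>" _ "N\<^sup>2"] by (simp add: abs_mult flip: distrib_left)
    then have q: "q (x - y) * q y \<le> 2 * q x * (q (x - y) + q y)" unfolding q_def by (rule cden_mult_le)
    have r: "cden (x - y) * cden y \<le> 2 * cden x * (cden (x - y) + cden y)" by (rule cden_mult_le) simp
    have "lattice_weight N (\<xi> - N * y) * lattice_weight N (N * y) = N\<^sup>2 * ((cden (x - y) * cden y) * (q (x - y) * q y))"
      unfolding lattice_weight_def q_def x_def using N by (simp add: diff_divide_distrib power2_eq_square)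
    also have "\<dots> \<le> N\<^sup>2 * ((2 * cden x * (cden (x - y) + cden y)) * (2 * q x * (q (x - y) + q y)))"
      using q0 cden_nonneg by (intro mult_left_mono mult_mono q r mult_nonneg_nonneg add_nonneg_nonneg) auto
    finally show ?thesis by (simp add: algebra_simps)
  qed
  have "(\<integral>\<^sup>+\<eta>. ennreal (lattice_weight N (\<xi> - \<eta>) * lattice_weight N \<eta>) \<partial>lborel)
    = ennreal N * (\<integral>\<^sup>+y. ennreal (lattice_weight N (\<xi> - N * y) * lattice_weight N (N * y)) \<partial>lborel)"
    using N by (subst nn_integral_real_affine[of _ N 0]) auto
  also have "\<dots> \<le> ennreal N * (\<integral>\<^sup>+y. ennreal ?c * (ennreal (cden y * q (x - y)) + ennreal (cden y * q y) + ennreal (cden (x - y) * q y) + ennreal (cden (x - y) * q (x - y))) \<partial>lborel)"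
    using pt c0 q0 cden_nonneg
    by (intro mult_left_mono nn_integral_mono) (simp_all add: ennreal_leI flip: ennreal_plus ennreal_mult)
  also have "\<dots> = ennreal N * (ennreal ?c * ((\<integral>\<^sup>+y. ennreal (cden y * q (x - y)) \<partial>lborel) + (\<integral>\<^sup>+y. ennreal (cden y * q y) \<partial>lborel)
      + (\<integral>\<^sup>+y. ennreal (cden (x - y) * q y) \<partial>lborel) + (\<integral>\<^sup>+y. ennreal (cden (x - y) * q (x - y)) \<partial>lborel)))"
    by (simp add: nn_integral_add nn_integral_cmult)
  also have "\<dots> \<le> ennreal N * (ennreal ?c * (ennreal (9 * pi\<^sup>2 / N\<^sup>2) + ennreal (9 * pi\<^sup>2 / N\<^sup>2) + ennreal (9 * pi\<^sup>2 / N\<^sup>2) + ennreal (9 * pi\<^sup>2 / N\<^sup>2)))"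
    by (intro mult_left_mono add_mono J J0 J1 J2) auto
  also have "\<dots> = ennreal (N * (?c * (36 * pi\<^sup>2 / N\<^sup>2)))"
  proof -
    have "ennreal a * (ennreal c * (ennreal d + ennreal d + ennreal d + ennreal d)) = ennreal (a * (c * (4 * d)))"
      if "0 \<le> a" "0 \<le> c" "0 \<le> d" for a c d using that by (simp flip: ennreal_plus ennreal_mult)
    from this[OF _ c0, of N "9 * pi\<^sup>2 / N\<^sup>2"] N show ?thesis by simp
  qed
  also have "N * (?c * (36 * pi\<^sup>2 / N\<^sup>2)) = conv_const * lattice_weight N \<xi>"
    unfolding conv_const_def lattice_weight_def x_def q_def using N by (simp add: field_simps)
  finally have le: "(\<integral>\<^sup>+\<eta>. ennreal (lattice_weight N (\<xi> - \<eta>) * lattice_weight N \<eta>) \<partial>lborel) \<le> ennreal (conv_const * lattice_weight N \<xi>)" .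
  have p: "0 \<le> lattice_weight N z" for z using lattice_weight_pos by (rule less_imp_le)
  have "(LINT \<eta>|lborel. lattice_weight N (\<xi> - \<eta>) * lattice_weight N \<eta>) = enn2real (\<integral>\<^sup>+\<eta>. ennreal (lattice_weight N (\<xi> - \<eta>) * lattice_weight N \<eta>) \<partial>lborel)"
    by (rule integral_eq_nn_integral) (auto simp: p)
  also have "\<dots> \<le> conv_const * lattice_weight N \<xi>"
    by (rule enn2real_leI[OF _ le]) (simp add: p conv_const_nonneg)
  finally show ?thesis .
qed

end

subsection \<open>The initial datum\<close>

definition gaussian :: "real \<Rightarrow> real \<Rightarrow> real" where "gaussian \<sigma> v = exp (- (\<sigma> * v)\<^sup>2 / 2)"

lemma gauss_cut_gaussian: "gauss_cut \<sigma> = (\<lambda>v. of_real (gaussian \<sigma> v))"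
  unfolding gauss_cut_def gaussian_def ..

lemma gaussian_pos: "0 < gaussian \<sigma> v" and gaussian_nonneg: "0 \<le> gaussian \<sigma> v" and gaussian_le_1: "gaussian \<sigma> v \<le> 1"
  unfolding gaussian_def by auto

lemma borel_measurable_gaussian[measurable]: "gaussian \<sigma> \<in> borel_measurable borel"
  unfolding gaussian_def[abs_def] by measurable

lemma continuous_on_gaussian[continuous_intros]: "continuous_on S f \<Longrightarrow> continuous_on S (\<lambda>x. gaussian \<sigma> (f x))"
  unfolding gaussian_def by (intro continuous_intros) auto

lemma gaussian_integral:
  assumes "\<sigma> > 0"
  shows "integrable lborel (\<lambda>v. gaussian \<sigma> (v + c))" "(LINT v|lborel. gaussian \<sigma> (v + c)) = sqrt (2 * pi) / \<sigma>"
proof -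
  have g: "gaussian \<sigma> = (\<lambda>v. sqrt (2 * pi) / \<sigma> * normal_density 0 (1 / \<sigma>) v)"
    using gauss_cut_normal_density[OF assms] unfolding gauss_cut_gaussian by (metis of_real_eq_iff)
  have i: "integrable lborel (gaussian \<sigma>)" unfolding g using assms by simp
  show "integrable lborel (\<lambda>v. gaussian \<sigma> (v + c))"
    using lborel_integrable_real_affine[OF i, of 1 c] by (simp add: add.commute)
  have "(LINT v|lborel. gaussian \<sigma> (v + c)) = (LINT v|lborel. gaussian \<sigma> v)"
    using lborel_integral_real_affine[of 1 "gaussian \<sigma>" c] by (simp add: add.commute)
  also have "\<dots> = sqrt (2 * pi) / \<sigma>" unfolding g using assms by simp
  finally show "(LINT v|lborel. gaussian \<sigma> (v + c)) = sqrt (2 * pi) / \<sigma>" .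
qed

lemma sqrt_2pi_bounds: "2 \<le> sqrt (2 * pi)" "sqrt (2 * pi) \<le> 3"
  using pi_approx by (auto intro!: real_le_rsqrt real_le_lsqrt simp: power2_eq_square)

lemma synth_gaussian:
  assumes "\<sigma> > 0"
  shows "synth (\<lambda>\<xi>. of_real (gaussian \<sigma> (\<xi> - c))) x
    = of_real (sqrt (2 * pi) / \<sigma>) * exp (\<i> * of_real (c * x) - of_real (x\<^sup>2 / (2 * \<sigma>\<^sup>2)))"
proof -
  have "synth (\<lambda>\<xi>. of_real (gaussian \<sigma> (\<xi> - c))) x
      = (LINT \<xi>|lborel. exp (\<i> * of_real (c * x)) * (exp (\<i> * of_real (x * \<xi>)) * gauss_cut \<sigma> \<xi>))"
    unfolding synth_def gauss_cut_gaussian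
    by (subst lborel_integral_real_affine[of 1 _ c]) (auto intro!: Bochner_Integration.integral_cong simp: algebra_simps exp_add)
  also have "\<dots> = exp (\<i> * of_real (c * x)) * synth (gauss_cut \<sigma>) x"
    unfolding synth_def by (rule integral_mult_right_zero)
  also have "synth (gauss_cut \<sigma>) x = of_real (sqrt (2 * pi) / \<sigma> * exp (- (x\<^sup>2 / (2 * \<sigma>\<^sup>2))))"
  proof -
    have "sqrt (2 * pi) / \<sigma> = 2 * pi * (1 / sqrt (2 * pi * \<sigma>\<^sup>2))"
      using assms by (simp add: real_sqrt_mult field_simps)
    then show ?thesis unfolding synth_gauss_cut[OF assms] normal_density_def by simp
  qed
  finally show ?thesis by (simp add: exp_diff exp_minus field_simps exp_of_real[symmetric])
qed

text \<open>From |x| \<le> 1 + x^2 the Gaussian lies below e^a e^{-a|x|}, which reduces the claim to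
  \<open>power_le_exp\<close>.\<close>

lemma bounded_power_gaussian:
  assumes "a > 0" shows "bounded (range (\<lambda>x::real. x ^ j *\<^sub>R exp (\<i> * of_real (c * x) - of_real (a * x\<^sup>2))))"
proof (rule boundedI)
  fix z assume "z \<in> range (\<lambda>x. x ^ j *\<^sub>R exp (\<i> * of_real (c * x) - of_real (a * x\<^sup>2)))"
  then obtain x :: real where z: "z = x ^ j *\<^sub>R exp (\<i> * of_real (c * x) - of_real (a * x\<^sup>2))" by blast
  have "0 \<le> (\<bar>x\<bar> - 1)\<^sup>2 + \<bar>x\<bar>" by simp
  then have "\<bar>x\<bar> \<le> 1 + x\<^sup>2" by (simp add: power2_eq_square algebra_simps)
  then have "a * \<bar>x\<bar> \<le> a * (1 + x\<^sup>2)" using assms by (intro mult_left_mono) auto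
  then have e: "exp (- (a * x\<^sup>2)) \<le> exp a * exp (- a * \<bar>x\<bar>)" by (simp add: algebra_simps flip: exp_add)
  have "norm z = \<bar>x\<bar> ^ j * exp (- (a * x\<^sup>2))" unfolding z by (simp add: norm_exp_eq_Re power_abs)
  also have "\<dots> \<le> \<bar>x\<bar> ^ j * (exp a * exp (- a * \<bar>x\<bar>))" by (intro mult_left_mono e) simp
  also have "\<dots> = exp a * (\<bar>x\<bar> ^ j * exp (- a * \<bar>x\<bar>))" by simp
  also have "\<dots> \<le> exp a * (real (Suc j) / a) ^ j" by (intro mult_left_mono power_le_exp assms) auto
  finally show "norm z \<le> exp a * (real (Suc j) / a) ^ j" .
qed

lemma bounded_poly_gaussian:
  assumes "a > 0" shows "bounded (range (\<lambda>x::real. x ^ j *\<^sub>R (poly q (of_real x) * exp (\<i> * of_real (c * x) - of_real (a * x\<^sup>2)))))"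
proof (induction q arbitrary: j)
  case 0 then show ?case by (simp add: image_constant_conv)
next
  case (pCons d q)
  let ?E = "\<lambda>x::real. exp (\<i> * of_real (c * x) - of_real (a * x\<^sup>2))"
  have "bounded (range (\<lambda>x::real. d * (x ^ j *\<^sub>R ?E x) + x ^ Suc j *\<^sub>R (poly q (of_real x) * ?E x)))"
    by (intro bounded_plus_comp pCons.IH bounded_linear_image[OF bounded_power_gaussian[OF assms, of j c] bounded_linear_mult_right, unfolded image_image])
  then show ?case by (rule back_subst[of bounded]) (auto intro!: image_cong simp: scaleR_conv_of_real algebra_simps)
qed

text \<open>Polynomials times a modulated Gaussian are closed under differentiation, which acts on
  the polynomial as \<open>D\<close>. Two frequencies with a common width cover the datum.\<close>

lemma schwartz_gaussian_sum:
  fixes q1 q2 :: "complex poly"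
  assumes "a > 0"
  shows "schwartz (\<lambda>x. poly q1 (of_real x) * exp (\<i> * of_real (c * x) - of_real (a * x\<^sup>2))
    + poly q2 (of_real x) * exp (\<i> * of_real (d * x) - of_real (a * x\<^sup>2)))"
proof -
  define E where "E = (\<lambda>c x::real. exp (\<i> * of_real (c * x) - of_real (a * x\<^sup>2)))"
  define f where "f = (\<lambda>q1 q2 x. poly q1 (of_real x) * E c x + poly q2 (of_real x) * E d x)"
  define D where "D = (\<lambda>c q. pderiv q + [:\<i> * of_real c, - 2 * of_real a:] * q)"
  have dE: "(E c has_vector_derivative (\<i> * of_real c - 2 * of_real a * of_real x) * E c x) (at x)" for c x
  proof -
    have "((\<lambda>z. exp (\<i> * (of_real c * z) - of_real a * z\<^sup>2)) has_field_derivative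
      (\<i> * of_real c - 2 * of_real a * of_real x) * exp (\<i> * (of_real c * of_real x) - of_real a * (of_real x)\<^sup>2)) (at (of_real x))"
      by (auto intro!: derivative_eq_intros)
    from has_vector_derivative_real_field[OF this] show ?thesis unfolding E_def by simp
  qed
  have dp: "((\<lambda>x. poly q (of_real x)) has_vector_derivative poly (pderiv q) (of_real x)) (at x)" for q :: "complex poly" and x
    by (rule has_vector_derivative_real_field[OF poly_DERIV])
  have t: "((\<lambda>x. poly q (of_real x) * E c x) has_vector_derivative poly (D c q) (of_real x) * E c x) (at x)" for q c x
    by (rule has_vector_derivative_eq_rhs[OF has_vector_derivative_mult[OF dp dE]]) (simp add: D_def algebra_simps)
  have df: "(f q1 q2 has_vector_derivative f (D c q1) (D d q2) x) (at x)" for q1 q2 x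
    unfolding f_def by (intro has_vector_derivative_add t)
  then have dxf: "dx (f q1 q2) = f (D c q1) (D d q2)" for q1 q2
    unfolding dx_def by (auto intro!: ext vector_derivative_at)
  have it: "\<exists>r1 r2. (dx ^^ j) (f q1 q2) = f r1 r2" for j
  proof (induction j)
    case (Suc j)
    then obtain r1 r2 where "(dx ^^ j) (f q1 q2) = f r1 r2" by blast
    then have "(dx ^^ Suc j) (f q1 q2) = f (D c r1) (D d r2)" by (simp add: dxf)
    then show ?case by blast
  qed auto
  have bd: "bounded (range (\<lambda>x. x ^ p *\<^sub>R f r1 r2 x))" for p r1 r2
    unfolding f_def E_def scaleR_add_right by (intro bounded_plus_comp bounded_poly_gaussian assms)
  have "schwartz (f q1 q2)" unfolding schwartz_def smooth_fun_def
  proof (intro conjI allI)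
    fix j x show "(dx ^^ j) (f q1 q2) differentiable at x" using it[of j] df by (metis differentiableI_vector)
    fix p j show "bounded (range (\<lambda>x. x ^ p *\<^sub>R (dx ^^ j) (f q1 q2) x))" using it[of j] bd by metis
  qed
  then show ?thesis unfolding f_def E_def .
qed

text \<open>The shift by \<open>1/2\<close> makes the frequencies of a pair of opposite bumps add up to about \<open>1\<close>, which is
  the resonance condition.\<close>

definition datum :: "real \<Rightarrow> real \<Rightarrow> real \<Rightarrow> real" where
  "datum a N \<xi> = a * N * (gaussian N (\<xi> - (1 / 2 + N)) + gaussian N (\<xi> - (1 / 2 - N)))"

lemma schwartz_synth_datum:
  assumes N: "N > 0" shows "schwartz (synth (\<lambda>\<xi>. of_real (datum a N \<xi>)))"
proof -
  let ?g = "\<lambda>c \<xi>. complex_of_real (gaussian N (\<xi> - c))"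
  have i: "integrable lborel (?g c)" for c using gaussian_integral(1)[OF N, of "- c"] by simp
  have "synth (\<lambda>\<xi>. of_real (datum a N \<xi>)) x = synth (\<lambda>\<xi>. of_real (a * N) * ?g (1 / 2 + N) \<xi> + of_real (a * N) * ?g (1 / 2 - N) \<xi>) x" for x
    unfolding datum_def by (simp add: algebra_simps)
  also have "\<dots> x = of_real (a * N) * synth (?g (1 / 2 + N)) x + of_real (a * N) * synth (?g (1 / 2 - N)) x" for x
    using i[of "1 / 2 + N"] i[of "1 / 2 - N"] by (subst synth_add) (simp_all add: synth_cmult)
  also have "\<dots> x = poly [:of_real (a * N) * of_real (sqrt (2 * pi) / N):] (of_real x) * exp (\<i> * of_real ((1 / 2 + N) * x) - of_real (1 / (2 * N\<^sup>2) * x\<^sup>2))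
    + poly [:of_real (a * N) * of_real (sqrt (2 * pi) / N):] (of_real x) * exp (\<i> * of_real ((1 / 2 - N) * x) - of_real (1 / (2 * N\<^sup>2) * x\<^sup>2))" for x
    unfolding synth_gaussian[OF N] by (simp add: mult_ac)
  finally have "synth (\<lambda>\<xi>. of_real (datum a N \<xi>)) = (\<lambda>x. poly [:of_real (a * N) * of_real (sqrt (2 * pi) / N):] (of_real x) * exp (\<i> * of_real ((1 / 2 + N) * x) - of_real (1 / (2 * N\<^sup>2) * x\<^sup>2))
    + poly [:of_real (a * N) * of_real (sqrt (2 * pi) / N):] (of_real x) * exp (\<i> * of_real ((1 / 2 - N) * x) - of_real (1 / (2 * N\<^sup>2) * x\<^sup>2)))" by (rule ext)
  moreover have "1 / (2 * N\<^sup>2) > 0" using N by simp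
  ultimately show ?thesis using schwartz_gaussian_sum by presburger
qed

text \<open>With y = N z the Gaussian has exponent y^2/2, split as 1/4 + 1/8 + 1/8 of y^2 to pay for
  the periodic factor, the slow factor and the exponential weight, at the cost of the constants 64,
  16 and e^4. The exponential weight costs only a constant because the radius 1/N is the inverse of
  the frequency scale.\<close>

lemma gaussian_le_lattice_weight:
  assumes N: "N \<ge> 1" and m: "m = N \<or> m = - N"
  shows "gaussian N z \<le> 1024 * exp 4 / N * lattice_weight N (m + z) * exp (- (1 / N) * \<bar>1 / 2 + m + z\<bar>)"
proof -
  define y where "y = N * z"
  have N0: "N > 0" using N by simp
  have zy: "\<bar>z\<bar> / N \<le> \<bar>y\<bar>"
  proof -
    have "\<bar>z\<bar> * 1 \<le> \<bar>z\<bar> * N\<^sup>2" using N by (intro mult_left_mono) (auto simp: one_le_power)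
    then show ?thesis using N0 unfolding y_def by (simp add: abs_mult field_simps power2_eq_square)
  qed
  have mN: "\<bar>m / N\<bar> = 1" using m N0 by auto
  have 1: "cden (1 + \<bar>y\<bar>) \<le> cden ((m + z) / N)"
  proof (rule cden_antimono)
    have "\<bar>(m + z) / N\<bar> \<le> \<bar>m / N\<bar> + \<bar>z / N\<bar>" unfolding add_divide_distrib by (rule abs_triangle_ineq)
    then show "\<bar>(m + z) / N\<bar> \<le> \<bar>1 + \<bar>y\<bar>\<bar>" using mN zy N0 by simp
  qed
  have 2: "cden (4 * y) \<le> cden (N\<^sup>2 * sin (pi * ((m + z) / N)))"
  proof (rule cden_antimono)
    have "\<bar>sin (pi * ((m + z) / N))\<bar> = \<bar>sin (pi * (z / N))\<bar>"
    proof -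
      have *: "pi * ((N + z) / N) = pi * (z / N) + pi" "pi * ((- N + z) / N) = pi * (z / N) - pi"
        using N0 by (simp_all add: field_simps)
      have "sin (pi * (z / N) - pi) = - sin (pi * (z / N))" by (simp add: sin_diff)
      with * m show ?thesis by auto
    qed
    also have "\<dots> \<le> \<bar>pi * (z / N)\<bar>" by (rule abs_sin_x_le_abs_x)
    finally have "N\<^sup>2 * \<bar>sin (pi * ((m + z) / N))\<bar> \<le> N\<^sup>2 * \<bar>pi * (z / N)\<bar>" by (intro mult_left_mono) auto
    then have "\<bar>N\<^sup>2 * sin (pi * ((m + z) / N))\<bar> \<le> N\<^sup>2 * \<bar>pi * (z / N)\<bar>" unfolding abs_mult by simp
    also have "\<dots> = pi * \<bar>y\<bar>" using N0 unfolding y_def by (simp add: abs_mult power2_eq_square)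
    also have "\<dots> \<le> 4 * \<bar>y\<bar>" using pi_less_4 by (intro mult_right_mono) auto
    finally show "\<bar>N\<^sup>2 * sin (pi * ((m + z) / N))\<bar> \<le> \<bar>4 * y\<bar>" by simp
  qed
  have 3: "exp (- (2 + \<bar>y\<bar>)) \<le> exp (- (1 / N) * \<bar>1 / 2 + m + z\<bar>)"
  proof -
    have "1 / N * \<bar>1 / 2 + m + z\<bar> \<le> 1 / N * (1 / 2 + N + \<bar>z\<bar>)" using m N0 by (intro mult_left_mono) auto
    also have "\<dots> = 1 / 2 * (1 / N) + 1 + \<bar>z\<bar> / N" using N0 by (simp add: field_simps)
    also have "\<dots> \<le> 1 / 2 * 1 + 1 + \<bar>y\<bar>" using zy N by (intro add_mono mult_left_mono) auto
    finally show ?thesis by simp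
  qed
  have e: "1 + x \<le> exp x" for x :: real by (rule exp_ge_add_one_self)
  have 4: "1 \<le> 64 * exp (y\<^sup>2 / 4) * cden (4 * y)"
  proof -
    have "1 + (4 * y)\<^sup>2 \<le> 64 * (1 + y\<^sup>2 / 4)" by (simp add: power_mult_distrib)
    also have "\<dots> \<le> 64 * exp (y\<^sup>2 / 4)" by (intro mult_left_mono e) simp
    finally show ?thesis unfolding cden_def using one_plus_square_pos[of "4 * y"] by (simp add: field_simps)
  qed
  have 5: "1 \<le> 16 * exp (y\<^sup>2 / 8) * cden (1 + \<bar>y\<bar>)"
  proof -
    have "0 \<le> (\<bar>y\<bar> - 1)\<^sup>2" by simp
    then have "1 + (1 + \<bar>y\<bar>)\<^sup>2 \<le> 16 * (1 + y\<^sup>2 / 8)" by (simp add: power2_eq_square algebra_simps)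
    also have "\<dots> \<le> 16 * exp (y\<^sup>2 / 8)" by (intro mult_left_mono e) simp
    finally show ?thesis unfolding cden_def using one_plus_square_pos[of "1 + \<bar>y\<bar>"] by (simp add: field_simps)
  qed
  have 6: "1 \<le> exp (4 + y\<^sup>2 / 8) * exp (- (2 + \<bar>y\<bar>))"
  proof -
    have "0 \<le> (\<bar>y\<bar> - 4)\<^sup>2" by simp
    then have "2 + \<bar>y\<bar> \<le> 4 + y\<^sup>2 / 8" by (simp add: power2_eq_square algebra_simps)
    then show ?thesis by (simp flip: exp_add)
  qed
  have "1 * 1 * 1 \<le> (64 * exp (y\<^sup>2 / 4) * cden (4 * y)) * (16 * exp (y\<^sup>2 / 8) * cden (1 + \<bar>y\<bar>)) * (exp (4 + y\<^sup>2 / 8) * exp (- (2 + \<bar>y\<bar>)))"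
    by (intro mult_mono 4 5 6) (auto simp: cden_nonneg)
  also have "\<dots> = 1024 * (exp (y\<^sup>2 / 4) * exp (y\<^sup>2 / 8) * exp (4 + y\<^sup>2 / 8)) * (cden (1 + \<bar>y\<bar>) * cden (4 * y) * exp (- (2 + \<bar>y\<bar>)))"
    by simp
  also have "exp (y\<^sup>2 / 4) * exp (y\<^sup>2 / 8) * exp (4 + y\<^sup>2 / 8) = exp 4 * exp (y\<^sup>2 / 2)" by (simp flip: exp_add)
  finally have "gaussian N z * 1 \<le> gaussian N z * (1024 * (exp 4 * exp (y\<^sup>2 / 2)) * (cden (1 + \<bar>y\<bar>) * cden (4 * y) * exp (- (2 + \<bar>y\<bar>))))"
    by (intro mult_left_mono) (auto simp: gaussian_nonneg)
  also have "\<dots> = 1024 * exp 4 * (gaussian N z * exp (y\<^sup>2 / 2)) * (cden (1 + \<bar>y\<bar>) * cden (4 * y) * exp (- (2 + \<bar>y\<bar>)))" by simp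
  also have "gaussian N z * exp (y\<^sup>2 / 2) = 1" unfolding gaussian_def y_def by (simp flip: exp_add)
  also have "1024 * exp 4 * 1 * (cden (1 + \<bar>y\<bar>) * cden (4 * y) * exp (- (2 + \<bar>y\<bar>)))
    \<le> 1024 * exp 4 * 1 * (cden ((m + z) / N) * cden (N\<^sup>2 * sin (pi * ((m + z) / N))) * exp (- (1 / N) * \<bar>1 / 2 + m + z\<bar>))"
    by (intro mult_left_mono mult_mono 1 2 3) (auto simp: cden_nonneg)
  finally show ?thesis using N0 unfolding lattice_weight_def by simp
qed

text \<open>Two bumps, each with the constant 1024 e^4.\<close>

definition datum_const :: real where "datum_const = 2048 * exp 4"

lemma datum_const_pos: "0 < datum_const" unfolding datum_const_def by simp

lemma datum_nonneg: "0 \<le> a \<Longrightarrow> 0 \<le> N \<Longrightarrow> 0 \<le> datum a N \<xi>"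
  unfolding datum_def by (intro mult_nonneg_nonneg add_nonneg_nonneg gaussian_nonneg)

lemma continuous_on_datum: "continuous_on S (datum a N)"
  unfolding datum_def[abs_def] by (intro continuous_intros)

lemma datum_le:
  assumes N: "N \<ge> 1" and a: "a > 0"
  shows "datum a N \<xi> \<le> datum_const * a * lattice_weight N (\<xi> - 1 / 2) * exp (- (1 / N) * \<bar>\<xi>\<bar>)"
proof -
  have p: "gaussian N (\<xi> - (1 / 2 + m)) \<le> 1024 * exp 4 / N * lattice_weight N (\<xi> - 1 / 2) * exp (- (1 / N) * \<bar>\<xi>\<bar>)" if "m = N \<or> m = - N" for m
    using gaussian_le_lattice_weight[OF N that, of "\<xi> - (1 / 2 + m)"] by simp
  have "datum a N \<xi> \<le> a * N * (1024 * exp 4 / N * lattice_weight N (\<xi> - 1 / 2) * exp (- (1 / N) * \<bar>\<xi>\<bar>) + 1024 * exp 4 / N * lattice_weight N (\<xi> - 1 / 2) * exp (- (1 / N) * \<bar>\<xi>\<bar>))"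
    unfolding datum_def using p[of N] p[of "- N"] a N by (intro mult_left_mono add_mono) auto
  also have "\<dots> = datum_const * a * lattice_weight N (\<xi> - 1 / 2) * exp (- (1 / N) * \<bar>\<xi>\<bar>)"
    using N unfolding datum_const_def by simp
  finally show ?thesis .
qed

lemma datum_rapid:
  assumes N: "N \<ge> 1" and a: "a > 0"
  shows "rapid (\<lambda>\<xi>. of_real (datum a N \<xi>))"
proof (rule rapid_bound)
  have N0: "N > 0" using N by simp
  have i: "integrable lborel (\<lambda>\<xi>. lattice_weight N (\<xi> - 1 / 2))"
    using lborel_integrable_real_affine[OF lattice_weight_integrable[OF N0], of 1 "- (1 / 2)"] by simp
  show "integrable lborel (\<lambda>\<xi>. \<bar>\<xi>\<bar> ^ j * (datum_const * a * lattice_weight N (\<xi> - 1 / 2) * exp (- (1 / N) * \<bar>\<xi>\<bar>)))" for j :: nat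
    using N0 by (intro integrable_weight_moment[OF _ i] less_imp_le[OF lattice_weight_pos]) auto
  show "(\<lambda>\<xi>. complex_of_real (datum a N \<xi>)) \<in> borel_measurable borel"
    unfolding datum_def by measurable
  show "cmod (complex_of_real (datum a N \<xi>)) \<le> datum_const * a * lattice_weight N (\<xi> - 1 / 2) * exp (- (1 / N) * \<bar>\<xi>\<bar>)" for \<xi>
    using datum_le[OF N a, of \<xi>] datum_nonneg[of a N \<xi>] a N by simp
qed

lemma datum_le_const:
  assumes "N > 0" "a > 0" shows "datum a N \<xi> \<le> 2 * a * N"
proof -
  have "datum a N \<xi> \<le> a * N * (1 + 1)"
    unfolding datum_def using assms by (intro mult_left_mono add_mono gaussian_le_1) auto
  then show ?thesis by simp
qed

text \<open>On a bump the Sobolev weight is at most 6 N^{2\<kappa>} (1 + z^2), and one of the two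
  Gaussian factors absorbs 1 + z^2. The parameter \<kappa> covers negative k by monotonicity of the
  power, and \<kappa> \<le> 1 keeps the powers of 6 and of 1 + z^2 in check.\<close>

lemma weighted_gaussian_le:
  assumes N: "N \<ge> 1" and k: "k \<le> \<kappa>" "0 \<le> \<kappa>" "\<kappa> \<le> 1" and m: "m = N \<or> m = - N"
  shows "(1 + (1 / 2 + m + z)\<^sup>2) powr k * (gaussian N z)\<^sup>2 \<le> 12 * N powr (2 * \<kappa>) * gaussian N z"
proof -
  have N0: "N > 0" using N by simp
  have "(1 / 2 + m + z)\<^sup>2 \<le> 2 * (1 / 2 + m)\<^sup>2 + 2 * z\<^sup>2" using sum_squares_bound[of "1 / 2 + m" z] by (simp add: power2_sum)
  moreover have "(1 / 2 + m)\<^sup>2 \<le> (3 / 2 * N)\<^sup>2" using m N by (intro power2_le_iff_abs_le[THEN iffD2]) auto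
  moreover have "1 \<le> N\<^sup>2" using N by (simp add: one_le_power)
  moreover have "z\<^sup>2 \<le> N\<^sup>2 * z\<^sup>2" using mult_right_mono[OF \<open>1 \<le> N\<^sup>2\<close>, of "z\<^sup>2"] by simp
  moreover have "0 \<le> N\<^sup>2 * z\<^sup>2" by simp
  moreover have "1 + p \<le> 6 * q + 6 * r" if "p \<le> 2 * d + 2 * e" "d \<le> 9 / 4 * q" "1 \<le> q" "e \<le> r" "0 \<le> r" for p q r d e :: real
    using that by simp
  moreover have "(3 / 2 * N)\<^sup>2 = 9 / 4 * N\<^sup>2" by (simp add: power_mult_distrib power2_eq_square)
  ultimately have "1 + (1 / 2 + m + z)\<^sup>2 \<le> 6 * N\<^sup>2 + 6 * (N\<^sup>2 * z\<^sup>2)" by metis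
  then have b: "1 + (1 / 2 + m + z)\<^sup>2 \<le> 6 * N\<^sup>2 * (1 + z\<^sup>2)" by (simp add: algebra_simps)
  have "(1 + (1 / 2 + m + z)\<^sup>2) powr k \<le> (1 + (1 / 2 + m + z)\<^sup>2) powr \<kappa>" using k by (intro powr_mono) auto
  also have "\<dots> \<le> (6 * N\<^sup>2 * (1 + z\<^sup>2)) powr \<kappa>" using b k one_plus_square_pos by (intro powr_mono2) (auto intro: less_imp_le)
  also have "\<dots> = 6 powr \<kappa> * (N\<^sup>2) powr \<kappa> * (1 + z\<^sup>2) powr \<kappa>" using one_plus_square_pos[of z] by (simp add: powr_mult)
  also have "\<dots> \<le> 6 * (N\<^sup>2) powr \<kappa> * (1 + z\<^sup>2)"
    using powr_mono[OF k(3), of 6] powr_mono[OF k(3), of "1 + z\<^sup>2"] one_plus_square_pos[of z] by (intro mult_mono) auto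
  also have "(N\<^sup>2) powr \<kappa> = N powr (2 * \<kappa>)" using N0 powr_powr[of N 2 \<kappa>] by simp
  finally have c: "(1 + (1 / 2 + m + z)\<^sup>2) powr k \<le> 6 * N powr (2 * \<kappa>) * (1 + z\<^sup>2)" .
  have d: "(1 + z\<^sup>2) * gaussian N z \<le> 2"
  proof -
    have "1 + z\<^sup>2 \<le> 2 * (1 + (N * z)\<^sup>2 / 2)" using \<open>z\<^sup>2 \<le> N\<^sup>2 * z\<^sup>2\<close> by (simp add: power_mult_distrib)
    also have "\<dots> \<le> 2 * exp ((N * z)\<^sup>2 / 2)" by (intro mult_left_mono exp_ge_add_one_self) simp
    finally have "(1 + z\<^sup>2) * gaussian N z \<le> 2 * exp ((N * z)\<^sup>2 / 2) * gaussian N z" by (intro mult_right_mono gaussian_nonneg)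
    then show ?thesis unfolding gaussian_def by (simp add: mult.assoc flip: exp_add)
  qed
  have "(1 + (1 / 2 + m + z)\<^sup>2) powr k * (gaussian N z)\<^sup>2 \<le> 6 * N powr (2 * \<kappa>) * (1 + z\<^sup>2) * (gaussian N z)\<^sup>2"
    by (intro mult_right_mono c) simp
  also have "\<dots> = 6 * N powr (2 * \<kappa>) * gaussian N z * ((1 + z\<^sup>2) * gaussian N z)" by (simp add: power2_eq_square)
  also have "\<dots> \<le> 6 * N powr (2 * \<kappa>) * gaussian N z * 2" by (intro mult_left_mono d) (auto simp: gaussian_nonneg)
  finally show ?thesis by simp
qed

text \<open>Up to the factor 2 pi the squared norm is at most 144 a^2 N^{1 + 2\<kappa>} = 144 / 1600
  = 9 / 100, so the normalisation 1/40 leaves room for 2 pi.\<close>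

lemma Hs_norm_datum:
  assumes N: "N \<ge> 1" and k: "k \<le> \<kappa>" "0 \<le> \<kappa>" "\<kappa> \<le> 1" and a: "a = N powr (- \<kappa> - 1 / 2) / 40"
  shows "Hs_norm k (synth (\<lambda>\<xi>. of_real (datum a N \<xi>))) \<le> 1"
proof -
  have N0: "N > 0" using N by simp
  have a0: "a > 0" unfolding a using N0 by simp
  let ?g = "\<lambda>m \<xi>. gaussian N (\<xi> - (1 / 2 + m))"
  let ?K = "24 * a\<^sup>2 * N\<^sup>2 * N powr (2 * \<kappa>)"
  have B: "cmod (complex_of_real (datum a N \<xi>)) \<le> 2 * a * N" for \<xi>
    using datum_le_const[OF N0 a0, of \<xi>] datum_nonneg[of a N \<xi>] N0 a0 by simp
  have pt: "(1 + \<xi>\<^sup>2) powr k * (datum a N \<xi>)\<^sup>2 \<le> ?K * (?g N \<xi> + ?g (- N) \<xi>)" for \<xi>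
  proof -
    have w: "(1 + \<xi>\<^sup>2) powr k * (?g m \<xi>)\<^sup>2 \<le> 12 * N powr (2 * \<kappa>) * ?g m \<xi>" if "m = N \<or> m = - N" for m
      using weighted_gaussian_le[OF N k that, of "\<xi> - (1 / 2 + m)"] by simp
    have "(datum a N \<xi>)\<^sup>2 \<le> 2 * a\<^sup>2 * N\<^sup>2 * ((?g N \<xi>)\<^sup>2 + (?g (- N) \<xi>)\<^sup>2)"
    proof -
      have "(?g N \<xi> + ?g (- N) \<xi>)\<^sup>2 \<le> 2 * ((?g N \<xi>)\<^sup>2 + (?g (- N) \<xi>)\<^sup>2)"
        using sum_squares_bound[of "?g N \<xi>" "?g (- N) \<xi>"] by (simp add: power2_sum)
      from mult_left_mono[OF this zero_le_power2[of "a * N"]] show ?thesis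
        unfolding datum_def power_mult_distrib by (simp only: mult_ac add_uminus_conv_diff)
    qed
    then have "(1 + \<xi>\<^sup>2) powr k * (datum a N \<xi>)\<^sup>2 \<le> (1 + \<xi>\<^sup>2) powr k * (2 * a\<^sup>2 * N\<^sup>2 * ((?g N \<xi>)\<^sup>2 + (?g (- N) \<xi>)\<^sup>2))"
      by (intro mult_left_mono) auto
    also have "\<dots> = 2 * a\<^sup>2 * N\<^sup>2 * ((1 + \<xi>\<^sup>2) powr k * (?g N \<xi>)\<^sup>2 + (1 + \<xi>\<^sup>2) powr k * (?g (- N) \<xi>)\<^sup>2)" by (simp add: algebra_simps)
    also have "\<dots> \<le> 2 * a\<^sup>2 * N\<^sup>2 * (12 * N powr (2 * \<kappa>) * ?g N \<xi> + 12 * N powr (2 * \<kappa>) * ?g (- N) \<xi>)"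
      by (intro mult_left_mono add_mono w) auto
    finally show ?thesis by (simp add: algebra_simps)
  qed
  have gi: "integrable lborel (?g m)" "(LINT \<xi>|lborel. ?g m \<xi>) \<le> 3 / N" for m
    using gaussian_integral[OF N0, of "- (1 / 2 + m)"] sqrt_2pi_bounds N0 unfolding add_uminus_conv_diff by (auto intro!: divide_right_mono)
  have "(LINT \<xi>|lborel. (1 + \<xi>\<^sup>2) powr k * (datum a N \<xi>)\<^sup>2) \<le> (LINT \<xi>|lborel. ?K * (?g N \<xi> + ?g (- N) \<xi>))"
    by (rule Bochner_Integration.integral_mono'[OF integrable_mult_right[OF Bochner_Integration.integrable_add[OF gi(1) gi(1)]] pt])
       (simp add: gaussian_nonneg)
  also have "\<dots> = ?K * ((LINT \<xi>|lborel. ?g N \<xi>) + (LINT \<xi>|lborel. ?g (- N) \<xi>))"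
    by (subst integral_mult_right_zero, subst Bochner_Integration.integral_add[OF gi(1) gi(1)]) simp
  also have "\<dots> \<le> ?K * (3 / N + 3 / N)" by (intro mult_left_mono add_mono gi) auto
  also have "\<dots> = 144 * (a\<^sup>2 * (N * N powr (2 * \<kappa>)))" using N0 by (simp add: power2_eq_square)
  also have "a\<^sup>2 = N powr (- 2 * \<kappa> - 1) / 1600" unfolding a power_divide using N0 by (simp add: power2_eq_square flip: powr_add)
  also have "144 * (N powr (- 2 * \<kappa> - 1) / 1600 * (N * N powr (2 * \<kappa>))) = 9 / 100 * (N powr (- 2 * \<kappa> - 1) * (N powr 1 * N powr (2 * \<kappa>)))"
    using N0 by simp
  also have "N powr (- 2 * \<kappa> - 1) * (N powr 1 * N powr (2 * \<kappa>)) = 1" using N0 unfolding powr_add[symmetric] by simp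
  finally have I: "(LINT \<xi>|lborel. (1 + \<xi>\<^sup>2) powr k * (datum a N \<xi>)\<^sup>2) \<le> 9 / 100" by simp
  have "(Hs_norm k (synth (\<lambda>\<xi>. of_real (datum a N \<xi>))))\<^sup>2 \<le> 2 * pi * (9 / 100)"
    unfolding Hs_synth(2)[OF datum_rapid[OF N a0] B] using I by simp
  also have "\<dots> \<le> 1\<^sup>2" using pi_less_4 by simp
  finally show ?thesis by (rule power2_le_imp_le) simp
qed

subsection \<open>The resonant high-high interaction\<close>

lemma cmod_exp_diff_le: "cmod (exp (- \<i> * of_real x) - exp (- \<i> * of_real y)) \<le> \<bar>x - y\<bar>"
proof -
  have "cmod (exp (- \<i> * of_real x) - exp (- \<i> * of_real y)) = cmod (exp (\<i> * of_real (- y)) * (exp (\<i> * of_real (y - x)) - 1))"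
    by (simp add: algebra_simps flip: exp_add)
  also have "\<dots> = cmod (exp (\<i> * of_real (y - x)) - 1)" unfolding norm_mult norm_exp_i_real by simp
  also have "\<dots> \<le> \<bar>y - x\<bar>"
    using iexp_approx1[of "y - x" 0] by (simp add: norm_minus_commute)
  finally show ?thesis by (simp add: abs_minus_commute)
qed

context ck_system
begin

lemma integrable_W1_pair: "integrable lborel (\<lambda>\<eta>. W1 (\<xi> + \<eta>) * W1 \<eta>)"
proof (rule Bochner_Integration.integrable_bound[OF integrable_mult_right[OF W1(4), of B]])
  have [measurable]: "W1 \<in> borel_measurable borel" by (rule borel_measurable_continuous_onI[OF W1(3)])
  show "(\<lambda>\<eta>. W1 (\<xi> + \<eta>) * W1 \<eta>) \<in> borel_measurable lborel" by measurable
  show "AE \<eta> in lborel. norm (W1 (\<xi> + \<eta>) * W1 \<eta>) \<le> norm (B * W1 \<eta>)"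
    using W1(2)[of "\<xi> + _"] W_nonneg(1) by (auto simp: abs_mult intro!: AE_I2 mult_right_mono intro: order_trans[OF _ abs_ge_self])
qed

lemma p_norm_le: "cmod (p \<xi>) \<le> A * W1 \<xi>"
proof -
  have "cmod (p \<xi>) \<le> A * W1 \<xi> * exp (- b * \<bar>\<xi>\<bar>)" by (rule p(2))
  also have "\<dots> \<le> A * W1 \<xi> * 1" using A W_nonneg(1) b by (intro mult_left_mono) auto
  finally show ?thesis by simp
qed

text \<open>Replacing the two factors by the free evolution one at a time costs \<kappa> A times 2A
  and A times \<kappa> A, hence the 3. The phases of the free factors combine through (\<xi> +
  \<eta>)^2 - \<eta>^2 = \<xi> (\<xi> + 2 \<eta>).\<close>

lemma Y_free_approx:
  assumes U: "adm W1 (2 * A) U"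
    and close: "\<And>t \<xi>. t \<in> {0..T} \<Longrightarrow> cmod (U t \<xi> - exp (- \<i> * of_real (t * \<xi>\<^sup>2)) * p \<xi>) \<le> \<kappa> * A * W1 \<xi>"
    and t: "t \<in> {0..T}"
  shows "cmod (Yb U U t \<xi> - (LINT \<eta>|lborel. exp (- \<i> * of_real (t * \<xi> * (\<xi> + 2 * \<eta>))) * (p (\<xi> + \<eta>) * cnj (p \<eta>))))
    \<le> 3 * \<kappa> * A\<^sup>2 * C * W2 \<xi>"
proof -
  define V where "V = (\<lambda>\<xi>. exp (- \<i> * of_real (t * \<xi>\<^sup>2)) * p \<xi>)"
  have Vc: "continuous_on UNIV V" unfolding V_def by (intro continuous_intros p(1))
  have [measurable]: "V \<in> borel_measurable borel" by (rule borel_measurable_continuous_onI[OF Vc])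
  have e: "cmod (exp (- \<i> * of_real x)) = 1" for x using norm_exp_i_real[of "- x"] by simp
  have V_le: "cmod (V \<xi>) \<le> A * W1 \<xi>" for \<xi> unfolding V_def norm_mult e using p_norm_le by simp
  have D_le: "cmod (U t \<xi> - V \<xi>) \<le> \<kappa> * A * W1 \<xi>" for \<xi> unfolding V_def by (rule close[OF t])
  have U_le: "cmod (U t \<xi>) \<le> 2 * A * W1 \<xi>" for \<xi>
  proof -
    have "cmod (U t \<xi>) \<le> cmod (U t \<xi> - V \<xi>) + cmod (V \<xi>)" using norm_triangle_ineq[of "U t \<xi> - V \<xi>" "V \<xi>"] by simp
    also have "\<dots> \<le> \<kappa> * A * W1 \<xi> + A * W1 \<xi>" by (intro add_mono D_le V_le)
    also have "\<dots> = (\<kappa> + 1) * (A * W1 \<xi>)" by (simp add: algebra_simps)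
    also have "\<dots> \<le> 2 * (A * W1 \<xi>)" using \<kappa>_bounds A W_nonneg(1)[of \<xi>] by (intro mult_right_mono) auto
    finally show ?thesis by simp
  qed
  have iU: "integrable lborel (\<lambda>\<eta>. U t (\<xi> + \<eta>) * cnj (U t \<eta>))" using Y_int[OF U U _ _ t] A by simp
  have iV: "integrable lborel (\<lambda>\<eta>. V (\<xi> + \<eta>) * cnj (V \<eta>))"
  proof (rule Bochner_Integration.integrable_bound[OF integrable_mult_right[OF integrable_W1_pair, of "A * A" \<xi>]])
    have "cmod (V (\<xi> + \<eta>) * cnj (V \<eta>)) \<le> (A * W1 (\<xi> + \<eta>)) * (A * W1 \<eta>)" for \<eta>
      unfolding norm_mult using A W_nonneg(1) by (intro mult_mono) (auto simp: V_le)
    then show "AE \<eta> in lborel. norm (V (\<xi> + \<eta>) * cnj (V \<eta>)) \<le> norm (A * A * (W1 (\<xi> + \<eta>) * W1 \<eta>))"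
      by (intro AE_I2) (auto simp: mult_ac intro: order_trans[OF _ abs_ge_self])
  qed measurable
  have VV: "V (\<xi> + \<eta>) * cnj (V \<eta>) = exp (- \<i> * of_real (t * \<xi> * (\<xi> + 2 * \<eta>))) * (p (\<xi> + \<eta>) * cnj (p \<eta>))" for \<eta>
  proof -
    have "exp (- \<i> * of_real (t * (\<xi> + \<eta>)\<^sup>2)) * exp (\<i> * of_real (t * \<eta>\<^sup>2)) = exp (- \<i> * of_real (t * \<xi> * (\<xi> + 2 * \<eta>)))"
      unfolding exp_add[symmetric] by (simp add: power2_eq_square algebra_simps)
    moreover have "cnj (exp (- \<i> * of_real (t * \<eta>\<^sup>2))) = exp (\<i> * of_real (t * \<eta>\<^sup>2))" unfolding exp_cnj by simp
    ultimately show ?thesis unfolding V_def complex_cnj_mult by (simp add: mult_ac)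
  qed
  have "cmod (Yb U U t \<xi> - (LINT \<eta>|lborel. V (\<xi> + \<eta>) * cnj (V \<eta>)))
      = cmod (LINT \<eta>|lborel. U t (\<xi> + \<eta>) * cnj (U t \<eta>) - V (\<xi> + \<eta>) * cnj (V \<eta>))"
    unfolding Yb_def by (subst Bochner_Integration.integral_diff[OF iU iV]) simp
  also have "\<dots> \<le> (LINT \<eta>|lborel. 3 * \<kappa> * A\<^sup>2 * (W1 (\<xi> + \<eta>) * W1 \<eta>))"
  proof (rule Bochner_Integration.integral_norm_bound_integral[OF Bochner_Integration.integrable_diff[OF iU iV] integrable_mult_right[OF integrable_W1_pair]])
    fix \<eta>
    have "U t (\<xi> + \<eta>) * cnj (U t \<eta>) - V (\<xi> + \<eta>) * cnj (V \<eta>) = (U t (\<xi> + \<eta>) - V (\<xi> + \<eta>)) * cnj (U t \<eta>) + V (\<xi> + \<eta>) * cnj (U t \<eta> - V \<eta>)"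
      by (simp add: algebra_simps)
    also have "cmod \<dots> \<le> cmod (U t (\<xi> + \<eta>) - V (\<xi> + \<eta>)) * cmod (U t \<eta>) + cmod (V (\<xi> + \<eta>)) * cmod (U t \<eta> - V \<eta>)"
      by (rule order_trans[OF norm_triangle_ineq]) (simp only: norm_mult complex_mod_cnj order_refl)
    also have "\<dots> \<le> (\<kappa> * A * W1 (\<xi> + \<eta>)) * (2 * A * W1 \<eta>) + (A * W1 (\<xi> + \<eta>)) * (\<kappa> * A * W1 \<eta>)"
      using A W_nonneg(1) \<kappa>_bounds by (intro add_mono mult_mono D_le U_le V_le mult_nonneg_nonneg) auto
    finally show "cmod (U t (\<xi> + \<eta>) * cnj (U t \<eta>) - V (\<xi> + \<eta>) * cnj (V \<eta>)) \<le> 3 * \<kappa> * A\<^sup>2 * (W1 (\<xi> + \<eta>) * W1 \<eta>)"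
      by (simp add: power2_eq_square algebra_simps)
  qed
  also have "\<dots> = 3 * \<kappa> * A\<^sup>2 * (LINT \<eta>|lborel. W1 (\<xi> + \<eta>) * W1 \<eta>)" by (rule integral_mult_right_zero)
  also have "\<dots> \<le> 3 * \<kappa> * A\<^sup>2 * (C * W2 \<xi>)" using \<kappa>_bounds by (intro mult_left_mono conv1) auto
  finally show ?thesis unfolding VV by (simp add: mult_ac)
qed

text \<open>Against the wave propagator the phase \<open>exp (-\<i> t \<xi>)\<close> is resonant, so that the Duhamel
  integral grows linearly in \<open>t\<close>.\<close>

lemma NN_lower_bound:
  assumes U: "adm W1 (2 * A) U" and t: "t \<in> {0..T}" and \<xi>: "\<xi> > 0" and P: "P \<ge> 0"
    and Y: "\<And>\<tau>. \<tau> \<in> {0..t} \<Longrightarrow> cmod (Yb U U \<tau> \<xi> - exp (- \<i> * of_real (\<tau> * \<xi>)) * of_real P) \<le> E"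
  shows "\<xi> * (P * (t / 2 - 1 / (4 * \<xi>)) - t * E) \<le> cmod (NN U t \<xi>)"
proof -
  have sc: "strip_cont T (Yb U U)" using A by (intro admD(1)[OF Y_adm[OF U U]]) auto
  let ?f = "\<lambda>\<tau>. of_real (sin ((t - \<tau>) * \<xi>)) * Yb U U \<tau> \<xi>"
  let ?c = "exp (\<i> * of_real (t * \<xi>))"
  have fi: "?f integrable_on {0..t}"
    using strip_cont_time[OF sc, of \<xi>] t by (intro integrable_continuous_real continuous_intros) (auto intro: continuous_on_subset)
  \<comment> \<open>Rotating by exp (\<i> t \<xi>) turns the resonant phase into one whose imaginary
    part is sin ((t - \<tau>) \<xi>), so this component of the integrand is a sine squared with mean
    1/2; the modulus of the integral is bounded below by it.\<close>
  have bl: "bounded_linear (\<lambda>z. Im (?c * z))"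
    by (rule bounded_linear_compose[OF bounded_linear_Im bounded_linear_mult_right])
  have h: "((\<lambda>\<tau>. Im (?c * ?f \<tau>)) has_integral Im (?c * integral {0..t} ?f)) {0..t}"
    using has_integral_linear[OF integrable_integral[OF fi] bl] by (simp add: o_def)
  \<comment> \<open>The oscillating half of the sine squared leaves only a boundary term of modulus
    at most 1 / (4 \<xi>).\<close>
  have s: "((\<lambda>\<tau>. (sin ((t - \<tau>) * \<xi>))\<^sup>2) has_integral (\<lambda>\<tau>. \<tau> / 2 + sin (2 * ((t - \<tau>) * \<xi>)) / (4 * \<xi>)) t - (\<lambda>\<tau>. \<tau> / 2 + sin (2 * ((t - \<tau>) * \<xi>)) / (4 * \<xi>)) 0) {0..t}"
  proof (rule fundamental_theorem_of_calculus)
    fix \<tau>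
    have sq: "(sin ((t - \<tau>) * \<xi>))\<^sup>2 = (1 - cos (2 * ((t - \<tau>) * \<xi>))) / 2" using cos_double_sin[of "(t - \<tau>) * \<xi>"] by simp
    show "((\<lambda>\<tau>. \<tau> / 2 + sin (2 * ((t - \<tau>) * \<xi>)) / (4 * \<xi>)) has_vector_derivative (sin ((t - \<tau>) * \<xi>))\<^sup>2) (at \<tau> within {0..t})"
      using \<xi> unfolding has_real_derivative_iff_has_vector_derivative[symmetric] sq
      by (auto intro!: derivative_eq_intros simp: field_simps)
  qed (use t in auto)
  have c: "((\<lambda>\<tau>. E) has_integral t * E) {0..t}" using has_integral_const_real[of E 0 t] t by simp
  have "P * ((\<lambda>\<tau>. \<tau> / 2 + sin (2 * ((t - \<tau>) * \<xi>)) / (4 * \<xi>)) t - (\<lambda>\<tau>. \<tau> / 2 + sin (2 * ((t - \<tau>) * \<xi>)) / (4 * \<xi>)) 0) - t * E \<le> Im (?c * integral {0..t} ?f)"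
  proof (rule has_integral_le[OF has_integral_diff[OF has_integral_mult_right[OF s] c] h])
    fix \<tau> assume \<tau>: "\<tau> \<in> {0..t}"
    let ?s = "sin ((t - \<tau>) * \<xi>)"
    define R where "R = Yb U U \<tau> \<xi> - exp (- \<i> * of_real (\<tau> * \<xi>)) * of_real P"
    have "?c * Yb U U \<tau> \<xi> = ?c * exp (- \<i> * of_real (\<tau> * \<xi>)) * of_real P + ?c * R" unfolding R_def by (simp add: algebra_simps)
    also have "?c * exp (- \<i> * of_real (\<tau> * \<xi>)) = cis ((t - \<tau>) * \<xi>)"
      unfolding cis_conv_exp exp_add[symmetric] by (simp add: algebra_simps)
    finally have "Im (?c * Yb U U \<tau> \<xi>) = P * ?s + Im (?c * R)" by simp
    moreover have "?c * ?f \<tau> = of_real ?s * (?c * Yb U U \<tau> \<xi>)" by (simp only: mult_ac)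
    moreover have "Im (of_real ?s * z) = ?s * Im z" for z by simp
    ultimately have "Im (?c * ?f \<tau>) = P * ?s\<^sup>2 + ?s * Im (?c * R)"
      unfolding power2_eq_square by (simp only: distrib_left mult.left_commute)
    moreover have "\<bar>?s * Im (?c * R)\<bar> \<le> 1 * E"
    proof -
      have "\<bar>Im (?c * R)\<bar> \<le> cmod (?c * R)" by (rule abs_Im_le_cmod)
      also have "\<dots> \<le> E" unfolding norm_mult norm_exp_i_real R_def using Y[OF \<tau>] by simp
      finally show ?thesis unfolding abs_mult by (intro mult_mono) auto
    qed
    ultimately show "P * ?s\<^sup>2 - E \<le> Im (?c * ?f \<tau>)" by linarith
  qed
  moreover have "sin (2 * ((t - 0) * \<xi>)) / (4 * \<xi>) \<le> 1 / (4 * \<xi>)" using \<xi> by (intro divide_right_mono) auto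
  then have "P * (t / 2 - 1 / (4 * \<xi>)) \<le> P * ((\<lambda>\<tau>. \<tau> / 2 + sin (2 * ((t - \<tau>) * \<xi>)) / (4 * \<xi>)) t - (\<lambda>\<tau>. \<tau> / 2 + sin (2 * ((t - \<tau>) * \<xi>)) / (4 * \<xi>)) 0)"
    using P by (intro mult_left_mono) auto
  moreover have "Im (?c * integral {0..t} ?f) \<le> cmod (integral {0..t} ?f)"
    using abs_Im_le_cmod[of "?c * integral {0..t} ?f"] unfolding norm_mult norm_exp_i_real by simp
  ultimately have "P * (t / 2 - 1 / (4 * \<xi>)) - t * E \<le> cmod (integral {0..t} ?f)" by linarith
  then have "\<xi> * (P * (t / 2 - 1 / (4 * \<xi>)) - t * E) \<le> \<xi> * cmod (integral {0..t} ?f)" using \<xi> by (intro mult_left_mono) auto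
  also have "\<dots> = cmod (NN U t \<xi>)"
    unfolding NN_def Nb_eq[OF sc t] tint_def norm_mult using \<xi> by simp
  finally show ?thesis .
qed

end

lemma datum_pair_integrable:
  assumes N: "N \<ge> 1" and a: "a > 0"
  shows "integrable lborel (\<lambda>\<eta>. datum a N (\<xi> + \<eta>) * datum a N \<eta>)"
proof (rule Bochner_Integration.integrable_bound)
  have N0: "N > 0" using N by simp
  have i: "integrable lborel (datum a N)" using integrable_Re[OF rapid_integrable[OF datum_rapid[OF N a]]] by simp
  then show "integrable lborel (\<lambda>\<eta>. (2 * a * N) * datum a N \<eta>)" by simp
  show "(\<lambda>\<eta>. datum a N (\<xi> + \<eta>) * datum a N \<eta>) \<in> borel_measurable lborel" unfolding datum_def by measurable
  show "AE \<eta> in lborel. norm (datum a N (\<xi> + \<eta>) * datum a N \<eta>) \<le> norm ((2 * a * N) * datum a N \<eta>)"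
    using datum_le_const[OF N0 a] datum_nonneg[of a N] N0 a by (auto simp: abs_mult intro!: AE_I2 mult_right_mono)
qed

text \<open>With y = N v the factor |y| is at most exp (3 y^2 / 8), and 3/8 is the gap between the
  exponents y^2 / 2 and y^2 / 8 of the two Gaussians.\<close>

lemma gaussian_moment_le:
  assumes N: "N > 0"
  shows "\<bar>v\<bar> * gaussian N v \<le> gaussian (N / 2) v / N" and "gaussian N v \<le> gaussian (N / 2) v"
proof -
  define y where "y = N * v"
  have "0 \<le> 3 * (\<bar>y\<bar> - 4 / 3)\<^sup>2 + 8 / 3" by simp
  then have "\<bar>y\<bar> \<le> 1 + 3 * y\<^sup>2 / 8" by (simp add: power2_eq_square algebra_simps)
  also have "\<dots> \<le> exp (3 * y\<^sup>2 / 8)" by (rule exp_ge_add_one_self)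
  finally have "\<bar>y\<bar> * exp (- y\<^sup>2 / 2) \<le> exp (3 * y\<^sup>2 / 8) * exp (- y\<^sup>2 / 2)" by (intro mult_right_mono) auto
  also have "\<dots> = gaussian (N / 2) v" unfolding gaussian_def y_def exp_add[symmetric] by (simp add: power_mult_distrib power_divide)
  finally have "N * (\<bar>v\<bar> * gaussian N v) \<le> gaussian (N / 2) v"
    using N unfolding y_def gaussian_def by (simp add: abs_mult)
  then show "\<bar>v\<bar> * gaussian N v \<le> gaussian (N / 2) v / N" using N by (simp add: field_simps)
  show "gaussian N v \<le> gaussian (N / 2) v" unfolding gaussian_def by (simp add: power_mult_distrib power_divide)
qed

text \<open>All four products of bumps are positive, so it suffices to keep the pair near N + 1/2
  and -N + 1/2. For |\<xi> - 2N| \<le> 1/N their product is at least 1/e times a Gaussian of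
  parameter 2N, whose integral is sqrt (2 pi) / (2N).\<close>

lemma datum_correlation_lower:
  assumes N: "N \<ge> 1" and a: "a > 0" and \<xi>: "\<bar>\<xi> - 2 * N\<bar> \<le> 1 / N"
  shows "a\<^sup>2 * N / 3 \<le> (LINT \<eta>|lborel. datum a N (\<xi> + \<eta>) * datum a N \<eta>)"
proof -
  have N0: "N > 0" using N by simp
  define h where "h = \<xi> - 2 * N"
  have h: "(N * h)\<^sup>2 \<le> 1"
  proof -
    have "N * \<bar>h\<bar> \<le> 1" using \<xi> N0 unfolding h_def by (simp add: field_simps)
    then have "\<bar>N * h\<bar> \<le> 1" using N0 by (simp add: abs_mult)
    then show ?thesis by (simp add: abs_square_le_1)
  qed
  have pt: "a\<^sup>2 * N\<^sup>2 * exp (- 1) * gaussian (2 * N) (\<eta> + (N - 1 / 2)) \<le> datum a N (\<xi> + \<eta>) * datum a N \<eta>" for \<eta>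
  proof -
    define y where "y = \<eta> + (N - 1 / 2)"
    have "exp (- 1) * gaussian (2 * N) y \<le> gaussian N (h + y) * gaussian N y"
    proof -
      have "(N * (h + y))\<^sup>2 \<le> 2 * (N * h)\<^sup>2 + 2 * (N * y)\<^sup>2" using sum_squares_bound[of "N * h" "N * y"] unfolding distrib_left by (simp add: power2_sum)
      moreover have "(2 * N * y)\<^sup>2 = 4 * (N * y)\<^sup>2" by (simp add: power_mult_distrib)
      moreover have "0 \<le> (N * y)\<^sup>2" by simp
      ultimately have "- 1 + - (2 * N * y)\<^sup>2 / 2 \<le> - (N * (h + y))\<^sup>2 / 2 + - (N * y)\<^sup>2 / 2" using h by linarith
      then show ?thesis unfolding gaussian_def exp_add[symmetric] by simp
    qed
    also have "\<dots> \<le> (gaussian N (\<xi> + \<eta> - (1 / 2 + N)) + gaussian N (\<xi> + \<eta> - (1 / 2 - N))) * (gaussian N (\<eta> - (1 / 2 + N)) + gaussian N (\<eta> - (1 / 2 - N)))"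
    proof (rule mult_mono)
      have e: "h + y = \<xi> + \<eta> - (1 / 2 + N)" "y = \<eta> - (1 / 2 - N)" unfolding h_def y_def by simp_all
      show "gaussian N (h + y) \<le> gaussian N (\<xi> + \<eta> - (1 / 2 + N)) + gaussian N (\<xi> + \<eta> - (1 / 2 - N))"
        unfolding e(1) by (simp add: gaussian_nonneg)
      show "gaussian N y \<le> gaussian N (\<eta> - (1 / 2 + N)) + gaussian N (\<eta> - (1 / 2 - N))"
        unfolding e(2) by (simp add: gaussian_nonneg)
    qed (auto intro: add_nonneg_nonneg gaussian_nonneg)
    finally have "(a * N)\<^sup>2 * (exp (- 1) * gaussian (2 * N) y) \<le> (a * N)\<^sup>2 * ((gaussian N (\<xi> + \<eta> - (1 / 2 + N)) + gaussian N (\<xi> + \<eta> - (1 / 2 - N))) * (gaussian N (\<eta> - (1 / 2 + N)) + gaussian N (\<eta> - (1 / 2 - N))))"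
      by (rule mult_left_mono) simp
    then show ?thesis unfolding datum_def y_def by (simp add: power2_eq_square mult_ac)
  qed
  have gi: "integrable lborel (\<lambda>\<eta>. gaussian (2 * N) (\<eta> + (N - 1 / 2)))" "(LINT \<eta>|lborel. gaussian (2 * N) (\<eta> + (N - 1 / 2))) = sqrt (2 * pi) / (2 * N)"
    using gaussian_integral[of "2 * N" "N - 1 / 2"] N0 by auto
  have "exp 1 \<le> (3::real)" by (rule exp_le)
  then have e: "1 / 3 \<le> exp (- 1 :: real)" by (simp add: exp_minus field_simps)
  have "a\<^sup>2 * N / 3 = a\<^sup>2 * N\<^sup>2 * (1 / 3) * (2 / (2 * N))" using N0 by (simp add: power2_eq_square)
  also have "\<dots> \<le> a\<^sup>2 * N\<^sup>2 * exp (- 1) * (sqrt (2 * pi) / (2 * N))"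
    using N0 sqrt_2pi_bounds by (intro mult_mono mult_left_mono e divide_right_mono) auto
  also have "\<dots> = (LINT \<eta>|lborel. a\<^sup>2 * N\<^sup>2 * exp (- 1) * gaussian (2 * N) (\<eta> + (N - 1 / 2)))"
    unfolding gi(2)[symmetric] by (rule integral_mult_right_zero[symmetric])
  also have "\<dots> \<le> (LINT \<eta>|lborel. datum a N (\<xi> + \<eta>) * datum a N \<eta>)"
    by (intro integral_mono integrable_mult_right gi(1) datum_pair_integrable[OF N a] pt)
  finally show ?thesis .
qed

text \<open>The deviation of \<xi> + 2 \<eta> from the resonant value 1, averaged over the pair. The
  bumps have width 1/N, so the bound is smaller by a factor of order 1/N than the correlation, which
  is of order a^2 N; this offsets the factor |\<xi>| in the phase.\<close>

lemma datum_correlation_moment: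
  assumes N: "N \<ge> 1" and a: "a > 0" and \<xi>: "\<bar>\<xi> - 2 * N\<bar> \<le> 1 / N"
  shows "integrable lborel (\<lambda>\<eta>. datum a N (\<xi> + \<eta>) * datum a N \<eta> * \<bar>\<xi> + 2 * \<eta> - 1\<bar>)"
    and "(LINT \<eta>|lborel. datum a N (\<xi> + \<eta>) * datum a N \<eta> * \<bar>\<xi> + 2 * \<eta> - 1\<bar>) \<le> 60 * a\<^sup>2"
proof -
  have N0: "N > 0" using N by simp
  define h where "h = \<xi> - 2 * N"
  have h: "\<bar>h\<bar> \<le> 1 / N" using \<xi> unfolding h_def .
  let ?g = "gaussian N" and ?G = "gaussian (N / 2)"
  \<comment> \<open>The coefficients 4, 4, 1, 1 count how often each displaced Gaussian occurs as a
    majorant in the four products of bumps; with integrals at most 6/N they add up to 60/N.\<close>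
  define F where "F = (\<lambda>\<eta>. 4 * ?G (\<eta> + (N - 1 / 2)) + 4 * ?G (\<eta> + (h + N - 1 / 2)) + ?G (\<eta> + (- N - 1 / 2)) + ?G (\<eta> + (h + 3 * N - 1 / 2)))"
  have gi: "integrable lborel (\<lambda>\<eta>. ?G (\<eta> + c))" "(LINT \<eta>|lborel. ?G (\<eta> + c)) \<le> 6 / N" for c
    using gaussian_integral[of "N / 2" c] N0 sqrt_2pi_bounds by (auto simp: field_simps)
  have Fi: "integrable lborel F" unfolding F_def by (intro Bochner_Integration.integrable_add integrable_mult_right gi)
  have "(LINT \<eta>|lborel. F \<eta>) = 4 * (LINT \<eta>|lborel. ?G (\<eta> + (N - 1 / 2))) + 4 * (LINT \<eta>|lborel. ?G (\<eta> + (h + N - 1 / 2)))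
      + (LINT \<eta>|lborel. ?G (\<eta> + (- N - 1 / 2))) + (LINT \<eta>|lborel. ?G (\<eta> + (h + 3 * N - 1 / 2)))"
    unfolding F_def by (simp add: gi(1) Bochner_Integration.integral_add)
  also have "\<dots> \<le> 4 * (6 / N) + 4 * (6 / N) + 6 / N + 6 / N" by (intro add_mono mult_left_mono gi) auto
  finally have FI: "(LINT \<eta>|lborel. F \<eta>) \<le> 60 / N" by simp
  have g1: "x * ?g v \<le> c * (?G v / N)" if "x \<le> m * \<bar>v\<bar> + n / N" "m + n = c" "0 \<le> m" "0 \<le> n" for x v m n c
  proof -
    have "x * ?g v \<le> (m * \<bar>v\<bar> + n / N) * ?g v" by (intro mult_right_mono that gaussian_nonneg)
    also have "\<dots> = m * (\<bar>v\<bar> * ?g v) + n * (?g v / N)" by (simp add: algebra_simps)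
    also have "\<dots> \<le> m * (?G v / N) + n * (?G v / N)"
      using N0 that gaussian_moment_le[OF N0] by (intro add_mono mult_left_mono divide_right_mono) auto
    finally show ?thesis unfolding that(2)[symmetric] distrib_right .
  qed
  have g2: "x * ?g v * ?g w \<le> c * (?G v / N)" if "x \<le> m * \<bar>v\<bar> + n / N" "m + n = c" "0 \<le> m" "0 \<le> n" "0 \<le> x" for x v w m n c
  proof -
    have "x * ?g v * ?g w \<le> x * ?g v * 1" by (intro mult_left_mono gaussian_le_1 mult_nonneg_nonneg gaussian_nonneg that(5))
    with g1[OF that(1-4)] show ?thesis by simp
  qed
  have pt: "datum a N (\<xi> + \<eta>) * datum a N \<eta> * \<bar>\<xi> + 2 * \<eta> - 1\<bar> \<le> a\<^sup>2 * N * F \<eta>" for \<eta>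
  proof -
    define y where "y = \<eta> + (N - 1 / 2)"
    let ?x = "\<bar>h + 2 * y\<bar>"
    have x: "\<bar>\<xi> + 2 * \<eta> - 1\<bar> = ?x" unfolding h_def y_def by (simp add: algebra_simps)
    have d: "datum a N (\<xi> + \<eta>) = a * N * (?g (h + y) + ?g (h + y + 2 * N))" "datum a N \<eta> = a * N * (?g (y - 2 * N) + ?g y)"
      unfolding datum_def h_def y_def by (simp_all add: algebra_simps)
    have 1: "?x * (?g (h + y) * ?g y) \<le> ?G y / N + ?G (h + y) / N"
    proof -
      have "?x * (?g (h + y) * ?g y) \<le> (\<bar>y\<bar> + \<bar>h + y\<bar>) * (?g (h + y) * ?g y)" by (intro mult_right_mono) (auto simp: gaussian_nonneg)
      also have "\<dots> = \<bar>y\<bar> * ?g y * ?g (h + y) + \<bar>h + y\<bar> * ?g (h + y) * ?g y" by (simp add: algebra_simps)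
      also have "\<dots> \<le> 1 * (?G y / N) + 1 * (?G (h + y) / N)" by (intro add_mono g2[where m = 1 and n = 0]) auto
      finally show ?thesis by simp
    qed
    \<comment> \<open>In the mixed products the deviation is measured from the centre of one bump
      and the other Gaussian is bounded by 1.\<close>
    have 2: "?x * (?g (h + y + 2 * N) * ?g y) \<le> 3 * (?G y / N)"
    proof -
      have "?x \<le> 2 * \<bar>y\<bar> + 1 / N" using h by linarith
      from g2[OF this, of 3 "h + y + 2 * N"] show ?thesis by (simp add: mult.assoc mult.commute[of "?g y"])
    qed
    have 3: "?x * (?g (h + y) * ?g (y - 2 * N)) \<le> 3 * (?G (h + y) / N)"
    proof -
      have "?x \<le> 2 * \<bar>h + y\<bar> + 1 / N" using h abs_triangle_ineq4[of "2 * (h + y)" h] abs_mult[of 2 "h + y"] by (simp add: algebra_simps)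
      from g2[OF this, of 3 "y - 2 * N"] show ?thesis by (simp add: mult.assoc)
    qed
    have 4: "?x * (?g (h + y + 2 * N) * ?g (y - 2 * N)) \<le> ?G (y - 2 * N) / N + ?G (h + y + 2 * N) / N"
    proof -
      have "?x * (?g (h + y + 2 * N) * ?g (y - 2 * N)) \<le> (\<bar>y - 2 * N\<bar> + \<bar>h + y + 2 * N\<bar>) * (?g (h + y + 2 * N) * ?g (y - 2 * N))"
        by (intro mult_right_mono) (auto simp: gaussian_nonneg)
      also have "\<dots> = \<bar>y - 2 * N\<bar> * ?g (y - 2 * N) * ?g (h + y + 2 * N) + \<bar>h + y + 2 * N\<bar> * ?g (h + y + 2 * N) * ?g (y - 2 * N)" by (simp add: algebra_simps)
      also have "\<dots> \<le> 1 * (?G (y - 2 * N) / N) + 1 * (?G (h + y + 2 * N) / N)" by (intro add_mono g2[where m = 1 and n = 0]) auto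
      finally show ?thesis by simp
    qed
    have F: "F \<eta> / N = 4 * (?G y / N) + 4 * (?G (h + y) / N) + ?G (y - 2 * N) / N + ?G (h + y + 2 * N) / N"
    proof -
      have "\<eta> + (h + N - 1 / 2) = h + y" "\<eta> + (- N - 1 / 2) = y - 2 * N" "\<eta> + (h + 3 * N - 1 / 2) = h + y + 2 * N"
        unfolding y_def by simp_all
      then show ?thesis unfolding F_def y_def[symmetric] by (simp only: add_divide_distrib times_divide_eq_right)
    qed
    have "datum a N (\<xi> + \<eta>) * datum a N \<eta> * \<bar>\<xi> + 2 * \<eta> - 1\<bar> = (a * N)\<^sup>2 * (?x * (?g (h + y) * ?g y) + ?x * (?g (h + y + 2 * N) * ?g y)
      + ?x * (?g (h + y) * ?g (y - 2 * N)) + ?x * (?g (h + y + 2 * N) * ?g (y - 2 * N)))"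
      unfolding d x by (simp add: power2_eq_square algebra_simps)
    also have "\<dots> \<le> (a * N)\<^sup>2 * (F \<eta> / N)" unfolding F by (intro mult_left_mono) (use 1 2 3 4 in linarith, simp)
    also have "\<dots> = a\<^sup>2 * N * F \<eta>" using N0 by (simp add: power2_eq_square)
    finally show ?thesis .
  qed
  have nn: "0 \<le> datum a N (\<xi> + \<eta>) * datum a N \<eta> * \<bar>\<xi> + 2 * \<eta> - 1\<bar>" for \<eta>
    using N0 a by (intro mult_nonneg_nonneg datum_nonneg) auto
  have Fi': "integrable lborel (\<lambda>\<eta>. a\<^sup>2 * N * F \<eta>)" using Fi by simp
  show i: "integrable lborel (\<lambda>\<eta>. datum a N (\<xi> + \<eta>) * datum a N \<eta> * \<bar>\<xi> + 2 * \<eta> - 1\<bar>)"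
  proof (rule Bochner_Integration.integrable_bound[OF Fi'])
    show "(\<lambda>\<eta>. datum a N (\<xi> + \<eta>) * datum a N \<eta> * \<bar>\<xi> + 2 * \<eta> - 1\<bar>) \<in> borel_measurable lborel" unfolding datum_def by measurable
    show "AE \<eta> in lborel. norm (datum a N (\<xi> + \<eta>) * datum a N \<eta> * \<bar>\<xi> + 2 * \<eta> - 1\<bar>) \<le> norm (a\<^sup>2 * N * F \<eta>)"
      using pt nn by (intro AE_I2) (simp add: order_trans[OF _ abs_ge_self])
  qed
  have "(LINT \<eta>|lborel. datum a N (\<xi> + \<eta>) * datum a N \<eta> * \<bar>\<xi> + 2 * \<eta> - 1\<bar>) \<le> (LINT \<eta>|lborel. a\<^sup>2 * N * F \<eta>)"
    by (intro integral_mono i Fi' pt)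
  also have "\<dots> = a\<^sup>2 * N * (LINT \<eta>|lborel. F \<eta>)" by (rule integral_mult_right_zero)
  also have "\<dots> \<le> a\<^sup>2 * N * (60 / N)" using N0 by (intro mult_left_mono FI) auto
  finally show "(LINT \<eta>|lborel. datum a N (\<xi> + \<eta>) * datum a N \<eta> * \<bar>\<xi> + 2 * \<eta> - 1\<bar>) \<le> 60 * a\<^sup>2" using N0 by simp
qed

text \<open>Replacing \<xi> (\<xi> + 2 \<eta>) by \<xi> in the phase changes it by \<xi> times the
  deviation from resonance, to which the moment bound applies.\<close>

lemma datum_correlation_phase:
  assumes N: "N \<ge> 1" and a: "a > 0" and \<xi>: "\<bar>\<xi> - 2 * N\<bar> \<le> 1 / N" and t: "0 \<le> t"
  shows "cmod ((LINT \<eta>|lborel. exp (- \<i> * of_real (t * \<xi> * (\<xi> + 2 * \<eta>))) * (of_real (datum a N (\<xi> + \<eta>)) * cnj (of_real (datum a N \<eta>))))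
    - exp (- \<i> * of_real (t * \<xi>)) * of_real (LINT \<eta>|lborel. datum a N (\<xi> + \<eta>) * datum a N \<eta>)) \<le> t * \<bar>\<xi>\<bar> * (60 * a\<^sup>2)"
proof -
  let ?d = "\<lambda>\<eta>. datum a N (\<xi> + \<eta>) * datum a N \<eta>"
  have N0: "N > 0" using N by simp
  have d0: "0 \<le> ?d \<eta>" for \<eta> using N0 a by (intro mult_nonneg_nonneg datum_nonneg) auto
  have [measurable]: "?d \<in> borel_measurable borel" unfolding datum_def by measurable
  note di = datum_pair_integrable[OF N a, of \<xi>] and mi = datum_correlation_moment[OF N a \<xi>]
  let ?e = "\<lambda>x. exp (- \<i> * complex_of_real x)"
  have e: "cmod (?e x) = 1" for x using norm_exp_i_real[of "- x"] by simp
  have i1: "integrable lborel (\<lambda>\<eta>. ?e (t * \<xi> * (\<xi> + 2 * \<eta>)) * of_real (?d \<eta>))"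
    by (rule Bochner_Integration.integrable_bound[OF di]) (auto simp: norm_mult e simp del: of_real_mult)
  have i2: "integrable lborel (\<lambda>\<eta>. ?e (t * \<xi>) * of_real (?d \<eta>))" by (intro integrable_mult_right integrable_of_real di)
  have eq: "(LINT \<eta>|lborel. ?e (t * \<xi> * (\<xi> + 2 * \<eta>)) * of_real (?d \<eta>)) - ?e (t * \<xi>) * of_real (LINT \<eta>|lborel. ?d \<eta>)
     = (LINT \<eta>|lborel. ?e (t * \<xi> * (\<xi> + 2 * \<eta>)) * of_real (?d \<eta>) - ?e (t * \<xi>) * of_real (?d \<eta>))"
    unfolding Bochner_Integration.integral_diff[OF i1 i2] by (simp only: integral_mult_right_zero integral_complex_of_real)
  have "cmod (LINT \<eta>|lborel. ?e (t * \<xi> * (\<xi> + 2 * \<eta>)) * of_real (?d \<eta>) - ?e (t * \<xi>) * of_real (?d \<eta>)) \<le> (LINT \<eta>|lborel. t * \<bar>\<xi>\<bar> * (?d \<eta> * \<bar>\<xi> + 2 * \<eta> - 1\<bar>))"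
  proof (rule Bochner_Integration.integral_norm_bound_integral[OF Bochner_Integration.integrable_diff[OF i1 i2] integrable_mult_right[OF mi(1)]])
    fix \<eta>
    have "cmod (?e (t * \<xi> * (\<xi> + 2 * \<eta>)) * of_real (?d \<eta>) - ?e (t * \<xi>) * of_real (?d \<eta>)) = cmod (?e (t * \<xi> * (\<xi> + 2 * \<eta>)) - ?e (t * \<xi>)) * ?d \<eta>"
      unfolding left_diff_distrib[symmetric] norm_mult norm_of_real using d0 by simp
    also have "\<dots> \<le> \<bar>t * \<xi> * (\<xi> + 2 * \<eta>) - t * \<xi>\<bar> * ?d \<eta>" by (intro mult_right_mono cmod_exp_diff_le d0)
    also have "t * \<xi> * (\<xi> + 2 * \<eta>) - t * \<xi> = t * \<xi> * (\<xi> + 2 * \<eta> - 1)" by (simp add: algebra_simps)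
    also have "\<bar>t * \<xi> * (\<xi> + 2 * \<eta> - 1)\<bar> * ?d \<eta> = t * \<bar>\<xi>\<bar> * (?d \<eta> * \<bar>\<xi> + 2 * \<eta> - 1\<bar>)" using t by (simp add: abs_mult)
    finally show "cmod (?e (t * \<xi> * (\<xi> + 2 * \<eta>)) * of_real (?d \<eta>) - ?e (t * \<xi>) * of_real (?d \<eta>)) \<le> t * \<bar>\<xi>\<bar> * (?d \<eta> * \<bar>\<xi> + 2 * \<eta> - 1\<bar>)" .
  qed
  also have "\<dots> = t * \<bar>\<xi>\<bar> * (LINT \<eta>|lborel. ?d \<eta> * \<bar>\<xi> + 2 * \<eta> - 1\<bar>)" by (rule integral_mult_right_zero)
  also have "\<dots> \<le> t * \<bar>\<xi>\<bar> * (60 * a\<^sup>2)" using t by (intro mult_left_mono mi) auto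
  finally show ?thesis unfolding eq[symmetric] by simp
qed

section \<open>Choice of constants and growth of the norm\<close>

lemma datum_const_ge_1: "1 \<le> datum_const"
proof -
  have "1 * 1 \<le> 2048 * exp (4::real)" by (intro mult_mono) auto
  then show ?thesis unfolding datum_const_def by simp
qed

lemma conv_const_ge_1: "1 \<le> conv_const"
proof -
  have "1 * 1 \<le> 144 * pi\<^sup>2" using pi_ge_two by (intro mult_mono one_le_power) auto
  then show ?thesis unfolding conv_const_def by simp
qed

text \<open>Small enough for three purposes: the contraction of the fixed-point map, the drift of
  the phase, and the distance to the free evolution. It depends neither on N nor on the height of
  the datum.\<close>

definition lifespan :: real where "lifespan = 1 / (10000 * datum_const\<^sup>2 * conv_const\<^sup>2)"

lemma lifespan_pos: "0 < lifespan"
  using datum_const_ge_1 conv_const_ge_1 unfolding lifespan_def by simp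

lemma lifespan_le:
  shows "lifespan \<le> 1 / 10000" and "datum_const * conv_const * lifespan \<le> 1 / 10000"
    and "datum_const ^ 4 * conv_const ^ 3 * lifespan\<^sup>2 \<le> 1 / 10000"
proof -
  note c = datum_const_ge_1 conv_const_ge_1
  have p: "0 < datum_const" "0 < conv_const" using c by auto
  have dc: "1 \<le> datum_const * conv_const" using mult_mono[OF c] p by simp
  then have dc2: "1 \<le> datum_const\<^sup>2 * conv_const\<^sup>2" using one_le_power[OF dc, of 2] by (simp add: power_mult_distrib)
  then show "lifespan \<le> 1 / 10000" unfolding lifespan_def by (intro divide_left_mono) auto
  have "datum_const * conv_const * lifespan = 1 / (10000 * (datum_const * conv_const))"
    using p unfolding lifespan_def by (simp add: power2_eq_square)
  also have "\<dots> \<le> 1 / 10000" using dc p by (intro divide_left_mono) auto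
  finally show "datum_const * conv_const * lifespan \<le> 1 / 10000" .
  have "datum_const ^ 4 * conv_const ^ 3 * lifespan\<^sup>2 = 1 / (10000\<^sup>2 * conv_const)"
    using p unfolding lifespan_def power_divide by (simp add: power_mult_distrib power2_eq_square power3_eq_cube power4_eq_xxxx)
  also have "\<dots> \<le> 1 / 10000" using c p by (intro divide_left_mono) auto
  finally show "datum_const ^ 4 * conv_const ^ 3 * lifespan\<^sup>2 \<le> 1 / 10000" .
qed

context
  fixes N a :: real
  assumes N: "N \<ge> 1" and a: "a > 0" and aN: "a\<^sup>2 * N \<le> 1 / 1600"
begin

lemma N_pos: "N > 0" using N by simp

text \<open>The weight of u is shifted by 1/2 to sit on the bumps of the datum. Correlating two
  shifted weights cancels the shift, and multiplying u by n restores it, so both convolution bounds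
  reduce to \<open>lattice_weight_convolution\<close>.\<close>

lemma ck_system_datum:
  "ck_system lifespan (1 / N) (\<lambda>\<xi>. lattice_weight N (\<xi> - 1 / 2)) (lattice_weight N) N conv_const (datum_const * a)
    (\<lambda>\<xi>. of_real (datum a N \<xi>))"
proof
  note N0 = N_pos
  show "lifespan > 0" by (rule lifespan_pos)
  show "1 / N > 0" using N0 by simp
  fix \<xi>
  show "0 < lattice_weight N (\<xi> - 1 / 2)" "0 < lattice_weight N \<xi>" by (rule lattice_weight_pos[OF N0])+
  show "lattice_weight N (\<xi> - 1 / 2) \<le> N" "lattice_weight N \<xi> \<le> N" by (rule lattice_weight_le[OF N0])+
  have "(LINT \<eta>|lborel. lattice_weight N (\<xi> + \<eta> - 1 / 2) * lattice_weight N (\<eta> - 1 / 2)) = (LINT \<eta>|lborel. lattice_weight N (\<xi> - \<eta>) * lattice_weight N (- \<eta>))"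
    by (subst lborel_integral_real_affine[of "-1" _ "1 / 2"]) (auto simp: algebra_simps)
  then show "(LINT \<eta>|lborel. lattice_weight N (\<xi> + \<eta> - 1 / 2) * lattice_weight N (\<eta> - 1 / 2)) \<le> conv_const * lattice_weight N \<xi>"
    using lattice_weight_convolution[OF N0, of \<xi>] by (simp add: lattice_weight_even)
  have "(LINT \<eta>|lborel. lattice_weight N (\<xi> + \<eta>) * lattice_weight N (- \<eta> - 1 / 2)) = (LINT \<eta>|lborel. lattice_weight N ((\<xi> - 1 / 2) - \<eta>) * lattice_weight N \<eta>)"
    by (subst lborel_integral_real_affine[of "-1" _ "- (1 / 2)"]) (auto simp: algebra_simps)
  then show "(LINT \<eta>|lborel. lattice_weight N (\<xi> + \<eta>) * lattice_weight N (- \<eta> - 1 / 2)) \<le> conv_const * lattice_weight N (\<xi> - 1 / 2)"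
    using lattice_weight_convolution[OF N0, of "\<xi> - 1 / 2"] by simp
  show "cmod (complex_of_real (datum a N \<xi>)) \<le> datum_const * a * lattice_weight N (\<xi> - 1 / 2) * exp (- (1 / N) * \<bar>\<xi>\<bar>)"
    using datum_le[OF N a, of \<xi>] datum_nonneg[of a N \<xi>] a N0 by simp
next
  note N0 = N_pos
  show "continuous_on UNIV (\<lambda>\<xi>. lattice_weight N (\<xi> - 1 / 2))"
    by (rule continuous_on_compose2[OF lattice_weight_continuous[OF N0, of UNIV]]) (auto intro!: continuous_intros)
  show "continuous_on UNIV (lattice_weight N)" by (rule lattice_weight_continuous[OF N0])
  show "integrable lborel (lattice_weight N)" by (rule lattice_weight_integrable[OF N0])
  then show "integrable lborel (\<lambda>\<xi>. lattice_weight N (\<xi> - 1 / 2))"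
    using lborel_integrable_real_affine[of "lattice_weight N" 1 "- (1 / 2)"] by simp
  show "0 < datum_const * a" using datum_const_pos a by simp
  show "0 \<le> conv_const" by (rule conv_const_nonneg)
  show "continuous_on UNIV (\<lambda>\<xi>. complex_of_real (datum a N \<xi>))" by (intro continuous_intros continuous_on_datum)
  have "(datum_const * conv_const * lifespan)\<^sup>2 \<le> 1\<^sup>2"
    using lifespan_le(2) datum_const_pos conv_const_nonneg lifespan_pos by (intro power_mono mult_nonneg_nonneg) auto
  then have "48 * a\<^sup>2 * (datum_const * conv_const * lifespan)\<^sup>2 \<le> 48 * a\<^sup>2 * 1" by (intro mult_left_mono) auto
  \<comment> \<open>Here uniformity in N is decided: a^2 is at most 1 / (1600 N), which matches the
    radius 1/N.\<close>
  also have "\<dots> \<le> 1 / N" using aN N0 by (simp add: field_simps)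
  finally show "48 * (datum_const * a)\<^sup>2 * conv_const\<^sup>2 * lifespan\<^sup>2 \<le> 1 / N" by (simp add: power_mult_distrib mult_ac)
qed

interpretation ck_system lifespan "1 / N" "\<lambda>\<xi>. lattice_weight N (\<xi> - 1 / 2)" "lattice_weight N" N conv_const "datum_const * a"
    "\<lambda>\<xi>. of_real (datum a N \<xi>)"
  by (rule ck_system_datum)

text \<open>The main term is at least (a^2 N / 3) (t / 4) and the error at most t a^2 N / 48; the
  difference t a^2 N / 16, multiplied by \<xi> \<ge> N, exceeds the claim. The condition N \<ge> 1/t
  enters through 1/(4 \<xi>) \<le> t/4.\<close>

lemma wave_lower_bound:
  assumes U: "adm (\<lambda>\<xi>. lattice_weight N (\<xi> - 1 / 2)) (2 * (datum_const * a)) U"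
    and close: "\<And>t \<xi>. t \<in> {0..lifespan} \<Longrightarrow> cmod (U t \<xi> - exp (- \<i> * of_real (t * \<xi>\<^sup>2)) * of_real (datum a N \<xi>))
      \<le> \<kappa> * (datum_const * a) * lattice_weight N (\<xi> - 1 / 2)"
    and t: "0 < t" "t \<le> lifespan" "1 / t \<le> N" and \<xi>: "\<bar>\<xi> - 2 * N\<bar> \<le> 1 / N"
  shows "t * N\<^sup>2 * a\<^sup>2 / 24 \<le> cmod (NN U t \<xi>)"
proof -
  note N0 = N_pos
  have "1 / N \<le> 1" using N by simp
  with \<xi> N have \<xi>N: "N \<le> \<xi>" "\<xi> \<le> 3 * N" by linarith+
  then have \<xi>0: "\<xi> > 0" using N0 by simp
  define P where "P = (LINT \<eta>|lborel. datum a N (\<xi> + \<eta>) * datum a N \<eta>)"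
  define E where "E = 3 * \<kappa> * (datum_const * a)\<^sup>2 * conv_const * lattice_weight N \<xi> + lifespan * \<bar>\<xi>\<bar> * (60 * a\<^sup>2)"
  have P: "a\<^sup>2 * N / 3 \<le> P" unfolding P_def by (rule datum_correlation_lower[OF N a \<xi>])
  have P0: "0 \<le> P" using P N0 by (intro order_trans[OF _ P]) auto
  \<comment> \<open>Two errors: the nonlinear part of u, which carries a surplus factor a^2 N \<le>
    1/1600, and the drift of the phase, of order \<open>lifespan\<close> times N a^2.\<close>
  have E: "E \<le> a\<^sup>2 * N / 48"
  proof -
    have "3 * \<kappa> * (datum_const * a)\<^sup>2 * conv_const * lattice_weight N \<xi> \<le> 3 * \<kappa> * (datum_const * a)\<^sup>2 * conv_const * N"
      using \<kappa>_bounds conv_const_nonneg by (intro mult_left_mono lattice_weight_le N0 mult_nonneg_nonneg) auto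
    also have "\<dots> = 48 * (a\<^sup>2 * N) * (datum_const ^ 4 * conv_const ^ 3 * lifespan\<^sup>2) * (a\<^sup>2 * N)"
      unfolding \<kappa>_def by (simp add: power_mult_distrib power2_eq_square power3_eq_cube power4_eq_xxxx)
    also have "\<dots> \<le> 48 * (1 / 1600) * (1 / 10000) * (a\<^sup>2 * N)"
      using N0 datum_const_pos conv_const_nonneg by (intro mult_right_mono mult_mono aN lifespan_le(3)) auto
    finally have 1: "3 * \<kappa> * (datum_const * a)\<^sup>2 * conv_const * lattice_weight N \<xi> \<le> 48 * (1 / 1600) * (1 / 10000) * (a\<^sup>2 * N)" .
    have "lifespan * \<bar>\<xi>\<bar> * (60 * a\<^sup>2) \<le> 1 / 10000 * (3 * N) * (60 * a\<^sup>2)"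
      using \<xi>N \<xi>0 by (intro mult_right_mono mult_mono lifespan_le(1)) auto
    also have "\<dots> = 180 / 10000 * (a\<^sup>2 * N)" by simp
    finally have "E \<le> 48 * (1 / 1600) * (1 / 10000) * (a\<^sup>2 * N) + 180 / 10000 * (a\<^sup>2 * N)" using 1 unfolding E_def by linarith
    also have "\<dots> = (48 * (1 / 1600) * (1 / 10000) + 180 / 10000) * (a\<^sup>2 * N)" by (simp only: distrib_right)
    also have "\<dots> \<le> 1 / 48 * (a\<^sup>2 * N)" using N0 by (intro mult_right_mono) auto
    finally show ?thesis by simp
  qed
  have Y: "cmod (Yb U U \<tau> \<xi> - exp (- \<i> * of_real (\<tau> * \<xi>)) * of_real P) \<le> E" if \<tau>: "\<tau> \<in> {0..t}" for \<tau>
  proof -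
    have \<tau>': "\<tau> \<in> {0..lifespan}" using \<tau> t by auto
    let ?L = "LINT \<eta>|lborel. exp (- \<i> * of_real (\<tau> * \<xi> * (\<xi> + 2 * \<eta>))) * (complex_of_real (datum a N (\<xi> + \<eta>)) * cnj (of_real (datum a N \<eta>)))"
    have 1: "cmod (Yb U U \<tau> \<xi> - ?L) \<le> 3 * \<kappa> * (datum_const * a)\<^sup>2 * conv_const * lattice_weight N \<xi>"
      by (rule Y_free_approx[OF U close \<tau>'])
    have "cmod (?L - exp (- \<i> * of_real (\<tau> * \<xi>)) * of_real P) \<le> \<tau> * \<bar>\<xi>\<bar> * (60 * a\<^sup>2)"
      unfolding P_def using \<tau> by (intro datum_correlation_phase[OF N a \<xi>]) auto
    also have "\<dots> \<le> lifespan * \<bar>\<xi>\<bar> * (60 * a\<^sup>2)" using \<tau>' by (intro mult_right_mono) auto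
    finally have 2: "cmod (?L - exp (- \<i> * of_real (\<tau> * \<xi>)) * of_real P) \<le> lifespan * \<bar>\<xi>\<bar> * (60 * a\<^sup>2)" .
    show ?thesis unfolding E_def by (rule norm_diff_triangle_le[OF 1 2])
  qed
  have tT: "t \<in> {0..lifespan}" using t by simp
  have "1 / (4 * \<xi>) \<le> 1 / (4 * N)" using \<xi>N N0 by (intro divide_left_mono) auto
  also have "\<dots> \<le> t / 4" using t N0 by (simp add: field_simps)
  finally have q: "t / 4 \<le> t / 2 - 1 / (4 * \<xi>)" by linarith
  have diff: "(a\<^sup>2 * N / 3) * (t / 4) - t * (a\<^sup>2 * N / 48) \<le> P * (t / 2 - 1 / (4 * \<xi>)) - t * E"
  proof (rule diff_mono)
    show "(a\<^sup>2 * N / 3) * (t / 4) \<le> P * (t / 2 - 1 / (4 * \<xi>))" using t by (intro mult_mono P q P0) auto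
    show "t * E \<le> t * (a\<^sup>2 * N / 48)" using t by (intro mult_left_mono E) auto
  qed
  have eq: "(a\<^sup>2 * N / 3) * (t / 4) - t * (a\<^sup>2 * N / 48) = t * a\<^sup>2 * N / 16" by (simp add: algebra_simps)
  have nn: "0 \<le> t * a\<^sup>2 * N" using t N0 by simp
  have "t * N\<^sup>2 * a\<^sup>2 / 24 = N * (t * a\<^sup>2 * N / 24)" by (simp add: power2_eq_square)
  also have "\<dots> \<le> \<xi> * (P * (t / 2 - 1 / (4 * \<xi>)) - t * E)"
    using diff nn \<xi>N(1) N0 unfolding eq by (intro mult_mono) auto
  also have "\<dots> \<le> cmod (NN U t \<xi>)" by (rule NN_lower_bound[OF U tT \<xi>0 P0 Y])
  finally show ?thesis .
qed

text \<open>The pointwise lower bound holds on an interval of length 2/N about 2N, where 1 + \<xi>^2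
  lies between N^2 and 10 N^2; the factor 10^{-|s|} serves both signs of s. The square root of the
  length turns N^{s+2} into N^{s+3/2}.\<close>

lemma datum_norm_growth:
  shows "\<exists>u n. zakharov_solution lifespan (synth (\<lambda>\<xi>. of_real (datum a N \<xi>))) (\<lambda>x. 0) (\<lambda>x. 0) u n"
    and "zakharov_solution lifespan (synth (\<lambda>\<xi>. of_real (datum a N \<xi>))) (\<lambda>x. 0) (\<lambda>x. 0) u n \<Longrightarrow>
      0 < t \<Longrightarrow> t \<le> lifespan \<Longrightarrow> 1 / t \<le> N \<Longrightarrow>
      10 powr (- \<bar>s\<bar>) * (t * N powr (s + 3 / 2) * a\<^sup>2 / 24) \<le> Hs_norm s (\<lambda>x. complex_of_real (n t x))"
proof -
  obtain u' n' U where Z: "zakharov_solution lifespan (synth (\<lambda>\<xi>. of_real (datum a N \<xi>))) (\<lambda>x. 0) (\<lambda>x. 0) u' n'"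
    and n': "\<And>t x. t \<in> {0..lifespan} \<Longrightarrow> complex_of_real (n' t x) = synth (NN U t) x"
    and U: "adm (\<lambda>\<xi>. lattice_weight N (\<xi> - 1 / 2)) (2 * (datum_const * a)) U"
    and close: "\<And>t \<xi>. t \<in> {0..lifespan} \<Longrightarrow> cmod (U t \<xi> - exp (- \<i> * of_real (t * \<xi>\<^sup>2)) * of_real (datum a N \<xi>))
      \<le> \<kappa> * (datum_const * a) * lattice_weight N (\<xi> - 1 / 2)"
    by (rule zakharov_solution_exists) blast
  show "\<exists>u n. zakharov_solution lifespan (synth (\<lambda>\<xi>. of_real (datum a N \<xi>))) (\<lambda>x. 0) (\<lambda>x. 0) u n" using Z by blast
  note N0 = N_pos
  assume Zu: "zakharov_solution lifespan (synth (\<lambda>\<xi>. of_real (datum a N \<xi>))) (\<lambda>x. 0) (\<lambda>x. 0) u n"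
    and t: "0 < t" "t \<le> lifespan" "1 / t \<le> N"
  then have tT: "t \<in> {0..lifespan}" by simp
  have A0: "0 \<le> 2 * (datum_const * a)" using A by simp
  define F where "F = NN U t"
  define K where "K = 2 * (datum_const * a) * (2 * (datum_const * a)) * conv_const * (2 * lifespan / (1 / N))"
  have K0: "0 \<le> K" using datum_const_pos a C lifespan_pos N0 unfolding K_def by (intro mult_nonneg_nonneg divide_nonneg_nonneg) auto
  have adm: "adm (lattice_weight N) K (NN U)" unfolding K_def by (rule NN_adm[OF U A0])
  have rF: "rapid F" unfolding F_def by (rule adm_rapid[OF adm K0 W_nonneg(2) W2(4) tT])
  have bF: "cmod (F \<xi>) \<le> K * N" for \<xi>
  proof -
    have "cmod (F \<xi>) \<le> K * lattice_weight N \<xi> * exp (- (1 / N / 2) * \<bar>\<xi>\<bar>)"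
      unfolding F_def by (rule adm_dominated[OF adm K0 W_nonneg(2) tT])
    also have "\<dots> \<le> K * N * 1" using K0 N0 W_nonneg(2) by (intro mult_mono mult_left_mono lattice_weight_le) auto
    finally show ?thesis by simp
  qed
  define M where "M = 10 powr (- \<bar>s\<bar>) * N powr (2 * s) * (t * N\<^sup>2 * a\<^sup>2 / 24)\<^sup>2"
  have le1: "10 powr (- \<bar>s\<bar>) \<le> (1::real)" using powr_mono[of "- \<bar>s\<bar>" 0 10] by simp
  have N2: "(N\<^sup>2) powr s = N powr (2 * s)" using N0 powr_powr[of N 2 s] by simp
  have pt: "M * indicator {2 * N - 1 / N..2 * N + 1 / N} \<xi> \<le> (1 + \<xi>\<^sup>2) powr s * (cmod (F \<xi>))\<^sup>2" for \<xi>
  proof (cases "\<xi> \<in> {2 * N - 1 / N..2 * N + 1 / N}")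
    case True
    then have \<xi>: "\<bar>\<xi> - 2 * N\<bar> \<le> 1 / N" by (simp add: abs_le_iff)
    have "1 / N \<le> 1" using N by simp
    with \<xi> N have \<xi>N: "N \<le> \<xi>" "\<xi> \<le> 3 * N" by linarith+
    have "N\<^sup>2 \<le> \<xi>\<^sup>2" "\<xi>\<^sup>2 \<le> (3 * N)\<^sup>2" using \<xi>N N0 by (intro power_mono; simp)+
    moreover have "1 \<le> N\<^sup>2" using N by (simp add: one_le_power)
    ultimately have b: "N\<^sup>2 \<le> 1 + \<xi>\<^sup>2" "1 + \<xi>\<^sup>2 \<le> 10 * N\<^sup>2" by (auto simp: power_mult_distrib)
    have "10 powr (- \<bar>s\<bar>) * N powr (2 * s) \<le> (1 + \<xi>\<^sup>2) powr s"
    proof (cases "s \<ge> 0")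
      case True
      have "10 powr (- \<bar>s\<bar>) * N powr (2 * s) \<le> 1 * (N\<^sup>2) powr s"
        unfolding N2 by (intro mult_right_mono le1) auto
      also have "\<dots> \<le> (1 + \<xi>\<^sup>2) powr s" using b True by (simp add: powr_mono2)
      finally show ?thesis .
    next
      case False
      then have "10 powr (- \<bar>s\<bar>) * N powr (2 * s) = (10 * N\<^sup>2) powr s" by (simp add: powr_mult N2)
      also have "\<dots> \<le> (1 + \<xi>\<^sup>2) powr s" using b False one_plus_square_pos[of \<xi>] by (intro powr_mono2') auto
      finally show ?thesis .
    qed
    moreover have "(t * N\<^sup>2 * a\<^sup>2 / 24)\<^sup>2 \<le> (cmod (F \<xi>))\<^sup>2"
      using wave_lower_bound[OF U close t \<xi>] t unfolding F_def by (intro power_mono) auto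
    ultimately show ?thesis using True unfolding M_def by (auto intro!: mult_mono)
  qed simp
  have "2 / N * M = (LINT \<xi>|lborel. M * indicator {2 * N - 1 / N..2 * N + 1 / N} \<xi>)" using N0 by simp
  also have "\<dots> \<le> (LINT \<xi>|lborel. (1 + \<xi>\<^sup>2) powr s * (cmod (F \<xi>))\<^sup>2)"
    by (intro integral_mono rapid_weighted_square[OF rF bF] pt integrable_mult_right integrable_real_indicator) (auto simp: emeasure_lborel_Icc_eq)
  finally have "2 * pi * (2 / N * M) \<le> (Hs_norm s (synth F))\<^sup>2" unfolding Hs_synth(2)[OF rF bF] by (intro mult_left_mono) auto
  moreover have "(10 powr (- \<bar>s\<bar>) * (t * N powr (s + 3 / 2) * a\<^sup>2 / 24))\<^sup>2 \<le> 2 * pi * (2 / N * M)"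
  proof -
    have "(N powr (s + 3 / 2))\<^sup>2 = N powr (2 * s + 3)" unfolding power2_eq_square powr_add[symmetric] by simp
    also have "\<dots> = N powr (2 * s) * N ^ 3" using N0 unfolding powr_add by simp
    finally have "(10 powr (- \<bar>s\<bar>) * (t * N powr (s + 3 / 2) * a\<^sup>2 / 24))\<^sup>2 = 10 powr (- \<bar>s\<bar>) * (1 / N * M)"
      unfolding M_def using N0 by (simp add: power_mult_distrib power_divide power2_eq_square power3_eq_cube)
    also have "\<dots> \<le> (2 * pi * 2) * (1 / N * M)"
    proof (rule mult_right_mono)
      show "10 powr (- \<bar>s\<bar>) \<le> 2 * pi * 2" using le1 pi_ge_two by linarith
      show "0 \<le> 1 / N * M" unfolding M_def using N0 by simp
    qed
    finally show ?thesis by simp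
  qed
  ultimately have "(10 powr (- \<bar>s\<bar>) * (t * N powr (s + 3 / 2) * a\<^sup>2 / 24))\<^sup>2 \<le> (Hs_norm s (synth F))\<^sup>2" by linarith
  then have "10 powr (- \<bar>s\<bar>) * (t * N powr (s + 3 / 2) * a\<^sup>2 / 24) \<le> Hs_norm s (synth F)"
    by (rule power2_le_imp_le) (rule Hs_norm_nonneg)
  \<comment> \<open>Uniqueness carries the estimate from the constructed solution to an arbitrary
    one.\<close>
  moreover have "n t = n' t" by (rule zakharov_solution_unique[OF Zu Z tT])
  then have "(\<lambda>x. complex_of_real (n t x)) = synth F" using n'[OF tT] unfolding F_def by auto
  ultimately show "10 powr (- \<bar>s\<bar>) * (t * N powr (s + 3 / 2) * a\<^sup>2 / 24) \<le> Hs_norm s (\<lambda>x. complex_of_real (n t x))" by simp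
qed

end

theorem theorem1p2:
  fixes k s :: real
  assumes "(0 < k \<and> k < 1 \<and> s > 2 * k - 1 / 2) \<or> (k \<le> 0 \<and> s > - 1 / 2)"
  shows "\<exists>(T::real) (\<alpha>::real) (c1::real) (c2::real) (\<phi> :: nat \<Rightarrow> real \<Rightarrow> complex).
    T > 0 \<and> \<alpha> > 0 \<and> c1 > 0 \<and> c2 > 0 \<and>
    (\<forall>N\<ge>1. schwartz (\<phi> N) \<and> Hs_norm k (\<phi> N) \<le> 1 \<and>
      (\<exists>u n. zakharov_solution T (\<phi> N) (\<lambda>x. 0) (\<lambda>x. 0) u n) \<and>
      (\<forall>u n. zakharov_solution T (\<phi> N) (\<lambda>x. 0) (\<lambda>x. 0) u n \<longrightarrow>
        (\<forall>t. 0 < t \<and> t \<le> T \<and> real N \<ge> c2 * inverse t \<longrightarrow>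
          Hs_norm s (\<lambda>x. complex_of_real (n t x)) \<ge> c1 * t * real N powr \<alpha>)))"
proof -
  \<comment> \<open>For negative k the datum keeps its size for k = 0, because the fixed point
    requires a^2 N to stay bounded.\<close>
  define \<kappa> where "\<kappa> = max k 0"
  \<comment> \<open>The exponent s + 3/2 of the growth estimate plus the exponent -2\<kappa> - 1 of
    a^2; the assumption on s makes it positive.\<close>
  define \<alpha> where "\<alpha> = s + 1 / 2 - 2 * \<kappa>"
  define a where "a = (\<lambda>N::nat. real N powr (- \<kappa> - 1 / 2) / 40)"
  define \<phi> where "\<phi> N = synth (\<lambda>\<xi>. of_real (datum (a N) (real N) \<xi>))" for N
  \<comment> \<open>38400 = 24 * 1600: the denominator of the growth estimate times the square of
    the 40 in the height of the datum.\<close>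
  define c1 where "c1 = 10 powr (- \<bar>s\<bar>) / 38400"
  have \<kappa>: "k \<le> \<kappa>" "0 \<le> \<kappa>" "\<kappa> \<le> 1" and \<alpha>: "\<alpha> > 0" using assms unfolding \<kappa>_def \<alpha>_def by auto
  have c1: "c1 > 0" unfolding c1_def by simp
  have main: "schwartz (\<phi> N) \<and> Hs_norm k (\<phi> N) \<le> 1 \<and>
      (\<exists>u n. zakharov_solution lifespan (\<phi> N) (\<lambda>x. 0) (\<lambda>x. 0) u n) \<and>
      (\<forall>u n. zakharov_solution lifespan (\<phi> N) (\<lambda>x. 0) (\<lambda>x. 0) u n \<longrightarrow>
        (\<forall>t. 0 < t \<and> t \<le> lifespan \<and> real N \<ge> 1 * inverse t \<longrightarrow>
          Hs_norm s (\<lambda>x. complex_of_real (n t x)) \<ge> c1 * t * real N powr \<alpha>))" if "N \<ge> 1" for N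
  proof -
    have N: "real N \<ge> 1" and N0: "real N > 0" using that by auto
    have a0: "a N > 0" unfolding a_def using N0 by simp
    have sq: "real N powr (- \<kappa> - 1 / 2) * real N powr (- \<kappa> - 1 / 2) = real N powr (- 2 * \<kappa> - 1)"
      unfolding powr_add[symmetric] by simp
    have a2: "(a N)\<^sup>2 = real N powr (- 2 * \<kappa> - 1) / 1600"
      unfolding sq[symmetric] a_def by (simp add: power2_eq_square)
    have aN: "(a N)\<^sup>2 * real N \<le> 1 / 1600"
    proof -
      have "real N powr (- 2 * \<kappa> - 1) * real N = real N powr (- 2 * \<kappa> - 1) * real N powr 1" using N0 by simp
      also have "\<dots> = real N powr (- 2 * \<kappa>)" unfolding powr_add[symmetric] by simp
      also have "\<dots> \<le> real N powr 0" using N \<kappa> by (intro powr_mono) auto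
      finally show ?thesis unfolding a2 using N0 by simp
    qed
    note growth = datum_norm_growth[OF N a0 aN, folded \<phi>_def]
    have eq: "10 powr (- \<bar>s\<bar>) * (t * real N powr (s + 3 / 2) * (a N)\<^sup>2 / 24) = c1 * t * real N powr \<alpha>" for t
    proof -
      have "real N powr (s + 3 / 2) * real N powr (- 2 * \<kappa> - 1) = real N powr \<alpha>" unfolding powr_add[symmetric] \<alpha>_def by (simp add: algebra_simps)
      then show ?thesis unfolding a2 c1_def by simp
    qed
    have "schwartz (\<phi> N)" unfolding \<phi>_def by (rule schwartz_synth_datum[OF N0])
    moreover have "Hs_norm k (\<phi> N) \<le> 1" unfolding \<phi>_def by (rule Hs_norm_datum[OF N \<kappa>]) (simp add: a_def)
    moreover note growth(1)
    moreover have "c1 * t * real N powr \<alpha> \<le> Hs_norm s (\<lambda>x. complex_of_real (n t x))"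
      if "zakharov_solution lifespan (\<phi> N) (\<lambda>x. 0) (\<lambda>x. 0) u n" "0 < t" "t \<le> lifespan" "real N \<ge> 1 * inverse t" for u n t
      using growth(2)[OF that(1-3), of s] that(4) unfolding eq by (simp add: inverse_eq_divide)
    ultimately show ?thesis by blast
  qed
  show ?thesis
    by (rule exI[of _ lifespan], rule exI[of _ \<alpha>], rule exI[of _ c1], rule exI[of _ 1], rule exI[of _ \<phi>])
       (use lifespan_pos \<alpha> c1 main in auto)
qed

end
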